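(* Let $p$ be an odd prime, $N$ a prime with $N\equiv1\pmod p$ and $L=\mathbb{Q}(\zeta_p,N^{1/p})$. Then $\operatorname{rk}_p(\operatorname{Cl}(L))\ge\frac{p-1}{2}$.
   Context: $\operatorname{rk}_p(X)=\dim_{\mathbb{F}_p}(X\otimes\mathbb{F}_p)$; $\zeta_p$ is a primitive $p$-th root of unity. *)

theory Defs
  imports
    Complex_Main
    "HOL-Library.Extended_Nat"
    "HOL-Computational_Algebra.Computational_Algebra"
    "HOL-Number_Theory.Number_Theory"
    "HOL-Algebra.Generated_Fields"
    "HOL-Algebra.Ideal_Product"
    "HOL-Algebra.Free_Abelian_Groups"
    "HOL-Algebra.Algebraic_Closure_Type"
    "Jordan_Normal_Form.Missing_VectorSpace"
begin

section \<open>Subfields of the complex numbers and their class groups\<close>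

abbreviation complex_ring :: "complex ring"
  where "complex_ring \<equiv> ring_of_type_algebra"

text \<open>Every subfield of the complex numbers contains the rationals, so this is
  \<open>\<rat>(S)\<close>.\<close>

definition rat_adjoin :: "complex set \<Rightarrow> complex set"
  where "rat_adjoin S = generate_field complex_ring S"

definition ring_of_integers :: "complex set \<Rightarrow> complex ring"
  where "ring_of_integers L = complex_ring\<lparr>carrier := {x \<in> L. algebraic_int x}\<rparr>"

text \<open>The nonzero fractional ideals: the sets \<open>d\<^sup>-\<^sup>1 I\<close> with \<open>I\<close> a nonzero ideal and \<open>d\<close> a
  nonzero element of the ring of integers.\<close>

definition fractional_ideals :: "complex set \<Rightarrow> complex set set"
  where "fractional_ideals L =
    {(\<lambda>x. x / d) ` I | d I. ideal I (ring_of_integers L) \<and> I \<noteq> {0} \<and>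
       d \<in> carrier (ring_of_integers L) \<and> d \<noteq> 0}"

text \<open>The product of two fractional ideals is formed in the ambient field, hence
  \<^term>\<open>ideal_prod complex_ring\<close>: all finite sums of products of elements.\<close>

definition fractional_ideal_group :: "complex set \<Rightarrow> complex set monoid"
  where "fractional_ideal_group L =
    \<lparr>carrier = fractional_ideals L,
     monoid.mult = ideal_prod complex_ring,
     one = carrier (ring_of_integers L)\<rparr>"

definition principal_fractional_ideals :: "complex set \<Rightarrow> complex set set"
  where "principal_fractional_ideals L =
    {(\<lambda>y. x * y) ` carrier (ring_of_integers L) | x. x \<in> L \<and> x \<noteq> 0}"

definition class_group :: "complex set \<Rightarrow> complex set set monoid"
  where "class_group L = fractional_ideal_group L Mod principal_fractional_ideals L"


section \<open>Tensor products of abelian groups and the p-rank\<close>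

definition tensor_relations ::
  "('a, 'c) monoid_scheme \<Rightarrow> ('b, 'd) monoid_scheme \<Rightarrow> ('a \<times> 'b \<Rightarrow>\<^sub>0 int) set"
  where "tensor_relations G H =
    {frag_of (x \<otimes>\<^bsub>G\<^esub> x', y) - frag_of (x, y) - frag_of (x', y) | x x' y.
       x \<in> carrier G \<and> x' \<in> carrier G \<and> y \<in> carrier H} \<union>
    {frag_of (x, y \<otimes>\<^bsub>H\<^esub> y') - frag_of (x, y) - frag_of (x, y') | x y y'.
       x \<in> carrier G \<and> y \<in> carrier H \<and> y' \<in> carrier H}"

definition tensor_product ::
  "('a, 'c) monoid_scheme \<Rightarrow> ('b, 'd) monoid_scheme \<Rightarrow> ('a \<times> 'b \<Rightarrow>\<^sub>0 int) set monoid"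
  where "tensor_product G H =
    (let F = free_Abelian_group (carrier G \<times> carrier H)
     in F Mod generate F (tensor_relations G H))"

text \<open>\<open>G \<otimes> \<int>/p\<close> as a \<open>\<int>/p\<close>-module. A scalar \<open>c \<in> {0..p - 1}\<close> acts as the \<open>c\<close>-fold sum (which
  is \<open>x \<otimes> a \<mapsto> x \<otimes> c a\<close>). The fields \<open>mult\<close> and \<open>one\<close> of a module record have no meaning.\<close>

definition tensor_residue_module ::
  "('a, 'c) monoid_scheme \<Rightarrow> nat \<Rightarrow> (int, ('a \<times> int \<Rightarrow>\<^sub>0 int) set) module"
  where "tensor_residue_module G p =
    (let T = tensor_product G (add_monoid (residue_ring (int p)))
     in \<lparr>carrier = carrier T, monoid.mult = undefined, one = undefined,
         ring.zero = \<one>\<^bsub>T\<^esub>, add = monoid.mult T, module.smult = (\<lambda>c u. u [^]\<^bsub>T\<^esub> c)\<rparr>)"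

lemma vectorspace_tensor_residue_module:
  assumes "comm_group G" "Factorial_Ring.prime (p::nat)"
  shows "vectorspace (residue_ring (int p)) (tensor_residue_module G p)"
proof -
  interpret G: comm_group G by fact
  have p1: "int p > 1" using prime_gt_1_nat[OF assms(2)] by simp
  interpret R: residues_prime p "residue_ring (int p)"
    by unfold_locales (use assms in auto)
  define H where "H = add_monoid (residue_ring (int p))"
  define F where "F = free_Abelian_group (carrier G \<times> carrier H)"
  define S where "S = generate F (tensor_relations G H)"
  define T where "T = tensor_product G H"
  have T_F: "T = F Mod S" by (simp add: T_def tensor_product_def F_def S_def Let_def)
  have cH: "carrier H = {0..int p - 1}" "mult H = (\<lambda>a b. (a+b) mod int p)"
    by (simp_all add: H_def residue_ring_def)
  interpret F: comm_group F unfolding F_def by (rule abelian_free_Abelian_group)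
  have sub: "tensor_relations G H \<subseteq> carrier F"
  proof
    fix r assume "r \<in> tensor_relations G H"
    then obtain a b c where r: "r = frag_of a - frag_of b - frag_of c" and
      "a \<in> carrier G \<times> carrier H" "b \<in> carrier G \<times> carrier H" "c \<in> carrier G \<times> carrier H"
      using p1 unfolding tensor_relations_def cH by auto
    then have "Poly_Mapping.keys r \<subseteq> carrier G \<times> carrier H"
      using keys_diff[of "frag_of a - frag_of b" "frag_of c"] keys_diff[of "frag_of a" "frag_of b"]
      by auto
    then show "r \<in> carrier F" by (simp add: F_def carrier_free_Abelian_group_iff)
  qed
  have sgS: "subgroup S F" unfolding S_def using sub by (rule F.generate_is_subgroup)
  interpret S: normal S F using F.subgroup_imp_normal[OF sgS] .
  interpret T: comm_group T unfolding T_F using sgS by (rule F.abelian_FactGroup)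
  have addS: "u + v \<in> S" if "u \<in> S" "v \<in> S" for u v
    using S.m_closed[OF that] by (simp add: F_def free_Abelian_group_def)
  have minusS: "- u \<in> S" if "u \<in> S" for u
    using S.m_inv_closed[OF that] S.mem_carrier[OF that] by (simp add: F_def)
  have zeroS: "0 \<in> S" using S.one_closed by (simp add: F_def)
  have inS: "r \<in> S" if "r \<in> tensor_relations G H" for r
    unfolding S_def using that by (rule generate.incl)
  have base: "frag_cmul (int n) (frag_of (x,a)) - frag_of (x, (int n * a) mod int p) \<in> S"
    if "x \<in> carrier G" "a \<in> carrier H" for n x a
  proof (induction n)
    case 0
    have "frag_of (x, 0 \<otimes>\<^bsub>H\<^esub> 0) - frag_of (x,0) - frag_of (x,0) \<in> S"
    proof -
      have "0 \<in> carrier H" using p1 by (simp add: cH)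
      then show ?thesis by (intro inS) (use that(1) in \<open>unfold tensor_relations_def, blast\<close>)
    qed
    then show ?case by (simp add: cH)
  next
    case (Suc n)
    let ?b = "(int n * a) mod int p"
    have b: "?b \<in> carrier H" using p1 by (auto simp: cH)
    have "frag_of (x, ?b \<otimes>\<^bsub>H\<^esub> a) - frag_of (x,?b) - frag_of (x,a) \<in> S"
      by (rule inS) (use that b in \<open>unfold tensor_relations_def, blast\<close>)
    moreover have "?b \<otimes>\<^bsub>H\<^esub> a = (int (Suc n) * a) mod int p" by (simp add: cH mod_simps algebra_simps)
    ultimately have r: "frag_of (x, (int (Suc n) * a) mod int p) - frag_of (x,?b) - frag_of (x,a) \<in> S" by simp
    have "(frag_cmul (int n) (frag_of (x,a)) - frag_of (x, ?b)) +
       - (frag_of (x, (int (Suc n) * a) mod int p) - frag_of (x,?b) - frag_of (x,a)) \<in> S"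
      using addS[OF Suc minusS[OF r]] .
    then show ?case by (simp add: frag_cmul_distrib algebra_simps)
  qed
  have tors: "frag_cmul (int p) u \<in> S" if "Poly_Mapping.keys u \<subseteq> carrier G \<times> carrier H" for u
    using that
  proof (induction u rule: frag_induction)
    case zero then show ?case by (simp add: zeroS)
  next
    case (one x)
    obtain y a where x: "x = (y,a)" by fastforce
    have "frag_cmul (int p) (frag_of (y,a)) - frag_of (y, 0) \<in> S"
      using base[of y a p] one x by auto
    moreover have "frag_of (y,0) \<in> S" 
      using base[of y 0 0] minusS[of "- frag_of (y,0)"] one x p1 by (simp add: cH)
    ultimately show ?case using addS x by fastforce
  next
    case (diff a b)
    have "frag_cmul (int p) (a - b) = frag_cmul (int p) a + - frag_cmul (int p) b"
      by (rule poly_mapping_eqI) (simp add: lookup_add lookup_minus algebra_simps)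
    then show ?case using addS[OF diff(1) minusS[OF diff(2)]] by simp
  qed
  have powF: "u [^]\<^bsub>F\<^esub> n = frag_cmul (int n) u" for u and n :: nat
    by (simp only: F_def pow_free_Abelian_group)
  have pT: "t [^]\<^bsub>T\<^esub> p = \<one>\<^bsub>T\<^esub>" if "t \<in> carrier T" for t
  proof -
    have "t \<in> (\<lambda>u. S #>\<^bsub>F\<^esub> u) ` carrier F"
      using that by (simp only: T_F carrier_FactGroup)
    then obtain u where u: "u \<in> carrier F" "t = S #>\<^bsub>F\<^esub> u"
      by (rule imageE)
    have "t [^]\<^bsub>T\<^esub> p = S #>\<^bsub>F\<^esub> (u [^]\<^bsub>F\<^esub> p)"
      using S.FactGroup_int_pow[OF u(1), of "int p"] by (simp only: T_F u(2) int_pow_int)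
    also have "\<dots> = S" 
    proof (rule F.coset_join2[OF _ sgS])
      have "Poly_Mapping.keys u \<subseteq> carrier G \<times> carrier H"
        using u(1) unfolding F_def carrier_free_Abelian_group_iff .
      then show "u [^]\<^bsub>F\<^esub> p \<in> S" unfolding powF by (rule tors)
    qed (rule F.nat_pow_closed[OF u(1)])
    finally show ?thesis by (simp add: T_F)
  qed
  have pTi: "t [^]\<^bsub>T\<^esub> (c mod int p) = t [^]\<^bsub>T\<^esub> c" if "t \<in> carrier T" for t and c :: int
  proof -
    have "t [^]\<^bsub>T\<^esub> c = t [^]\<^bsub>T\<^esub> (int p * (c div int p) + c mod int p)" by simp
    also have "\<dots> = (t [^]\<^bsub>T\<^esub> int p) [^]\<^bsub>T\<^esub> (c div int p) \<otimes>\<^bsub>T\<^esub> t [^]\<^bsub>T\<^esub> (c mod int p)"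
      using that by (simp only: T.int_pow_mult T.int_pow_pow)
    also have "\<dots> = t [^]\<^bsub>T\<^esub> (c mod int p)" using pT[OF that] that by (simp add: int_pow_int)
    finally show ?thesis by simp
  qed
  have M: "tensor_residue_module G p = \<lparr>carrier = carrier T, monoid.mult = undefined, one = undefined,
         ring.zero = \<one>\<^bsub>T\<^esub>, add = monoid.mult T, module.smult = (\<lambda>c u. u [^]\<^bsub>T\<^esub> c)\<rparr>"
    by (simp add: tensor_residue_module_def T_def H_def Let_def)
  show ?thesis
    unfolding vectorspace_def
  proof
    show "module (residue_ring (int p)) (tensor_residue_module G p)"
    proof (rule moduleI, goal_cases)
      case 1 show ?case by (rule R.cring)
    next
      case 2 show ?case unfolding M
        by (rule abelian_groupI) (auto simp: T.m_ac intro: T.l_inv_ex)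
    qed (auto simp: M residue_ring_def pTi T.int_pow_mult T.int_pow_pow T.int_pow_mult_distrib[OF T.m_comm] mult.commute)
  qed (rule R.is_field)
qed

text \<open>The library dimension is a meaningful number only for finite-dimensional spaces.\<close>

definition vs_dim :: "('k, 'c) ring_scheme \<Rightarrow> ('k, 'v, 'd) module_scheme \<Rightarrow> enat"
  where "vs_dim K V =
    (if vectorspace.fin_dim K V then enat (vectorspace.dim K V) else \<infinity>)"

definition p_rank :: "nat \<Rightarrow> ('a, 'c) monoid_scheme \<Rightarrow> enat"
  where "p_rank p G = vs_dim (residue_ring (int p)) (tensor_residue_module G p)"

end

theory Submission
  imports Defs "Jordan_Normal_Form.Char_Poly" "HOL-Library.Function_Algebras"
begin

text \<open>Let K be the field of p-th roots of unity and \<sigma> a generator of the Galois group of L over K. The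
  p-1 primes of K over N are totally ramified in L, which gives classes of primes Q_i fixed by \<sigma>. One
  more class comes from an ideal J: if N is not 1 modulo p^2, the prime of K over p is also totally
  ramified and J is the prime of L over it; if N is 1 modulo p^2, a primitive p-th root of unity is
  the norm of some y in L, and J is an ideal with J = y \<sigma>(J). A relation modulo p-th powers between the
  classes of the Q_i and J gives an element z for which \<sigma>(z)/z, corrected by a power of y, is a
  unit u, and by the total ramification u modulo the units e/\<sigma>(e) determines the relation modulo p.
  As the units whose norm to K is a root of unity form, up to torsion, a lattice over the ring of
  integers of K of rank (p-1)/2, at most (p+1)/2 of the p exponents are lost, and p-torsion of rank
  at least (p-1)/2 remains.

  That the root of unity is a norm is obtained from an element of the field of p^2-th roots of unity
  whose norm to K is a power N^c with p not dividing c. It exists because the subfield of degree p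
  over the rationals has class number prime to p. Hilbert 90 over the compositum with L then
  turns N^c = Norm(W) into the required y.\<close>

text \<open>Why p classes: the count loses (p+1)/2 exponents, so the p-1 primes over N alone would
  leave only (p-3)/2, and one further class has to be found. If N is 1 modulo p^2, it is a p-th
  power in the p-adic numbers, primes over p do not ramify in L/K, and J is only required to be
  fixed up to a factor y. Where (p+1)/2 comes from: on logarithms of relative units the sum of the
  powers of \<sigma> vanishes, so 1 - \<sigma> acts like 1 - \<zeta>, a prime of norm p, and at most
  p^((p-1)/2) classes survive modulo its image; the torsion units add one more factor p. Why torsion
  is counted: for the subgroup A generated by the p classes, A/A^p and the p-torsion of A have the
  same size, and the torsion of A lies in that of the class group, whereas A/A^p need not embed in
  the corresponding quotient. The class number statement enters as a fixed point count: a nontrivial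
  p-torsion class of the field of p^2-th roots of unity that is fixed by the subgroup of order p-1
  forces a nontrivial one fixed by the whole Galois group, and such a class has order at most
  2.\<close>

abbreviation (input) "pdeg == Polynomial.degree"

section \<open>Algebraic integers\<close>


text \<open>The determinant trick: the vector of the \<open>v i\<close> is an eigenvector of an
  integer matrix for the eigenvalue \<open>x\<close>, so \<open>x\<close> is a root of the monic
  characteristic polynomial. The index \<open>k\<close> certifies that the vector is not
  zero.\<close>

lemma algebraic_int_of_integral_matrix:
 fixes x :: complex and v :: "'i => complex" and a :: "'i => 'i => int"
 assumes fin: "finite I" and nz: "k : I" "v k ~= 0"
  and eq: "!!i. i : I ==> x * v i = (\<Sum>j\<in>I. of_int (a i j) * v j)"
 shows "algebraic_int x"
proof -
 obtain h where h: "bij_betw h {0..<card I} I"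
  using ex_bij_betw_nat_finite[OF fin] by blast
 define n where "n = card I"
 define A where "A = Matrix.mat n n (%(i,j). a (h i) (h j))"
 define B where "B = map_mat (of_int :: int => complex) A"
 define w where "w = Matrix.vec n (%i. v (h i))"
 have A: "A : carrier_mat n n" by (simp add: A_def)
 have B: "B : carrier_mat n n" using A by (simp add: B_def)
 have w: "w : carrier_vec n" by (simp add: w_def)
 have "EX i<n. h i = k" using h nz(1) unfolding bij_betw_def n_def by (metis atLeastLessThan_iff imageE)
 then obtain i0 where i0: "i0 < n" "h i0 = k" by auto
 have wnz: "w ~= 0\<^sub>v n"
 proof
  assume "w = 0\<^sub>v n"
  hence "w $ i0 = 0" using i0 by simp
  thus False using i0 nz by (simp add: w_def)
 qed
 have "B *\<^sub>v w = x \<cdot>\<^sub>v w"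
 proof (rule eq_vecI)
  fix i assume "i < dim_vec (x \<cdot>\<^sub>v w)"
  hence i: "i < n" by (simp add: w_def)
  have "(B *\<^sub>v w) $ i = (\<Sum>j = 0..<n. of_int (a (h i) (h j)) * v (h j))"
   using i by (simp add: B_def A_def w_def scalar_prod_def)
  also have "... = (\<Sum>j\<in>I. of_int (a (h i) j) * v j)"
   using sum.reindex_bij_betw[OF h, of "%j. of_int (a (h i) j) * v j"] by (simp add: n_def)
  also have "... = x * v (h i)"
   using eq[of "h i"] bij_betwE[OF h] i by (simp add: n_def)
  finally show "(B *\<^sub>v w) $ i = (x \<cdot>\<^sub>v w) $ i" using i by (simp add: w_def)
 qed (simp add: B_def A_def w_def)
 hence "eigenvalue B x" unfolding eigenvalue_def eigenvector_def
  using w wnz B by (auto intro!: exI[of _ w])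
 hence "poly (char_poly B) x = 0"
  using eigenvalue_root_char_poly[OF B] by simp
 moreover have "char_poly B = map_poly of_int (char_poly A)"
  unfolding B_def by (rule of_int_hom.char_poly_hom[OF A])
 moreover have "lead_coeff (char_poly A) = 1"
  using degree_monic_char_poly[OF A] by simp
 ultimately show ?thesis unfolding algebraic_int_altdef_ipoly by auto
qed

lemma algebraic_int_powers:
 fixes x :: complex
 assumes "algebraic_int x"
 obtains n c where "n > 0" "x ^ n = (\<Sum>k<n. of_int (c k) * x ^ k)"
proof -
 obtain p where p: "poly (map_poly of_int p) x = 0" "lead_coeff p = 1"
  using assms unfolding algebraic_int_altdef_ipoly by blast
 have pos: "degree p > 0"
 using degree_eq_zeroE[of p] p ccontr by fastforce
 have "0 = (\<Sum>k\<le>degree p. of_int (poly.coeff p k) * x ^ k)"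
  using p(1) by (simp add: poly_altdef coeff_map_poly degree_map_poly)
 also have "{..degree p} = insert (degree p) {..<degree p}" by auto
 finally have "x ^ degree p = (\<Sum>k<degree p. of_int (- poly.coeff p k) * x ^ k)"
  using p(2) by (simp add: sum_negf add_eq_0_iff2)
 thus ?thesis by (rule that[OF pos])
qed

text \<open>The products \<open>x ^ i * y ^ j\<close> below the degrees of two monic relations span
  a group \<open>S\<close> that is stable under \<open>x\<close> and \<open>y\<close>, hence under
  their sum and product. The determinant trick applies, the entry 1 at \<open>(0,0)\<close> being
  nonzero.\<close>

lemma algebraic_int_span:
 fixes x y z :: complex
 assumes "algebraic_int x" "algebraic_int y"
  and z: "z = x + y \<or> z = x * y"
 shows "algebraic_int z"
proof -
 obtain m c where m: "m > 0" "x ^ m = (\<Sum>k<m. of_int (c k) * x ^ k)"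
  using algebraic_int_powers[OF assms(1)] by blast
 obtain n d where n: "n > 0" "y ^ n = (\<Sum>k<n. of_int (d k) * y ^ k)"
  using algebraic_int_powers[OF assms(2)] by blast
 define I where "I = {..<m} \<times> {..<n}"
 define v where "v = (%(i::nat,j::nat). x ^ i * y ^ j)"
 define S where "S = {s. EX a :: nat \<times> nat => int. s = (\<Sum>j\<in>I. of_int (a j) * v j)}"
 have fin: "finite I" by (simp add: I_def)
 have SI: "(\<Sum>j\<in>I. of_int (a j) * v j) : S" for a
  unfolding S_def mem_Collect_eq by (rule exI[of _ a], rule refl)
 have vS: "v i : S" if "i : I" for i
 proof -
  have "(\<Sum>j\<in>I. of_int (if j = i then 1 else 0) * v j) = (\<Sum>j\<in>I. if j = i then v j else 0)"
   by (rule sum.cong) auto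
  also have "... = v i" using that fin by (simp add: sum.delta)
  finally have "v i = (\<Sum>j\<in>I. of_int (if j = i then 1 else 0) * v j)" ..
  thus ?thesis by (simp only: SI)
 qed
 have addS: "s + t : S" if st: "s : S" "t : S" for s t
 proof -
  obtain a b where "s = (\<Sum>j\<in>I. of_int (a j) * v j)" "t = (\<Sum>j\<in>I. of_int (b j) * v j)"
   using st unfolding S_def mem_Collect_eq by metis
  hence "s + t = (\<Sum>j\<in>I. of_int (a j + b j) * v j)" by (simp add: sum.distrib algebra_simps)
  thus ?thesis by (simp only: SI)
 qed
 have scS: "of_int c * s : S" if s: "s : S" for s c
 proof -
  obtain a where "s = (\<Sum>j\<in>I. of_int (a j) * v j)" using s unfolding S_def mem_Collect_eq ..
  hence "of_int c * s = (\<Sum>j\<in>I. of_int (c * a j) * v j)" by (simp add: sum_distrib_left algebra_simps)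
  thus ?thesis by (simp only: SI)
 qed
 have zeroS: "0 : S" unfolding S_def by (auto intro!: exI[of _ "%_. 0"])
 have sumS: "sum f A : S" if "!!i. i : A ==> f i : S" for f :: "'k => complex" and A
  using that by (induction A rule: infinite_finite_induct) (auto simp: zeroS addS)
 have xS: "x * v i : S" if iI: "i : I" for i
 proof -
  obtain a b where i: "i = (a,b)" "a < m" "b < n" using iI by (auto simp: I_def)
  show ?thesis
  proof (cases "Suc a < m")
   case True
   hence "v (Suc a, b) : S" using i by (intro vS) (auto simp: I_def)
   thus ?thesis by (simp add: i v_def mult.assoc)
  next
   case False
   hence a: "Suc a = m" using i by simp
   have "x * v i = x ^ m * y ^ b" by (simp add: i v_def mult_ac flip: a)
   also have "... = (\<Sum>k<m. of_int (c k) * v (k,b))"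
    unfolding m(2) by (simp add: i v_def sum_distrib_right mult.assoc)
   also have "... : S" using i by (intro sumS scS vS) (auto simp: I_def)
   finally show ?thesis .
  qed
 qed
 have yS: "y * v i : S" if iI: "i : I" for i
 proof -
  obtain a b where i: "i = (a,b)" "a < m" "b < n" using iI by (auto simp: I_def)
  show ?thesis
  proof (cases "Suc b < n")
   case True
   hence "v (a, Suc b) : S" using i by (intro vS) (auto simp: I_def)
   thus ?thesis by (simp add: i v_def mult_ac)
  next
   case False
   hence b: "Suc b = n" using i by simp
   have "y * v i = x ^ a * y ^ n" by (simp add: i v_def mult_ac flip: b)
   also have "... = (\<Sum>k<n. of_int (d k) * v (a,k))"
    unfolding n(2) by (simp add: i v_def sum_distrib_left mult_ac)
   also have "... : S" using i by (intro sumS scS vS) (auto simp: I_def)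
   finally show ?thesis .
  qed
 qed
 have yS': "y * s : S" if s: "s : S" for s
 proof -
  obtain a where a: "s = (\<Sum>j\<in>I. of_int (a j) * v j)" using s unfolding S_def mem_Collect_eq ..
  have "(\<Sum>j\<in>I. of_int (a j) * (y * v j)) : S"
   by (rule sumS, rule scS, rule yS)
  thus ?thesis by (simp add: a sum_distrib_left mult_ac)
 qed
 have zS: "z * v i : S" if "i : I" for i
  using z addS[OF xS[OF that] yS[OF that]] yS'[OF xS[OF that]]
  by (auto simp: algebra_simps)
 hence ex: "ALL i:I. EX a. z * v i = (\<Sum>j\<in>I. of_int (a j) * v j)" by (simp add: S_def)
 from bchoice[OF ex] obtain a where a: "ALL i:I. z * v i = (\<Sum>j\<in>I. of_int (a i j) * v j)" ..
 show ?thesis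
 using m n algebraic_int_of_integral_matrix[OF fin, of "(0,0)" v z a] a by (auto simp: I_def v_def)
qed

lemma algebraic_int_add_complex: "algebraic_int (x::complex) ==> algebraic_int y ==> algebraic_int (x + y)"
 and algebraic_int_mult_complex: "algebraic_int (x::complex) ==> algebraic_int y ==> algebraic_int (x * y)"
 using algebraic_int_span by blast+

lemma algebraic_int_diff_complex: "algebraic_int (x::complex) ==> algebraic_int y ==> algebraic_int (x - y)"
 using algebraic_int_add_complex[of x "- y"] by simp

lemma algebraic_int_sum_complex: "(!!i. i : A ==> algebraic_int (f i :: complex)) ==> algebraic_int (sum f A)"
 by (induction A rule: infinite_finite_induct) (auto intro: algebraic_int_add_complex)

lemma algebraic_int_prod_complex: "(!!i. i : A ==> algebraic_int (f i :: complex)) ==> algebraic_int (prod f A)"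
 by (induction A rule: infinite_finite_induct) (auto intro: algebraic_int_mult_complex)

lemma algebraic_int_power_complex: "algebraic_int (x::complex) ==> algebraic_int (x ^ n)"
 by (induction n) (auto intro: algebraic_int_mult_complex)

section \<open>Number fields with an explicit Galois group\<close>


text \<open>An automorphism is a total function that vanishes outside \<open>L\<close>
  (\<open>Gout\<close>), so its values on \<open>L\<close> determine it and equality in
  \<open>G\<close> is equality of functions. \<open>Tr_Rats\<close> encodes that the fixed field is
  the field of rationals. \<open>bas\<close> and \<open>dua\<close> are a frame with its trace duals
  up to the factor \<open>D\<close>; the frame need not be an integral basis, but it bounds
  denominators and makes the quotients of the ring of integers finite.\<close>

locale numfield =
 fixes L :: "complex set" and G :: "(complex => complex) set"
  and B :: "(nat \<times> nat) set" and bas dua :: "nat \<times> nat => complex" and D :: nat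
 assumes L1: "1 : L"
  and Ladd: "x : L ==> y : L ==> x + y : L"
  and Lmult: "x : L ==> y : L ==> x * y : L"
  and Lminus: "x : L ==> - x : L"
  and Linv: "x : L ==> inverse x : L"
  and Gfin: "finite G"
  and Gid: "EX e:G. ALL x:L. e x = x"
  and GL: "g : G ==> x : L ==> g x : L"
  and Gadd: "g : G ==> x : L ==> y : L ==> g (x + y) = g x + g y"
  and Gmult: "g : G ==> x : L ==> y : L ==> g (x * y) = g x * g y"
  and G1: "g : G ==> g 1 = 1"
  and Gout: "g : G ==> x ~: L ==> g x = 0"
  and Gcomp: "g : G ==> h : G ==> (%x. g (h x)) : G"
  and Tr_Rats: "x : L ==> (\<Sum>g\<in>G. g x) : \<rat>"
  and Bfin: "finite B" and Dpos: "D > 0"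
  and bas: "k : B ==> bas k : L" "k : B ==> algebraic_int (bas k)"
  and dua: "k : B ==> dua k : L" "k : B ==> algebraic_int (dua k)"
  and dual: "x : L ==> of_nat D * x = (\<Sum>k\<in>B. (\<Sum>g\<in>G. g (dua k * x)) * bas k)"
begin

definition Oi :: "complex set" where "Oi = {x : L. algebraic_int x}"
definition Nm :: "complex => complex" where "Nm x = (\<Prod>g\<in>G. g x)"
definition Tr :: "complex => complex" where "Tr x = (\<Sum>g\<in>G. g x)"

lemma L0: "0 : L" using Ladd[OF L1 Lminus[OF L1]] by simp

lemma Ldiff: "x : L ==> y : L ==> x - y : L" using Ladd[OF _ Lminus, of x y] by simp

lemma Ldiv: "x : L ==> y : L ==> x / y : L"
 using Lmult[OF _ Linv, of x y] by (simp add: divide_inverse)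

lemma Lof_nat: "of_nat n : L"
 by (induction n) (auto simp: L0 L1 Ladd)

lemma Lof_int: "of_int n : L"
 by (cases n rule: int_cases2) (auto simp: Lof_nat Lminus)

lemma LRats: "x : \<rat> ==> x : L"
 by (auto elim!: Rats_cases' simp: Ldiv Lof_int)

lemma Lsum: "(!!i. i : A ==> f i : L) ==> sum f A : L"
 by (induction A rule: infinite_finite_induct) (auto simp: L0 Ladd)

lemma Lprod: "(!!i. i : A ==> f i : L) ==> prod f A : L"
 by (induction A rule: infinite_finite_induct) (auto simp: L1 Lmult)

lemma Lpow: "x : L ==> x ^ n : L"
 by (induction n) (auto simp: L1 Lmult)

context
 fixes g assumes g: "g : G"
begin

lemmas gL = GL[OF g] and gadd = Gadd[OF g] and gmult = Gmult[OF g] and g1 = G1[OF g]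

lemma G0: "g 0 = 0"
 using gadd[of 0 0] L0 by simp

lemma Gminus: "x : L ==> g (- x) = - g x"
 using gadd[of x "- x"] G0 Lminus[of x] by (simp add: add_eq_0_iff)

lemma Gdiff: "x : L ==> y : L ==> g (x - y) = g x - g y"
 using gadd[of x "- y"] Gminus[of y] Lminus[of y] by simp

lemma Gof_nat: "g (of_nat n) = of_nat n"
 by (induction n) (auto simp: G0 g1 gadd L1 Lof_nat)

lemma Gof_int: "g (of_int n) = of_int n"
 by (cases n rule: int_cases2) (auto simp: Gof_nat Gminus Lof_nat)

lemma Gne: "x : L ==> x ~= 0 ==> g x ~= 0"
 using gmult[of x "inverse x"] g1 Linv[of x] by auto

lemma Ginv: "x : L ==> g (inverse x) = inverse (g x)"
 using gmult[of x "inverse x"] g1 Linv[of x] G0 Gne[of x]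
 by (cases "x = 0") (auto simp: field_simps)

lemma Gdiv: "x : L ==> y : L ==> g (x / y) = g x / g y"
 using gmult[of x "inverse y"] Ginv[of y] Linv[of y] by (simp add: divide_inverse)

lemma GRats: "x : \<rat> ==> g x = x"
 by (auto elim!: Rats_cases' simp: Gdiv Lof_int Gof_int)

lemma Gsum: "(!!i. i : A ==> f i : L) ==> g (sum f A) = (\<Sum>i\<in>A. g (f i))"
 by (induction A rule: infinite_finite_induct) (auto simp: G0 gadd Lsum)

lemma Gprod: "(!!i. i : A ==> f i : L) ==> g (prod f A) = (\<Prod>i\<in>A. g (f i))"
 by (induction A rule: infinite_finite_induct) (auto simp: g1 gmult Lprod)

lemma Gpow: "x : L ==> g (x ^ n) = g x ^ n"
 by (induction n) (auto simp: g1 gmult Lpow)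

lemma Ginj: "inj_on g L"
proof (rule inj_onI, rule ccontr)
 fix x y assume "x : L" "y : L" "g x = g y" "x ~= y"
 thus False using Gdiff[of x y] Gne[of "x - y"] Ldiff[of x y] by simp
qed

lemma G_alg:
 assumes x: "x : L" and a: "algebraic_int x"
 shows "algebraic_int (g x)"
proof -
 obtain p where p: "poly (map_poly of_int p) x = 0" "lead_coeff p = 1"
  using a unfolding algebraic_int_altdef_ipoly by blast
 have "g (poly (map_poly of_int p) x) = poly (map_poly of_int p) (g x)"
  by (simp add: poly_altdef coeff_map_poly degree_map_poly x Gsum gmult Gpow Gof_int Lmult Lof_int Lpow)
 hence "poly (map_poly of_int p) (g x) = 0" using p G0 by simp
 thus ?thesis unfolding algebraic_int_altdef_ipoly using p(2) by (intro exI[of _ p]) simp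
qed

end

lemma Gbij: assumes h: "h : G" shows "bij_betw (%g x. h (g x)) G G"
proof -
 have "inj_on (%g x. h (g x)) G"
 proof (rule inj_onI, rule ext)
  fix g g' x assume g: "g : G" "g' : G" and e: "(%x. h (g x)) = (%x. h (g' x))"
  show "g x = g' x"
  proof (cases "x : L")
   case True
   show ?thesis
    by (rule inj_onD[OF Ginj[OF h]]) (use fun_cong[OF e, of x] GL[OF g(1) True] GL[OF g(2) True] in auto)
  next
   case False
   thus ?thesis using Gout[OF g(1)] Gout[OF g(2)] by simp
  qed
 qed
 moreover have "(%g x. h (g x)) ` G <= G" using Gcomp h by auto
 ultimately show ?thesis
  unfolding bij_betw_def using Gfin by (simp add: endo_inj_surj)
qed

lemma G_right_inverse:
 assumes h: "h : G"
 obtains g where "g : G" "ALL x:L. h (g x) = x"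
proof -
 obtain e where e: "e : G" "ALL x:L. e x = x" using Gid by blast
 have "e : (%g x. h (g x)) ` G" using e(1) Gbij[OF h] unfolding bij_betw_def by simp
 then obtain g where g: "g : G" "e = (%x. h (g x))" by (rule imageE)
 show ?thesis
 proof (rule that[OF g(1)], rule ballI)
  fix x assume "x : L"
  hence "e x = x" using e(2) by blast
  thus "h (g x) = x" unfolding g(2) .
 qed
qed

lemma Gbij_L: assumes h: "h : G" shows "bij_betw h L L"
proof -
 obtain g where g: "g : G" "ALL x:L. h (g x) = x" by (rule G_right_inverse[OF h])
 have "L <= h ` L"
 proof
  fix x assume x: "x : L"
  show "x : h ` L" using bspec[OF g(2) x] GL[OF g(1) x] by (metis image_eqI)
 qed
 thus ?thesis unfolding bij_betw_def using Ginj[OF h] GL[OF h] by auto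
qed

lemma sum_G_comp: "h : G ==> (\<Sum>g\<in>G. f (%x. h (g x))) = (\<Sum>g\<in>G. f g)"
 by (rule sum.reindex_bij_betw[OF Gbij])

lemma prod_G_comp: "h : G ==> (\<Prod>g\<in>G. f (%x. h (g x))) = (\<Prod>g\<in>G. f g)"
 by (rule prod.reindex_bij_betw[OF Gbij])

text \<open>The trace of a fixed element is \<open>card G\<close> times that element, and traces are
  rational.\<close>

lemma fixed_Rats:
 assumes x: "x : L" and f: "!!g. g : G ==> g x = x"
 shows "x : \<rat>"
proof -
 have "(\<Sum>g\<in>G. g x) = (\<Sum>g\<in>G. x)" by (rule sum.cong[OF refl f])
 hence "of_nat (card G) * x : \<rat>" using Tr_Rats[OF x] by simp
 moreover have "card G > 0" using Gfin Gid by (auto simp: card_gt_0_iff)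
 ultimately have "of_nat (card G) * x / of_nat (card G) : \<rat>" by (intro Rats_divide) auto
 thus ?thesis using \<open>card G > 0\<close> by simp
qed

lemma NmL: "x : L ==> Nm x : L" unfolding Nm_def by (rule Lprod) (rule GL)

lemma Nm_mult: assumes "x : L" "y : L" shows "Nm (x * y) = Nm x * Nm y"
 unfolding Nm_def prod.distrib[symmetric] by (rule prod.cong[OF refl Gmult[OF _ assms]])

lemma Nm_1: "Nm 1 = 1" unfolding Nm_def by (rule prod.neutral) (use G1 in blast)

lemma Nm_nz: assumes x: "x : L" shows "Nm x = 0 \<longleftrightarrow> x = 0"
using Gfin Gne x Gid G0 by (auto simp: Nm_def prod_zero_iff)

lemma Nm_pow: "x : L ==> Nm (x ^ n) = Nm x ^ n"
 by (induction n) (auto simp: Nm_1 Nm_mult Lpow)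

lemma Nm_of_int: "Nm (of_int n) = of_int n ^ card G"
using prod.cong[OF refl Gof_int] by (fastforce simp: Nm_def)

lemma Nm_G: assumes g: "g : G" and x: "x : L" shows "g (Nm x) = Nm x"
using Gprod[OF g] GL[OF _ x] prod_G_comp[OF g, of "%h. h x"] by (metis Gprod[OF g] GL[OF _ x] prod_G_comp[OF g, of "%h. h x"] Nm_def)

lemma Nm_Rats: "x : L ==> Nm x : \<rat>"
 by (rule fixed_Rats) (auto simp: NmL intro: Nm_G)

lemma Oi_L: "x : Oi ==> x : L" by (simp add: Oi_def)
lemma Oi_alg: "x : Oi ==> algebraic_int x" by (simp add: Oi_def)
lemma Oi_add: "x : Oi ==> y : Oi ==> x + y : Oi"
 by (simp add: Oi_def Ladd algebraic_int_add_complex)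
lemma Oi_mult: "x : Oi ==> y : Oi ==> x * y : Oi"
 by (simp add: Oi_def Lmult algebraic_int_mult_complex)
lemma Oi_minus: "x : Oi ==> - x : Oi" by (simp add: Oi_def Lminus)
lemma Oi_diff: "x : Oi ==> y : Oi ==> x - y : Oi"
 by (simp add: Oi_def Ldiff algebraic_int_diff_complex)
lemma Oi_of_int: "of_int n : Oi" by (simp add: Oi_def Lof_int)
lemma Oi_of_nat: "of_nat n : Oi" by (simp add: Oi_def Lof_nat)
lemma Oi_0: "0 : Oi" by (simp add: Oi_def L0)
lemma Oi_1: "1 : Oi" by (simp add: Oi_def L1)
lemma Oi_pow: "x : Oi ==> x ^ n : Oi" by (induction n) (auto simp: Oi_1 Oi_mult)
lemma Oi_sum: "(!!i. i : A ==> f i : Oi) ==> sum f A : Oi"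
 by (induction A rule: infinite_finite_induct) (auto simp: Oi_0 Oi_add)
lemma Oi_prod: "(!!i. i : A ==> f i : Oi) ==> prod f A : Oi"
 by (induction A rule: infinite_finite_induct) (auto simp: Oi_1 Oi_mult)
lemma Oi_G: "g : G ==> x : Oi ==> g x : Oi" by (simp add: Oi_def GL G_alg)
lemma Oi_bas: "k : B ==> bas k : Oi" "k : B ==> dua k : Oi" by (simp_all add: Oi_def bas dua)
lemma Oi_Rats: "x : Oi ==> x : \<rat> ==> x : \<int>"
 by (rule rational_algebraic_int_is_int) (simp_all add: Oi_def)

lemma Oi_G_image: assumes g: "g : G" shows "g ` Oi = Oi"
proof
 show "g ` Oi <= Oi" using Oi_G[OF g] by blast
 obtain h where h: "h : G" "ALL x:L. g (h x) = x" by (rule G_right_inverse[OF g])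
 show "Oi <= g ` Oi"
 proof
  fix x assume x: "x : Oi"
  show "x : g ` Oi" using bspec[OF h(2) Oi_L[OF x]] Oi_G[OF h(1) x] by (metis image_eqI)
 qed
qed

lemma Nm_Ints: assumes x: "x : Oi" shows "Nm x : \<int>"
proof (rule Oi_Rats)
 show "Nm x : Oi" unfolding Nm_def by (rule Oi_prod) (rule Oi_G[OF _ x])
qed (rule Nm_Rats[OF Oi_L[OF x]])

lemma Tr_Ints: assumes x: "x : Oi" shows "Tr x : \<int>"
using Oi_Rats Oi_sum Oi_G[OF _ x] by (metis Oi_Rats Oi_sum Oi_G[OF _ x] Tr_def Tr_Rats[OF Oi_L[OF x]])

lemma Nm_cofactor:
 assumes x: "x : Oi"
 obtains y where "y : Oi" "x * y = Nm x"
proof -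
 obtain e where e: "e : G" "ALL x:L. e x = x" using Gid by blast
 have "Nm x = e x * (\<Prod>g\<in>G - {e}. g x)" unfolding Nm_def using prod.remove[OF Gfin e(1)] by blast
 moreover have "(\<Prod>g\<in>G - {e}. g x) : Oi" by (rule Oi_prod) (use Oi_G[OF _ x] in auto)
 ultimately show ?thesis using that e Oi_L[OF x] by auto
qed

lemma Nm_abs:
 assumes x: "x : Oi" "x ~= 0"
 obtains n :: nat where "n > 0" "norm (Nm x) = of_nat n" "of_nat n / x : Oi" "Nm x = of_nat n \<or> Nm x = - of_nat n"
proof -
 obtain k where k: "Nm x = of_int k" using Nm_Ints[OF x(1)] by (auto elim: Ints_cases)
 have "k ~= 0" using Nm_nz[OF Oi_L[OF x(1)]] x k by auto
 obtain y where y: "y : Oi" "x * y = Nm x" using Nm_cofactor[OF x(1)] .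
 have y': "y = of_int k / x" using y k x by (simp add: field_simps)
 have e: "of_nat (nat \<bar>k\<bar>) = (of_int \<bar>k\<bar> :: complex)" "of_nat (nat \<bar>k\<bar>) = (of_int \<bar>k\<bar> :: real)" by simp_all
 have "of_nat (nat \<bar>k\<bar>) / x : Oi"
  unfolding e using y(1) y' Oi_minus[of y] by (cases "k >= 0") (auto simp: abs_if)
 moreover have "Nm x = of_nat (nat \<bar>k\<bar>) \<or> Nm x = - of_nat (nat \<bar>k\<bar>)"
  unfolding e k by (cases "k >= 0") (auto simp: abs_if)
 moreover have "norm (Nm x) = of_nat (nat \<bar>k\<bar>)" unfolding e k by (simp add: norm_of_int)
 ultimately show ?thesis using that[of "nat \<bar>k\<bar>"] \<open>k ~= 0\<close> by simp
qed

text \<open>The coordinates \<open>Tr (dua k * x)\<close> are finitely many rationals;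
  \<open>m\<close> clears their denominators and absorbs the factor \<open>D\<close> of the dual
  formula.\<close>

lemma L_denom:
 assumes x: "x : L"
 obtains n :: nat where "n > 0" "of_nat n * x : Oi"
proof -
 have ex: "ALL k:B. EX n>0. of_nat n * Tr (dua k * x) : \<int>"
 proof
  fix k assume "k : B"
  hence "Tr (dua k * x) : \<rat>" unfolding Tr_def by (intro Tr_Rats Lmult dua(1) x)
  then obtain a b where ab: "b > 0" "Tr (dua k * x) = of_int a / of_int b" by (auto elim: Rats_cases')
  hence "of_nat (nat b) * Tr (dua k * x) = of_int a" by simp
  hence "of_nat (nat b) * Tr (dua k * x) : \<int>" by simp
  thus "EX n>0. of_nat n * Tr (dua k * x) : \<int>" using ab(1) by (intro exI[of _ "nat b"]) auto
 qed
 from bchoice[OF ex] obtain n where n: "ALL k:B. n k > 0 & of_nat (n k) * Tr (dua k * x) : \<int>" ..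
 define m where "m = D * (\<Prod>k\<in>B. n k)"
 have "of_nat (\<Prod>k\<in>B. n k) * Tr (dua k * x) : Oi" if k: "k : B" for k
 proof -
  have "of_nat (\<Prod>k\<in>B. n k) * Tr (dua k * x) = of_nat (\<Prod>k\<in>B-{k}. n k) * (of_nat (n k) * Tr (dua k * x))"
   using prod.remove[OF Bfin k, of n] by (simp add: mult_ac)
  also have "... : Oi"
  using n k Oi_mult[OF Oi_of_nat] Ints_cases Oi_of_int by (metis n k Oi_mult[OF Oi_of_nat] Ints_cases Oi_of_int)
  finally show ?thesis .
 qed
 hence "(\<Sum>k\<in>B. (of_nat (\<Prod>k\<in>B. n k) * Tr (dua k * x)) * bas k) : Oi"
  by (intro Oi_sum, rule Oi_mult) (auto intro: Oi_bas)
 also have "(\<Sum>k\<in>B. (of_nat (\<Prod>k\<in>B. n k) * Tr (dua k * x)) * bas k)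
   = of_nat (\<Prod>k\<in>B. n k) * (of_nat D * x)"
  unfolding dual[OF x, folded Tr_def] sum_distrib_left by (simp only: mult.assoc)
 also have "... = of_nat m * x" by (simp add: m_def)
 finally have "of_nat m * x : Oi" .
 moreover have "m > 0" using n Dpos by (simp add: m_def prod_pos)
 ultimately show ?thesis using that by blast
qed

text \<open>Traces of integers against the dual frame are integers. They are recorded modulo
  \<open>m * D\<close> instead of \<open>m\<close>, because the dual formula expresses
  \<open>D\<close> times the difference; equal records then force a difference in
  \<open>m * Oi\<close>. The map \<open>f\<close> stands in for reduction modulo \<open>m\<close>,
  of which it may be a refinement.\<close>

lemma finite_quotient:
 assumes m: "m > (0::nat)"
 obtains f :: "complex => nat \<times> nat => int"
 where "finite (f ` Oi)" "!!x y. x : Oi ==> y : Oi ==> f x = f y ==> (x - y) / of_nat m : Oi"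
proof
 define t where "t = (%x k. \<lfloor>Re (Tr (dua k * x))\<rfloor>)"
 define f where "f = (%x k. if k : B then t x k mod int (m * D) else 0)"
 have t: "of_int (t x k) = Tr (dua k * x)" if "x : Oi" "k : B" for x k
  using Tr_Ints[of "dua k * x"] that Oi_mult Oi_bas by (auto simp: t_def elim!: Ints_cases)
 have "f ` Oi <= {h. ALL k. (k : B --> h k : {0..<int (m * D)}) & (k ~: B --> h k = 0)}"
  using m Dpos by (auto simp: f_def)
 moreover have "finite ..." by (rule finite_set_of_finite_funs[OF Bfin]) simp
 ultimately show "finite (f ` Oi)" by (rule finite_subset)
 fix x y assume xy: "x : Oi" "y : Oi" "f x = f y"
 have ex: "ALL k:B. EX c. t x k - t y k = int (m * D) * c"
 proof
  fix k assume kB: "k : B"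
  have "t x k mod int (m * D) = t y k mod int (m * D)"
   using fun_cong[OF xy(3), of k] kB by (simp add: f_def)
  hence "int (m * D) dvd t x k - t y k" by (simp only: mod_eq_dvd_iff)
  thus "EX c. t x k - t y k = int (m * D) * c" by (rule dvdE) blast
 qed
 from bchoice[OF ex] obtain c where c: "ALL k:B. t x k - t y k = int (m * D) * c k" ..
 have tc: "Tr (dua k * x) - Tr (dua k * y) = of_nat D * (of_nat m * of_int (c k))" if "k : B" for k
 proof -
  have "Tr (dua k * x) - Tr (dua k * y) = of_int (t x k - t y k)" using t xy that by simp
  thus ?thesis using bspec[OF c that] by simp
 qed
 have "of_nat D * (x - y) = (\<Sum>k\<in>B. (Tr (dua k * x) - Tr (dua k * y)) * bas k)"
  using dual[OF Oi_L[OF xy(1)]] dual[OF Oi_L[OF xy(2)]]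
  by (simp add: Tr_def algebra_simps sum_subtractf)
 also have "... = of_nat D * (of_nat m * (\<Sum>k\<in>B. of_int (c k) * bas k))"
  unfolding sum_distrib_left by (rule sum.cong) (simp_all add: tc)
 finally have "(x - y) / of_nat m = (\<Sum>k\<in>B. of_int (c k) * bas k)" using Dpos m by simp
 also have "... : Oi" by (intro Oi_sum Oi_mult Oi_of_int Oi_bas)
 finally show "(x - y) / of_nat m : Oi" .
qed

end

section \<open>Fractional ideals\<close>


context numfield
begin

abbreviation iprod :: "complex set => complex set => complex set" (infixl "\<star>" 75)
 where "I \<star> J \<equiv> ideal_prod complex_ring I J"

definition smul :: "complex => complex set => complex set"
 where "smul x J = (%y. x * y) ` J"

definition idl :: "complex set => bool"
 where "idl I \<longleftrightarrow> I <= Oi & 0 : I & (ALL x:I. ALL y:I. x + y : I) & (ALL a:Oi. ALL x:I. a * x : I)"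

text \<open>Fractional ideals through closure properties and a common denominator, the form in which
  they are handled; \<open>fractional_ideals_eq\<close> identifies them with the sets of the
  problem.\<close>

definition fid :: "complex set => bool"
 where "fid J \<longleftrightarrow> J <= L & 0 : J & (ALL x:J. ALL y:J. x + y : J) & (ALL a:Oi. ALL x:J. a * x : J) &
   (EX x:J. x ~= 0) & (EX d:Oi. d ~= 0 & (ALL x:J. d * x : Oi))"

lemma ops: "x \<otimes>\<^bsub>complex_ring\<^esub> y = x * y" "x \<oplus>\<^bsub>complex_ring\<^esub> y = x + y"
 by (simp_all add: ring_of_type_algebra_def)

lemma iprod_prod: "x : I ==> y : J ==> x * y : I \<star> J"
 using ideal_prod.prod[of x I y J complex_ring] by (simp add: ops)

lemma iprod_add: "x : I \<star> J ==> y : I \<star> J ==> x + y : I \<star> J"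
 using ideal_prod.sum[of x complex_ring I J y] by (simp add: ops)

lemma iprod_least:
 assumes "!!x y. x : I ==> y : J ==> x * y : S" "!!x y. x : S ==> y : S ==> x + y : S"
 shows "I \<star> J <= S"
proof
 fix z assume "z : I \<star> J"
 thus "z : S" by (induction rule: ideal_prod.induct) (simp_all add: ops assms)
qed

lemma iprod_comm: "I \<star> J = J \<star> I"
proof -
 have "I \<star> J <= J \<star> I" for I J
  by (rule iprod_least) (subst mult.commute, simp_all add: iprod_prod iprod_add)
 thus ?thesis by blast
qed

lemma iprod_mono: "I <= I' ==> J <= J' ==> I \<star> J <= I' \<star> J'"
 by (rule iprod_least) (auto intro: iprod_prod iprod_add)

lemma iprod_assoc_sub: "(I \<star> J) \<star> H <= I \<star> (J \<star> H)"
proof (rule iprod_least)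
 fix x y assume x: "x : I \<star> J" and y: "y : H"
 have "I \<star> J <= {x. x * y : I \<star> (J \<star> H)}"
 proof (rule iprod_least)
  fix u v assume "u : I" "v : J"
  hence "u * (v * y) : I \<star> (J \<star> H)" using y by (intro iprod_prod)
  thus "u * v : {x. x * y : I \<star> (J \<star> H)}" by (simp add: mult.assoc)
 qed (simp add: distrib_right iprod_add)
 thus "x * y : I \<star> (J \<star> H)" using x by blast
qed (rule iprod_add)

lemma iprod_assoc: "(I \<star> J) \<star> H = I \<star> (J \<star> H)"
using iprod_assoc_sub[of H J I] iprod_comm[of I "J \<star> H"] iprod_comm[of J H] iprod_comm[of H "J \<star> I"] iprod_comm[of J I] iprod_assoc_sub by fastforce

lemma fidD:
 assumes "fid J"
 shows "x : J ==> x : L" "0 : J" "x : J ==> y : J ==> x + y : J" "a : Oi ==> x : J ==> a * x : J"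
  "EX x:J. x ~= 0" "EX d:Oi. d ~= 0 & (ALL x:J. d * x : Oi)"
 using assms unfolding fid_def by blast+

lemma fid_minus: "fid J ==> x : J ==> - x : J"
 using fidD(4)[of J "-1" x] Oi_minus[OF Oi_1] by simp

lemma fid_diff: "fid J ==> x : J ==> y : J ==> x - y : J"
 using fidD(3)[of J x "- y"] fid_minus[of J y] by simp

lemma fid_sum: "fid J ==> (!!i. i : A ==> f i : J) ==> sum f A : J"
 by (induction A rule: infinite_finite_induct) (auto intro: fidD)

lemma idlD:
 assumes "idl I"
 shows "x : I ==> x : Oi" "0 : I" "x : I ==> y : I ==> x + y : I" "a : Oi ==> x : I ==> a * x : I"
 using assms unfolding idl_def by blast+

lemma idl_minus: "idl J ==> x : J ==> - x : J"
 using idlD(4)[of J "-1" x] Oi_minus[OF Oi_1] by simp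


lemma idl_fid: "idl I ==> x : I ==> x ~= 0 ==> fid I"
 unfolding fid_def using idlD[of I] Oi_L Oi_1 by (metis mult_1 subsetI zero_neq_one)

lemma fid_idl: "fid I ==> I <= Oi ==> idl I"
 unfolding fid_def idl_def by blast

lemma idl_one: "idl I ==> 1 : I ==> I = Oi"
 using idlD(1)[of I] idlD(4)[of I _ 1] by auto

lemma idl_Oi: "idl Oi" unfolding idl_def using Oi_0 Oi_add Oi_mult by blast
lemma fid_Oi: "fid Oi" using idl_fid[OF idl_Oi Oi_1] by simp

lemma smul_1 [simp]: "smul 1 J = J" by (simp add: smul_def)
lemma smul_smul: "smul x (smul y J) = smul (x * y) J" by (auto simp: smul_def image_image mult.assoc)
lemma smul_mem: "y : J ==> x * y : smul x J" unfolding smul_def by (rule imageI)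
lemma smul_iff: "x ~= 0 ==> y : smul x J \<longleftrightarrow> y / x : J"
 unfolding smul_def by (auto simp: image_iff intro!: bexI[of _ "y / x"])

lemma fid_smul:
 assumes J: "fid J" and x: "x : L" "x ~= 0"
 shows "fid (smul x J)"
proof -
 obtain z where z: "z : J" "z ~= 0" using fidD(5)[OF J] by blast
 obtain d where d: "d : Oi" "d ~= 0" "ALL x:J. d * x : Oi" using fidD(6)[OF J] by blast
 obtain n where n: "n > 0" "of_nat n * x : Oi" using L_denom[OF x(1)] .
 show ?thesis unfolding fid_def
 proof (intro conjI)
  show "smul x J <= L" unfolding smul_def using fidD(1)[OF J] x Lmult by blast
  show "0 : smul x J" using smul_mem[OF fidD(2)[OF J], of x] by simp
  show "ALL a:smul x J. ALL b:smul x J. a + b : smul x J"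
   using fidD(3)[OF J] by (auto simp: smul_iff[OF x(2)] add_divide_distrib)
  show "ALL a:Oi. ALL y:smul x J. a * y : smul x J"
   using fidD(4)[OF J] by (fastforce simp: smul_iff[OF x(2)])
  show "EX y:smul x J. y ~= 0" using smul_mem[OF z(1), of x] z x by (intro bexI[of _ "x * z"]) auto
  show "EX d:Oi. d ~= 0 & (ALL y:smul x J. d * y : Oi)"
  proof (intro bexI[of _ "of_nat n * d"] conjI ballI)
   show "of_nat n * d : Oi" using d Oi_mult Oi_of_nat by blast
   show "of_nat n * d ~= 0" using n d by simp
   fix y assume "y : smul x J"
   then obtain v where v: "v : J" "y = x * v" unfolding smul_def by blast
   have "(of_nat n * x) * (d * v) : Oi" using n(2) d(3) v(1) Oi_mult by blast
   thus "of_nat n * d * y : Oi" by (simp add: v mult_ac)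
  qed
 qed
qed

lemma smul_iprod: "smul x (I \<star> J) = smul x I \<star> J"
proof
 have "I \<star> J <= {z. x * z : smul x I \<star> J}"
 proof (rule iprod_least)
  fix u v assume "u : I" "v : J"
  hence "(x * u) * v : smul x I \<star> J" by (intro iprod_prod smul_mem)
  thus "u * v : {z. x * z : smul x I \<star> J}" by (simp add: mult.assoc)
 qed (simp add: distrib_left iprod_add)
 thus "smul x (I \<star> J) <= smul x I \<star> J" unfolding smul_def by blast
 show "smul x I \<star> J <= smul x (I \<star> J)"
 proof (rule iprod_least)
  fix u v assume "u : smul x I" "v : J"
  then obtain w where w: "w : I" "u = x * w" unfolding smul_def by blast
  have "x * (w * v) : smul x (I \<star> J)" using w \<open>v : J\<close> by (intro smul_mem iprod_prod)
  thus "u * v : smul x (I \<star> J)" by (simp add: w mult.assoc)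
 next
  fix u v assume "u : smul x (I \<star> J)" "v : smul x (I \<star> J)"
  then obtain a b where "a : I \<star> J" "u = x * a" "b : I \<star> J" "v = x * b" unfolding smul_def by blast
  thus "u + v : smul x (I \<star> J)" using smul_mem[OF iprod_add, of a I J b x] by (simp add: distrib_left)
 qed
qed

lemma iprod_Oi: assumes J: "fid J" shows "Oi \<star> J = J"
proof
 show "Oi \<star> J <= J" by (rule iprod_least) (use fidD[OF J] in auto)
 show "J <= Oi \<star> J" using iprod_prod[OF Oi_1, of _ J] by auto
qed

lemma iprod_smul: "fid J ==> smul x Oi \<star> J = smul x J"
 by (simp add: iprod_Oi flip: smul_iprod)

lemma fid_iprod:
 assumes I: "fid I" and J: "fid J"
 shows "fid (I \<star> J)"
proof -
 obtain z where z: "z : J" "z ~= 0" using fidD(5)[OF J] by blast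
 obtain d where d: "d : Oi" "d ~= 0" "ALL x:J. d * x : Oi" using fidD(6)[OF J] by blast
 obtain y where y: "y : I" "y ~= 0" using fidD(5)[OF I] by blast
 obtain e where e: "e : Oi" "e ~= 0" "ALL x:I. e * x : Oi" using fidD(6)[OF I] by blast
 show ?thesis unfolding fid_def
 proof (intro conjI)
  show "I \<star> J <= L" by (rule iprod_least) (auto intro: Lmult Ladd fidD(1)[OF I] fidD(1)[OF J])
  show "0 : I \<star> J" using iprod_prod[OF fidD(2)[OF I] fidD(2)[OF J]] by simp
  show "ALL a:I \<star> J. ALL b:I \<star> J. a + b : I \<star> J" using iprod_add by blast
  show "ALL a:Oi. ALL y:I \<star> J. a * y : I \<star> J"
  proof
   fix a assume a: "a : Oi"
   have "I \<star> J <= {y. a * y : I \<star> J}"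
   proof (rule iprod_least)
    fix u v assume "u : I" "v : J"
    hence "(a * u) * v : I \<star> J" using a fidD(4)[OF I] by (intro iprod_prod)
    thus "u * v : {y. a * y : I \<star> J}" by (simp add: mult.assoc)
   qed (simp add: distrib_left iprod_add)
   thus "ALL y:I \<star> J. a * y : I \<star> J" by blast
  qed
  show "EX x:I \<star> J. x ~= 0" using iprod_prod[OF y(1) z(1)] y z by (intro bexI[of _ "y * z"]) auto
  show "EX d:Oi. d ~= 0 & (ALL y:I \<star> J. d * y : Oi)"
  proof (intro bexI[of _ "d * e"] conjI)
   show "d * e : Oi" using d e Oi_mult by blast
   show "d * e ~= 0" using d e by simp
   have "I \<star> J <= {y. d * e * y : Oi}"
   proof (rule iprod_least)
    fix u v assume "u : I" "v : J"
    hence "(e * u) * (d * v) : Oi" using d e Oi_mult by blast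
    thus "u * v : {y. d * e * y : Oi}" by (simp add: mult_ac)
   qed (simp add: distrib_left Oi_add)
   thus "ALL y:I \<star> J. d * e * y : Oi" by blast
  qed
 qed
qed

primrec ipow :: "complex set => nat => complex set"
 where "ipow J 0 = Oi" | "ipow J (Suc n) = J \<star> ipow J n"

lemma fid_ipow: "fid J ==> fid (ipow J n)"
 by (induction n) (auto simp: fid_Oi fid_iprod)

lemma ipow_add: "fid J ==> ipow J (m + n) = ipow J m \<star> ipow J n"
 by (induction m) (auto simp: iprod_Oi fid_ipow iprod_assoc)

text \<open>An ideal that contains \<open>m\<close> is a union of classes modulo \<open>m\<close>,
  so it is recovered from its image under the finitely valued \<open>f\<close>.\<close>

lemma finite_ideals_containing:
 assumes m: "m > (0::nat)"
 shows "finite {I. idl I & of_nat m : I}"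
proof -
 obtain f :: "complex => nat \<times> nat => int" where f: "finite (f ` Oi)"
  and eq: "!!x y. x : Oi ==> y : Oi ==> f x = f y ==> (x - y) / of_nat m : Oi"
  by (rule finite_quotient[OF m]) blast
 have "inj_on (%I. f ` I) {I. idl I & of_nat m : I}"
 proof (rule inj_onI)
  have sub: "I <= J" if "idl I" "idl J" "of_nat m : J" "f ` I = f ` J" for I J
  proof
   fix x assume x: "x : I"
   hence "f x : f ` J" using that(4) by (metis imageI)
   then obtain y where y: "y : J" "f x = f y" by (rule imageE) simp
   have "(x - y) / of_nat m * of_nat m : J"
    using eq[of x y] idlD(1)[OF that(1) x] idlD(1)[OF that(2) y(1)] y(2) idlD(4)[OF that(2) _ that(3)] by blast
   hence "x - y : J" using m by simp
   from idlD(3)[OF that(2) this y(1)] show "x : J" by simp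
  qed
  fix I J assume "I : {I. idl I & of_nat m : I}" "J : {I. idl I & of_nat m : I}" "f ` I = f ` J"
  thus "I = J" using sub[of I J] sub[of J I] by auto
 qed
 moreover have "(%I. f ` I) ` {I. idl I & of_nat m : I} <= Pow (f ` Oi)"
  using idlD(1) by fast
 ultimately show ?thesis using f by (meson finite_Pow_iff inj_on_finite)
qed

text \<open>All powers of \<open>\<beta>\<close> have a common denominator \<open>m\<close>, so the
  sums of \<open>m * \<beta> ^ i\<close> over sets of exponents meet finitely many classes modulo
  \<open>m\<close>. Two sets in the same class give a monic polynomial with coefficients in {-1, 0,
  1} whose value at \<open>\<beta>\<close> is an algebraic integer, and therefore
  \<open>\<beta>\<close> is one.\<close>

lemma stable_imp_integral:
 assumes J: "fid J" and b: "\<beta> : L" and st: "!!x. x : J ==> \<beta> * x : J"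
 shows "\<beta> : Oi"
proof -
 obtain a where a: "a : J" "a ~= 0" using fidD(5)[OF J] by blast
 obtain d where d: "d : Oi" "d ~= 0" "ALL x:J. d * x : Oi" using fidD(6)[OF J] by blast
 define \<delta> where "\<delta> = d * a"
 have \<delta>: "\<delta> : Oi" "\<delta> ~= 0" using a d by (auto simp: \<delta>_def)
 have "\<beta> ^ n * a : J" for n
  by (induction n) (use a st in \<open>auto simp: mult.assoc\<close>)
 hence pw: "\<beta> ^ n * \<delta> : Oi" for n using d(3) by (metis \<delta>_def mult.left_commute)
 obtain m where m: "m > 0" "of_nat m / \<delta> : Oi" using Nm_abs[OF \<delta>] by metis
 have pm: "of_nat m * \<beta> ^ n : Oi" for n
  using Oi_mult[OF pw[of n] m(2)] \<delta> by (simp add: mult.commute)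
 obtain f :: "complex => nat \<times> nat => int" where f: "finite (f ` Oi)"
  and eq: "!!x y. x : Oi ==> y : Oi ==> f x = f y ==> (x - y) / of_nat m : Oi"
  by (rule finite_quotient[OF m(1)]) blast
 define s where "s = (%T. \<Sum>i\<in>T. of_nat m * \<beta> ^ i)"
 define K where "K = card (f ` Oi)"
 have sO: "s T : Oi" for T unfolding s_def by (rule Oi_sum) (rule pm)
 \<comment> \<open>There are \<open>K\<close> values of \<open>f\<close> and \<open>2 ^ K\<close>
   sets of exponents. The exponents start at 1 so that the difference polynomial has positive
   degree.\<close>
 have "card ((%T. f (s T)) ` Pow {1..K}) <= K" unfolding K_def
  by (rule card_mono[OF f]) (use sO in auto)
 also have "K < 2 ^ K" by simp
 also have "2 ^ K = card (Pow {1..K})" by (simp add: card_Pow)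
 finally have "~ inj_on (%T. f (s T)) (Pow {1..K})" by (rule pigeonhole)
 then obtain T U where TU: "T <= {1..K}" "U <= {1..K}" "T ~= U" "f (s T) = f (s U)"
  unfolding inj_on_def by auto
 have key: "\<beta> : Oi" if TU: "T <= {1..K}" "U <= {1..K}" "f (s T) = f (s U)"
  and k: "k : T" "k ~: U" "!!i. i > k ==> i : T \<longleftrightarrow> i : U" for T U k
 proof -
  have fin: "finite T" "finite U" using TU finite_subset by blast+
  define q :: "complex poly" where "q = (\<Sum>i\<in>T. Polynomial.monom 1 i) - (\<Sum>i\<in>U. Polynomial.monom 1 i)"
  have co: "poly.coeff q i = (if i : T then 1 else 0) - (if i : U then 1 else 0)" for i
   using fin by (simp add: q_def coeff_sum coeff_monom sum.delta)
  have "poly.coeff q i = 0" if "i > k" for i using k(3)[OF that] by (simp add: co)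
  hence deg: "pdeg q = k"
   using k by (intro le_antisym degree_le le_degree) (auto simp: co)
  have "(s T - s U) / of_nat m : Oi" using eq[OF sO sO TU(3)] .
  moreover have "(s T - s U) / of_nat m = poly q \<beta>"
   using m by (simp add: s_def q_def poly_sum poly_monom diff_divide_distrib flip: sum_distrib_left)
  ultimately have "algebraic_int (poly q \<beta>)" using Oi_alg by simp
  hence "algebraic_int \<beta>"
  proof (rule algebraic_int_root)
   show "ALL i. poly.coeff q i : \<int>" by (simp add: co)
   show "lead_coeff q = 1" using k by (simp add: deg co)
   show "pdeg q > 0" using k TU by (auto simp: deg)
  qed simp
  thus ?thesis using b by (simp add: Oi_def)
 qed
 define S where "S = (T - U) \<union> (U - T)"
 \<comment> \<open>The largest exponent that lies in only one of the two sets. The difference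
   polynomial has leading coefficient 1 there, once the set that contains \<open>k\<close> is put
   first.\<close>
 define k where "k = Max S"
 have S: "finite S" "S ~= {}" using TU finite_subset[of _ "{1..K}"] by (auto simp: S_def)
 have kS: "k : S" unfolding k_def using S by (rule Max_in)
 have gt: "i : T \<longleftrightarrow> i : U" if "i > k" for i
 proof (rule ccontr)
  assume "(i : T) ~= (i : U)"
  hence "i : S" by (auto simp: S_def)
  hence "i <= k" unfolding k_def using S by simp
  thus False using that by simp
 qed
 show ?thesis
 proof (cases "k : T")
  case True
  hence "k ~: U" using kS by (auto simp: S_def)
  from key[OF TU(1,2,4) True this gt] show ?thesis by blast
 next
  case False
  hence "k : U" using kS by (auto simp: S_def)
  from key[OF TU(2,1) TU(4)[symmetric] this False] gt show ?thesis by blast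
 qed
qed

end


section \<open>Finiteness of the class group and invertibility of ideals\<close>

context numfield
begin

text \<open>Pigeonhole on the fractional parts of the coordinates of \<open>t * \<gamma>\<close>:
  the \<open>M + 1\<close> multiples with t from 0 to \<open>M\<close> fall into
  \<open>M = m ^ card B\<close> boxes of side 1/m. For two multiples in one box, the coordinates of
  the difference are within 1/m of integers, so all its conjugates have absolute value at most
  \<open>C / m\<close> after subtraction of a suitable integer.\<close>

lemma hurwitz:
 obtains M :: nat where "M > 0"
  "!!\<gamma>. \<gamma> : L ==> EX t:{1..M}. EX \<omega>:Oi. norm (Nm (of_nat t * \<gamma> - \<omega>)) < 1"
proof -
 \<comment> \<open>Bounds every conjugate of a combination of the \<open>bas k\<close> with
   coefficients in [-1, 1]. The summand 1 keeps \<open>C\<close> positive.\<close>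
 define C where "C = 1 + (\<Sum>g\<in>G. \<Sum>k\<in>B. norm (g (bas k)))"
 have C1: "C >= 1" unfolding C_def by (simp add: sum_nonneg)
 have Cg: "(\<Sum>k\<in>B. norm (g (bas k))) <= C" if "g : G" for g
 using member_le_sum[OF that, of "%g. \<Sum>k\<in>B. norm (g (bas k))"] Gfin by (simp add: sum_nonneg C_def)
 obtain m :: nat where m: "real m > C" using reals_Archimedean2 by blast
 have m0: "m > 0" using m C1 by (metis gr0I le_less_trans less_irrefl not_one_le_zero of_nat_0 order_less_imp_le less_le_trans zero_less_one)
 define M where "M = m ^ card B"
 show ?thesis
 proof (rule that)
  show "M > 0" using m0 by (simp add: M_def)
  fix \<gamma> assume \<gamma>: "\<gamma> : L"
  define q where "q = (%k. Tr (dua k * \<gamma>) / of_nat D)"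
  define r where "r = (%k. Re (q k))"
  have qR: "q k : \<rat>" if "k : B" for k
   unfolding q_def Tr_def by (intro Rats_divide Tr_Rats Lmult dua(1)[OF that] \<gamma>) simp
  have rq: "of_real (r k) = q k" if "k : B" for k
   using qR[OF that] by (auto elim!: Rats_cases' simp: r_def)
  have g\<gamma>: "\<gamma> = (\<Sum>k\<in>B. of_real (r k) * bas k)"
  proof -
   have "(\<Sum>k\<in>B. of_real (r k) * bas k) = (\<Sum>k\<in>B. Tr (dua k * \<gamma>) * bas k) / of_nat D"
    unfolding sum_divide_distrib by (rule sum.cong) (auto simp: rq q_def)
   also have "... = \<gamma>" unfolding dual[OF \<gamma>, folded Tr_def, symmetric] using Dpos by simp
   finally show ?thesis ..
  qed
  define F where "F = (%t. \<lambda>k\<in>B. \<lfloor>real m * (real t * r k - of_int \<lfloor>real t * r k\<rfloor>)\<rfloor>)"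
  have "\<lfloor>real m * (x - of_int \<lfloor>x\<rfloor>)\<rfloor> : {0..<int m}" for x :: real
  proof -
   have "0 <= x - of_int \<lfloor>x\<rfloor>" "x - of_int \<lfloor>x\<rfloor> < 1" by linarith+
   hence "0 <= real m * (x - of_int \<lfloor>x\<rfloor>)" "real m * (x - of_int \<lfloor>x\<rfloor>) < real m * 1"
    using m0 by (simp, intro mult_strict_left_mono) auto
   thus ?thesis by (simp add: floor_less_iff)
  qed
  hence FP: "F ` {0..M} <= (\<Pi>\<^sub>E k\<in>B. {0..<int m})" unfolding F_def by (auto simp: PiE_def)
  have "card (F ` {0..M}) <= card (\<Pi>\<^sub>E k\<in>B. {0..<int m})"
   by (rule card_mono[OF _ FP]) (simp add: finite_PiE Bfin)
  also have "... = M" by (simp add: card_PiE Bfin M_def)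
  also have "M < card {0..M}" by simp
  finally have "~ inj_on F {0..M}" by (rule pigeonhole)
  then obtain t1 t2 where t: "t1 < t2" "t2 <= M" "F t1 = F t2"
   unfolding inj_on_def by (metis atLeastAtMost_iff nat_neq_iff)
  define w where "w = (%k. \<lfloor>real t2 * r k\<rfloor> - \<lfloor>real t1 * r k\<rfloor>)"
  define \<delta> where "\<delta> = (%k. real (t2 - t1) * r k - of_int (w k))"
  have \<delta>: "\<bar>\<delta> k\<bar> <= 1 / real m" if k: "k : B" for k
  proof -
   have "\<lfloor>real m * (real t1 * r k - of_int \<lfloor>real t1 * r k\<rfloor>)\<rfloor> = \<lfloor>real m * (real t2 * r k - of_int \<lfloor>real t2 * r k\<rfloor>)\<rfloor>"
    using fun_cong[OF t(3), of k] k by (simp add: F_def)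
   hence "\<bar>real m * (real t2 * r k - of_int \<lfloor>real t2 * r k\<rfloor>) - real m * (real t1 * r k - of_int \<lfloor>real t1 * r k\<rfloor>)\<bar> <= 1"
    by linarith
   also have "real m * (real t2 * r k - of_int \<lfloor>real t2 * r k\<rfloor>) - real m * (real t1 * r k - of_int \<lfloor>real t1 * r k\<rfloor>) = real m * \<delta> k"
    using t(1) by (simp add: \<delta>_def w_def of_nat_diff algebra_simps)
   finally have "real m * \<bar>\<delta> k\<bar> <= 1" by (simp add: abs_mult)
   thus ?thesis using m0 by (simp add: field_simps)
  qed
  define \<omega> where "\<omega> = (\<Sum>k\<in>B. of_int (w k) * bas k)"
  have \<omega>: "\<omega> : Oi" unfolding \<omega>_def by (intro Oi_sum Oi_mult Oi_of_int Oi_bas)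
  define z where "z = of_nat (t2 - t1) * \<gamma> - \<omega>"
  have z: "z = (\<Sum>k\<in>B. of_real (\<delta> k) * bas k)"
  using g\<gamma> by (simp add: z_def \<omega>_def sum_distrib_left mult.assoc \<delta>_def sum_subtractf left_diff_distrib)
  have gz: "norm (g z) <= C / real m" if g: "g : G" for g
  proof -
   have \<delta>Q: "complex_of_real (\<delta> k) : \<rat>" if "k : B" for k
    unfolding \<delta>_def of_real_diff of_real_mult rq[OF that] using qR[OF that] by simp
   have "g z = (\<Sum>k\<in>B. g (of_real (\<delta> k) * bas k))"
    unfolding z by (rule Gsum[OF g]) (intro Lmult LRats \<delta>Q bas(1))
   also have "... = (\<Sum>k\<in>B. of_real (\<delta> k) * g (bas k))"
    by (rule sum.cong[OF refl]) (simp only: Gmult[OF g LRats[OF \<delta>Q] bas(1)] GRats[OF g \<delta>Q])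
   finally have "norm (g z) <= (\<Sum>k\<in>B. norm (of_real (\<delta> k) * g (bas k)))"
    by (simp only: norm_sum)
   also have "... <= (\<Sum>k\<in>B. (1 / real m) * norm (g (bas k)))"
    by (rule sum_mono, unfold norm_mult norm_of_real) (intro mult_right_mono \<delta> norm_ge_zero)
   also have "... = (\<Sum>k\<in>B. norm (g (bas k))) / real m" by (simp add: sum_divide_distrib)
   also have "... <= C / real m" by (rule divide_right_mono[OF Cg[OF g]]) simp
   finally show ?thesis .
  qed
  have c: "0 <= C / real m" "C / real m < 1" using C1 m m0 by (auto simp: field_simps)
  have cG: "card G > 0" using Gfin Gid by (auto simp: card_gt_0_iff)
  have "norm (Nm z) = (\<Prod>g\<in>G. norm (g z))" by (simp add: Nm_def prod_norm)
  also have "... <= (\<Prod>g\<in>G. C / real m)" by (rule prod_mono) (use gz in auto)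
  also have "... = (C / real m) ^ card G" by simp
  also have "... <= (C / real m) ^ 1" using c cG by (intro power_decreasing) auto
  also have "... < 1" using c by simp
  finally have "norm (Nm (of_nat (t2 - t1) * \<gamma> - \<omega>)) < 1" by (simp only: z_def)
  moreover have "t2 - t1 : {1..M}" using t by auto
  ultimately show "EX t:{1..M}. EX \<omega>:Oi. norm (Nm (of_nat t * \<gamma> - \<omega>)) < 1" using \<omega> by blast
 qed
qed

text \<open>Scale the ideal into \<open>Oi\<close> and take \<open>\<beta>\<close> in it of least
  nonzero norm. By \<open>hurwitz\<close> and minimality each element has a multiple by some t <=
  \<open>M\<close> that is an integral multiple of \<open>\<beta>\<close>. So scaling by
  \<open>M! / \<beta>\<close> gives an integral ideal that contains \<open>M!\<close>, one of
  finitely many.\<close>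

lemma finite_classes:
 obtains R where "finite R" "!!J. fid J ==> EX x:L. x ~= 0 & smul x J : R"
proof -
 obtain M :: nat where M: "M > 0"
  and hur: "!!\<gamma>. \<gamma> : L ==> EX t:{1..M}. EX \<omega>:Oi. norm (Nm (of_nat t * \<gamma> - \<omega>)) < 1"
  using hurwitz by metis
 have fM: "(fact M :: nat) > 0" by simp
 show ?thesis
 proof (rule that[OF finite_ideals_containing[OF fM]])
  fix J assume J: "fid J"
  obtain d where d: "d : Oi" "d ~= 0" "ALL x:J. d * x : Oi" using fidD(6)[OF J] by blast
  define I where "I = smul d J"
  have fI: "fid I" unfolding I_def by (rule fid_smul[OF J Oi_L[OF d(1)] d(2)])
  have IO: "I <= Oi" unfolding I_def smul_def using d by blast
  define P where "P = (%n. EX \<beta>:I. \<beta> ~= 0 & norm (Nm \<beta>) = real n)"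
  obtain \<beta>0 where "\<beta>0 : I" "\<beta>0 ~= 0" using fidD(5)[OF fI] by blast
  moreover from this obtain n0 where "norm (Nm \<beta>0) = real n0" using Nm_abs[of \<beta>0] IO by blast
  ultimately have "P n0" unfolding P_def by blast
  define n where "n = (LEAST n. P n)"
  have "P n" unfolding n_def by (rule LeastI[of P, OF \<open>P n0\<close>])
  then obtain \<beta> where \<beta>: "\<beta> : I" "\<beta> ~= 0" "norm (Nm \<beta>) = real n" unfolding P_def by blast
  have \<beta>L: "\<beta> : L" using \<beta> IO Oi_L by blast
  have key: "of_nat (fact M) * a / \<beta> : Oi" if a: "a : I" for a
  proof -
   have aL: "a : L" using a IO Oi_L by blast
   obtain t \<omega> where t: "t : {1..M}" "\<omega> : Oi" "norm (Nm (of_nat t * (a / \<beta>) - \<omega>)) < 1"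
    using hur[OF Ldiv[OF aL \<beta>L]] by blast
   define c where "c = of_nat t * a - \<omega> * \<beta>"
   have cI: "c : I" unfolding c_def by (intro fid_diff[OF fI] fidD(4)[OF fI] Oi_of_nat t(2) a \<beta>(1))
   have "c = (of_nat t * (a / \<beta>) - \<omega>) * \<beta>" using \<beta> by (simp add: c_def field_simps)
   hence "Nm c = Nm (of_nat t * (a / \<beta>) - \<omega>) * Nm \<beta>"
    using Nm_mult[of "of_nat t * (a / \<beta>) - \<omega>" \<beta>] \<beta>L t(2) aL by (simp add: Ldiff Lmult Ldiv Lof_nat Oi_L)
   moreover have "real n > 0" unfolding \<beta>(3)[symmetric] using Nm_nz[OF \<beta>L] \<beta>(2) by simp
   ultimately have lt: "norm (Nm c) < real n" using t(3) \<beta>(3) by (simp add: norm_mult)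
   have "c = 0"
   proof (rule ccontr)
    assume "c ~= 0"
    then obtain k where k: "norm (Nm c) = real k" using Nm_abs[of c] IO cI by blast
    hence "P k" unfolding P_def using cI \<open>c ~= 0\<close> by blast
    hence "n <= k" unfolding n_def by (rule Least_le)
    thus False using lt k by simp
   qed
   hence at: "of_nat t * a = \<omega> * \<beta>" by (simp add: c_def)
   have "t dvd fact M" using t(1) by (intro dvd_fact) auto
   then obtain s where s: "fact M = t * s" by (rule dvdE)
   have "of_nat (fact M) * a / \<beta> = of_nat s * (of_nat t * a / \<beta>)" unfolding s by (simp add: mult_ac)
   also have "... = of_nat s * \<omega>" using at \<beta> by simp
   also have "... : Oi" using t Oi_mult Oi_of_nat by blast
   finally show ?thesis .
  qed
  define x where "x = of_nat (fact M) / \<beta>"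
  have x: "x : L" "x ~= 0" unfolding x_def using \<beta> \<beta>L by (simp_all add: Ldiv Lof_nat del: of_nat_fact)
  have xI: "smul x I <= Oi" unfolding smul_def x_def using key by auto
  have "x * \<beta> : smul x I" using \<beta>(1) by (rule smul_mem)
  hence "of_nat (fact M) : smul x I" using \<beta> by (simp add: x_def)
  hence "smul x I : {I. idl I & of_nat (fact M) : I}"
   using fid_idl[OF fid_smul[OF fI x] xI] by simp
  hence "smul (x * d) J : {I. idl I & of_nat (fact M) : I}" by (simp only: I_def smul_smul)
  moreover have "x * d : L" "x * d ~= 0" using x d Lmult Oi_L by auto
  ultimately show "EX x:L. x ~= 0 & smul x J : {I. idl I & of_nat (fact M) : I}" by blast
 qed
qed

definition span_by :: "complex set => complex set => complex set"
 where "span_by C T = {s. EX c. (ALL t:T. c t : C) & s = (\<Sum>t\<in>T. c t * t)}"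

lemma span_byI: "(!!t. t : T ==> c t : C) ==> (\<Sum>t\<in>T. c t * t) : span_by C T"
 unfolding span_by_def mem_Collect_eq by (rule exI[of _ c]) blast

lemma span_byE:
 assumes "s : span_by C T"
 obtains c where "ALL t:T. c t : C" "s = (\<Sum>t\<in>T. c t * t)"
 using assms unfolding span_by_def by auto

lemma span_by_add:
 assumes C: "idl C" and s: "s : span_by C T" "s' : span_by C T"
 shows "s + s' : span_by C T"
proof -
 obtain c where c: "ALL t:T. c t : C" "s = (\<Sum>t\<in>T. c t * t)" using s(1) by (rule span_byE)
 obtain c' where c': "ALL t:T. c' t : C" "s' = (\<Sum>t\<in>T. c' t * t)" using s(2) by (rule span_byE)
 have "s + s' = (\<Sum>t\<in>T. (c t + c' t) * t)" by (simp add: c c' sum.distrib distrib_right)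
 also have "... : span_by C T" by (rule span_byI) (use idlD(3)[OF C] c(1) c'(1) in blast)
 finally show ?thesis .
qed

lemma span_by_mult:
 assumes C: "idl C" and s: "s : span_by Oi T" and v: "v : C"
 shows "v * s : span_by C T"
proof -
 obtain c where c: "ALL t:T. c t : Oi" "s = (\<Sum>t\<in>T. c t * t)" using s by (rule span_byE)
 have "v * s = (\<Sum>t\<in>T. (c t * v) * t)" by (simp add: c sum_distrib_left mult_ac)
 also have "... : span_by C T" by (rule span_byI) (use idlD(4)[OF C _ v] c(1) in blast)
 finally show ?thesis .
qed

text \<open>Elimination of generators: \<open>claim\<close> keeps a c in \<open>C\<close> with
  \<open>(1 - c) * A\<close> inside the span of the generators not yet removed. When none is left,
  \<open>(1 - c) * A\<close> is zero and c is 1.\<close>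

lemma nakayama:
 assumes A: "fid A" and AO: "A <= Oi" and C: "idl C" and AC: "A <= A \<star> C"
 shows "C = Oi"
proof -
 obtain a0 where a0: "a0 : A" "a0 ~= 0" using fidD(5)[OF A] by blast
 obtain m where m: "m > 0" "of_nat m / a0 : Oi" using Nm_abs[of a0] a0 AO by blast
 have mA: "of_nat m : A" using fidD(4)[OF A m(2) a0(1)] a0 by simp
 obtain f :: "complex => nat \<times> nat => int" where f: "finite (f ` Oi)"
  and eq: "!!x y. x : Oi ==> y : Oi ==> f x = f y ==> (x - y) / of_nat m : Oi"
  by (rule finite_quotient[OF m(1)]) blast
 \<comment> \<open>One element of \<open>A\<close> for each value of \<open>f\<close> on
   \<open>A\<close>. Together with \<open>m\<close> these generate \<open>A\<close>.\<close>
 define S where "S = inv_into A f ` f ` A"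
 have finS: "finite S" unfolding S_def using finite_subset[OF image_mono[OF AO] f] by simp
 have SA: "S <= A" unfolding S_def by (auto intro: inv_into_into)
 define T0 where "T0 = insert (of_nat m) S"
 have T0: "finite T0" "T0 <= A" using finS SA mA by (auto simp: T0_def)
 have gen: "x : span_by Oi T0" if x: "x : A" for x
 proof -
  define y where "y = inv_into A f (f x)"
  have y: "y : S" "f y = f x" using x by (auto simp: y_def S_def f_inv_into_f)
  have "(x - y) / of_nat m : Oi" using eq[of x y] y x SA AO by auto
  define z where "z = (x - y) / of_nat m"
  have z: "z : Oi" "x = z * of_nat m + y" using \<open>(x - y) / of_nat m : Oi\<close> m by (auto simp: z_def)
  have d: "(\<Sum>t\<in>T0. (if t = u then c else 0) * t) = c * u" if "u : T0" for u c
  proof -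
   have "(\<Sum>t\<in>T0. (if t = u then c else 0) * t) = (\<Sum>t\<in>T0. if t = u then c * t else 0)"
    by (rule sum.cong) auto
   thus ?thesis using that T0(1) by simp
  qed
  have "c * u : span_by Oi T0" if "u : T0" "c : Oi" for c u
   using span_byI[of T0 "%t. if t = u then c else 0" Oi] d[OF that(1), of c] that(2) Oi_0 by auto
  from span_by_add[OF idl_Oi this[of "of_nat m" z] this[of y 1]] show ?thesis
   using z y Oi_1 by (simp add: T0_def)
 qed
 have claim: "EX c:C. ALL x:A. (1 - c) * x : span_by Oi (T0 - U)" if "finite U" "U <= T0" for U
  using that
 proof (induction U)
  case empty
  have "ALL x:A. (1 - 0) * x : span_by Oi (T0 - {})" using gen by simp
  thus ?case using idlD(2)[OF C] by blast
 next
  case (insert y U)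
  then obtain c where c: "c : C" "ALL x:A. (1 - c) * x : span_by Oi (T0 - U)" by blast
  define T where "T = T0 - insert y U"
  have TU: "T0 - U = insert y T" "y ~: T" "finite T" using insert.hyps insert.prems T0 by (auto simp: T_def)
  have yA: "y : A" using insert.prems T0 by auto
  have "A \<star> C <= {x. (1 - c) * x : span_by C (T0 - U)}"
  proof (rule iprod_least)
   fix u v assume "u : A" "v : C"
   hence "v * ((1 - c) * u) : span_by C (T0 - U)" using c by (intro span_by_mult[OF C]) auto
   thus "u * v : {x. (1 - c) * x : span_by C (T0 - U)}" by (simp add: mult_ac)
  qed (simp add: distrib_left span_by_add[OF C])
  hence "(1 - c) * y : span_by C (insert y T)" using AC yA TU by auto
  then obtain e where e: "ALL t:insert y T. e t : C" "(1 - c) * y = (\<Sum>t\<in>insert y T. e t * t)"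
   by (rule span_byE)
  define s where "s = (\<Sum>t\<in>T. e t * t)"
  have s: "(1 - c - e y) * y = s" using e(2) TU by (simp add: s_def algebra_simps)
  have sT: "s : span_by Oi T" unfolding s_def by (rule span_byI) (use e(1) idlD(1)[OF C] in blast)
  \<comment> \<open>Chosen so that \<open>1 - c' = (1 - c) * (1 - c - e y)\<close>: the second
    factor carries the generator \<open>y\<close> into the span of the remaining ones.\<close>
  define c' where "c' = c + (1 - c) * (c + e y)"
  have cO: "c : Oi" "e y : Oi" using c e idlD(1)[OF C] by auto
  have c'C: "c' : C" unfolding c'_def
   by (intro idlD(3)[OF C] idlD(4)[OF C] c(1) bspec[OF e(1)] Oi_diff Oi_1 cO) simp
  have "(1 - c') * x : span_by Oi T" if x: "x : A" for x
  proof -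
   have "(1 - c) * x : span_by Oi (insert y T)" using c(2) x unfolding TU(1) by blast
   then obtain b where b: "ALL t:insert y T. b t : Oi" "(1 - c) * x = (\<Sum>t\<in>insert y T. b t * t)"
    by (rule span_byE)
   define w where "w = (\<Sum>t\<in>T. b t * t)"
   have w: "(1 - c) * x = b y * y + w" using b(2) TU by (simp add: w_def)
   have wT: "w : span_by Oi T" unfolding w_def by (rule span_byI) (use b(1) in blast)
   have "(1 - c') * x = (1 - c - e y) * ((1 - c) * x)" by (simp add: c'_def algebra_simps)
   also have "... = b y * ((1 - c - e y) * y) + (1 - c - e y) * w" unfolding w by (simp add: algebra_simps)
   also have "... = b y * s + (1 - c - e y) * w" unfolding s ..
   also have "... : span_by Oi T"
    by (intro span_by_add[OF idl_Oi] span_by_mult[OF idl_Oi] sT wT bspec[OF b(1)] Oi_diff Oi_1 cO) simp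
   finally show ?thesis .
  qed
  thus ?case using c'C unfolding T_def by blast
 qed
 from claim[OF T0(1) order.refl] obtain c where c: "c : C" "ALL x:A. (1 - c) * x : span_by Oi {}" by auto
 have "(1 - c) * a0 : span_by Oi {}" using c(2) a0(1) by blast
 hence "(1 - c) * a0 = 0" by (simp add: span_by_def)
 hence "c = 1" using a0 by simp
 thus ?thesis using idl_one[OF C] c by simp
qed

text \<open>Two powers of \<open>A\<close> lie in the same class, so \<open>ipow A i\<close> equals
  its own product with an ideal \<open>C\<close> that is a multiple of
  \<open>ipow A (j - i)\<close>. Hence \<open>C\<close> stabilises \<open>ipow A i\<close>, is
  integral by \<open>stable_imp_integral\<close>, and equals \<open>Oi\<close> by
  \<open>nakayama\<close>. Inverses of ideals are read off from this.\<close>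

lemma principal_power:
 assumes A: "fid A"
 obtains n x where "n > 0" "x : L" "x ~= 0" "ipow A n = smul x Oi"
proof -
 obtain R where R: "finite R" "!!J. fid J ==> EX x:L. x ~= 0 & smul x J : R"
  using finite_classes by metis
 have "ALL n. EX x. x : L & x ~= 0 & smul x (ipow A n) : R" using R(2)[OF fid_ipow[OF A]] by blast
 from choice[OF this] obtain x where x: "ALL n. x n : L & x n ~= 0 & smul (x n) (ipow A n) : R" ..
 have "~ inj_on (%n. smul (x n) (ipow A n)) UNIV"
 using x inj_on_finite[OF _ _ R(1)] infinite_UNIV_nat by auto
 then obtain i j where ij: "i < j" "smul (x i) (ipow A i) = smul (x j) (ipow A j)"
  unfolding inj_on_def by (metis nat_neq_iff)
 define n where "n = j - i"
 define y where "y = x j / x i"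
 have y: "y : L" "y ~= 0" using x by (auto simp: y_def intro: Ldiv)
 have "smul (inverse (x i)) (smul (x i) (ipow A i)) = smul (inverse (x i)) (smul (x j) (ipow A j))"
  using ij(2) by simp
 hence eq: "ipow A i = smul y (ipow A j)" using x[rule_format, of i]
  by (simp add: smul_smul y_def divide_inverse mult.commute)
 also have "ipow A j = ipow A i \<star> ipow A n" using ipow_add[OF A, of i n] ij by (simp add: n_def)
 finally have eq2: "ipow A i = ipow A i \<star> smul y (ipow A n)"
  by (simp add: smul_iprod iprod_comm[of "ipow A i"])
 define C where "C = smul y (ipow A n)"
 have fC: "fid C" unfolding C_def by (rule fid_smul[OF fid_ipow[OF A] y])
 have fi: "fid (ipow A i)" by (rule fid_ipow[OF A])
 have "C <= Oi"
 proof
  fix c assume c: "c : C"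
  show "c : Oi"
  using fidD(1)[OF fC] c eq2 stable_imp_integral[OF fi] iprod_prod by (metis fidD(1)[OF fC] c eq2 stable_imp_integral[OF fi] iprod_prod C_def mult.commute)
 qed
 hence C: "idl C" using fid_idl fC by blast
 obtain d where d: "d : Oi" "d ~= 0" "ALL x:ipow A i. d * x : Oi" using fidD(6)[OF fi] by blast
 have "smul d (ipow A i) <= smul d (ipow A i) \<star> C" using eq2 unfolding C_def smul_iprod[symmetric] by simp
 hence "C = Oi"
  by (intro nakayama[of "smul d (ipow A i)" C] C fid_smul[OF fi] Oi_L[OF d(1)] d(2))
    (use d(3) in \<open>auto simp: smul_def\<close>)
 hence "smul (inverse y) (smul y (ipow A n)) = smul (inverse y) Oi" by (simp add: C_def)
 hence "ipow A n = smul (inverse y) Oi" using y by (simp add: smul_smul)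
 moreover have "n > 0" using ij by (simp add: n_def)
 ultimately show ?thesis using that[of n "inverse y"] y Linv by simp
qed

lemma fid_inverse:
 assumes A: "fid A"
 obtains A' where "fid A'" "A \<star> A' = Oi"
proof -
 obtain n x where n: "n > 0" "x : L" "x ~= 0" "ipow A n = smul x Oi" using principal_power[OF A] by metis
 define A' where "A' = smul (inverse x) (ipow A (n - 1))"
 have "A \<star> A' = smul (inverse x) (ipow A (n - 1) \<star> A)" by (simp add: A'_def smul_iprod iprod_comm[of A])
 also have "ipow A (n - 1) \<star> A = ipow A n" using n(1) by (cases n) (simp_all add: iprod_comm)
 finally have "A \<star> A' = Oi" using n by (simp add: smul_smul)
 moreover have "fid A'" unfolding A'_def using n by (intro fid_smul fid_ipow A Linv) auto
 ultimately show ?thesis using that by blast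
qed

end

section \<open>Torsion and p-ranks of abelian groups\<close>


lemma (in comm_group) pow_image_subgroup:
 "subgroup ((%x. x [^] (p::nat)) ` carrier G) G"
proof (rule subgroupI)
 show "(%x. x [^] p) ` carrier G ~= {}" by auto
 fix a assume "a : (%x. x [^] p) ` carrier G"
 then obtain x where x: "x : carrier G" "a = x [^] p" by auto
 show "inv a : (%x. x [^] p) ` carrier G"
  using x nat_pow_inv[OF x(1), of p] by (intro image_eqI[of _ _ "inv x"]) auto
 fix b assume "b : (%x. x [^] p) ` carrier G"
 then obtain y where y: "y : carrier G" "b = y [^] p" by auto
 show "a \<otimes> b : (%x. x [^] p) ` carrier G"
  using x y nat_pow_distrib[of x y p] by (intro image_eqI[of _ _ "x \<otimes> y"]) auto
qed auto

text \<open>The nonempty fibres of the p-th power map are translates of its kernel, so the sizes of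
  kernel and image multiply to the order of the group.\<close>

lemma (in comm_group) card_pow_cosets:
 assumes fin: "finite (carrier G)"
 shows "card (rcosets ((%x. x [^] (p::nat)) ` carrier G)) = card {x : carrier G. x [^] p = \<one>}"
proof -
 define f where "f = (%x. x [^] p)"
 define N where "N = {x : carrier G. f x = \<one>}"
 have fib: "card {x : carrier G. f x = y} = card N" if "y : f ` carrier G" for y
 proof -
  obtain z where z: "z : carrier G" "y = f z" using \<open>y : f ` carrier G\<close> by auto
  have "bij_betw (%x. z \<otimes> x) N {x : carrier G. f x = y}"
  proof (rule bij_betwI[of _ _ _ "%x. inv z \<otimes> x"])
   show "(%x. z \<otimes> x) : N \<rightarrow> {x : carrier G. f x = y}"
    using z by (auto simp: N_def f_def nat_pow_distrib)
   show "(%x. inv z \<otimes> x) : {x : carrier G. f x = y} \<rightarrow> N"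
    using z by (auto simp: N_def f_def nat_pow_distrib nat_pow_inv)
   fix x assume "x : N" thus "inv z \<otimes> (z \<otimes> x) = x"
    using z by (simp add: N_def m_assoc[symmetric])
  next
   fix x assume "x : {x : carrier G. f x = y}" thus "z \<otimes> (inv z \<otimes> x) = x"
    using z by (simp add: m_assoc[symmetric])
  qed
  thus ?thesis using bij_betw_same_card by force
 qed
 have "card (carrier G) = (\<Sum>y\<in>f ` carrier G. card {x : carrier G. f x = y})"
  using sum.image_gen[OF fin, of "%_. 1::nat" f] by (simp only: card_eq_sum)
 also have "... = card (f ` carrier G) * card N" by (simp add: fib)
 finally have "card (carrier G) = card (f ` carrier G) * card N" .
 moreover have "card (rcosets (f ` carrier G)) * card (f ` carrier G) = card (carrier G)"
  using lagrange[OF pow_image_subgroup[of p]] by (simp add: f_def Coset.order_def)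
 moreover have "card (f ` carrier G) > 0" using fin by (auto simp: card_gt_0_iff)
 ultimately have "card (rcosets (f ` carrier G)) = card N" by (simp add: mult.commute)
 thus ?thesis by (simp add: f_def N_def)
qed

lemma (in vectorspace) card_carrier_le:
 assumes fd: "fin_dim" and K: "finite (carrier K)"
 shows "finite (carrier V)" "card (carrier V) <= card (carrier K) ^ dim"
proof -
 obtain \<beta> where b: "finite \<beta>" "basis \<beta>" using finite_basis_exists[OF fd] by blast
 have d: "dim = card \<beta>" using dim_basis b by blast
 have bC: "\<beta> <= carrier V" using b unfolding basis_def by blast
 have sub: "carrier V <= (%a. lincomb a \<beta>) ` (\<beta> \<rightarrow>\<^sub>E carrier K)"
 proof
  fix v assume "v : carrier V"
  hence "v : span \<beta>" using b unfolding basis_def by blast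
  then obtain a where a: "a : \<beta> \<rightarrow> carrier K" "lincomb a \<beta> = v"
   using finite_in_span[OF b(1) bC] by blast
  have "lincomb (restrict a \<beta>) \<beta> = lincomb a \<beta>"
   by (rule lincomb_cong) (use b bC a in auto)
  thus "v : (%a. lincomb a \<beta>) ` (\<beta> \<rightarrow>\<^sub>E carrier K)"
   using a by (intro image_eqI[of _ _ "restrict a \<beta>"]) auto
 qed
 have fin: "finite (\<beta> \<rightarrow>\<^sub>E carrier K)" using b K by (simp add: finite_PiE)
 show "finite (carrier V)" using finite_subset[OF sub] fin by simp
 have "card (carrier V) <= card (\<beta> \<rightarrow>\<^sub>E carrier K)" using surj_card_le[OF fin sub] .
 also have "... = card (carrier K) ^ dim" using b by (simp add: card_PiE d)
 finally show "card (carrier V) <= card (carrier K) ^ dim" .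
qed

text \<open>The map sends x tensor a to the class of x raised to the power a. Classes modulo p-th
  powers have trivial p-th power, so it respects addition modulo \<open>p\<close> in the second
  factor as well. The function \<open>q\<close> reads the value off an arbitrary representative of a
  coset, which is enough to bound the size of the tensor product from below.\<close>

lemma tensor_residue_surj:
 assumes G: "comm_group G" and p: "p > 1"
 obtains q where "rcosets\<^bsub>G\<^esub> ((%x. x [^]\<^bsub>G\<^esub> (p::nat)) ` carrier G) <= q ` carrier (tensor_residue_module G p)"
proof -
 interpret G: comm_group G by fact
 define Gp where "Gp = (%x. x [^]\<^bsub>G\<^esub> p) ` carrier G"
 have sg: "subgroup Gp G" unfolding Gp_def by (rule G.pow_image_subgroup)
 define Q where "Q = G Mod Gp"
 interpret Q: comm_group Q unfolding Q_def by (rule G.abelian_FactGroup[OF sg])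
 interpret N: normal Gp G using G.subgroup_imp_normal[OF sg] .
 define c where "c = (%x. Gp #>\<^bsub>G\<^esub> x)"
 have c: "c : hom G Q" unfolding c_def Q_def by (rule N.r_coset_hom_Mod)
 have cc: "c x : carrier Q" if "x : carrier G" for x using c that by (auto simp: hom_def)
 have cm: "c (x \<otimes>\<^bsub>G\<^esub> y) = c x \<otimes>\<^bsub>Q\<^esub> c y" if "x : carrier G" "y : carrier G" for x y
  using c that by (auto simp: hom_def)
 have cp: "c x [^]\<^bsub>Q\<^esub> p = \<one>\<^bsub>Q\<^esub>" if "x : carrier G" for x
 proof -
  have "c x [^]\<^bsub>Q\<^esub> p = c (x [^]\<^bsub>G\<^esub> p)"
   unfolding c_def Q_def by (rule N.FactGroup_pow[OF that])
  also have "... = Gp" unfolding c_def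
   by (rule G.coset_join2[OF _ sg]) (use that in \<open>auto simp: Gp_def\<close>)
  finally show ?thesis by (simp add: Q_def)
 qed
 define H where "H = add_monoid (residue_ring (int p))"
 have cH: "carrier H = {0..int p - 1}" "monoid.mult H = (%a b. (a+b) mod int p)"
  by (simp_all add: H_def residue_ring_def)
 define F where "F = free_Abelian_group (carrier G \<times> carrier H)"
 define S where "S = generate F (tensor_relations G H)"
 interpret F: comm_group F unfolding F_def by (rule abelian_free_Abelian_group)
 have im: "(%(x,a). c x [^]\<^bsub>Q\<^esub> a) ` (carrier G \<times> carrier H) <= carrier Q" using cc by auto
 obtain h where h: "h : hom F Q"
  and hf: "ALL z:carrier G \<times> carrier H. h (frag_of z) = (%(x,a). c x [^]\<^bsub>Q\<^esub> a) z"
 proof (rule Q.free_Abelian_group_universal[OF im])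
  fix h assume "h : hom (free_Abelian_group (carrier G \<times> carrier H)) Q"
   and e: "!!x. x : carrier G \<times> carrier H ==> h (frag_of x) = (case x of (x, a) => c x [^]\<^bsub>Q\<^esub> a)"
  hence "h : hom F Q" by (simp only: F_def)
  thus thesis by (rule that) (rule ballI, rule e)
 qed
 interpret h: group_hom F Q h using h by unfold_locales
 have modp: "u [^]\<^bsub>Q\<^esub> (k mod int p) = u [^]\<^bsub>Q\<^esub> k"
  if u: "u : carrier Q" "u [^]\<^bsub>Q\<^esub> p = \<one>\<^bsub>Q\<^esub>" for u and k :: int
 proof -
  have "u [^]\<^bsub>Q\<^esub> k = u [^]\<^bsub>Q\<^esub> (int p * (k div int p) + k mod int p)" by simp
  also have "... = (u [^]\<^bsub>Q\<^esub> int p) [^]\<^bsub>Q\<^esub> (k div int p) \<otimes>\<^bsub>Q\<^esub> u [^]\<^bsub>Q\<^esub> (k mod int p)"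
   using u(1) by (simp only: Q.int_pow_mult Q.int_pow_pow)
  also have "... = u [^]\<^bsub>Q\<^esub> (k mod int p)" using u by (simp add: int_pow_int)
  finally show ?thesis by simp
 qed
 have frag_car: "frag_of z : carrier F" if "z : carrier G \<times> carrier H" for z
  using that by (simp add: F_def carrier_free_Abelian_group_iff)
 have diff: "u - v - w = u \<otimes>\<^bsub>F\<^esub> inv\<^bsub>F\<^esub> v \<otimes>\<^bsub>F\<^esub> inv\<^bsub>F\<^esub> w" if "v : carrier F" "w : carrier F" for u v w
  using that by (simp add: F_def)
 have rel: "r : carrier F & h r = \<one>\<^bsub>Q\<^esub>" if "r : tensor_relations G H" for r
 proof -
  obtain a b d where r: "r = frag_of a - frag_of b - frag_of d" and
   abd: "a : carrier G \<times> carrier H" "b : carrier G \<times> carrier H" "d : carrier G \<times> carrier H"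
   and e: "(%(x,a). c x [^]\<^bsub>Q\<^esub> a) a = (%(x,a). c x [^]\<^bsub>Q\<^esub> a) b \<otimes>\<^bsub>Q\<^esub> (%(x,a). c x [^]\<^bsub>Q\<^esub> a) d"
  proof -
   from \<open>r : tensor_relations G H\<close> consider
    x x' y where "r = frag_of (x \<otimes>\<^bsub>G\<^esub> x', y) - frag_of (x, y) - frag_of (x', y)" "x : carrier G" "x' : carrier G" "y : carrier H"
    | x y y' where "r = frag_of (x, y \<otimes>\<^bsub>H\<^esub> y') - frag_of (x, y) - frag_of (x, y')" "x : carrier G" "y : carrier H" "y' : carrier H"
    unfolding tensor_relations_def by blast
   thus thesis
   proof cases
    case 1
    thus ?thesis
     by (intro that[of "(x \<otimes>\<^bsub>G\<^esub> x', y)" "(x,y)" "(x',y)"]) (auto simp: cm cc Q.int_pow_distrib)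
   next
    case 2
    thus ?thesis using p
     by (intro that[of "(x, y \<otimes>\<^bsub>H\<^esub> y')" "(x,y)" "(x,y')"])
      (auto simp: cH modp cc cp Q.int_pow_mult)
   qed
  qed
  have cin: "(%(x,a). c x [^]\<^bsub>Q\<^esub> a) z : carrier Q" if "z : carrier G \<times> carrier H" for z
   using that cc by auto
  have comm: "u \<otimes>\<^bsub>Q\<^esub> v \<otimes>\<^bsub>Q\<^esub> inv\<^bsub>Q\<^esub> u \<otimes>\<^bsub>Q\<^esub> inv\<^bsub>Q\<^esub> v = \<one>\<^bsub>Q\<^esub>"
   if uv: "u : carrier Q" "v : carrier Q" for u v
  proof -
   have "u \<otimes>\<^bsub>Q\<^esub> v \<otimes>\<^bsub>Q\<^esub> inv\<^bsub>Q\<^esub> u \<otimes>\<^bsub>Q\<^esub> inv\<^bsub>Q\<^esub> v = (u \<otimes>\<^bsub>Q\<^esub> v) \<otimes>\<^bsub>Q\<^esub> inv\<^bsub>Q\<^esub> (v \<otimes>\<^bsub>Q\<^esub> u)"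
    using uv by (simp add: Q.inv_mult_group Q.m_assoc)
   also have "v \<otimes>\<^bsub>Q\<^esub> u = u \<otimes>\<^bsub>Q\<^esub> v" by (rule Q.m_comm[OF uv(2,1)])
   finally show ?thesis using uv by simp
  qed
  have "h r = h (frag_of a) \<otimes>\<^bsub>Q\<^esub> inv\<^bsub>Q\<^esub> h (frag_of b) \<otimes>\<^bsub>Q\<^esub> inv\<^bsub>Q\<^esub> h (frag_of d)"
   unfolding r by (subst diff) (simp_all add: frag_car abd)
  also have "... = \<one>\<^bsub>Q\<^esub>"
   unfolding bspec[OF hf abd(1)] bspec[OF hf abd(2)] bspec[OF hf abd(3)] e by (rule comm[OF cin[OF abd(2)] cin[OF abd(3)]])
  finally have "h r = \<one>\<^bsub>Q\<^esub>" .
  moreover have "r : carrier F" unfolding r by (subst diff) (simp_all add: frag_car abd)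
  ultimately show ?thesis by blast
 qed
 have sub: "tensor_relations G H <= carrier F" using rel by blast
 have SF: "subgroup S F" unfolding S_def by (rule F.generate_is_subgroup[OF sub])
 have "S <= kernel F Q h" unfolding S_def
  by (rule F.generate_subgroup_incl[OF _ h.subgroup_kernel]) (use rel in \<open>auto simp: kernel_def\<close>)
 hence hS: "s : carrier F & h s = \<one>\<^bsub>Q\<^esub>" if "s : S" for s using that by (auto simp: kernel_def)
 have car: "carrier (tensor_residue_module G p) = (%u. S #>\<^bsub>F\<^esub> u) ` carrier F"
  by (simp add: tensor_residue_module_def tensor_product_def Let_def carrier_FactGroup S_def F_def H_def)
 define q where "q = (%U. h (SOME u. u : U))"
 have "c x : q ` carrier (tensor_residue_module G p)" if x: "x : carrier G" for x
 proof -
  have x1: "(x, 1) : carrier G \<times> carrier H" using x p by (auto simp: cH)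
  define U where "U = S #>\<^bsub>F\<^esub> frag_of (x, 1)"
  have fc: "frag_of (x,1) : carrier F" using frag_car[OF x1] .
  have ne: "frag_of (x,1) : U" unfolding U_def by (rule F.rcos_self[OF fc SF])
  have "h u = c x" if uU: "u : U" for u
  proof -
   obtain s where s: "s : S" "u = s \<otimes>\<^bsub>F\<^esub> frag_of (x,1)" using uU unfolding U_def r_coset_def by blast
   have "h u = h s \<otimes>\<^bsub>Q\<^esub> h (frag_of (x,1))" unfolding s(2) using hS[OF s(1)] fc by simp
   thus ?thesis using hS[OF s(1)] bspec[OF hf x1] cc[OF x] by simp
  qed
  moreover have "(SOME u. u : U) : U" using ne by (rule someI)
  ultimately have "q U = c x" by (simp add: q_def)
  moreover have "U : carrier (tensor_residue_module G p)" using fc by (auto simp: car U_def)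
  ultimately show ?thesis by (metis image_eqI)
 qed
 thus ?thesis using that[of q] by (auto simp: RCOSETS_def c_def Gp_def)
qed

text \<open>A space of dimension k over the field with \<open>p\<close> elements has at most
  \<open>p ^ k\<close> vectors. It maps onto the group modulo p-th powers, which has the size of the
  p-torsion. In infinite dimension the rank is infinite by definition.\<close>

lemma p_rank_ge_torsion:
 assumes G: "comm_group G" and fin: "finite (carrier G)" and p: "Factorial_Ring.prime (p::nat)"
  and c: "p ^ m <= card {x : carrier G. x [^]\<^bsub>G\<^esub> p = \<one>\<^bsub>G\<^esub>}"
 shows "p_rank p G >= enat m"
proof -
 interpret G: comm_group G by fact
 have p1: "p > 1" using prime_gt_1_nat[OF p] .
 interpret V: vectorspace "residue_ring (int p)" "tensor_residue_module G p"
  by (rule vectorspace_tensor_residue_module[OF G p])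
 have Kc: "finite (carrier (residue_ring (int p)))" "card (carrier (residue_ring (int p))) = p"
  by (simp_all add: residue_ring_def)
 show ?thesis
 proof (cases "V.fin_dim")
  case True
  obtain q where q: "rcosets\<^bsub>G\<^esub> ((%x. x [^]\<^bsub>G\<^esub> p) ` carrier G) <= q ` carrier (tensor_residue_module G p)"
   by (rule tensor_residue_surj[OF G p1])
  have "p ^ m <= card (rcosets\<^bsub>G\<^esub> ((%x. x [^]\<^bsub>G\<^esub> p) ` carrier G))"
   using c G.card_pow_cosets[OF fin, of p] by simp
  also have "... <= card (carrier (tensor_residue_module G p))"
   by (rule surj_card_le[OF V.card_carrier_le(1)[OF True Kc(1)] q])
  also have "... <= p ^ V.dim" using V.card_carrier_le(2)[OF True Kc(1)] Kc(2) by simp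
  finally have pm: "p ^ m <= p ^ V.dim" .
  have "m <= V.dim" by (rule power_le_imp_le_exp[OF p1 pm])
  thus ?thesis using True by (simp add: p_rank_def vs_dim_def)
 qed (simp add: p_rank_def vs_dim_def)
qed

section \<open>Torsion counted by fibres of exponent vectors\<close>

definition gprod :: "('a, 'b) monoid_scheme => nat => (nat => 'a) => (nat => nat) => 'a"
 where "gprod G r x c = finprod G (%i. x i [^]\<^bsub>G\<^esub> c i) {..<r}"

context comm_group
begin

lemma gprod_closed: "(!!i. i < r ==> x i : carrier G) ==> gprod G r x c : carrier G"
 unfolding gprod_def by (rule finprod_closed) auto

lemma gprod_0: "gprod G 0 x c = \<one>" by (simp add: gprod_def)

lemma gprod_Suc: "(!!i. i < Suc r ==> x i : carrier G) ==> gprod G (Suc r) x c = x r [^] c r \<otimes> gprod G r x c"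
 unfolding gprod_def lessThan_Suc by (subst finprod_insert) auto

lemma gprod_add:
 assumes x: "!!i. i < r ==> x i : carrier G"
 shows "gprod G r x (%i. c i + d i) = gprod G r x c \<otimes> gprod G r x d"
proof -
 have "gprod G r x (%i. c i + d i) = finprod G (%i. x i [^] c i \<otimes> x i [^] d i) {..<r}"
  unfolding gprod_def by (rule finprod_cong') (use x in \<open>auto simp: nat_pow_mult\<close>)
 also have "... = gprod G r x c \<otimes> gprod G r x d"
  unfolding gprod_def by (rule finprod_multf) (use x in auto)
 finally show ?thesis .
qed

lemma gprod_zero: "gprod G r x (%i. 0) = \<one>"
 unfolding gprod_def by simp

lemma gprod_pow:
 assumes x: "!!i. i < r ==> x i : carrier G"
 shows "gprod G r x (%i. k * c i) = gprod G r x c [^] (k::nat)"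
proof (induction k)
 case (Suc k)
 have "gprod G r x (%i. Suc k * c i) = gprod G r x (%i. k * c i + c i)" by (simp add: add.commute)
 thus ?case using Suc gprod_add[OF x, of r] x by simp
qed (simp add: gprod_zero)

text \<open>Exponent vectors are mapped to \<open>A\<close> modulo p-th powers of \<open>A\<close>,
  where \<open>A\<close> is generated by the \<open>x i\<close>. The image is at most as large as
  the p-torsion of \<open>A\<close>, and each fibre has at most \<open>K\<close> elements. The p-th
  powers are taken in \<open>A\<close> and not in \<open>G\<close>, so that the element raised to
  the power \<open>p\<close> is again a product of the generators, on which the Galois action is
  known.\<close>

lemma card_torsion_ge:
 assumes fin: "finite (carrier G)" and p: "p > 0" and K: "K > 0"
  and x: "!!i. i < r ==> x i : carrier G"
  and fib: "!!a0. a0 : {..<r} \<rightarrow>\<^sub>E {0..<p} ==>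
   card {a : {..<r} \<rightarrow>\<^sub>E {0..<p}. EX c. gprod G r x a = gprod G r x c [^] p \<otimes> gprod G r x a0} <= K"
 shows "p ^ r <= K * card {y : carrier G. y [^] p = \<one>}"
proof -
 \<comment> \<open>Natural exponents already give a subgroup, since inverses in a finite group are
   powers.\<close>
 define A where "A = range (gprod G r x)"
 define Xs where "Xs = ({..<r} \<rightarrow>\<^sub>E {0..<p})"
 have Ac: "A <= carrier G" using gprod_closed[OF x] by (auto simp: A_def)
 have A: "subgroup A G"
 proof (rule subgroupI[OF Ac])
  show "A ~= {}" by (auto simp: A_def)
  fix a assume "a : A"
  then obtain c where a: "a = gprod G r x c" by (auto simp: A_def)
  have ac: "a : carrier G" unfolding a by (rule gprod_closed[OF x])
  have o: "Coset.order G > 0" using fin by (auto simp: Coset.order_def card_gt_0_iff)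
  have "a [^] (Coset.order G - 1) \<otimes> a = \<one>"
   using pow_order_eq_1[OF ac] o ac by (metis Suc_pred' nat_pow_Suc diff_Suc_1)
  hence "inv a = a [^] (Coset.order G - 1)" using ac by (simp add: inv_equality)
  also have "... = gprod G r x (%i. (Coset.order G - 1) * c i)" unfolding a using gprod_pow[OF x, of r] by simp
  finally show "inv a : A" by (auto simp: A_def)
  fix b assume "b : A"
  then obtain d where b: "b = gprod G r x d" by (auto simp: A_def)
  have eq: "gprod G r x (%i. c i + d i) = gprod G r x c \<otimes> gprod G r x d" by (rule gprod_add[OF x])
  show "a \<otimes> b : A" unfolding a b A_def eq[symmetric] by (rule rangeI)
 qed
 define GA where "GA = G\<lparr>carrier := A\<rparr>"
 interpret GA: comm_group GA 
 proof (rule group.group_comm_groupI)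
  show "Group.group GA" unfolding GA_def by (rule subgroup.subgroup_is_group[OF A is_group])
  fix x y assume "x : carrier GA" "y : carrier GA"
  thus "x \<otimes>\<^bsub>GA\<^esub> y = y \<otimes>\<^bsub>GA\<^esub> x" using Ac m_comm by (auto simp: GA_def)
 qed
 have GAs: "carrier GA = A" "monoid.mult GA = (\<otimes>)" "one GA = \<one>" by (simp_all add: GA_def)
 have GAp: "y [^]\<^bsub>GA\<^esub> (k::nat) = y [^] k" for y k by (simp add: GA_def nat_pow_consistent[symmetric])
 have finA: "finite (carrier GA)" using finite_subset[OF Ac fin] by (simp add: GAs)
 define Ap where "Ap = (%y. y [^]\<^bsub>GA\<^esub> p) ` carrier GA"
 have Ap: "subgroup Ap GA" unfolding Ap_def by (rule GA.pow_image_subgroup)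
 define \<phi> where "\<phi> = (%a. Ap #>\<^bsub>GA\<^esub> gprod G r x a)"
 have finX: "finite Xs" unfolding Xs_def by (simp add: finite_PiE)
 have finR: "finite (rcosets\<^bsub>GA\<^esub> Ap)" unfolding RCOSETS_def using finA by simp
 have \<phi>R: "\<phi> ` Xs <= rcosets\<^bsub>GA\<^esub> Ap" unfolding \<phi>_def RCOSETS_def by (auto simp: GAs A_def)
 have fb: "card {a : Xs. \<phi> a = C} <= K" if C: "C : \<phi> ` Xs" for C
 proof -
  obtain a0 where a0: "a0 : Xs" "C = \<phi> a0" using C by blast
  have "{a : Xs. \<phi> a = C} <= {a : Xs. EX c. gprod G r x a = gprod G r x c [^] p \<otimes> gprod G r x a0}"
  using a0 GA.rcos_self[OF _ Ap] by (auto simp: \<phi>_def r_coset_def Ap_def GAp GAs A_def)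
  hence "card {a : Xs. \<phi> a = C} <= card {a : Xs. EX c. gprod G r x a = gprod G r x c [^] p \<otimes> gprod G r x a0}"
   using finX by (intro card_mono) auto
  also have "... <= K" using fib[of a0] a0 by (simp add: Xs_def)
  finally show ?thesis .
 qed
 have "p ^ r = card Xs" by (simp add: Xs_def card_PiE)
 also have "card Xs = (\<Sum>C\<in>\<phi> ` Xs. card {a : Xs. \<phi> a = C})"
  using sum.image_gen[OF finX, of "%_. 1::nat" \<phi>] by (simp only: card_eq_sum)
 also have "... <= (\<Sum>C\<in>\<phi> ` Xs. K)" by (rule sum_mono) (rule fb)
 also have "... = card (\<phi> ` Xs) * K" by simp
 also have "... <= card (rcosets\<^bsub>GA\<^esub> Ap) * K" by (intro mult_right_mono card_mono finR \<phi>R) simp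
 also have "card (rcosets\<^bsub>GA\<^esub> Ap) = card {y : A. y [^] p = \<one>}"
  unfolding Ap_def GA.card_pow_cosets[OF finA] unfolding GAp GAs ..
 also have "... * K <= card {y : carrier G. y [^] p = \<one>} * K"
  using fin Ac by (intro mult_right_mono card_mono) auto
 finally show ?thesis by (simp add: mult.commute)
qed

end

section \<open>Class groups\<close>


context numfield
begin

lemma carrier_ring_of_integers: "carrier (ring_of_integers L) = Oi"
 by (simp add: ring_of_integers_def Oi_def)

lemma ring_ring_of_integers: "ring (ring_of_integers L)"
proof -
 interpret R: ring complex_ring by (rule ring_from_type_algebra)
 have inv: "\<ominus>\<^bsub>complex_ring\<^esub> x = - x" for x
  by (rule R.minus_equality) (simp_all add: ring_of_type_algebra_def)
 have "subring Oi complex_ring"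
  by (rule R.subringI) (auto simp: inv ops Oi_minus Oi_add Oi_mult, simp_all add: ring_of_type_algebra_def Oi_1)
 thus ?thesis using R.subring_is_ring by (simp add: ring_of_integers_def Oi_def)
qed

lemma idl_mult_right: "idl I ==> x : I ==> a : Oi ==> x * a : I"
 using idlD(4)[of I a x] by (simp add: mult.commute)

lemma fid_mult_right: "fid I ==> x : I ==> a : Oi ==> x * a : I"
 using fidD(4)[of I a x] by (simp add: mult.commute)

lemma ideal_iff: "ideal I (ring_of_integers L) \<longleftrightarrow> idl I"
proof
 assume "ideal I (ring_of_integers L)"
 then interpret ideal I "ring_of_integers L" .
 have rops: "monoid.mult (ring_of_integers L) = (*)" "add (ring_of_integers L) = (+)" "ring.zero (ring_of_integers L) = 0"
  by (simp_all add: ring_of_integers_def ring_of_type_algebra_def)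
 show "idl I" unfolding idl_def
  using a_subset additive_subgroup.zero_closed[OF additive_subgroup_axioms]
   additive_subgroup.a_closed[OF additive_subgroup_axioms] I_l_closed
  unfolding rops carrier_ring_of_integers by blast
next
 assume I: "idl I"
 interpret R: ring "ring_of_integers L" by (rule ring_ring_of_integers)
 have rops: "monoid.mult (ring_of_integers L) = (*)" "add (ring_of_integers L) = (+)" "ring.zero (ring_of_integers L) = 0"
  by (simp_all add: ring_of_integers_def ring_of_type_algebra_def)
 show "ideal I (ring_of_integers L)"
 proof (rule idealI[OF ring_ring_of_integers])
  show "subgroup I (add_monoid (ring_of_integers L))"
  proof (rule R.add.subgroupI)
   fix a assume a: "a : I"
   have "\<ominus>\<^bsub>ring_of_integers L\<^esub> a = - a"
    using idlD(1)[OF I a] Oi_minus by (intro R.minus_equality) (simp_all add: rops carrier_ring_of_integers)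
   thus "\<ominus>\<^bsub>ring_of_integers L\<^esub> a : I" using idl_minus[OF I a] by simp
  qed (use idlD[OF I] in \<open>auto simp: rops carrier_ring_of_integers\<close>)
 qed (use idlD(4)[OF I] idl_mult_right[OF I] in \<open>auto simp: rops carrier_ring_of_integers\<close>)
qed

lemma fractional_ideals_eq: "fractional_ideals L = {J. fid J}"
proof (intro Set.set_eqI iffI)
 fix J assume "J : fractional_ideals L"
 then obtain d I where J: "J = (%x. x / d) ` I" and I: "idl I" "I ~= {0}" and d: "d : Oi" "d ~= 0"
  unfolding fractional_ideals_def ideal_iff carrier_ring_of_integers by blast
 have J': "J = smul (inverse d) I" unfolding J smul_def by (simp add: divide_inverse mult.commute)
 obtain x where "x : I" "x ~= 0" using I idlD(2)[OF I(1)] by blast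
 hence "fid I" using idl_fid[OF I(1)] by blast
 hence "fid J" unfolding J' using fid_smul[of I "inverse d"] d Linv Oi_L by simp
 thus "J : {J. fid J}" by simp
next
 fix J assume "J : {J. fid J}"
 hence J: "fid J" by simp
 obtain d where d: "d : Oi" "d ~= 0" "ALL x:J. d * x : Oi" using fidD(6)[OF J] by blast
 define I where "I = smul d J"
 have I: "fid I" unfolding I_def using fid_smul[OF J Oi_L[OF d(1)] d(2)] .
 have "I <= Oi" unfolding I_def smul_def using d by blast
 hence "idl I" using fid_idl[OF I] by blast
 moreover have "I ~= {0}" using fidD(5)[OF I] by blast
 moreover have "J = (%x. x / d) ` I" using d by (simp add: I_def smul_def image_image)
 ultimately show "J : fractional_ideals L"
  unfolding fractional_ideals_def ideal_iff carrier_ring_of_integers using d(1,2) by blast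
qed

lemma fig_simps:
 "carrier (fractional_ideal_group L) = {J. fid J}"
 "monoid.mult (fractional_ideal_group L) = (%I J. I \<star> J)" "one (fractional_ideal_group L) = Oi"
 by (simp_all add: fractional_ideal_group_def fractional_ideals_eq carrier_ring_of_integers)

lemma comm_group_fig: "comm_group (fractional_ideal_group L)"
proof (rule comm_groupI, unfold fig_simps mem_Collect_eq)
 fix x assume "fid x"
 then obtain x' where "fid x'" "x \<star> x' = Oi" using fid_inverse by metis
 thus "EX y:{J. fid J}. y \<star> x = Oi" using iprod_comm by auto
next
 fix x y show "x \<star> y = y \<star> x" by (rule iprod_comm)
qed (auto simp: fid_iprod fid_Oi iprod_Oi iprod_assoc)

lemma principal_eq: "principal_fractional_ideals L = {smul x Oi | x. x : L & x ~= 0}"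
 by (auto simp: principal_fractional_ideals_def smul_def carrier_ring_of_integers)

lemma smul_Oi_mult: "x : L ==> x ~= 0 ==> y : L ==> y ~= 0 ==> smul x Oi \<star> smul y Oi = smul (x * y) Oi"
 using iprod_smul[OF fid_smul[OF fid_Oi], of y x] by (simp add: smul_smul)

lemma subgroup_principal: "subgroup (principal_fractional_ideals L) (fractional_ideal_group L)"
proof -
 interpret F: comm_group "fractional_ideal_group L" by (rule comm_group_fig)
 show ?thesis
 proof (rule F.subgroupI)
  show "principal_fractional_ideals L <= carrier (fractional_ideal_group L)"
   by (auto simp: principal_eq fig_simps fid_smul fid_Oi)
  show "principal_fractional_ideals L ~= {}" using L1 by (auto simp: principal_eq)
  fix a assume "a : principal_fractional_ideals L"
  then obtain x where x: "x : L" "x ~= 0" "a = smul x Oi" by (auto simp: principal_eq)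
  have "inv\<^bsub>fractional_ideal_group L\<^esub> a = smul (inverse x) Oi"
   using x Linv[OF x(1)] smul_Oi_mult[of "inverse x" x]
   by (intro F.inv_equality) (auto simp: fig_simps fid_smul fid_Oi)
  thus "inv\<^bsub>fractional_ideal_group L\<^esub> a : principal_fractional_ideals L"
   using x Linv[OF x(1)] by (auto simp: principal_eq)
  fix b assume "b : principal_fractional_ideals L"
  then obtain y where y: "y : L" "y ~= 0" "b = smul y Oi" by (auto simp: principal_eq)
  show "a \<otimes>\<^bsub>fractional_ideal_group L\<^esub> b : principal_fractional_ideals L"
   unfolding fig_simps x(3) y(3) smul_Oi_mult[OF x(1,2) y(1,2)] principal_eq
   using x y Lmult[of x y] by (intro CollectI exI[of _ "x * y"]) auto
 qed
qed

lemma comm_group_class_group: "comm_group (class_group L)"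
 unfolding class_group_def by (rule comm_group.abelian_FactGroup[OF comm_group_fig subgroup_principal])

definition cls :: "complex set => complex set set"
 where "cls J = principal_fractional_ideals L #>\<^bsub>fractional_ideal_group L\<^esub> J"

lemma cls_eq_collect: "fid J ==> cls J = {smul x J | x. x : L & x ~= 0}"
 unfolding cls_def r_coset_def fig_simps principal_eq using iprod_smul by auto

lemma cls_eq_iff:
 assumes I: "fid I" and J: "fid J"
 shows "cls I = cls J \<longleftrightarrow> (EX x:L. x ~= 0 & I = smul x J)"
proof
 assume "cls I = cls J"
 moreover have "I : cls I" unfolding cls_eq_collect[OF I] using L1 by (intro CollectI exI[of _ 1]) auto
 ultimately show "EX x:L. x ~= 0 & I = smul x J" unfolding cls_eq_collect[OF J] by blast
next
 assume "EX x:L. x ~= 0 & I = smul x J"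
 then obtain x where x: "x : L" "x ~= 0" "I = smul x J" by blast
 have "{smul y I | y. y : L & y ~= 0} = {smul y J | y. y : L & y ~= 0}"
 proof (intro Set.set_eqI iffI)
  fix A assume "A : {smul y I | y. y : L & y ~= 0}"
  then obtain y where y: "y : L" "y ~= 0" "A = smul y I" by blast
  thus "A : {smul y J | y. y : L & y ~= 0}"
   using x Lmult by (intro CollectI exI[of _ "y * x"]) (auto simp: smul_smul)
 next
  fix A assume "A : {smul y J | y. y : L & y ~= 0}"
  then obtain y where y: "y : L" "y ~= 0" "A = smul y J" by blast
  thus "A : {smul y I | y. y : L & y ~= 0}"
   using x Ldiv by (intro CollectI exI[of _ "y / x"]) (auto simp: smul_smul)
 qed
 thus "cls I = cls J" unfolding cls_eq_collect[OF I] cls_eq_collect[OF J] .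
qed

lemma cls_carrier: "fid J ==> cls J : carrier (class_group L)"
 unfolding class_group_def carrier_FactGroup cls_def fig_simps by blast

lemma cls_surj: "Xs : carrier (class_group L) ==> EX J. fid J & Xs = cls J"
 unfolding class_group_def carrier_FactGroup cls_def fig_simps by blast

lemma cls_mult: "fid I ==> fid J ==> cls (I \<star> J) = cls I \<otimes>\<^bsub>class_group L\<^esub> cls J"
proof -
 assume IJ: "fid I" "fid J"
 interpret F: comm_group "fractional_ideal_group L" by (rule comm_group_fig)
 interpret N: normal "principal_fractional_ideals L" "fractional_ideal_group L"
  using F.subgroup_imp_normal[OF subgroup_principal] .
 show ?thesis using N.r_coset_hom_Mod IJ unfolding hom_def cls_def class_group_def fig_simps by auto
qed

lemma cls_one: "cls Oi = \<one>\<^bsub>class_group L\<^esub>"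
proof -
 interpret F: comm_group "fractional_ideal_group L" by (rule comm_group_fig)
 have "cls Oi = principal_fractional_ideals L"
  unfolding cls_def using F.coset_mult_one subgroup.subset[OF subgroup_principal] by (simp add: fig_simps(3)[symmetric])
 thus ?thesis by (simp add: class_group_def)
qed

lemma cls_pow: "fid J ==> cls J [^]\<^bsub>class_group L\<^esub> (n::nat) = cls (ipow J n)"
proof (induction n)
 case 0
 thus ?case using cls_one by simp
next
 case (Suc n)
 interpret C: comm_group "class_group L" by (rule comm_group_class_group)
 show ?case using Suc cls_mult[of J "ipow J n"] C.m_comm[OF cls_carrier cls_carrier, of J "ipow J n"]
  by (simp add: fid_ipow)
qed

lemma finite_class_group: "finite (carrier (class_group L))"
proof -
 obtain R where R: "finite R" "!!J. fid J ==> EX x:L. x ~= 0 & smul x J : R" using finite_classes by metis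
 have "carrier (class_group L) <= cls ` R"
 proof
  fix Xs assume "Xs : carrier (class_group L)"
  then obtain J where J: "fid J" "Xs = cls J" using cls_surj by blast
  obtain x where x: "x : L" "x ~= 0" "smul x J : R" using R(2)[OF J(1)] by blast
  have "cls (smul x J) = cls J" using cls_eq_iff[OF fid_smul[OF J(1) x(1,2)] J(1)] x by blast
  thus "Xs : cls ` R" using J x by (metis image_eqI)
 qed
 thus ?thesis using R(1) finite_surj by blast
qed

primrec iprods :: "nat => (nat => complex set) => (nat => nat) => complex set"
 where "iprods 0 Q c = Oi" | "iprods (Suc r) Q c = ipow (Q r) (c r) \<star> iprods r Q c"

lemma fid_iprods: "(!!i. i < r ==> fid (Q i)) ==> fid (iprods r Q c)"
 by (induction r) (auto simp: fid_Oi fid_iprod fid_ipow)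

lemma cls_iprods:
 assumes "!!i. i < r ==> fid (Q i)"
 shows "cls (iprods r Q c) = gprod (class_group L) r (%i. cls (Q i)) c"
 using assms
proof (induction r)
 case 0
 interpret C: comm_group "class_group L" by (rule comm_group_class_group)
 show ?case by (simp add: C.gprod_0 cls_one)
next
 case (Suc r)
 interpret C: comm_group "class_group L" by (rule comm_group_class_group)
 have "cls (iprods (Suc r) Q c) = cls (Q r) [^]\<^bsub>class_group L\<^esub> c r \<otimes>\<^bsub>class_group L\<^esub> cls (iprods r Q c)"
  using Suc.prems by (simp add: cls_mult fid_ipow fid_iprods cls_pow)
 also have "... = gprod (class_group L) (Suc r) (%i. cls (Q i)) c"
  using Suc by (subst C.gprod_Suc) (auto simp: cls_carrier)
 finally show ?case .
qed

section \<open>Prime ideals and cancellation\<close>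

definition prm :: "complex set => bool"
 where "prm P \<longleftrightarrow> fid P & P <= Oi & 1 ~: P & (ALL a:Oi. ALL b:Oi. a * b : P --> a : P \<or> b : P)"

text \<open>Only finitely many ideals contain \<open>m\<close>, so there is a maximal one among the
  proper ideals above \<open>I\<close>, and maximality makes it prime.\<close>

lemma ex_prime_ideal:
 assumes I: "idl I" and m: "m > (0::nat)" "of_nat m : I" and one: "1 ~: I"
 obtains P where "prm P" "I <= P"
proof -
 define S where "S = {J. idl J & of_nat m : J & 1 ~: J & I <= J}"
 have "finite S" by (rule finite_subset[OF _ finite_ideals_containing[OF m(1)]]) (auto simp: S_def)
 moreover have "I : S" using assms by (simp add: S_def)
 ultimately obtain P where P: "P : S" "ALL J:S. P <= J --> P = J" using finite_has_maximal[of S] by blast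
 have Pi: "idl P" "of_nat m : P" "1 ~: P" "I <= P" using P(1) by (auto simp: S_def)
 have prime: "b : P" if ab: "a : Oi" "b : Oi" "a * b : P" "a ~: P" for a b
 proof -
  define J where "J = {u + a * t | u t. u : P & t : Oi}"
  have Jm: "u + a * t : J" if "u : P" "t : Oi" for u t using that by (auto simp: J_def)
  have PJ: "P <= J" using Jm[OF _ Oi_0] by auto
  have "a : J" using Jm[OF idlD(2)[OF Pi(1)] Oi_1] by simp
  have "idl J" unfolding idl_def
  proof (intro conjI ballI)
   show "J <= Oi" using idlD(1)[OF Pi(1)] ab(1) Oi_add Oi_mult by (auto simp: J_def)
   show "0 : J" using PJ idlD(2)[OF Pi(1)] by blast
   fix x assume "x : J"
   then obtain u t where x: "x = u + a * t" "u : P" "t : Oi" by (auto simp: J_def)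
   { fix y assume "y : J"
    then obtain u' t' where y: "y = u' + a * t'" "u' : P" "t' : Oi" by (auto simp: J_def)
    have "(u + u') + a * (t + t') : J" using x y idlD(3)[OF Pi(1)] Oi_add by (intro Jm)
    thus "x + y : J" by (simp add: x y algebra_simps) }
   { fix c assume c: "c : Oi"
    have "(c * u) + a * (c * t) : J" using x c idlD(4)[OF Pi(1)] Oi_mult by (intro Jm)
    thus "c * x : J" by (simp add: x algebra_simps) }
  qed
  have "1 : J"
  proof (rule ccontr)
   assume "1 ~: J"
   hence "J : S" using \<open>idl J\<close> PJ Pi by (auto simp: S_def)
   hence "P = J" using P(2) PJ by blast
   thus False using \<open>a : J\<close> ab by simp
  qed
  then obtain u t where ut: "1 = u + a * t" "u : P" "t : Oi" by (auto simp: J_def)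
  have "b = b * (u + a * t)" using ut(1) by simp
  also have "... = b * u + t * (a * b)" by (simp add: algebra_simps)
  also have "... : P" using ut ab idlD[OF Pi(1)] by blast
  finally show "b : P" .
 qed
 have "fid P" using idl_fid[OF Pi(1,2)] m by simp
 hence "prm P" unfolding prm_def using Pi idlD(1)[OF Pi(1)] prime by blast
 thus ?thesis using that Pi by blast
qed

lemma fid_subset_iprod: "fid A ==> C <= Oi ==> A \<star> C <= A"
 by (rule iprod_least) (auto intro: fidD(3) fid_mult_right)

definition inve :: "complex set => complex set" where "inve A = (SOME A'. fid A' & A \<star> A' = Oi)"

lemma inve: assumes A: "fid A" shows "fid (inve A)" "A \<star> inve A = Oi"
proof -
 obtain A' where "fid A' & A \<star> A' = Oi" using fid_inverse[OF A] by metis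
 hence "fid (inve A) & A \<star> inve A = Oi" unfolding inve_def by (rule someI)
 thus "fid (inve A)" "A \<star> inve A = Oi" by auto
qed

lemma iprod_cancel_subset:
 assumes "fid A" "fid I" "fid J" "A \<star> I <= A \<star> J" shows "I <= J"
proof -
 have s: "inve A \<star> (A \<star> I) <= inve A \<star> (A \<star> J)" by (rule iprod_mono[OF order.refl assms(4)])
 have c: "inve A \<star> (A \<star> B) = B" if "fid B" for B
  using inve(2)[OF assms(1)] iprod_Oi[OF that] iprod_comm[of A "inve A"] iprod_assoc[of "inve A" A B] by simp
 show ?thesis using s unfolding c[OF assms(2)] c[OF assms(3)] .
qed

lemma iprod_cancel: "fid A ==> fid I ==> fid J ==> A \<star> I = A \<star> J ==> I = J"
 using iprod_cancel_subset[of A I J] iprod_cancel_subset[of A J I] by auto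

end

section \<open>Valuations\<close>


locale numfield_prime = numfield +
 fixes P :: "complex set"
 assumes P: "prm P"
begin

lemma fidP: "fid P" and P_Oi: "P <= Oi" and P1: "1 ~: P"
 and Pprime: "a : Oi ==> b : Oi ==> a * b : P ==> a : P \<or> b : P"
 using P unfolding prm_def by blast+

lemma ipow_P_Oi: "ipow P n <= Oi"
proof (induction n)
 case (Suc n)
 show ?case using fid_subset_iprod[OF fidP Suc] P_Oi by auto
qed simp

lemma ipow_P_sub: "ipow P (Suc n) <= P"
 using fid_subset_iprod[OF fidP ipow_P_Oi, of n] by simp

lemma ipow_inve: "ipow P n \<star> ipow (inve P) n = Oi"
proof (induction n)
 case (Suc n)
 have "ipow P (Suc n) \<star> ipow (inve P) (Suc n) = (P \<star> inve P) \<star> (ipow P n \<star> ipow (inve P) n)"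
  using iprod_assoc[of P "ipow P n" "inve P \<star> ipow (inve P) n"] iprod_assoc[of "ipow P n" "inve P" "ipow (inve P) n"]
   iprod_comm[of "ipow P n" "inve P"] iprod_assoc[of "inve P" "ipow P n" "ipow (inve P) n"]
   iprod_assoc[of P "inve P" "ipow P n \<star> ipow (inve P) n"] by simp
 thus ?case using Suc inve(2)[OF fidP] iprod_Oi[OF fid_Oi] by simp
qed (simp add: iprod_Oi fid_Oi)

lemma ipow_not_Oi: "n > 0 ==> ipow P n ~= Oi"
 using ipow_P_sub[of "n - 1"] P1 Oi_1 by auto

text \<open>Otherwise the quotients of \<open>I\<close> by all powers of \<open>P\<close> would be
  integral ideals containing one fixed \<open>m\<close>. Two of them would coincide, and
  cancellation would make a positive power of \<open>P\<close> equal to \<open>Oi\<close>.\<close>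

lemma not_all_powers:
 assumes I: "fid I" "I <= Oi"
 shows "EX n. ~ I <= ipow P n"
proof (rule ccontr)
 assume "~ (EX n. ~ I <= ipow P n)"
 hence all: "I <= ipow P n" for n by blast
 define R where "R = inve P"
 have R: "fid R" unfolding R_def by (rule inve(1)[OF fidP])
 have oneR: "1 : ipow R n" for n
 using ipow_inve Oi_1 iprod_mono[OF ipow_P_Oi order.refl] iprod_Oi[OF fid_ipow[OF R]] by (fastforce simp: R_def)
 define A where "A = (%n. I \<star> ipow R n)"
 have fA: "fid (A n)" for n unfolding A_def by (intro fid_iprod I fid_ipow R)
 have AO: "A n <= Oi" for n
  using iprod_mono[OF all[of n] order.refl, of "ipow R n"] ipow_inve[of n] by (simp add: A_def R_def)
 obtain a0 where a0: "a0 : I" "a0 ~= 0" using fidD(5)[OF I(1)] by blast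
 obtain m where m: "m > 0" "of_nat m / a0 : Oi" using Nm_abs[of a0] a0 I by blast
 have mI: "of_nat m : I" using fidD(4)[OF I(1) m(2) a0(1)] a0 by simp
 have mA: "of_nat m : A n" for n using iprod_prod[OF mI oneR[of n]] by (simp add: A_def)
 have "range A <= {I. idl I & of_nat m : I}" using fid_idl[OF fA AO] mA by blast
 hence "finite (range A)" using finite_ideals_containing[OF m(1)] finite_subset by blast
 hence "~ inj A" using finite_imageD[of A UNIV] by auto
 then obtain i j where ij: "i < j" "A i = A j" unfolding inj_on_def by (metis nat_neq_iff)
 have "ipow R i = ipow R j" by (rule iprod_cancel[OF I(1)]) (use ij in \<open>auto simp: A_def fid_ipow R\<close>)
 also have "ipow R j = ipow R i \<star> ipow R (j - i)" using ipow_add[OF R, of i "j - i"] ij by simp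
 finally have "ipow R i \<star> Oi = ipow R i \<star> ipow R (j - i)"
  using iprod_Oi[OF fid_ipow[OF R, of i]] iprod_comm[of Oi "ipow R i"] by simp
 hence "Oi = ipow R (j - i)" by (intro iprod_cancel[OF fid_ipow[OF R] fid_Oi fid_ipow[OF R]])
 hence "ipow P (j - i) \<star> Oi = Oi" using ipow_inve[of "j - i"] by (simp add: R_def)
 hence "ipow P (j - i) = Oi" using iprod_Oi[OF fid_ipow[OF fidP]] iprod_comm[of Oi] by simp
 thus False using ipow_not_Oi[of "j - i"] ij by simp
qed

lemma prime_decomp:
 assumes I: "fid I" "I <= Oi"
 shows "EX n I'. fid I' & I' <= Oi & ~ I' <= P & I = ipow P n \<star> I'"
proof -
 define n where "n = (LEAST n. ~ I <= ipow P (Suc n))"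
 obtain k where k: "~ I <= ipow P k" using not_all_powers[OF I] by blast
 hence "k ~= 0" using I by (metis ipow.simps(1))
 hence "~ I <= ipow P (Suc (k - 1))" using k by simp
 hence n1: "~ I <= ipow P (Suc n)" unfolding n_def by (rule LeastI)
 have n2: "I <= ipow P n"
 proof (cases n)
  case 0 thus ?thesis using I by simp
 next
  case (Suc m)
  thus ?thesis using not_less_Least[of m "%n. ~ I <= ipow P (Suc n)"] n_def by auto
 qed
 define I' where "I' = ipow (inve P) n \<star> I"
 have fi: "fid (ipow (inve P) n)" by (intro fid_ipow inve(1) fidP)
 have "I' <= ipow (inve P) n \<star> ipow P n" unfolding I'_def by (rule iprod_mono[OF order.refl n2])
 hence I'O: "I' <= Oi" using ipow_inve[of n] iprod_comm[of "ipow P n"] by simp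
 have "ipow P n \<star> I' = (ipow P n \<star> ipow (inve P) n) \<star> I" unfolding I'_def by (simp only: iprod_assoc)
 hence eq: "I = ipow P n \<star> I'" using ipow_inve[of n] iprod_Oi[OF I(1)] by simp
 moreover have "~ I' <= P"
 proof
  assume "I' <= P"
  hence "ipow P n \<star> I' <= ipow P n \<star> P" by (intro iprod_mono order.refl)
  thus False using n1 eq iprod_comm[of P] by simp
 qed
 ultimately show ?thesis using I'O fid_iprod[OF fi I(1)] unfolding I'_def by blast
qed

text \<open>The exponent of \<open>P\<close> in an integral ideal. The choice is harmless:
  \<open>w_ge_iff\<close> determines the value by containment in powers of \<open>P\<close>.\<close>

definition w :: "complex set => nat"
 where "w I = (SOME n. EX I'. fid I' & I' <= Oi & ~ I' <= P & I = ipow P n \<star> I')"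

lemma w_decomp:
 assumes I: "fid I" "I <= Oi"
 obtains I' where "fid I'" "I' <= Oi" "~ I' <= P" "I = ipow P (w I) \<star> I'"
using someI_ex[OF prime_decomp[OF I]] by (auto simp: w_def)

lemma w_ge_iff:
 assumes I: "fid I" "I <= Oi"
 shows "n <= w I \<longleftrightarrow> I <= ipow P n"
proof
 obtain I' where I': "fid I'" "I' <= Oi" "~ I' <= P" "I = ipow P (w I) \<star> I'" using w_decomp[OF I] .
 {
  assume "n <= w I"
  hence "ipow P (w I) = ipow P n \<star> ipow P (w I - n)" using ipow_add[OF fidP, of n "w I - n"] by simp
  hence "ipow P (w I) <= ipow P n" using fid_subset_iprod[OF fid_ipow[OF fidP] ipow_P_Oi] by simp
  moreover have "I <= ipow P (w I)" using fid_subset_iprod[OF fid_ipow[OF fidP, of "w I"] I'(2)] I'(4) by simp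
  ultimately show "I <= ipow P n" by blast
 next
  assume s: "I <= ipow P n"
  show "n <= w I"
  proof (rule ccontr)
   assume lt: "~ n <= w I"
   hence "ipow P n = ipow P (w I) \<star> ipow P (n - w I)" using ipow_add[OF fidP, of "w I" "n - w I"] by simp
   hence "ipow P (w I) \<star> I' <= ipow P (w I) \<star> ipow P (n - w I)" using s I'(4) by simp
   hence "I' <= ipow P (n - w I)" by (rule iprod_cancel_subset[OF fid_ipow[OF fidP] I'(1) fid_ipow[OF fidP]])
   moreover obtain k where "n - w I = Suc k" using lt by (metis diff_is_0_eq not0_implies_Suc)
   ultimately show False using ipow_P_sub[of k] I'(3) by (metis order_trans)
  qed
 }
qed

lemma w_mult:
 assumes I: "fid I" "I <= Oi" and J: "fid J" "J <= Oi"
 shows "w (I \<star> J) = w I + w J"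
proof -
 obtain I' where I': "fid I'" "I' <= Oi" "~ I' <= P" "I = ipow P (w I) \<star> I'" using w_decomp[OF I] .
 obtain J' where J': "fid J'" "J' <= Oi" "~ J' <= P" "J = ipow P (w J) \<star> J'" using w_decomp[OF J] .
 have IJ: "fid (I \<star> J)" "I \<star> J <= Oi"
  using fid_iprod I J fid_subset_iprod[OF I(1) J(2)] by auto
 have fIJ': "fid (I' \<star> J')" using fid_iprod I' J' by auto
 have nP: "~ I' \<star> J' <= P"
 proof
  assume s: "I' \<star> J' <= P"
  obtain a b where ab: "a : I'" "a ~: P" "b : J'" "b ~: P" using I'(3) J'(3) by blast
  hence "a * b : P" using s iprod_prod by blast
  thus False using Pprime[of a b] ab I'(2) J'(2) by blast
 qed
 have eq: "I \<star> J = ipow P (w I + w J) \<star> (I' \<star> J')"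
 using I'(4) J'(4) iprod_assoc[of "ipow P (w I)" I' "ipow P (w J) \<star> J'"] iprod_assoc[of I' "ipow P (w J)" J'] iprod_comm[of I' "ipow P (w J)"] iprod_assoc[of "ipow P (w J)" I' J'] iprod_assoc[of "ipow P (w I)" "ipow P (w J)" "I' \<star> J'"] by (simp add: ipow_add[OF fidP])
 have "I' \<star> J' <= Oi" using fid_subset_iprod[OF I'(1) J'(2)] I'(2) by blast
 hence "I \<star> J <= ipow P (w I + w J)" unfolding eq by (rule fid_subset_iprod[OF fid_ipow[OF fidP]])
 hence "w I + w J <= w (I \<star> J)" using w_ge_iff[OF IJ] by simp
 moreover have "~ Suc (w I + w J) <= w (I \<star> J)"
 using w_ge_iff[OF IJ] eq iprod_comm[of P] nP iprod_cancel_subset[OF fid_ipow[OF fidP] fIJ' fidP] by fastforce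
 ultimately show ?thesis by simp
qed

definition we :: "complex => nat" where "we x = w (smul x Oi)"

lemma principal:
 assumes x: "x : Oi" "x ~= 0" shows "fid (smul x Oi)" "smul x Oi <= Oi"
 using fid_smul[OF fid_Oi Oi_L[OF x(1)] x(2)] Oi_mult[OF x(1)] by (auto simp: smul_def)

lemma we_ge_iff: assumes x: "x : Oi" "x ~= 0" shows "n <= we x \<longleftrightarrow> x : ipow P n"
proof -
 have "smul x Oi <= ipow P n \<longleftrightarrow> x : ipow P n"
 using smul_mem[OF Oi_1, of x] fid_mult_right[OF fid_ipow[OF fidP]] by (auto simp: smul_def)
 thus ?thesis unfolding we_def using w_ge_iff[OF principal[OF x]] by simp
qed

lemma we_mult: "x : Oi ==> x ~= 0 ==> y : Oi ==> y ~= 0 ==> we (x * y) = we x + we y"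
 unfolding we_def using smul_Oi_mult[OF Oi_L _ Oi_L] w_mult[OF principal principal] by metis

lemma we_pos_iff: "x : Oi ==> x ~= 0 ==> we x = 0 \<longleftrightarrow> x ~: P"
 using we_ge_iff[of x 1] iprod_Oi[OF fidP] iprod_comm[of P Oi] by auto

lemma we_add:
 assumes "x : Oi" "x ~= 0" "y : Oi" "y ~= 0" "x + y ~= 0"
 shows "min (we x) (we y) <= we (x + y)"
proof -
 have "x : ipow P (min (we x) (we y))" "y : ipow P (min (we x) (we y))"
  using we_ge_iff assms by (metis min.cobounded1 min.cobounded2)+
 thus ?thesis using we_ge_iff[OF Oi_add[OF assms(1,3)] assms(5)] fidD(3)[OF fid_ipow[OF fidP]] by blast
qed

lemma w_le_we: "fid I ==> I <= Oi ==> x : I ==> x ~= 0 ==> w I <= we x"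
 using w_ge_iff[of I "w I"] we_ge_iff[of x] by blast

lemma w_attained:
 assumes I: "fid I" "I <= Oi"
 obtains x where "x : I" "x ~= 0" "we x = w I"
proof -
 have "~ I <= ipow P (Suc (w I))" using w_ge_iff[OF I, of "Suc (w I)"] by simp
 then obtain x where x: "x : I" "x ~: ipow P (Suc (w I))" by blast
 hence x0: "x ~= 0" using fidD(2)[OF fid_ipow[OF fidP]] by blast
 have "~ Suc (w I) <= we x" using x x0 we_ge_iff[of x] I by blast
 hence "we x = w I" using w_le_we[OF I x(1) x0] by simp
 thus ?thesis using that x x0 by blast
qed

text \<open>The valuation on the field. A natural denominator is picked only to have some fraction
  at hand; by \<open>v_frac\<close> every fraction gives the same value.\<close>

definition v :: "complex => int"
 where "v x = (let d = (SOME d. d > 0 & of_nat d * x : Oi) in int (we (of_nat d * x)) - int (we (of_nat d)))"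

lemma v_frac:
 assumes a: "a : Oi" "a ~= 0" and b: "b : Oi" "b ~= 0"
 shows "v (a / b) = int (we a) - int (we b)"
proof -
 define x where "x = a / b"
 define d where "d = (SOME d::nat. d > 0 & of_nat d * x : Oi)"
 have xL: "x : L" using a b by (simp add: x_def Ldiv Oi_L)
 have "EX d::nat. d > 0 & of_nat d * x : Oi" using L_denom[OF xL] by metis
 hence d: "d > 0 & of_nat d * x : Oi" unfolding d_def by (rule someI_ex)
 have nz: "(of_nat d :: complex) ~= 0" "of_nat d * x ~= 0" using d a b by (auto simp: x_def)
 have "we (of_nat d * x * b) = we (of_nat d * x) + we b" using d nz b by (intro we_mult) auto
 moreover have "we (of_nat d * a) = we (of_nat d) + we a" using d nz a Oi_of_nat by (intro we_mult) auto
 moreover have "of_nat d * x * b = of_nat d * a" using b by (simp add: x_def)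
 ultimately have "int (we (of_nat d * x)) - int (we (of_nat d)) = int (we a) - int (we b)" by simp
 thus ?thesis by (simp add: v_def Let_def d_def x_def)
qed

lemma L_frac:
 assumes "x : L" "x ~= 0"
 obtains a b where "a : Oi" "a ~= 0" "b : Oi" "b ~= 0" "x = a / b"
proof -
 obtain n where n: "n > 0" "of_nat n * x : Oi" using L_denom[OF assms(1)] .
 show ?thesis by (rule that[of "of_nat n * x" "of_nat n"]) (use n assms Oi_of_nat in auto)
qed

lemma we_1: "we 1 = 0" using we_pos_iff[OF Oi_1] P1 by simp

lemma v_Oi: "x : Oi ==> x ~= 0 ==> v x = int (we x)"
 using v_frac[of x 1] Oi_1 we_1 by simp

lemma v_mult:
 assumes x: "x : L" "x ~= 0" and y: "y : L" "y ~= 0"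
 shows "v (x * y) = v x + v y"
proof -
 obtain a b where ab: "a : Oi" "a ~= 0" "b : Oi" "b ~= 0" "x = a / b" using L_frac[OF x] .
 obtain c d where cd: "c : Oi" "c ~= 0" "d : Oi" "d ~= 0" "y = c / d" using L_frac[OF y] .
 have "v (x * y) = v ((a * c) / (b * d))" by (simp add: ab cd)
 also have "... = int (we (a * c)) - int (we (b * d))" using ab cd Oi_mult by (intro v_frac) auto
 also have "... = v x + v y" using ab cd by (simp add: v_frac we_mult)
 finally show ?thesis .
qed

lemma v_1: "v 1 = 0" using v_Oi[OF Oi_1] we_1 by simp

lemma v_inverse: "x : L ==> x ~= 0 ==> v (inverse x) = - v x"
 using v_mult[of x "inverse x"] v_1 Linv[of x] by simp

lemma v_divide: "x : L ==> x ~= 0 ==> y : L ==> y ~= 0 ==> v (x / y) = v x - v y"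
 using v_mult[of x "inverse y"] v_inverse[of y] Linv[of y] by (simp add: divide_inverse)

lemma v_power: "x : L ==> x ~= 0 ==> v (x ^ n) = int n * v x"
 by (induction n) (auto simp: v_1 v_mult Lpow algebra_simps)

lemma v_prod: "finite A ==> (!!i. i : A ==> f i : L & f i ~= 0) ==> v (prod f A) = (\<Sum>i\<in>A. v (f i))"
 by (induction A rule: finite_induct) (auto simp: v_1 v_mult Lprod)

lemma v_minus: "x : L ==> x ~= 0 ==> v (- x) = v x"
using v_power[of "-1" 2] Lminus[OF L1] v_1 v_mult by fastforce

lemma v_add:
 assumes x: "x : L" "x ~= 0" and y: "y : L" "y ~= 0" and xy: "x + y ~= 0"
 shows "min (v x) (v y) <= v (x + y)"
proof -
 obtain a b where ab: "a : Oi" "a ~= 0" "b : Oi" "b ~= 0" "x = a / b" using L_frac[OF x] .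
 obtain c d where cd: "c : Oi" "c ~= 0" "d : Oi" "d ~= 0" "y = c / d" using L_frac[OF y] .
 have bd: "b * d : Oi" "b * d ~= 0" "a * d : Oi" "a * d ~= 0" "c * b : Oi" "c * b ~= 0" using ab cd Oi_mult by auto
 have e: "x = (a * d) / (b * d)" "y = (c * b) / (b * d)" "x + y = (a * d + c * b) / (b * d)"
  using ab cd by (auto simp: field_simps)
 have nz: "a * d + c * b ~= 0" using xy e(3) by auto
 have "min (we (a * d)) (we (c * b)) <= we (a * d + c * b)" using bd nz by (intro we_add) auto
 moreover have "v x = int (we (a * d)) - int (we (b * d))" unfolding e(1) using bd by (intro v_frac)
 moreover have "v y = int (we (c * b)) - int (we (b * d))" unfolding e(2) using bd by (intro v_frac)
 moreover have "v (x + y) = int (we (a * d + c * b)) - int (we (b * d))"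
  unfolding e(3) using bd nz Oi_add by (intro v_frac) auto
 ultimately show ?thesis by auto
qed

lemma v_add_less:
 assumes x: "x : L" "x ~= 0" and y: "y : L" "y ~= 0" and lt: "v x < v y"
 shows "x + y ~= 0" "v (x + y) = v x"
proof -
 show nz: "x + y ~= 0"
 using v_minus[OF x] lt by (auto simp: add_eq_0_iff)
 have "v x <= v (x + y)" using v_add[OF x y nz] lt by simp
 moreover have "min (v (x + y)) (v (- y)) <= v (x + y + - y)"
  using x y nz Ladd Lminus by (intro v_add) auto
 ultimately show "v (x + y) = v x" using v_minus[OF y] lt by simp
qed

text \<open>Terms of different valuations cannot cancel, so the least valuation wins. Both
  ramification proofs rest on expansions whose terms have this property.\<close>

lemma v_sum_distinct:
 assumes "finite A" "A ~= {}" "!!i. i : A ==> f i : L & f i ~= 0" "inj_on (%i. v (f i)) A"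
 shows "sum f A ~= 0 & v (sum f A) = Min ((%i. v (f i)) ` A)"
 using assms
proof (induction A rule: finite_ne_induct)
 case (insert a A)
 define m where "m = Min ((%i. v (f i)) ` A)"
 have IH: "sum f A ~= 0" "v (sum f A) = m" using insert unfolding m_def by auto
 have sL: "sum f A : L" using insert.prems by (intro Lsum) auto
 have fa: "f a : L" "f a ~= 0" using insert.prems by auto
 have "m : (%i. v (f i)) ` A" unfolding m_def using insert.hyps by (intro Min_in) auto
 hence ne: "v (f a) ~= m" using insert.prems(2) insert.hyps by (auto simp: inj_on_def)
 have mi: "Min ((%i. v (f i)) ` insert a A) = min (v (f a)) m"
  using insert.hyps by (simp add: m_def)
 have s: "sum f (insert a A) = f a + sum f A" using insert.hyps by simp
 show ?case
 proof (cases "v (f a) < m")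
  case True
  thus ?thesis using v_add_less[OF fa sL IH(1)] IH(2) unfolding s mi by simp
 next
  case False
  hence "m < v (f a)" using ne by simp
  thus ?thesis using v_add_less[OF sL IH(1) fa] IH(2) unfolding s mi by (simp add: add.commute)
 qed
qed simp

lemma w_smul:
 assumes I: "fid I" "I <= Oi" and x: "x : L" "x ~= 0" and xI: "smul x I <= Oi"
 shows "int (w (smul x I)) = v x + int (w I)"
proof -
 obtain a b where ab: "a : Oi" "a ~= 0" "b : Oi" "b ~= 0" "x = a / b" using L_frac[OF x] .
 have "smul b (smul x I) = smul a I" using ab by (simp add: smul_smul)
 hence "smul b Oi \<star> smul x I = smul a Oi \<star> I"
  using iprod_smul[OF I(1), of a] iprod_smul[OF fid_smul[OF I(1) x], of b] by simp
 moreover have "w (smul b Oi \<star> smul x I) = we b + w (smul x I)"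
  unfolding we_def by (intro w_mult principal ab fid_smul I x xI)
 moreover have "w (smul a Oi \<star> I) = we a + w I" unfolding we_def by (intro w_mult principal ab I)
 ultimately show ?thesis using ab v_frac[of a b] by simp
qed

lemma w_ipow: "fid I ==> I <= Oi ==> w (ipow I n) = n * w I & ipow I n <= Oi"
proof (induction n)
 case 0
 have "w Oi = we 1" by (simp add: we_def)
 thus ?case using we_1 by simp
next
 case (Suc n)
 thus ?case using w_mult[of I "ipow I n"] fid_ipow fid_subset_iprod[of I "ipow I n"] by auto
qed

lemma w_iprods:
 "(!!i. i < r ==> fid (Q i) & Q i <= Oi) ==>
  w (iprods r Q c) = (\<Sum>i<r. c i * w (Q i)) & iprods r Q c <= Oi"
proof (induction r)
 case 0
 have "w Oi = we 1" by (simp add: we_def)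
 thus ?case using we_1 by simp
next
 case (Suc r)
 have Q: "fid (Q r)" "Q r <= Oi" using Suc.prems by auto
 have ih: "w (iprods r Q c) = (\<Sum>i<r. c i * w (Q i))" "iprods r Q c <= Oi" using Suc by auto
 have "fid (iprods r Q c)" using Suc.prems by (intro fid_iprods) auto
 thus ?case using ih w_ipow[OF Q, of "c r"] w_mult[OF fid_ipow[OF Q(1)], of "c r" "iprods r Q c"]
   fid_subset_iprod[OF fid_ipow[OF Q(1)] ih(2), of "c r"] by auto
qed

lemma w_self: "w P = 1"
proof -
 have PO: "P \<star> Oi = P" using iprod_Oi[OF fidP] iprod_comm[of P Oi] by simp
 have "P <= ipow P (Suc 0)" by (simp add: PO)
 hence "1 <= w P" using w_ge_iff[OF fidP P_Oi, of "Suc 0"] by simp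
 moreover have "~ P <= ipow P (Suc (Suc 0))"
 proof
  assume "P <= ipow P (Suc (Suc 0))"
  hence "P \<star> Oi <= P \<star> P" by (simp add: PO)
  hence "Oi <= P" by (rule iprod_cancel_subset[OF fidP fid_Oi fidP])
  thus False using Oi_1 P1 by blast
 qed
 hence "~ 2 <= w P" using w_ge_iff[OF fidP P_Oi, of "Suc (Suc 0)"] by simp
 ultimately show ?thesis by simp
qed

text \<open>Integers prime to \<open>l\<close> stay outside \<open>P\<close> by Bezout, so only the
  power of \<open>l\<close> in \<open>s\<close> counts. The number \<open>v (of_nat l)\<close> is
  the ramification index of \<open>P\<close>.\<close>

lemma v_int:
 assumes l: "Factorial_Ring.prime (l::nat)" "of_nat l : P" and s: "s ~= 0"
 shows "v (of_int s) = int (multiplicity (int l) s) * v (of_nat l)" "v (of_nat l) > 0"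
  "~ int l dvd s ==> of_int s ~: P"
proof -
 have v0: "v x >= 0" if "x : Oi" "x ~= 0" for x using v_Oi that by simp
 have vpos: "v x > 0 \<longleftrightarrow> x : P" if "x : Oi" "x ~= 0" for x
  using v_Oi[of x] we_pos_iff[of x] that by auto
 have nP: "of_int s ~: P" if "~ int l dvd s" for s
 proof
  assume sP: "of_int s : P"
  have "coprime (int l) s" using that l by (simp add: prime_imp_coprime)
  then obtain a b where "a * int l + b * s = 1" using bezout_int[of "int l" s] by auto
  hence "(of_int a * of_nat l + of_int b * of_int s :: complex) = 1"
   by (metis of_int_1 of_int_add of_int_mult of_int_of_nat_eq)
  moreover have "of_int a * of_nat l + of_int b * of_int s : P"
   using fidD(3,4)[OF fidP] Oi_of_int l(2) sP by blast
  ultimately show False using P1 by simp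
 qed
 thus "~ int l dvd s ==> of_int s ~: P" .
 have l0: "(of_nat l :: complex) ~= 0" "of_nat l : Oi" using l(1) Oi_of_nat by (auto simp: prime_gt_0_nat)
 show "v (of_nat l) > 0" using vpos[OF l0(2,1)] l(2) by simp
 have "~ is_unit (int l)" using l(1) by (auto simp: prime_nat_iff)
 then obtain y where y: "s = int l ^ multiplicity (int l) s * y" "~ int l dvd y"
  using multiplicity_decompose'[OF s] by blast
 have y0: "y ~= 0" using y(2) by auto
 have "v (of_int y) = 0"
 proof -
  have "~ v (of_int y) > 0" using vpos[OF Oi_of_int, of y] nP[OF y(2)] y0 by simp
  thus ?thesis using v0[OF Oi_of_int, of y] y0 by simp
 qed
 moreover have "(of_int s :: complex) = of_nat l ^ multiplicity (int l) s * of_int y"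
  by (subst y(1)) simp
 ultimately show "v (of_int s) = int (multiplicity (int l) s) * v (of_nat l)"
  using v_mult[of "of_nat l ^ multiplicity (int l) s" "of_int y"] v_power[OF Oi_L[OF l0(2)] l0(1)]
   y0 l0 Lpow[OF Oi_L[OF l0(2)]] Lof_int by simp
qed

end

section \<open>Cyclotomic fields\<close>


lemma sum_unit_powers:
 fixes x :: complex assumes "x ^ M = 1"
 shows "(\<Sum>k<M. x ^ k) = (if x = 1 then of_nat M else 0)"
 using assms by (auto simp: sum_gp_strict)

text \<open>The subring \<open>S\<close> is carried along because \<open>kum_p\<close> divides
  complex polynomials whose coefficients lie in a subfield and needs the remainder to stay
  there.\<close>

lemma monic_division_closed:
 fixes f h :: "'a::comm_ring_1 poly"
 assumes f: "lead_coeff f = 1" "pdeg f > 0"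
  and S: "0 : S" "!!x y. x : S ==> y : S ==> x - y : S" "!!x y. x : S ==> y : S ==> x * y : S"
  and fS: "!!i. poly.coeff f i : S" and hS: "!!i. poly.coeff h i : S"
 shows "EX u r. h = f * u + r & pdeg r < pdeg f & (ALL i. poly.coeff r i : S)"
 using hS
proof (induction h)
 case 0
 show ?case using f S(1) by (intro exI[of _ 0]) auto
next
 case (pCons a h)
 have "poly.coeff h i : S" for i using pCons.prems[of "Suc i"] by simp
 then obtain u r where ur: "h = f * u + r" "pdeg r < pdeg f" "ALL i. poly.coeff r i : S"
  using pCons.IH by blast
 define s where "s = pCons a r"
 define c where "c = poly.coeff s (pdeg f)"
 have sS: "poly.coeff s i : S" for i
  using ur(3) pCons.prems[of 0] by (cases i) (auto simp: s_def)
 have "pCons a h = f * pCons 0 u + s" using ur(1) by (simp add: s_def)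
 hence eq: "pCons a h = f * (pCons 0 u + [:c:]) + (s - Polynomial.smult c f)"
  by (simp add: algebra_simps)
 have "pdeg (s - Polynomial.smult c f) < pdeg f"
 proof (rule degree_lessI)
  show "s - Polynomial.smult c f ~= 0 \<or> 0 < pdeg f" using f by simp
  show "ALL k>=pdeg f. poly.coeff (s - Polynomial.smult c f) k = 0"
  proof (intro allI impI)
   fix k assume k: "k >= pdeg f"
   show "poly.coeff (s - Polynomial.smult c f) k = 0"
   proof (cases "k = pdeg f")
    case True thus ?thesis using f by (simp add: c_def)
   next
    case False
    hence "k > pdeg f" using k by simp
    moreover obtain j where "k = Suc j" using calculation by (cases k) auto
    ultimately show ?thesis using ur(2) by (simp add: s_def coeff_eq_0)
   qed
  qed
 qed
 moreover have "ALL i. poly.coeff (s - Polynomial.smult c f) i : S"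
  using sS fS S by (simp add: c_def)
 ultimately show ?case using eq by blast
qed

lemma monic_division:
 fixes f h :: "'a::comm_ring_1 poly"
 assumes f: "lead_coeff f = 1" "pdeg f > 0"
 obtains u r where "h = f * u + r" "pdeg r < pdeg f"
 using monic_division_closed[OF f, of UNIV h] by auto

text \<open>Evaluation of polynomials through a coefficient map. It is interpreted twice:
  \<open>I\<close> evaluates integer polynomials, and \<open>E\<close> evaluates polynomials in two
  variables, with \<open>I\<close> as its coefficient map.\<close>

locale evhom =
 fixes \<phi> :: "'a::comm_ring_1 => complex"
 assumes h0: "\<phi> 0 = 0" and h1: "\<phi> 1 = 1"
  and hadd: "\<phi> (a + b) = \<phi> a + \<phi> b" and hmult: "\<phi> (a * b) = \<phi> a * \<phi> b"
begin

definition ev :: "complex => 'a poly => complex" where "ev x f = poly (map_poly \<phi> f) x"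

lemma ev_0: "ev x 0 = 0" by (simp add: ev_def)
lemma ev_pCons: "ev x (pCons a f) = \<phi> a + x * ev x f" by (simp add: ev_def Polynomial.map_poly_pCons[of \<phi>, OF h0])
lemma ev_1: "ev x 1 = 1" by (simp add: ev_pCons ev_0 h1 one_pCons)

lemma ev_add: "ev x (f + g) = ev x f + ev x g"
 by (induction f g rule: poly_induct2) (auto simp: ev_pCons ev_0 hadd algebra_simps)

lemma ev_smult: "ev x (Polynomial.smult a f) = \<phi> a * ev x f"
 by (induction f) (auto simp: ev_pCons ev_0 hmult algebra_simps)

lemma ev_mult: "ev x (f * g) = ev x f * ev x g"
 by (induction f) (auto simp: ev_pCons ev_0 ev_add ev_smult h0 algebra_simps)

lemma ev_evhom: "evhom (ev x)"
 by unfold_locales (auto simp: ev_0 ev_1 ev_add ev_mult)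

lemma ev_monom: "ev x (Polynomial.monom a i) = \<phi> a * x ^ i"
 by (simp add: ev_def map_poly_monom h0 poly_monom)

lemma ev_sum: "ev x (sum f A) = (\<Sum>i\<in>A. ev x (f i))"
 by (induction A rule: infinite_finite_induct) (auto simp: ev_0 ev_add)

lemma ev_altdef: "ev x f = (\<Sum>i\<le>pdeg f. \<phi> (poly.coeff f i) * x ^ i)"
proof -
 have "ev x f = ev x (\<Sum>i\<le>pdeg f. Polynomial.monom (poly.coeff f i) i)"
  by (simp only: poly_as_sum_of_monoms)
 thus ?thesis by (simp add: ev_sum ev_monom)
qed

end

interpretation I: evhom "of_int :: int => complex"
 by unfold_locales auto


lemma poly_eq_prod_roots:
 fixes f :: "complex poly"
 assumes S: "finite S" and f: "lead_coeff f = 1" "pdeg f = card S"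
  and r: "!!x. x : S ==> poly f x = 0"
 shows "f = (\<Prod>x\<in>S. [:- x, 1:])"
proof (rule ccontr)
 define g where "g = (\<Prod>x\<in>S. [:- x, 1:])"
 assume "f ~= (\<Prod>x\<in>S. [:- x, 1:])"
 hence nz: "f - g ~= 0" by (simp add: g_def)
 have g: "lead_coeff g = 1" unfolding g_def lead_coeff_prod by simp
 have gd: "pdeg g = card S" unfolding g_def by (subst degree_prod_eq_sum_degree) auto
 have "S ~= {}"
 proof
  assume "S = {}"
  hence "pdeg f = 0" "g = 1" using f by (auto simp: g_def)
  thus False using f(1) nz by (metis degree_0_id diff_self one_poly_eq_simps(1) pCons_one)
 qed
 hence c0: "card S > 0" using S by (simp add: card_gt_0_iff)
 have "pdeg (f - g) < card S"
  by (rule degree_lessI) (use c0 f g gd in \<open>auto simp: le_less coeff_eq_0\<close>)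
 moreover have "card S <= card {x. poly (f - g) x = 0}"
  using r S by (intro card_mono poly_roots_finite nz) (auto simp: g_def poly_prod)
 moreover have "card {x. poly (f - g) x = 0} <= pdeg (f - g)"
  by (rule card_poly_roots_bound[OF nz])
 ultimately show False by simp
qed

text \<open>\<open>eta\<close> is a primitive root of unity of the prime power order
  \<open>q\<close>: its order divides \<open>q\<close> but not \<open>r = q / p\<close>. The case n
  = 1 gives K, and n = 2 gives the field of p^2-th roots of unity.\<close>

locale cyc =
 fixes p n q r :: nat and eta :: complex
 assumes p: "Factorial_Ring.prime p" and n: "n > 0" and q_def: "q = p ^ n" and r_pow: "r = p ^ (n - 1)"
  and etaq: "eta ^ q = 1" and etar: "eta ^ r ~= 1"
begin

definition \<zeta> where "\<zeta> = eta ^ r"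
definition A where "A = {a. a < q & ~ p dvd a}"
text \<open>The prime element over \<open>p\<close>: its power with exponent \<open>card A\<close>
  is \<open>p\<close> up to a unit (\<open>p_dvd_lm\<close>, \<open>lm_dvd_p\<close>).\<close>

definition lm where "lm = 1 - eta"
text \<open>The q-th cyclotomic polynomial, in the form (X^q - 1) / (X^r - 1).\<close>

definition \<Phi> :: "int poly" where "\<Phi> = (\<Sum>k<p. Polynomial.monom 1 (r * k))"

lemma p_gt: "p > 1" using prime_gt_1_nat[OF p] .
lemma qrp: "q = r * p" unfolding q_def r_pow using n by (cases n) auto
lemma r_pos: "r > 0" unfolding r_pow using p_gt by simp
lemma q_pos: "q > 1" unfolding q_def using p_gt n by (rule one_less_power)
lemma r_less_q: "r * j < q \<longleftrightarrow> j < p" unfolding qrp using r_pos by simp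
lemma r_dvd_q: "p dvd q" unfolding qrp by simp

lemma eta_pow_1_iff: "eta ^ k = 1 \<longleftrightarrow> q dvd k"
proof
 assume "q dvd k" thus "eta ^ k = 1" using etaq by (auto simp: power_mult)
next
 assume k: "eta ^ k = 1"
 show "q dvd k"
 proof (cases "k = 0")
  case False
  obtain x y where xy: "k * x = q * y + gcd k q" using bezout_nat[OF False, of q] by blast
  have "eta ^ (k * x) = 1" by (simp add: power_mult k)
  hence g1: "eta ^ gcd k q = 1" unfolding xy by (simp add: power_add power_mult etaq)
  have "gcd k q dvd p ^ n" by (simp add: q_def[symmetric])
  then obtain j where j: "j <= n" "gcd k q = p ^ j" using p divides_primepow_nat by blast
  have "j = n"
  proof (rule ccontr)
   assume "j ~= n"
   hence "p ^ j dvd r" using j(1) by (simp add: r_pow le_imp_power_dvd)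
   hence "eta ^ r = 1" using g1 j(2) by (auto simp: power_mult)
   thus False using etar by simp
  qed
  thus ?thesis using j q_def by (metis gcd_dvd1)
 qed simp
qed

lemma eta_ne0: "eta ~= 0" 
proof
 assume "eta = 0"
 thus False using etaq q_pos by (cases q) auto
qed

lemma norm_eta: "norm eta = 1"
proof -
 have "norm eta ^ q = 1 ^ q" using etaq by (metis norm_power norm_one power_one)
 thus ?thesis by (rule power_eq_imp_eq_base) (use q_pos in auto)
qed

lemma \<zeta>_pow_1_iff: "\<zeta> ^ k = 1 \<longleftrightarrow> p dvd k"
proof -
 have "\<zeta> ^ k = eta ^ (r * k)" by (simp add: \<zeta>_def power_mult)
 hence "\<zeta> ^ k = 1 \<longleftrightarrow> r * p dvd r * k" by (simp only: eta_pow_1_iff qrp[symmetric])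
 thus ?thesis using r_pos by simp
qed

lemma \<zeta>p: "\<zeta> ^ p = 1" using \<zeta>_pow_1_iff by simp

lemma coprime_A: assumes a: "a : A" shows "coprime a q"
proof -
 have "coprime p a" using a p by (simp add: A_def prime_imp_coprime)
 thus ?thesis unfolding q_def by (simp add: coprime_commute)
qed

lemma A_fin: "finite A" by (simp add: A_def)

lemma card_A: "card A = r * (p - 1)"
proof -
 have lt: "p * j < q \<longleftrightarrow> j < r" for j unfolding qrp using p_gt by (simp add: mult.commute)
 have "{..<q} = A \<union> (%j. p * j) ` {..<r}" unfolding A_def using lt by (auto elim!: dvdE)
 moreover have "A \<inter> (%j. p * j) ` {..<r} = {}" by (auto simp: A_def)
 ultimately have "card {..<q} = card A + card ((%j. p * j) ` {..<r})" by (simp add: card_Un_disjoint A_fin)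
 moreover have "card ((%j. p * j) ` {..<r}) = r" using p_gt by (subst card_image) (auto simp: inj_on_def)
 ultimately have "r * p = card A + r" by (simp add: qrp[symmetric])
 thus ?thesis by (simp add: diff_mult_distrib2)
qed

lemma \<Phi>_ev: "I.ev x \<Phi> = (\<Sum>k<p. (x ^ r) ^ k)"
 by (simp add: \<Phi>_def I.ev_sum I.ev_monom power_mult)

lemma \<Phi>_root: "a : A ==> I.ev (eta ^ a) \<Phi> = 0"
proof -
 assume a: "a : A"
 have "(eta ^ a) ^ r = \<zeta> ^ a" by (simp add: \<zeta>_def mult.commute flip: power_mult)
 moreover have "\<zeta> ^ a ~= 1" using a \<zeta>_pow_1_iff by (simp add: A_def)
 moreover have "(\<zeta> ^ a) ^ p = 1" by (metis \<zeta>p mult.commute power_mult power_one)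
 ultimately show ?thesis unfolding \<Phi>_ev using sum_unit_powers[of "\<zeta> ^ a" p] by simp
qed

lemma coeff_\<Phi>: "poly.coeff \<Phi> i = (if r dvd i & i < q then 1 else 0)"
proof -
 have "poly.coeff \<Phi> i = (\<Sum>k<p. if r * k = i then 1 else 0)" by (simp add: \<Phi>_def coeff_sum coeff_monom)
 also have "... = (if r dvd i & i < q then 1 else 0)"
 proof (cases "r dvd i & i < q")
  case True
  then obtain j where j: "i = r * j" by auto
  hence "j < p" using True r_less_q by simp
  thus ?thesis using True j r_pos by simp
 next
  case False
  have ne: "r * k ~= i" if k: "k < p" for k
  using r_less_q[of k] k False by auto
  have "(\<Sum>k<p. if r * k = i then 1 else 0) = (0::int)" by (rule sum.neutral) (use ne in auto)
  thus ?thesis by (simp only: False if_False)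
 qed
 finally show ?thesis .
qed

lemma degree_\<Phi>: "pdeg \<Phi> = r * (p - 1)" and lead_\<Phi>: "lead_coeff \<Phi> = 1"
proof -
 have lt: "r * (p - 1) < q" unfolding r_less_q using p_gt by simp
 show d: "pdeg \<Phi> = r * (p - 1)"
 proof (rule le_antisym)
  show "r * (p - 1) <= pdeg \<Phi>" by (rule le_degree) (use lt in \<open>simp add: coeff_\<Phi>\<close>)
  show "pdeg \<Phi> <= r * (p - 1)"
  proof (rule degree_le, intro allI impI)
   fix i assume i: "r * (p - 1) < i"
   have "~ (r dvd i & i < q)"
   using r_less_q i by fastforce
   thus "poly.coeff \<Phi> i = 0" by (simp add: coeff_\<Phi>)
  qed
 qed
 show "lead_coeff \<Phi> = 1" unfolding d using lt by (simp add: coeff_\<Phi>)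
qed

lemma eta_inj: "inj_on (%k. eta ^ k) {..<q}"
proof (rule inj_onI)
 have *: "i = j" if "i <= j" "j < q" "eta ^ i = eta ^ j" for i j
 proof -
  have "eta ^ j = eta ^ i * eta ^ (j - i)" using that(1) by (simp only: power_add[symmetric] le_add_diff_inverse)
  hence "eta ^ (j - i) = 1" using that eta_ne0 by simp
  hence "q dvd j - i" using eta_pow_1_iff by simp
  hence "j - i = 0" using that(2) dvd_imp_le[of q "j - i"] by (cases "j - i = 0") auto
  thus ?thesis using that(1) by simp
 qed
 fix i j assume "i : {..<q}" "j : {..<q}" "eta ^ i = eta ^ j"
 thus "i = j" using *[of i j] *[of j i] by (cases "i <= j") auto
qed

lemma \<Phi>_prod: "I.ev x \<Phi> = (\<Prod>a\<in>A. (x - eta ^ a))"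
proof -
 define f :: "complex poly" where "f = map_poly of_int \<Phi>"
 have d: "pdeg f = r * (p - 1)" by (simp add: f_def degree_map_poly degree_\<Phi>)
 have inj: "inj_on (%k. eta ^ k) A" by (rule inj_on_subset[OF eta_inj]) (auto simp: A_def)
 have "f = (\<Prod>x\<in>(%k. eta ^ k) ` A. [:- x, 1:])"
 proof (rule poly_eq_prod_roots)
  show "lead_coeff f = 1" using lead_\<Phi> by (simp add: d degree_\<Phi>) (simp add: f_def coeff_map_poly)
  show "pdeg f = card ((%k. eta ^ k) ` A)" by (simp add: d card_image[OF inj] card_A)
  fix x assume "x : (%k. eta ^ k) ` A"
  thus "poly f x = 0" using \<Phi>_root by (auto simp: f_def I.ev_def)
 qed (simp add: A_fin)
 hence "poly f x = (\<Prod>a\<in>A. (x - eta ^ a))"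
  using inj by (simp add: poly_prod prod.reindex)
 thus ?thesis by (simp add: I.ev_def f_def)
qed

lemma prod_p: "(\<Prod>a\<in>A. (1 - eta ^ a)) = of_nat p"
 using \<Phi>_prod[of 1] \<Phi>_ev[of 1] by simp

lemma eta_alg: "algebraic_int eta"
proof (rule algebraic_int_root[of 1 "Polynomial.monom 1 q"])
 show "pdeg (Polynomial.monom 1 q :: complex poly) > 0" using q_pos by (simp add: degree_monom_eq)
qed (auto simp: poly_monom etaq degree_monom_eq coeff_monom)

lemma one_minus_dvd: "1 - eta ^ a = lm * (\<Sum>k<a. eta ^ k)"
 by (simp add: lm_def one_diff_power_eq)

lemma lm_ne0: "lm ~= 0"
using etar by (auto simp: lm_def)

lemma p_dvd_lm: "EX u. algebraic_int u & of_nat p = lm ^ card A * u"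
proof (intro exI conjI)
 show "of_nat p = lm ^ card A * (\<Prod>a\<in>A. (\<Sum>k<a. eta ^ k))"
  unfolding prod_p[symmetric] by (simp add: one_minus_dvd prod.distrib)
 show "algebraic_int (\<Prod>a\<in>A. (\<Sum>k<a. eta ^ k))"
  by (intro algebraic_int_prod_complex algebraic_int_sum_complex algebraic_int_power_complex eta_alg)
qed

lemma A_inverse: assumes a: "a : A" obtains b where "b : A" "a * b mod q = 1"
proof -
 have "coprime a q" using coprime_A[OF a] .
 then obtain b where b: "[a * b = 1] (mod q)" using cong_solve_coprime_nat by (metis One_nat_def)
 hence b1: "a * (b mod q) mod q = 1" using q_pos by (simp add: cong_def mod_mult_right_eq)
 have "~ p dvd b mod q"
 using r_dvd_q b1 p_gt by (fastforce simp: dvd_mod_iff)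
 hence "b mod q : A" using q_pos by (simp add: A_def)
 thus ?thesis using that b1 by blast
qed

lemma eta_mod: "eta ^ k = eta ^ (k mod q)"
proof -
 have "eta ^ k = eta ^ (q * (k div q) + k mod q)" by simp
 thus ?thesis by (simp only: power_add power_mult etaq power_one mult_1)
qed

lemma lm_dvd_conj: assumes a: "a : A" obtains u where "algebraic_int u" "lm = (1 - eta ^ a) * u"
proof -
 obtain b where b: "b : A" "a * b mod q = 1" using A_inverse[OF a] .
 have "eta = (eta ^ a) ^ b" using b eta_mod[of "a * b"] by (simp add: power_mult)
 hence "lm = (1 - eta ^ a) * (\<Sum>k<b. (eta ^ a) ^ k)"
  unfolding lm_def using one_diff_power_eq[of "eta ^ a" b] by simp
 moreover have "algebraic_int (\<Sum>k<b. (eta ^ a) ^ k)"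
  by (intro algebraic_int_sum_complex algebraic_int_power_complex eta_alg)
 ultimately show ?thesis using that by blast
qed

lemma lm_dvd_p: "EX u. algebraic_int u & lm ^ card A = of_nat p * u"
proof -
 have "ALL a:A. EX u. algebraic_int u & lm = (1 - eta ^ a) * u" using lm_dvd_conj by metis
 from bchoice[OF this] obtain u where u: "ALL a:A. algebraic_int (u a) & lm = (1 - eta ^ a) * u a" ..
 have "(\<Prod>a\<in>A. (1 - eta ^ a) * u a) = (\<Prod>a\<in>A. lm)" by (rule prod.cong) (use u in auto)
 hence "lm ^ card A = (\<Prod>a\<in>A. (1 - eta ^ a) * u a)" by simp
 hence "lm ^ card A = of_nat p * (\<Prod>a\<in>A. u a)" by (simp add: prod.distrib prod_p)
 moreover have "algebraic_int (\<Prod>a\<in>A. u a)" by (intro algebraic_int_prod_complex) (use u in blast)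
 ultimately show ?thesis by blast
qed

text \<open>Since \<open>p\<close> divides \<open>lm ^ card A\<close>, it divides
  \<open>s ^ card A\<close> among the algebraic integers. The quotient is rational, hence an
  integer.\<close>

lemma int_dvd_lm:
 assumes s: "of_int s = lm * u" and u: "algebraic_int u"
 shows "int p dvd s"
proof -
 obtain w where w: "algebraic_int w" "lm ^ card A = of_nat p * w" using lm_dvd_p by blast
 have "of_int (s ^ card A) = of_nat p * (w * u ^ card A)" using s w by (simp add: power_mult_distrib)
 hence e: "of_int (s ^ card A) / of_nat p = w * u ^ card A" using p_gt by (simp add: field_simps)
 have "algebraic_int (of_int (s ^ card A) / of_nat p :: complex)"
  unfolding e by (intro algebraic_int_mult_complex algebraic_int_power_complex w u)
 moreover have "(of_int (s ^ card A) / of_nat p :: complex) : \<rat>" by simp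
 ultimately have "(of_int (s ^ card A) / of_nat p :: complex) : \<int>" by (rule rational_algebraic_int_is_int)
 then obtain k where "(of_int (s ^ card A) / of_nat p :: complex) = of_int k" by (auto elim: Ints_cases)
 hence "(of_int (s ^ card A) :: complex) = of_int (int p * k)" using p_gt by (simp add: field_simps)
 hence "s ^ card A = int p * k" by (simp only: of_int_eq_iff)
 hence "int p dvd s ^ card A" by simp
 moreover have "Factorial_Ring.prime (int p)" using p by simp
 ultimately show ?thesis using prime_dvd_power_iff[of "int p" "card A" s] by (metis Factorial_Ring.prime_dvd_power)
qed

lemma lm_alg: "algebraic_int lm"
 unfolding lm_def by (intro algebraic_int_diff_complex eta_alg) simp

text \<open>Compare from the lowest power upwards: once the earlier coefficients are divisible by
  \<open>p\<close>, every other term is divisible by \<open>lm ^ Suc j\<close>, so \<open>lm\<close>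
  divides \<open>s j\<close>. Both the irreducibility of \<open>\<Phi>\<close>
  (\<open>ev_small_zero\<close>) and the integral basis of powers of \<open>lm\<close>
  (\<open>integral_basis\<close>) come from here.\<close>

lemma lm_sum_dvd:
 assumes z: "(\<Sum>i<card A. of_int (s i) * lm ^ i) = of_nat p * x" and x: "algebraic_int x" and j: "j < card A"
 shows "int p dvd s j"
 using j
proof (induction j rule: less_induct)
 case (less j)
 obtain u where u: "algebraic_int u" "of_nat p = lm ^ card A * u" using p_dvd_lm by blast
 have pj: "of_nat p = lm ^ Suc j * (lm ^ (card A - Suc j) * u)"
  using less.prems u(2) by (simp add: mult.assoc[symmetric] flip: power_add power_Suc)
 have ulm: "algebraic_int (lm ^ (card A - Suc j) * u)"
  by (intro algebraic_int_mult_complex algebraic_int_power_complex lm_alg u(1))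
 have ex: "ALL i:{..<card A} - {j}. EX t. algebraic_int t & of_int (s i) * lm ^ i = lm ^ Suc j * t"
 proof
  fix i assume i: "i : {..<card A} - {j}"
  show "EX t. algebraic_int t & of_int (s i) * lm ^ i = lm ^ Suc j * t"
  proof (cases "i < j")
   case True
   then obtain c where c: "s i = int p * c" using less.IH[OF True] i by (auto elim: dvdE)
   have "of_int (s i) * lm ^ i = lm ^ Suc j * ((lm ^ (card A - Suc j) * u) * (of_int c * lm ^ i))"
    unfolding c using pj by simp
   moreover have "algebraic_int ((lm ^ (card A - Suc j) * u) * (of_int c * lm ^ i))"
    by (intro algebraic_int_mult_complex ulm algebraic_int_power_complex lm_alg) simp
   ultimately show ?thesis by blast
  next
   case False
   hence "i = Suc j + (i - Suc j)" using i by auto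
   hence "of_int (s i) * lm ^ i = lm ^ Suc j * (of_int (s i) * lm ^ (i - Suc j))" by (metis mult.left_commute power_add)
   moreover have "algebraic_int (of_int (s i) * lm ^ (i - Suc j))"
    by (intro algebraic_int_mult_complex algebraic_int_power_complex lm_alg) simp
   ultimately show ?thesis by blast
  qed
 qed
 obtain t where t: "ALL i:{..<card A} - {j}. algebraic_int (t i) & of_int (s i) * lm ^ i = lm ^ Suc j * t i"
  using bchoice[OF ex] ..
 have "of_nat p * x = of_int (s j) * lm ^ j + (\<Sum>i\<in>{..<card A} - {j}. of_int (s i) * lm ^ i)"
  unfolding z[symmetric] using less.prems by (simp add: sum.remove)
 also have "(\<Sum>i\<in>{..<card A} - {j}. of_int (s i) * lm ^ i) = (\<Sum>i\<in>{..<card A} - {j}. lm ^ Suc j * t i)"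
  by (rule sum.cong[OF refl]) (use t in blast)
 also have "... = lm ^ Suc j * (\<Sum>i\<in>{..<card A} - {j}. t i)" by (simp only: sum_distrib_left)
 finally have "of_int (s j) * lm ^ j = of_nat p * x - lm ^ Suc j * (\<Sum>i\<in>{..<card A} - {j}. t i)" by simp
 also have "... = lm ^ j * (lm * ((lm ^ (card A - Suc j) * u) * x - (\<Sum>i\<in>{..<card A} - {j}. t i)))"
  unfolding pj by (simp add: algebra_simps)
 finally have "of_int (s j) = lm * ((lm ^ (card A - Suc j) * u) * x - (\<Sum>i\<in>{..<card A} - {j}. t i))"
  using lm_ne0 by simp
 thus ?case
  by (rule int_dvd_lm)
   (use t x ulm in \<open>auto intro!: algebraic_int_diff_complex algebraic_int_mult_complex algebraic_int_sum_complex\<close>)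
qed

end

section \<open>Kummer extensions of cyclotomic fields\<close>


interpretation E: evhom "I.ev x" for x by (rule I.ev_evhom)

context cyc
begin

lemma ev_pcompose: "I.ev x (pcompose f g) = I.ev (I.ev x g) f"
 by (induction f) (auto simp: pcompose_pCons I.ev_0 I.ev_add I.ev_mult I.ev_pCons)

lemma ev_small_dvd:
 assumes d: "pdeg f < card A" and z: "I.ev eta f = 0"
 obtains g where "f = Polynomial.smult (int p) g" "pdeg g < card A" "I.ev eta g = 0"
proof -
 \<comment> \<open>The substitution X -> 1 - X is its own inverse. It exchanges polynomials in
   \<open>eta\<close> with polynomials in \<open>lm\<close> and preserves degrees.\<close>
 define c :: "int poly" where "c = [:1, -1:]"
 define s where "s = pcompose f c"
 have ds: "pdeg s = pdeg f" by (simp add: s_def c_def degree_pcompose)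
 have cc: "pcompose s c = f"
  by (simp add: s_def c_def pcompose_pCons flip: pcompose_assoc)
 have "I.ev lm s = I.ev eta f" by (simp add: s_def ev_pcompose c_def I.ev_pCons I.ev_0 lm_def)
 hence "(\<Sum>i\<le>pdeg s. of_int (poly.coeff s i) * lm ^ i) = 0"
  using z I.ev_altdef by metis
 moreover have "(\<Sum>i<card A. of_int (poly.coeff s i) * lm ^ i) = (\<Sum>i\<le>pdeg s. of_int (poly.coeff s i) * lm ^ i)"
  by (rule sum.mono_neutral_right) (use ds d in \<open>auto simp: coeff_eq_0\<close>)
 ultimately have z0: "(\<Sum>i<card A. of_int (poly.coeff s i) * lm ^ i) = 0" by simp
 have dv: "int p dvd poly.coeff s i" for i
 proof (cases "i < card A")
  case True
  show ?thesis using lm_sum_dvd[of _ 0] z0 True by simp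
 next
  case False
  hence "poly.coeff s i = 0" using ds d by (intro coeff_eq_0) simp
  thus ?thesis by simp
 qed
 define t where "t = map_poly (%x. x div int p) s"
 have st: "s = Polynomial.smult (int p) t"
  by (rule poly_eqI) (use dv in \<open>simp add: t_def coeff_map_poly\<close>)
 define g where "g = pcompose t c"
 have fg: "f = Polynomial.smult (int p) g" using cc by (simp add: g_def st pcompose_smult)
 have "pdeg g = pdeg f" unfolding fg using p_gt by simp
 moreover have "I.ev eta g = 0" using z p_gt unfolding fg I.ev_smult by simp
 ultimately show ?thesis using that fg d by simp
qed

text \<open>Descent: by \<open>ev_small_dvd\<close> such a polynomial is \<open>p\<close> times
  another one of the same kind, so its coefficients are divisible by all powers of \<open>p\<close>.
  This is the irreducibility of \<open>\<Phi>\<close>.\<close>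

lemma ev_small_zero:
 assumes "pdeg f < card A" "I.ev eta f = 0"
 shows "f = 0"
proof -
 have *: "int p ^ k dvd poly.coeff f i"
  if "pdeg f < card A" "I.ev eta f = 0" for k f i
  using that
 proof (induction k arbitrary: f)
  case (Suc k)
  obtain g where g: "f = Polynomial.smult (int p) g" "pdeg g < card A" "I.ev eta g = 0"
   using ev_small_dvd[OF Suc.prems] .
  have "int p ^ k dvd poly.coeff g i" using Suc.IH[OF g(2,3)] .
  thus ?case by (simp add: g(1) mult_dvd_mono)
 qed simp
 show ?thesis
 proof (rule poly_eqI)
  fix i
  show "poly.coeff f i = poly.coeff 0 i"
  proof (rule ccontr)
   assume "poly.coeff f i ~= poly.coeff 0 i"
   hence nz: "poly.coeff f i ~= 0" by simp
   define k where "k = nat \<bar>poly.coeff f i\<bar>"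
   have "int p ^ k <= \<bar>poly.coeff f i\<bar>" using *[OF assms, of k i] nz by (metis abs_dvd_iff dvd_abs_iff dvd_imp_le_int abs_of_nonneg zero_le_power of_nat_0_le_iff)
   moreover have "int k < int p ^ k" using power_gt_expt[OF p_gt[unfolded One_nat_def], of k] by (metis of_nat_less_iff of_nat_power)
   ultimately show False by (simp add: k_def)
  qed
 qed
qed

lemma \<Phi>_degree: "pdeg \<Phi> = card A" by (simp add: degree_\<Phi> card_A)

lemma card_A_pos: "card A > 0" using card_A r_pos p_gt by simp

lemma ev_zero_dvd:
 assumes z: "I.ev eta g = 0"
 obtains u where "g = \<Phi> * u"
proof -
 obtain u s where us: "g = \<Phi> * u + s" "pdeg s < pdeg \<Phi>"
  using monic_division[OF lead_\<Phi>, of g] \<Phi>_degree card_A_pos by auto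
 have one: "1 : A" using q_pos p_gt by (simp add: A_def)
 have "I.ev eta \<Phi> = 0" using \<Phi>_root[OF one] by simp
 hence "I.ev eta s = 0" using z us(1) by (simp add: I.ev_add I.ev_mult)
 hence "s = 0" using us(2) \<Phi>_degree by (intro ev_small_zero) auto
 thus ?thesis by (intro that[of u]) (simp add: us(1))
qed

lemma ev_zero_conj: "I.ev eta g = 0 ==> a : A ==> I.ev (eta ^ a) g = 0"
 by (erule ev_zero_dvd) (simp add: I.ev_mult \<Phi>_root)

lemma sum_A: assumes "(x::complex) ^ q = 1" shows "(\<Sum>a\<in>A. x ^ a) : \<int>"
proof -
 have "{..<q} = A \<union> (%j. p * j) ` {..<r}"
 proof -
  have lt: "p * j < q \<longleftrightarrow> j < r" for j unfolding qrp using p_gt by (simp add: mult.commute)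
  show ?thesis unfolding A_def using lt by (auto elim!: dvdE)
 qed
 moreover have "A \<inter> (%j. p * j) ` {..<r} = {}" by (auto simp: A_def)
 ultimately have "(\<Sum>a<q. x ^ a) = (\<Sum>a\<in>A. x ^ a) + (\<Sum>a\<in>(%j. p * j) ` {..<r}. x ^ a)"
  by (simp add: sum.union_disjoint A_fin)
 also have "(\<Sum>a\<in>(%j. p * j) ` {..<r}. x ^ a) = (\<Sum>j<r. (x ^ p) ^ j)"
  using p_gt by (subst sum.reindex) (auto simp: inj_on_def power_mult)
 finally have "(\<Sum>a\<in>A. x ^ a) = (\<Sum>a<q. x ^ a) - (\<Sum>j<r. (x ^ p) ^ j)" by simp
 moreover have "(x ^ p) ^ r = 1" using assms by (simp add: qrp mult.commute flip: power_mult)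
 ultimately show ?thesis using sum_unit_powers[OF assms] sum_unit_powers[of "x ^ p" r] by simp
qed

end

text \<open>Cancelling powers of the variable leaves a relation with nonzero constant term, so
  \<open>x\<close> times a polynomial in \<open>x\<close> is a nonzero integer. This makes
  \<open>Lf\<close> closed under inverses.\<close>

lemma algebraic_int_relation:
 fixes x :: complex
 assumes "I.ev x f = 0" "f ~= 0" "x ~= 0"
 shows "EX g c. c ~= 0 & x * I.ev x g = of_int c"
 using assms
proof (induction f)
 case (pCons a h)
 show ?case
 proof (cases "a = 0")
  case True
  thus ?thesis using pCons by (auto simp: I.ev_pCons)
 next
  case False
  hence "x * I.ev x h = of_int (- a)" using pCons.prems by (simp add: I.ev_pCons add_eq_0_iff)
  thus ?thesis using False by (metis neg_equal_0_iff_equal)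
 qed
qed simp

text \<open>For \<open>d = 1\<close> this is the cyclotomic field itself, with \<alpha> = N; for
  \<open>d = p\<close> a p-th root of \<open>N\<close> is adjoined. The assumption
  \<open>indep\<close> says that the powers of \<alpha> below \<open>d\<close> are independent over
  the cyclotomic field; it makes the automorphisms well defined and is established by
  \<open>kum_one\<close> and \<open>kum_p\<close>.\<close>

locale kum = cyc +
 fixes d N :: nat and \<alpha> :: complex
 assumes Nprime: "Factorial_Ring.prime N" and N1: "[N = 1] (mod q)"
  and d: "d = 1 \<or> d = p" and \<alpha>d: "\<alpha> ^ d = of_nat N"
  and indep: "(\<Sum>j<d. I.ev eta (c j) * \<alpha> ^ j) = 0 ==> j < d ==> I.ev eta (c j) = 0"
begin

abbreviation Z :: "complex => complex => int poly poly => complex" where "Z \<equiv> E.ev"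

lemma d_pos: "d > 0" using d p_gt by auto
lemma \<alpha>_ne0: "\<alpha> ~= 0"
proof
 assume "\<alpha> = 0"
 thus False using \<alpha>d d_pos Nprime by (cases d) auto
qed

lemma \<zeta>d: "b < d ==> (\<zeta> ^ b) ^ d = 1"
 using d \<zeta>p by (auto simp: power_mult[symmetric] mult.commute[of b]) (simp add: power_mult)

lemma Z_altdef:
 assumes "pdeg f < k"
 shows "Z x y f = (\<Sum>j<k. I.ev x (poly.coeff f j) * y ^ j)"
 unfolding E.ev_altdef by (rule sum.mono_neutral_left) (use assms in \<open>auto simp: coeff_eq_0 I.ev_0\<close>)

lemma Z_reduce: "EX c. ALL x y. y ^ d = of_nat N --> Z x y f = (\<Sum>j<d. I.ev x (c j) * y ^ j)"
proof -
 define g :: "int poly poly" where "g = Polynomial.monom 1 d - [:[:int N:]:]"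
 have cg: "poly.coeff g i = (if i = d then 1 else if i = 0 then - [:int N:] else 0)" for i
  using d_pos by (auto simp: g_def coeff_pCons split: nat.split)
 have dg: "pdeg g = d"
  by (intro le_antisym degree_le le_degree) (auto simp: cg)
 have lg: "lead_coeff g = 1" by (simp add: dg cg)
 have Zg: "Z x y g = y ^ d - of_nat N" for x y
 proof -
  have "Z x y g + Z x y [:[:int N:]:] = Z x y (Polynomial.monom 1 d)" unfolding E.ev_add[symmetric] g_def by simp
  thus ?thesis by (simp add: E.ev_monom E.ev_pCons E.ev_0 I.ev_pCons I.ev_0 I.ev_1 algebra_simps)
 qed
 obtain u s where us: "f = g * u + s" "pdeg s < pdeg g"
  using monic_division[OF lg, of f] dg d_pos by auto
 have "Z x y f = (\<Sum>j<d. I.ev x (poly.coeff s j) * y ^ j)" if "y ^ d = of_nat N" for x y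
  using us(2) Z_altdef[of s d] that by (simp add: us(1) E.ev_add E.ev_mult Zg dg)
 thus ?thesis by (intro exI[of _ "poly.coeff s"]) simp
qed

text \<open>Reduction modulo Y^d - N turns a relation between \<open>eta\<close> and \<alpha> into
  relations for \<open>eta\<close> alone, by \<open>indep\<close>. Those are multiples of
  \<open>\<Phi>\<close> and hold for all conjugates of \<open>eta\<close>.\<close>

lemma kern:
 assumes z: "Z eta \<alpha> f = 0" and a: "a : A" and b: "b < d"
 shows "Z (eta ^ a) (\<zeta> ^ b * \<alpha>) f = 0"
proof -
 obtain c where c: "ALL x y. y ^ d = of_nat N --> Z x y f = (\<Sum>j<d. I.ev x (c j) * y ^ j)" using Z_reduce ..
 have "(\<Sum>j<d. I.ev eta (c j) * \<alpha> ^ j) = 0" using c[rule_format, OF \<alpha>d, of eta] z by simp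
 hence "I.ev eta (c j) = 0" if "j < d" for j using indep[of c] that by blast
 hence "I.ev (eta ^ a) (c j) = 0" if "j < d" for j using ev_zero_conj a that by blast
 moreover have "(\<zeta> ^ b * \<alpha>) ^ d = of_nat N" using \<zeta>d[OF b] \<alpha>d by (simp add: power_mult_distrib)
 ultimately show ?thesis using c by simp
qed

definition Lf :: "complex set" where "Lf = {Z eta \<alpha> f / of_nat m | f m. m > 0}"

text \<open>The automorphism with \<open>eta\<close> -> \<open>eta ^ a\<close> and \<alpha> ->
  \<open>\<zeta> ^ b * \<alpha>\<close>. An element has many polynomial representations; by
  \<open>au_eq\<close> they all give the same image. The value 0 outside \<open>Lf\<close> is the
  convention of \<open>numfield\<close>.\<close>

definition au :: "nat => nat => complex => complex" where
 "au a b x = (if x : Lf then (SOME y. EX f m. m > 0 & x = Z eta \<alpha> f / of_nat m & y = Z (eta ^ a) (\<zeta> ^ b * \<alpha>) f / of_nat m) else 0)"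

lemma LfI: "m > 0 ==> Z eta \<alpha> f / of_nat m : Lf" by (auto simp: Lf_def)

lemma LfE: assumes "x : Lf" obtains f m where "m > 0" "x = Z eta \<alpha> f / of_nat m"
 using assms by (auto simp: Lf_def)

lemma Z_int: "Z x y [:[:c:]:] = of_int c" by (simp add: E.ev_pCons E.ev_0 I.ev_pCons I.ev_0)
lemma Z_X: "Z x y [:[:0,1:]:] = x" by (simp add: E.ev_pCons E.ev_0 I.ev_pCons I.ev_0)
lemma Z_Y: "Z x y [:0,1:] = y" by (simp add: E.ev_pCons E.ev_0 I.ev_1 I.ev_0)
lemma Z_minus: "Z x y (- f) = - Z x y f" using E.ev_add[of x y f "- f"] by (simp add: E.ev_0 add_eq_0_iff)

lemma au_eq:
 assumes a: "a : A" and b: "b < d" and m: "m > 0"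
 shows "au a b (Z eta \<alpha> f / of_nat m) = Z (eta ^ a) (\<zeta> ^ b * \<alpha>) f / of_nat m"
proof -
 define x where "x = Z eta \<alpha> f / of_nat m"
 have xL: "x : Lf" unfolding x_def using m by (rule LfI)
 have "(SOME y. EX f m. m > 0 & x = Z eta \<alpha> f / of_nat m & y = Z (eta ^ a) (\<zeta> ^ b * \<alpha>) f / of_nat m)
   = Z (eta ^ a) (\<zeta> ^ b * \<alpha>) f / of_nat m"
 proof (rule some_equality)
  show "EX f' m'. m' > 0 & x = Z eta \<alpha> f' / of_nat m' & Z (eta ^ a) (\<zeta> ^ b * \<alpha>) f / of_nat m = Z (eta ^ a) (\<zeta> ^ b * \<alpha>) f' / of_nat m'"
   using m x_def by blast
  fix y assume "EX f m. m > 0 & x = Z eta \<alpha> f / of_nat m & y = Z (eta ^ a) (\<zeta> ^ b * \<alpha>) f / of_nat m"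
  then obtain f' m' where f': "m' > 0" "x = Z eta \<alpha> f' / of_nat m'" "y = Z (eta ^ a) (\<zeta> ^ b * \<alpha>) f' / of_nat m'" by blast
  define h where "h = [:[:int m:]:] * f' + - ([:[:int m':]:] * f)"
  have Zh: "Z s t h = of_nat m * Z s t f' - of_nat m' * Z s t f" for s t
   unfolding h_def E.ev_add Z_minus E.ev_mult Z_int by simp
  have "Z eta \<alpha> f / of_nat m = Z eta \<alpha> f' / of_nat m'" using f'(2) x_def by simp
  hence "Z eta \<alpha> h = 0" unfolding Zh using m f'(1) by (simp add: field_simps)
  hence "Z (eta ^ a) (\<zeta> ^ b * \<alpha>) h = 0" by (rule kern[OF _ a b])
  thus "y = Z (eta ^ a) (\<zeta> ^ b * \<alpha>) f / of_nat m" unfolding Zh f'(3) using m f'(1) by (simp add: field_simps)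
 qed
 thus ?thesis using xL unfolding au_def by (simp add: x_def)
qed

lemma Lf_add: assumes x: "x : Lf" and y: "y : Lf"
 shows "x + y : Lf" "a : A ==> b < d ==> au a b (x + y) = au a b x + au a b y"
  "x * y : Lf" "a : A ==> b < d ==> au a b (x * y) = au a b x * au a b y"
proof -
 obtain f m where f: "m > 0" "x = Z eta \<alpha> f / of_nat m" using LfE[OF x] .
 obtain g k where g: "k > 0" "y = Z eta \<alpha> g / of_nat k" using LfE[OF y] .
 define h where "h = [:[:int k:]:] * f + [:[:int m:]:] * g"
 have Zh: "Z s t h / of_nat (m * k) = Z s t f / of_nat m + Z s t g / of_nat k" for s t
  unfolding h_def E.ev_add E.ev_mult Z_int using f(1) g(1)
  by (subst add_frac_eq) (simp_all add: mult.commute)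
 have Zm: "Z s t (f * g) / of_nat (m * k) = Z s t f / of_nat m * (Z s t g / of_nat k)" for s t
  unfolding E.ev_mult by simp
 have mk: "m * k > 0" using f g by simp
 show "x + y : Lf" using LfI[OF mk, of h] unfolding Zh f g .
 show "x * y : Lf" using LfI[OF mk, of "f * g"] unfolding Zm f g .
 assume ab: "a : A" "b < d"
 show "au a b (x + y) = au a b x + au a b y"
  using au_eq[OF ab mk, of h] unfolding Zh f g au_eq[OF ab f(1)] au_eq[OF ab g(1)] .
 show "au a b (x * y) = au a b x * au a b y"
  using au_eq[OF ab mk, of "f * g"] unfolding Zm f g au_eq[OF ab f(1)] au_eq[OF ab g(1)] .
qed

lemma Z_Lf: "Z eta \<alpha> f : Lf" using LfI[of 1 f] by simp
lemma au_Z: "a : A ==> b < d ==> au a b (Z eta \<alpha> f) = Z (eta ^ a) (\<zeta> ^ b * \<alpha>) f" using au_eq[of a b 1 f] by simp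

lemma Lf_int: "of_int c : Lf" "a : A ==> b < d ==> au a b (of_int c) = of_int c"
 using Z_Lf[of "[:[:c:]:]"] au_Z[of a b "[:[:c:]:]"] by (simp_all add: Z_int)
lemma Lf_eta: "eta : Lf" "a : A ==> b < d ==> au a b eta = eta ^ a"
 using Z_Lf[of "[:[:0,1:]:]"] au_Z[of a b "[:[:0,1:]:]"] by (simp_all add: Z_X)
lemma Lf_\<alpha>: "\<alpha> : Lf" "a : A ==> b < d ==> au a b \<alpha> = \<zeta> ^ b * \<alpha>"
 using Z_Lf[of "[:0,1:]"] au_Z[of a b "[:0,1:]"] by (simp_all add: Z_Y)

lemma Lf_pow: assumes x: "x : Lf" shows "x ^ k : Lf"
proof (induction k)
 case 0
 show ?case using Lf_int(1)[of 1] by simp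
next
 case (Suc k)
 show ?case using Lf_add(3)[OF x Suc] by simp
qed

lemma au_pow: assumes x: "x : Lf" and ab: "a : A" "b < d" shows "au a b (x ^ k) = au a b x ^ k"
proof (induction k)
 case 0
 show ?case using Lf_int(2)[OF ab, of 1] by simp
next
 case (Suc k)
 show ?case using Lf_add(4)[OF x Lf_pow[OF x] ab, of k] Suc by simp
qed

lemma Lf_ev: assumes x: "x : Lf" shows "I.ev x g : Lf"
proof (induction g)
 case 0
 show ?case using Lf_int(1)[of 0] by (simp add: I.ev_0)
next
 case (pCons c g)
 show ?case using Lf_add(1)[OF Lf_int(1)[of c] Lf_add(3)[OF x pCons(2)]] by (simp add: I.ev_pCons)
qed

lemma au_ev: assumes x: "x : Lf" and ab: "a : A" "b < d" shows "au a b (I.ev x g) = I.ev (au a b x) g"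
proof (induction g)
 case 0
 show ?case using Lf_int(2)[OF ab, of 0] by (simp add: I.ev_0)
next
 case (pCons c g)
 have L: "I.ev x g : Lf" by (rule Lf_ev[OF x])
 show ?case unfolding I.ev_pCons Lf_add(2)[OF Lf_int(1)[of c] Lf_add(3)[OF x L] ab] Lf_add(4)[OF x L ab]
  pCons(2) Lf_int(2)[OF ab] ..
qed

lemma Lf_Z: assumes x: "x : Lf" and y: "y : Lf" shows "Z x y g : Lf"
proof (induction g)
 case 0
 show ?case using Lf_int(1)[of 0] by (simp add: E.ev_0)
next
 case (pCons c g)
 show ?case using Lf_add(1)[OF Lf_ev[OF x, of c] Lf_add(3)[OF y pCons(2)]] by (simp add: E.ev_pCons)
qed

lemma au_Z': assumes x: "x : Lf" and y: "y : Lf" and ab: "a : A" "b < d"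
 shows "au a b (Z x y g) = Z (au a b x) (au a b y) g"
proof (induction g)
 case 0
 show ?case using Lf_int(2)[OF ab, of 0] by (simp add: E.ev_0)
next
 case (pCons c g)
 have L: "Z x y g : Lf" by (rule Lf_Z[OF x y])
 show ?case unfolding E.ev_pCons Lf_add(2)[OF Lf_ev[OF x, of c] Lf_add(3)[OF y L] ab] Lf_add(4)[OF y L ab]
  pCons(2) au_ev[OF x ab] ..
qed

end


section \<open>Galois group, traces and dual frame of the Kummer extension\<close>

context kum
begin

definition Gk where "Gk = (%(a,b). au a b) ` (A \<times> {..<d})"
definition Bk where "Bk = {..<q} \<times> {..<d}"
definition bask where "bask = (%(i::nat,j::nat). eta ^ i * \<alpha> ^ j)"
text \<open>This is \<open>N\<close> times the inverse of \<open>bask\<close>, written with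
  nonnegative exponents to be visibly integral. The index \<open>i\<close> runs over all
  \<open>q\<close> residues, more than the degree, so that orthogonality becomes a matter of full
  geometric sums.\<close>

definition duak where "duak = (%(i::nat,j::nat). eta ^ (q - i) * \<alpha> ^ (d - j))"
definition Dk where "Dk = q * d * N"

lemma \<alpha>_alg: "algebraic_int \<alpha>"
proof (rule algebraic_int_root[of "of_nat N" "Polynomial.monom 1 d"])
 show "pdeg (Polynomial.monom 1 d :: complex poly) > 0" using d_pos by (simp add: degree_monom_eq)
qed (auto simp: poly_monom \<alpha>d degree_monom_eq coeff_monom)

lemma ev_alg: "algebraic_int x ==> algebraic_int (I.ev x g)"
 by (induction g) (auto simp: I.ev_0 I.ev_pCons intro!: algebraic_int_add_complex algebraic_int_mult_complex)

lemma Z_alg: "algebraic_int x ==> algebraic_int y ==> algebraic_int (Z x y f)"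
 by (induction f) (auto simp: E.ev_0 E.ev_pCons ev_alg intro!: algebraic_int_add_complex algebraic_int_mult_complex)

lemma Lf_minus: "x : Lf ==> - x : Lf" using Lf_add(3)[OF Lf_int(1)[of "-1"], of x] by simp

lemma Lf_div_nat: assumes y: "y : Lf" and k: "k > (0::nat)"
 shows "y / of_nat k : Lf" "a : A ==> b < d ==> au a b (y / of_nat k) = au a b y / of_nat k"
proof -
 obtain f m where f: "m > 0" "y = Z eta \<alpha> f / of_nat m" using LfE[OF y] .
 have e: "u / of_nat m / of_nat k = u / (of_nat (m * k) :: complex)" for u by simp
 have mk: "m * k > 0" using f k by simp
 show "y / of_nat k : Lf" unfolding f e using mk by (rule LfI)
 assume ab: "a : A" "b < d"
 show "au a b (y / of_nat k) = au a b y / of_nat k"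
  unfolding f e au_eq[OF ab f(1)] au_eq[OF ab mk] ..
qed

lemma Lf_div_int: assumes y: "y : Lf" and c: "c ~= (0::int)" shows "y / of_int c : Lf"
proof (cases "c > 0")
 case True
 thus ?thesis using Lf_div_nat(1)[OF y, of "nat c"] by simp
next
 case False
 hence "- y / of_nat (nat (- c)) : Lf" using c by (intro Lf_div_nat(1) Lf_minus y) auto
 thus ?thesis using False by simp
qed

lemma Lf_inverse: assumes x: "x : Lf" shows "inverse x : Lf"
proof (cases "x = 0")
 case False
 obtain f m where f: "m > 0" "x = Z eta \<alpha> f / of_nat m" using LfE[OF x] .
 define u where "u = Z eta \<alpha> f"
 have u0: "u ~= 0" using False f by (auto simp: u_def)
 have "algebraic_int u" unfolding u_def by (rule Z_alg[OF eta_alg \<alpha>_alg])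
 then obtain p where p: "poly (map_poly of_int p) u = 0" "lead_coeff p = 1"
  unfolding algebraic_int_altdef_ipoly by blast
 have "I.ev u p = 0" "p ~= 0" using p by (auto simp: I.ev_def)
 then obtain g c where gc: "c ~= 0" "u * I.ev u g = of_int c"
  using algebraic_int_relation[OF _ _ u0] by blast
 have uL: "u : Lf" unfolding u_def by (rule Z_Lf)
 have "of_int (int m) * I.ev u g / of_int c : Lf"
  by (intro Lf_div_int Lf_add(3) Lf_int(1) Lf_ev uL gc(1))
 moreover have "of_int (int m) * I.ev u g / of_int c = inverse x"
  unfolding gc(2)[symmetric] using u0 f(1) gc by (simp add: f(2) u_def field_simps)
 ultimately show ?thesis by simp
qed (use x in simp)

lemma Lf_\<zeta>: "\<zeta> : Lf" "a : A ==> b < d ==> au a b \<zeta> = \<zeta> ^ a"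
 unfolding \<zeta>_def using Lf_pow[OF Lf_eta(1)] au_pow[OF Lf_eta(1)] Lf_eta(2)
 by (auto simp: mult.commute simp flip: power_mult)

lemma \<zeta>_mod: "\<zeta> ^ k = \<zeta> ^ (k mod p)"
proof -
 have "\<zeta> ^ k = \<zeta> ^ (p * (k div p) + k mod p)" by simp
 thus ?thesis by (simp only: power_add power_mult \<zeta>p power_one mult_1)
qed

lemma A_mult: "a : A ==> a' : A ==> a * a' mod q : A"
 using p r_dvd_q q_pos by (auto simp: A_def dvd_mod_iff prime_dvd_mult_iff)

lemma one_A: "1 : A" using q_pos p_gt by (simp add: A_def)

lemma au_comp:
 assumes ab: "a : A" "b < d" and ab': "a' : A" "b' < d"
 shows "(%x. au a b (au a' b' x)) = au (a * a' mod q) ((b + a * b') mod d)"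
proof (rule ext)
 fix x
 have ab'': "a * a' mod q : A" "(b + a * b') mod d < d" using A_mult ab ab' d_pos by auto
 show "au a b (au a' b' x) = au (a * a' mod q) ((b + a * b') mod d) x"
 proof (cases "x : Lf")
  case False
  thus ?thesis using Lf_int(2)[OF ab, of 0] by (simp add: au_def[of a' b'] au_def[of "a * a' mod q"])
 next
  case True
  obtain f m where f: "m > 0" "x = Z eta \<alpha> f / of_nat m" using LfE[OF True] .
  have L1: "eta ^ a' : Lf" "\<zeta> ^ b' : Lf" by (intro Lf_pow Lf_eta(1) Lf_\<zeta>(1))+
  have L2: "\<zeta> ^ b' * \<alpha> : Lf" by (intro Lf_add(3) L1 Lf_\<alpha>(1))
  have e1: "au a b (eta ^ a') = eta ^ (a * a' mod q)"
   using eta_mod[of "a * a'"] by (simp add: au_pow[OF Lf_eta(1) ab] Lf_eta(2)[OF ab] power_mult)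
  have "\<zeta> ^ (b + a * b') = \<zeta> ^ ((b + a * b') mod d)"
   using d \<zeta>_mod[of "b + a * b'"] ab ab' by auto
  hence e: "\<zeta> ^ (b + a * b') = \<zeta> ^ ((b + a * b') mod d)" .
  have "au a b (\<zeta> ^ b' * \<alpha>) = (\<zeta> ^ a) ^ b' * (\<zeta> ^ b * \<alpha>)"
   by (simp only: Lf_add(4)[OF L1(2) Lf_\<alpha>(1) ab] au_pow[OF Lf_\<zeta>(1) ab] Lf_\<zeta>(2)[OF ab] Lf_\<alpha>(2)[OF ab])
  also have "... = \<zeta> ^ (b + a * b') * \<alpha>" by (simp add: power_add power_mult mult_ac)
  finally have e2: "au a b (\<zeta> ^ b' * \<alpha>) = \<zeta> ^ ((b + a * b') mod d) * \<alpha>" unfolding e .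
  show ?thesis
   unfolding f(2) au_eq[OF ab' f(1)] au_eq[OF ab'' f(1)] Lf_div_nat(2)[OF Lf_Z[OF L1(1) L2] f(1) ab]
    au_Z'[OF L1(1) L2 ab] e1 e2 ..
 qed
qed

lemma au_id: assumes "x : Lf" shows "au 1 0 x = x"
proof -
 obtain f m where f: "m > 0" "x = Z eta \<alpha> f / of_nat m" using LfE[OF assms] .
 show ?thesis unfolding f(2) au_eq[OF one_A d_pos f(1)] by simp
qed

lemma au_inj: "inj_on (%(a,b). au a b) (A \<times> {..<d})"
proof (rule inj_onI)
 fix u w assume uw: "u : A \<times> {..<d}" "w : A \<times> {..<d}" "(case u of (a,b) => au a b) = (case w of (a,b) => au a b)"
 obtain a b a' b' where ab: "u = (a,b)" "w = (a',b')" by (cases u, cases w)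
 have h: "a : A" "b < d" "a' : A" "b' < d" "au a b = au a' b'" using uw ab by auto
 have "au a b eta = au a' b' eta" "au a b \<alpha> = au a' b' \<alpha>" using h(5) by simp_all
 hence e: "eta ^ a = eta ^ a'" "\<zeta> ^ b * \<alpha> = \<zeta> ^ b' * \<alpha>"
  unfolding Lf_eta(2)[OF h(1,2)] Lf_eta(2)[OF h(3,4)] Lf_\<alpha>(2)[OF h(1,2)] Lf_\<alpha>(2)[OF h(3,4)] .
 have "a = a'" using inj_onD[OF eta_inj e(1)] h by (simp add: A_def)
 moreover have z: "\<zeta> ^ b = \<zeta> ^ b'" using e(2) \<alpha>_ne0 by simp
 have *: "i = j" if "i <= j" "j < d" "\<zeta> ^ i = \<zeta> ^ j" for i j
 proof -
  have "\<zeta> ^ j = \<zeta> ^ i * \<zeta> ^ (j - i)" using that(1) by (simp only: power_add[symmetric] le_add_diff_inverse)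
  moreover have "\<zeta> ~= 0" unfolding \<zeta>_def using eta_ne0 by simp
  ultimately have "\<zeta> ^ (j - i) = 1" using that by simp
  hence "p dvd j - i" using \<zeta>_pow_1_iff by simp
  hence "j - i = 0" using that(2) d p_gt dvd_imp_le[of p "j - i"] by (cases "j - i = 0") auto
  thus ?thesis using that(1) by simp
 qed
 have "b = b'" using *[of b b'] *[of b' b] z h by (cases "b <= b'") auto
 ultimately show "u = w" by (simp add: ab)
qed

lemma sum_Gk: "(\<Sum>g\<in>Gk. F g) = (\<Sum>a\<in>A. \<Sum>b<d. F (au a b))"
 unfolding Gk_def by (subst sum.reindex[OF au_inj]) (simp add: sum.cartesian_product case_prod_unfold)

lemma prod_Gk: "(\<Prod>g\<in>Gk. F g) = (\<Prod>a\<in>A. \<Prod>b<d. F (au a b))"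
 unfolding Gk_def by (subst prod.reindex[OF au_inj]) (simp add: prod.cartesian_product case_prod_unfold)

lemma sum_conj_\<alpha>: "(\<Sum>b<d. (\<zeta> ^ b * \<alpha>) ^ j) : \<int>"
proof -
 have e: "(\<zeta> ^ b) ^ j = (\<zeta> ^ j) ^ b" for b by (simp add: mult.commute flip: power_mult)
 have s: "(\<Sum>b<d. (\<zeta> ^ b * \<alpha>) ^ j) = (\<Sum>b<d. (\<zeta> ^ j) ^ b) * \<alpha> ^ j"
  unfolding power_mult_distrib e sum_distrib_right ..
 show ?thesis
 proof (cases "d = 1")
  case True
  thus ?thesis unfolding s using \<alpha>d by simp
 next
  case False
  hence dp: "d = p" using d by simp
  have "(\<zeta> ^ j) ^ p = (\<zeta> ^ p) ^ j" by (simp add: mult.commute flip: power_mult)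
  hence one: "(\<zeta> ^ j) ^ p = 1" using \<zeta>p by simp
  show ?thesis
  proof (cases "\<zeta> ^ j = 1")
   case True
   then obtain k where "j = p * k" using \<zeta>_pow_1_iff by blast
   hence "\<alpha> ^ j = of_nat N ^ k" using \<alpha>d dp by (simp add: power_mult)
   thus ?thesis unfolding s unfolding dp unfolding sum_unit_powers[OF one] by simp
  next
   case False
   thus ?thesis unfolding s unfolding dp unfolding sum_unit_powers[OF one] by simp
  qed
 qed
qed

lemma Ints_sum': "(!!i. i : S ==> f i : \<int>) ==> sum f S : (\<int> :: complex set)"
 by (induction S rule: infinite_finite_induct) auto

lemma sum_conj_ev: "(\<Sum>a\<in>A. I.ev (eta ^ a) g) : \<int>"
proof -
 have e: "(eta ^ a) ^ i = (eta ^ i) ^ a" for a i by (simp add: mult.commute flip: power_mult)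
 have ea: "I.ev (eta ^ a) g = (\<Sum>i\<le>pdeg g. of_int (poly.coeff g i) * (eta ^ i) ^ a)" for a
  unfolding I.ev_altdef by (rule sum.cong[OF refl]) (simp only: e[of a])
 have "(\<Sum>a\<in>A. I.ev (eta ^ a) g) = (\<Sum>i\<le>pdeg g. \<Sum>a\<in>A. of_int (poly.coeff g i) * (eta ^ i) ^ a)"
  unfolding ea by (rule sum.swap)
 also have "... = (\<Sum>i\<le>pdeg g. of_int (poly.coeff g i) * (\<Sum>a\<in>A. (eta ^ i) ^ a))"
  by (simp only: sum_distrib_left)
 also have "... : \<int>"
 proof (rule Ints_sum', rule Ints_mult)
  fix i
  have "(eta ^ i) ^ q = (eta ^ q) ^ i" by (simp only: power_mult[symmetric] mult.commute)
  hence "(eta ^ i) ^ q = 1" using etaq by simp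
  thus "(\<Sum>a\<in>A. (eta ^ i) ^ a) : \<int>" by (rule sum_A)
 qed simp
 finally show ?thesis .
qed

lemma trace_Z: "(\<Sum>a\<in>A. \<Sum>b<d. Z (eta ^ a) (\<zeta> ^ b * \<alpha>) f) : \<int>"
proof -
 have "(\<Sum>a\<in>A. \<Sum>b<d. Z (eta ^ a) (\<zeta> ^ b * \<alpha>) f)
   = (\<Sum>a\<in>A. \<Sum>j\<le>pdeg f. I.ev (eta ^ a) (poly.coeff f j) * (\<Sum>b<d. (\<zeta> ^ b * \<alpha>) ^ j))"
  unfolding E.ev_altdef sum_distrib_left by (rule sum.cong[OF refl], rule sum.swap)
 also have "... = (\<Sum>j\<le>pdeg f. (\<Sum>a\<in>A. I.ev (eta ^ a) (poly.coeff f j)) * (\<Sum>b<d. (\<zeta> ^ b * \<alpha>) ^ j))"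
  unfolding sum_distrib_right by (rule sum.swap)
 also have "... : \<int>" by (intro Ints_sum' Ints_mult sum_conj_ev sum_conj_\<alpha>)
 finally show ?thesis .
qed

lemma trace_Rats: assumes "x : Lf" shows "(\<Sum>g\<in>Gk. g x) : \<rat>"
proof -
 obtain f m where f: "m > 0" "x = Z eta \<alpha> f / of_nat m" using LfE[OF assms] .
 have "(\<Sum>g\<in>Gk. g x) = (\<Sum>a\<in>A. \<Sum>b<d. Z (eta ^ a) (\<zeta> ^ b * \<alpha>) f / of_nat m)"
  unfolding sum_Gk by (intro sum.cong refl) (simp add: f(2) au_eq[OF _ _ f(1)])
 also have "... = (\<Sum>a\<in>A. \<Sum>b<d. Z (eta ^ a) (\<zeta> ^ b * \<alpha>) f) / of_nat m"
  by (simp only: sum_divide_distrib)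
 also have "... : \<rat>" using trace_Z Ints_subset_Rats by (intro Rats_divide) auto
 finally show ?thesis .
qed

text \<open>A product of two geometric sums with ratios \<open>eta\<close> to the power 1 - a and
  \<open>\<zeta>\<close> to the power -b; each vanishes unless its ratio is 1.\<close>

lemma dual_sum:
 assumes ab: "a : A" "b < d"
 shows "(\<Sum>i<q. \<Sum>j<d. (eta ^ a) ^ (q - i) * (\<zeta> ^ b * \<alpha>) ^ (d - j) * (eta ^ i * \<alpha> ^ j))
  = (if a = 1 & b = 0 then of_nat Dk else 0)"
proof -
 define y where "y = eta * (eta ^ a) ^ (q - 1)"
 define z where "z = (\<zeta> ^ b) ^ (d - 1)"
 have "(eta ^ a) ^ q = (eta ^ q) ^ a" by (simp only: power_mult[symmetric] mult.commute)
 hence etaa: "(eta ^ a) ^ q = 1" using etaq by simp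
 have ya: "y * eta ^ a = eta"
  using etaa q_pos by (simp add: y_def mult.assoc flip: power_Suc2)
 have eq1: "(eta ^ a) ^ (q - i) * eta ^ i = y ^ i" if "i < q" for i
 proof -
  have "(eta ^ a) ^ (q - i) * eta ^ i * (eta ^ a) ^ i = (eta ^ a) ^ (q - i + i) * eta ^ i" by (simp only: power_add mult_ac)
  also have "... = eta ^ i" using that etaa by simp
  also have "... = (y * eta ^ a) ^ i" by (simp only: ya)
  finally have "(eta ^ a) ^ (q - i) * eta ^ i * (eta ^ a) ^ i = y ^ i * (eta ^ a) ^ i" by (simp only: power_mult_distrib)
  thus ?thesis using eta_ne0 by simp
 qed
 have \<zeta>0: "\<zeta> ~= 0" unfolding \<zeta>_def using eta_ne0 by simp
 have zb: "z * \<zeta> ^ b = 1" using \<zeta>d[OF ab(2)] d_pos by (simp add: z_def flip: power_Suc2)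
 have eq2: "(\<zeta> ^ b * \<alpha>) ^ (d - j) * \<alpha> ^ j = of_nat N * z ^ j" if "j < d" for j
 proof -
  have "(\<zeta> ^ b) ^ (d - j) * (\<zeta> ^ b) ^ j = z ^ j * (\<zeta> ^ b) ^ j"
   using that \<zeta>d[OF ab(2)] zb by (simp flip: power_add power_mult_distrib)
  hence e: "(\<zeta> ^ b) ^ (d - j) = z ^ j" using \<zeta>0 by simp
  have "\<alpha> ^ (d - j) * \<alpha> ^ j = of_nat N" using that \<alpha>d by (simp flip: power_add)
  thus ?thesis by (simp add: power_mult_distrib e mult_ac)
 qed
 have "(\<Sum>i<q. \<Sum>j<d. (eta ^ a) ^ (q - i) * (\<zeta> ^ b * \<alpha>) ^ (d - j) * (eta ^ i * \<alpha> ^ j))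
  = (\<Sum>i<q. \<Sum>j<d. y ^ i * (of_nat N * z ^ j))"
 proof (intro sum.cong refl)
  fix i j assume "i : {..<q}" "j : {..<d}"
  thus "(eta ^ a) ^ (q - i) * (\<zeta> ^ b * \<alpha>) ^ (d - j) * (eta ^ i * \<alpha> ^ j) = y ^ i * (of_nat N * z ^ j)"
   using eq1[of i] eq2[of j] by (metis lessThan_iff mult.assoc mult.left_commute)
 qed
 also have "... = (\<Sum>i<q. y ^ i) * (\<Sum>j<d. of_nat N * z ^ j)" by (rule sum_product[symmetric])
 also have "(\<Sum>j<d. of_nat N * z ^ j) = of_nat N * (\<Sum>j<d. z ^ j)" by (rule sum_distrib_left[symmetric])
 finally have S: "(\<Sum>i<q. \<Sum>j<d. (eta ^ a) ^ (q - i) * (\<zeta> ^ b * \<alpha>) ^ (d - j) * (eta ^ i * \<alpha> ^ j))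
  = (\<Sum>i<q. y ^ i) * (of_nat N * (\<Sum>j<d. z ^ j))" .
 have "y ^ q * (eta ^ a) ^ q = eta ^ q" by (simp only: ya flip: power_mult_distrib)
 hence yq: "y ^ q = 1" using etaa etaq by simp
 have "z ^ d * (\<zeta> ^ b) ^ d = 1" by (simp only: zb power_one flip: power_mult_distrib)
 hence zd: "z ^ d = 1" using \<zeta>d[OF ab(2)] by simp
 have y1: "y = 1 \<longleftrightarrow> a = 1"
 using ya inj_onD[OF eta_inj, of a 1] ab q_pos eta_ne0 by (auto simp: A_def)
 have z1: "z = 1 \<longleftrightarrow> b = 0"
 using zb \<zeta>_pow_1_iff ab(2) d p_gt by fastforce
 show ?thesis unfolding S sum_unit_powers[OF yq] sum_unit_powers[OF zd] y1 z1 by (simp add: Dk_def mult_ac)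
qed

lemma Lf_duak: "duak k : Lf" and Lf_bask: "bask k : Lf"
 unfolding duak_def bask_def by (auto simp: case_prod_unfold intro!: Lf_add(3) Lf_pow Lf_eta(1) Lf_\<alpha>(1))

lemma alg_duak: "algebraic_int (duak k)" and alg_bask: "algebraic_int (bask k)"
 unfolding duak_def bask_def
 by (auto simp: case_prod_unfold intro!: algebraic_int_mult_complex algebraic_int_power_complex eta_alg \<alpha>_alg)

lemma dual_k:
 assumes x: "x : Lf"
 shows "of_nat Dk * x = (\<Sum>k\<in>Bk. (\<Sum>g\<in>Gk. g (duak k * x)) * bask k)"
proof -
 have m: "au a b (duak (i,j) * x) = (eta ^ a) ^ (q - i) * (\<zeta> ^ b * \<alpha>) ^ (d - j) * au a b x" if ab: "a : A" "b < d" for a b i j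
  unfolding Lf_add(4)[OF Lf_duak x ab]
  by (simp add: duak_def Lf_add(4)[OF Lf_pow[OF Lf_eta(1)] Lf_pow[OF Lf_\<alpha>(1)] ab]
    au_pow[OF Lf_eta(1) ab] au_pow[OF Lf_\<alpha>(1) ab] Lf_eta(2)[OF ab] Lf_\<alpha>(2)[OF ab])
 have "(\<Sum>k\<in>Bk. (\<Sum>g\<in>Gk. g (duak k * x)) * bask k)
   = (\<Sum>i<q. \<Sum>j<d. (\<Sum>a\<in>A. \<Sum>b<d. au a b (duak (i,j) * x)) * bask (i,j))"
  unfolding Bk_def sum_Gk sum.cartesian_product by (simp only: case_prod_unfold prod.collapse)
 also have "... = (\<Sum>i<q. \<Sum>j<d. \<Sum>a\<in>A. \<Sum>b<d. au a b x * ((eta ^ a) ^ (q - i) * (\<zeta> ^ b * \<alpha>) ^ (d - j) * (eta ^ i * \<alpha> ^ j)))"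
  unfolding sum_distrib_right
 proof (intro sum.cong refl)
  fix i j a b assume "a : A" "b : {..<d}"
  hence ab: "a : A" "b < d" by auto
  show "au a b (duak (i,j) * x) * bask (i,j) = au a b x * ((eta ^ a) ^ (q - i) * (\<zeta> ^ b * \<alpha>) ^ (d - j) * (eta ^ i * \<alpha> ^ j))"
   unfolding m[OF ab] bask_def by (simp only: prod.case mult_ac)
 qed
 also have "... = (\<Sum>a\<in>A. \<Sum>b<d. \<Sum>i<q. \<Sum>j<d. au a b x * ((eta ^ a) ^ (q - i) * (\<zeta> ^ b * \<alpha>) ^ (d - j) * (eta ^ i * \<alpha> ^ j)))"
 proof -
  have sw: "(\<Sum>i<q. \<Sum>j<d. \<Sum>a\<in>A. \<Sum>b<d. F i j a b) = (\<Sum>a\<in>A. \<Sum>b<d. \<Sum>i<q. \<Sum>j<d. F i j a b)"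
   for F :: "nat => nat => nat => nat => complex"
  proof -
   have "(\<Sum>i<q. \<Sum>j<d. \<Sum>a\<in>A. \<Sum>b<d. F i j a b) = (\<Sum>i<q. \<Sum>a\<in>A. \<Sum>b<d. \<Sum>j<d. F i j a b)"
    by (rule sum.cong[OF refl], subst sum.swap, rule sum.cong[OF refl], rule sum.swap)
   also have "... = (\<Sum>a\<in>A. \<Sum>i<q. \<Sum>b<d. \<Sum>j<d. F i j a b)" by (rule sum.swap)
   also have "... = (\<Sum>a\<in>A. \<Sum>b<d. \<Sum>i<q. \<Sum>j<d. F i j a b)"
    by (rule sum.cong[OF refl], rule sum.swap)
   finally show ?thesis .
  qed
  show ?thesis by (rule sw)
 qed
 also have "... = (\<Sum>a\<in>A. \<Sum>b<d. au a b x * (if a = 1 & b = 0 then of_nat Dk else 0))"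
  by (intro sum.cong refl, unfold sum_distrib_left[symmetric], subst dual_sum) auto
 also have "... = (\<Sum>a\<in>A. if a = 1 then au 1 0 x * of_nat Dk else 0)"
 proof (rule sum.cong[OF refl])
  fix a assume "a : A"
  have "(\<Sum>b<d. au a b x * (if a = 1 & b = 0 then of_nat Dk else 0))
   = (\<Sum>b<d. if b = 0 then (if a = 1 then au 1 0 x * of_nat Dk else 0) else 0)"
   by (rule sum.cong) auto
  thus "(\<Sum>b<d. au a b x * (if a = 1 & b = 0 then of_nat Dk else 0)) = (if a = 1 then au 1 0 x * of_nat Dk else 0)"
   using d_pos by simp
 qed
 also have "... = of_nat Dk * x" using A_fin one_A au_id[OF x] by (simp add: mult.commute)
 finally show ?thesis ..
qed

lemma numfield_kum: "numfield Lf Gk Bk bask duak Dk"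
proof unfold_locales
 show "1 : Lf" using Lf_int(1)[of 1] by simp
 show "finite Gk" by (simp add: Gk_def A_fin)
 show "EX e:Gk. ALL x:Lf. e x = x"
  by (rule bexI[of _ "au 1 0"]) (use au_id one_A d_pos in \<open>auto simp: Gk_def\<close>)
 show "finite Bk" by (simp add: Bk_def)
 show "0 < Dk" using q_pos d_pos Nprime prime_gt_0_nat by (simp add: Dk_def)
next
 fix g assume "g : Gk"
 then obtain a b where ab: "a : A" "b < d" "g = au a b" by (auto simp: Gk_def)
 { fix x assume "x : Lf"
  then obtain f m where f: "m > 0" "x = Z eta \<alpha> f / of_nat m" by (rule LfE)
  show "g x : Lf" unfolding f(2) ab(3) au_eq[OF ab(1,2) f(1)]
   by (intro Lf_div_nat(1) f(1) Lf_Z Lf_pow Lf_add(3) Lf_eta(1) Lf_\<zeta>(1) Lf_\<alpha>(1)) }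
 { fix x y assume "x : Lf" "y : Lf"
  thus "g (x + y) = g x + g y" "g (x * y) = g x * g y" using Lf_add ab by auto }
 show "g 1 = 1" using Lf_int(2)[OF ab(1,2), of 1] by (simp add: ab)
 fix x assume "x ~: Lf" thus "g x = 0" by (simp add: ab au_def)
next
 fix g h assume "g : Gk" "h : Gk"
 then obtain a b a' b' where ab: "a : A" "b < d" "g = au a b" "a' : A" "b' < d" "h = au a' b'" by (auto simp: Gk_def)
 have "a * a' mod q : A" "(b + a * b') mod d < d" using A_mult ab d_pos by auto
 thus "(%x. g (h x)) : Gk" unfolding ab(3,6) au_comp[OF ab(1,2,4,5)] Gk_def by (intro image_eqI[of _ _ "(a * a' mod q, (b + a * b') mod d)"]) auto
qed (auto simp: Lf_add Lf_minus Lf_inverse trace_Rats Lf_duak Lf_bask alg_duak alg_bask dual_k)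

end

sublocale kum \<subseteq> nf: numfield Lf Gk Bk bask duak Dk
 by (rule numfield_kum)


section \<open>Splitting of N and independence of the powers of the p-th root\<close>

context cyc
begin

text \<open>As \<open>q\<close> divides \<open>N - 1\<close>, a power of a primitive root gives
  \<open>g\<close> with g^q = 1 modulo \<open>N ^ e\<close> but g^r not 1 modulo \<open>N\<close>.
  Then \<open>N ^ e\<close> divides g^q - 1 = \<open>\<Phi>\<close>(g) * (g^r - 1), whose last
  factor is prime to \<open>N\<close>. Such a \<open>g\<close> is an integer that behaves like
  \<open>eta\<close> modulo \<open>N ^ e\<close>.\<close>

lemma cyclotomic_root_mod:
 assumes N: "Factorial_Ring.prime N" "[N = 1] (mod q)" and p2: "odd p" and e: "e > 0"
 obtains g :: nat where "int N ^ e dvd poly \<Phi> (int g)" "~ [g ^ r = 1] (mod N)" "[g ^ q = 1] (mod N)"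
proof -
 have q1: "q dvd N - 1" by (rule cong_to_1_nat[OF N(2)])
 have N2: "N > 2"
 proof -
  have "N - 1 > 0" using prime_gt_1_nat[OF N(1)] by simp
  hence "q <= N - 1" using q1 dvd_imp_le by blast
  moreover have "q >= p" using r_pos by (simp add: qrp)
  moreover have "p ~= 2" using p2 by auto
  ultimately show ?thesis using p_gt by linarith
 qed
 have oddN: "odd N" using N N2 by (metis prime_odd_nat)
 obtain g0 where g0: "ALL k>0. residue_primroot (N ^ k) g0"
  using residue_primroot_odd_prime_power_exists[OF N(1) oddN] by blast
 obtain t where t: "N - 1 = q * t" using q1 by blast
 define h where "h = N ^ (e - 1) * t"
 define g where "g = g0 ^ h"
 have "totient (N ^ e) = N ^ (e - 1) * (N - 1)" using totient_prime_power[OF N(1) e] by simp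
 also have "... = h * q" unfolding t h_def by (simp only: mult_ac)
 finally have tot: "totient (N ^ e) = h * q" .
 have "ord (N ^ e) g0 = totient (N ^ e)" using g0 e by (simp add: residue_primroot_def)
 hence ge: "[g ^ q = 1] (mod N ^ e)" unfolding g_def power_mult[symmetric] ord_divides tot by simp
 have ord1: "ord N g0 = N - 1" using g0[rule_format, of 1] totient_prime[OF N(1)] by (simp add: residue_primroot_def)
 have nr: "~ [g ^ r = 1] (mod N)"
 proof
  assume "[g ^ r = 1] (mod N)"
  hence "q * t dvd h * r" unfolding g_def power_mult[symmetric] ord_divides ord1 t by (simp add: mult.commute)
  hence "(r * t) * p dvd (r * t) * N ^ (e - 1)" by (simp add: h_def qrp mult_ac)
  moreover have "r * t > 0" using r_pos t prime_gt_1_nat[OF N(1)] by (cases t) auto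
  ultimately have "p dvd N ^ (e - 1)" by simp
  hence "p dvd N" using p prime_dvd_power by blast
  hence "p dvd N - 1 & p dvd N" using q1 r_dvd_q dvd_trans by blast
  hence "p dvd 1" using prime_gt_1_nat[OF N(1)] by (metis dvd_diff_nat diff_diff_cancel less_imp_le_nat)
  thus False using p_gt by simp
 qed
 have geo: "poly \<Phi> (int g) * (int g ^ r - 1) = int g ^ q - 1"
 proof -
  have "poly \<Phi> (int g) = (\<Sum>k<p. (int g ^ r) ^ k)" by (simp add: \<Phi>_def poly_sum poly_monom power_mult)
  moreover have "int g ^ q = (int g ^ r) ^ p" by (simp only: qrp power_mult)
  ultimately show ?thesis using power_diff_1_eq[of "int g ^ r" p] by (simp add: mult.commute)
 qed
 have "int (N ^ e) dvd int (g ^ q) - 1" using ge cong_iff_dvd_diff cong_int_iff by (metis of_nat_1)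
 hence "int N ^ e dvd poly \<Phi> (int g) * (int g ^ r - 1)" unfolding geo by simp
 moreover have "coprime (int N ^ e) (int g ^ r - 1)"
 proof -
  have "~ int N dvd int g ^ r - 1"
  proof
   assume "int N dvd int g ^ r - 1"
   hence "[int (g ^ r) = int 1] (mod int N)" by (simp add: cong_iff_dvd_diff)
   thus False using nr cong_int_iff by blast
  qed
  thus ?thesis using N(1) by (simp add: prime_imp_coprime)
 qed
 ultimately have d: "int N ^ e dvd poly \<Phi> (int g)" by (simp add: coprime_dvd_mult_left_iff)
 have "N dvd N ^ e" using e by simp
 hence "[g ^ q = 1] (mod N)" using ge cong_dvd_modulus_nat by blast
 thus ?thesis using that[OF d nr] by blast
qed

lemma kum_one:
 assumes N: "Factorial_Ring.prime N" "[N = 1] (mod q)"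
 shows "kum p n q r eta 1 N (of_nat N)"
 by unfold_locales (use N in auto)

text \<open>Replacing \<open>eta\<close> by an integer root of \<open>\<Phi>\<close> modulo a high
  power of \<open>N\<close> turns the equation into a congruence between integers. The order of
  \<open>N\<close> is a multiple of \<open>p\<close> on one side and 1 plus a multiple of
  \<open>p\<close> on the other.\<close>

lemma not_pth_power:
 assumes N: "Factorial_Ring.prime N" "[N = 1] (mod q)" and p2: "odd p" and m: "m > (0::nat)"
 shows "(I.ev eta f / of_nat m) ^ p ~= of_nat N"
proof
 assume "(I.ev eta f / of_nat m) ^ p = of_nat N"
 hence "I.ev eta f ^ p = of_nat (N * m ^ p)" using m by (simp add: power_divide field_simps)
 moreover have "I.ev eta (f ^ p) = I.ev eta f ^ p" for p by (induction p) (auto simp: I.ev_1 I.ev_mult)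
 moreover have "I.ev eta (f ^ p + [:- int (N * m ^ p):]) = I.ev eta (f ^ p) - of_nat (N * m ^ p)"
  by (simp add: I.ev_add I.ev_pCons I.ev_0)
 ultimately have z: "I.ev eta (f ^ p + [:- int (N * m ^ p):]) = 0" by simp
 obtain u where u: "f ^ p + [:- int (N * m ^ p):] = \<Phi> * u" using ev_zero_dvd[OF z] .
 \<comment> \<open>A congruence modulo the power \<open>Suc k\<close> of \<open>N\<close> is just
   precise enough to transfer the order \<open>k\<close> of \<open>N * m ^ p\<close>.\<close>
 define k where "k = multiplicity (int N) (int (N * m ^ p))"
 have Nn: "N * m ^ p ~= 0" using N m by auto
 obtain g :: nat where g: "int N ^ Suc k dvd poly \<Phi> (int g)"
  using cyclotomic_root_mod[OF N p2, of "Suc k"] by blast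
 have "poly f (int g) ^ p - int (N * m ^ p) = poly \<Phi> (int g) * poly u (int g)"
  using arg_cong[OF u, of "%h. poly h (int g)"] by (simp add: poly_power)
 hence d: "int N ^ Suc k dvd poly f (int g) ^ p - int (N * m ^ p)" using g by simp
 define x where "x = nat \<bar>poly f (int g)\<bar>"
 have Np: "Factorial_Ring.prime (int N)" using N by simp
 have mk: "multiplicity (int N) (int (N * m ^ p)) = k" by (simp add: k_def)
 have Nu: "~ is_unit (int N)" using Np not_prime_unit by blast
 have kp: "k = 1 + p * multiplicity (int N) (int m)"
 proof -
  have pe: "prime_elem (int N)" using Np by (rule prime_imp_prime_elem)
  have m0: "int m ~= 0" "int N ~= 0" "int m ^ p ~= 0" using m N by auto
  have "k = multiplicity (int N) (int N) + multiplicity (int N) (int m ^ p)"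
   unfolding k_def of_nat_mult of_nat_power by (rule prime_elem_multiplicity_mult_distrib[OF pe m0(2,3)])
  also have "multiplicity (int N) (int m ^ p) = p * multiplicity (int N) (int m)"
   by (rule prime_elem_multiplicity_power_distrib[OF pe m0(1)])
  also have "multiplicity (int N) (int N) = 1" using m0(2) Nu by (rule multiplicity_self)
  finally show ?thesis .
 qed
 define y where "y = poly f (int g) ^ p"
 have "int N ^ k dvd int (N * m ^ p)" using multiplicity_dvd[of "int N" "int (N * m ^ p)"] by (simp only: mk)
 moreover have "int N ^ k dvd y - int (N * m ^ p)" using d dvd_trans[OF le_imp_power_dvd[of k "Suc k"]] by (auto simp: y_def)
 ultimately have "int N ^ k dvd y" by (metis dvd_add diff_add_cancel)
 moreover have "~ int N ^ Suc k dvd y"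
 proof
  assume "int N ^ Suc k dvd y"
  hence "int N ^ Suc k dvd int (N * m ^ p)" using d unfolding y_def by (metis dvd_diff_right_iff dvd_diff_commute)
  hence "Suc k <= multiplicity (int N) (int (N * m ^ p))"
   using Nn Nu by (intro multiplicity_geI) auto
  thus False by (simp only: mk)
 qed
 ultimately have my: "multiplicity (int N) y = k" by (intro multiplicity_eqI) auto
 have "poly f (int g) ~= 0"
 proof
  assume "poly f (int g) = 0"
  hence "y = 0" using p_gt by (simp add: y_def)
  thus False using my kp by simp
 qed
 hence "multiplicity (int N) y = p * multiplicity (int N) (poly f (int g))"
  unfolding y_def by (rule prime_elem_multiplicity_power_distrib[OF prime_imp_prime_elem[OF Np]])
 hence "p dvd 1 + p * multiplicity (int N) (int m)" using my kp by (metis dvd_triv_left)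
 hence "p dvd 1" by (simp only: dvd_add_left_iff[OF dvd_triv_left])
 thus False using p_gt by simp
qed

text \<open>A dependence gives \<alpha> a monic polynomial \<open>f\<close> of least degree k over
  the cyclotomic field, with 0 < k < p, and \<open>f\<close> divides X^p - N. Its constant term is,
  up to sign, a product of k p-th roots of \<open>N\<close>, so its p-th power is
  \<open>N ^ k\<close> up to sign. As k is prime to \<open>p\<close>, a p-th root of
  \<open>N\<close> would lie in the cyclotomic field.\<close>

lemma kum_p:
 assumes N: "Factorial_Ring.prime N" "[N = 1] (mod q)" and p2: "odd p" and \<alpha>: "\<alpha> ^ p = of_nat N"
 shows "kum p n q r eta p N \<alpha>"
proof unfold_locales
 interpret K: kum p n q r eta 1 N "of_nat N" by (rule kum_one[OF N])
 define EE where "EE = K.Lf"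
 have EEev: "I.ev eta g : EE" for g unfolding EE_def by (rule K.Lf_ev[OF K.Lf_eta(1)])
 have EEnp: "\<beta> ^ p ~= of_nat N" if "\<beta> : EE" for \<beta>
 proof -
  have bL: "\<beta> : K.Lf" using \<open>\<beta> : EE\<close> by (simp only: EE_def)
  obtain f m where f: "m > 0" "\<beta> = E.ev eta (of_nat N) f / of_nat m" using K.LfE[OF bL] .
  have "E.ev eta (of_nat N) f = I.ev eta (poly f [:int N:])"
   by (induction f) (auto simp: E.ev_0 I.ev_0 E.ev_pCons I.ev_add I.ev_mult I.ev_smult I.ev_pCons)
  thus ?thesis using not_pth_power[OF N p2 f(1)] f(2) by simp
 qed
 fix c :: "nat => int poly" and j0
 assume rel: "(\<Sum>j<p. I.ev eta (c j) * \<alpha> ^ j) = 0" and j0: "j0 < p"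
 show "I.ev eta (c j0) = 0"
 proof (rule ccontr)
  assume nz: "I.ev eta (c j0) ~= 0"
  define F :: "complex poly" where "F = (\<Sum>j<p. Polynomial.monom (I.ev eta (c j)) j)"
  have cF: "poly.coeff F i = (if i < p then I.ev eta (c i) else 0)" for i
   by (simp add: F_def coeff_sum coeff_monom)
  have F0: "F ~= 0" using nz j0 cF[of j0] by auto
  have FE: "poly.coeff F i : EE" for i using EEev[of 0] EEev by (simp add: cF I.ev_0)
  have Fd: "pdeg F < p" by (rule degree_lessI) (use p_gt cF in auto)
  have Fz: "poly F \<alpha> = 0" using rel by (simp add: F_def poly_sum poly_monom)
  define Q where "Q = (%k. EX f. lead_coeff f = 1 & (ALL i. poly.coeff f i : EE) & poly f \<alpha> = 0 & pdeg f = k)"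
  have norml: "Q (pdeg f)" if f: "f ~= 0" "ALL i. poly.coeff f i : EE" "poly f \<alpha> = 0" for f
  proof -
   define h where "h = Polynomial.smult (inverse (lead_coeff f)) f"
   have lz: "lead_coeff f ~= 0" using f(1) by simp
   have "pdeg h = pdeg f" using lz by (simp add: h_def)
   moreover have "lead_coeff h = 1" using lz calculation by (simp add: h_def)
   moreover have "ALL i. poly.coeff h i : EE"
    using f(2) K.Lf_add(3) K.Lf_inverse unfolding h_def EE_def by simp
   moreover have "poly h \<alpha> = 0" using f(3) by (simp add: h_def)
   ultimately show ?thesis unfolding Q_def by blast
  qed
  have "Q (pdeg F)" using norml[of F] F0 FE Fz by blast
  define k where "k = (LEAST k. Q k)"
  have "Q k" unfolding k_def by (rule LeastI) fact
  then obtain f where f: "lead_coeff f = 1" "ALL i. poly.coeff f i : EE" "poly f \<alpha> = 0" "pdeg f = k"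
   unfolding Q_def by blast
  have "k <= pdeg F" unfolding k_def by (rule Least_le) fact
  hence kp: "k < p" using Fd by simp
  have k0: "k > 0"
  proof (rule ccontr)
   assume "~ k > 0"
   then obtain a where "f = [:a:]" using f(4) degree_eq_zeroE[of f] by auto
   thus False using f by simp
  qed
  define H :: "complex poly" where "H = Polynomial.monom 1 p - [:of_nat N:]"
  have HE: "poly.coeff H i : EE" for i
   using K.Lf_int(1)[of 0] K.Lf_int(1)[of 1] K.Lf_int(1)[of "- int N"] K.Lf_int(1)[of "1 - int N"]
   by (auto simp: H_def coeff_pCons EE_def split: nat.split)
  have "EX u s. H = f * u + s & pdeg s < pdeg f & (ALL i. poly.coeff s i : EE)"
  proof (rule monic_division_closed[OF f(1)])
   show "0 : EE" using K.Lf_int(1)[of 0] by (simp add: EE_def)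
   fix x y assume "x : EE" "y : EE"
   thus "x - y : EE" "x * y : EE" using K.nf.Ldiff K.Lf_add(3) by (auto simp: EE_def)
  qed (use f k0 HE in auto)
  then obtain u s where us: "H = f * u + s" "pdeg s < k" "ALL i. poly.coeff s i : EE" using f(4) by blast
  have "poly s \<alpha> = poly H \<alpha>" using f(3) us(1) by simp
  hence sz: "poly s \<alpha> = 0" using \<alpha> by (simp add: H_def poly_monom)
  have "s = 0"
  proof (rule ccontr)
   assume "s ~= 0"
   hence "Q (pdeg s)" using norml us(3) sz by blast
   hence "k <= pdeg s" unfolding k_def by (rule Least_le)
   thus False using us(2) by simp
  qed
  hence Hf: "H = f * u" using us by simp
  obtain as where as: "Polynomial.smult (lead_coeff f) (\<Prod>a\<leftarrow>as. [:- a, 1:]) = f" "length as = pdeg f"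
   using fundamental_theorem_algebra_factorized[of f] by blast
  have fas: "f = (\<Prod>a\<leftarrow>as. [:- a, 1:])" using as(1) f(1) by simp
  have ra: "a ^ p = of_nat N" if "a : set as" for a
  proof -
   have "poly f a = 0" unfolding fas using that by (induction as) auto
   hence "poly H a = 0" by (simp add: Hf)
   thus ?thesis by (simp add: H_def poly_monom)
  qed
  have c0: "poly f 0 = (\<Prod>a\<leftarrow>as. - a)" unfolding fas by (induction as) auto
  have "(\<Prod>a\<leftarrow>bs. - a) ^ p = (- of_nat N) ^ length bs" if "set bs <= set as" for bs
   using that by (induction bs) (use ra p2 in \<open>auto simp: power_mult_distrib power_minus_odd\<close>)
  hence c1: "poly f 0 ^ p = (- of_nat N) ^ k" using c0 as(2) f(4) by simp
  define c' where "c' = (- 1) ^ k * poly f 0"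
  have c'E: "c' : EE"
  proof -
   have "poly f 0 : EE" using f(2) by (simp add: poly_0_coeff_0)
   thus ?thesis using K.Lf_add(3)[OF K.Lf_int(1)[of "(-1) ^ k"]] by (simp add: c'_def EE_def)
  qed
  have "c' ^ p = ((- 1) ^ p) ^ k * poly f 0 ^ p" by (simp add: c'_def power_mult_distrib mult.commute flip: power_mult)
  also have "((- 1) ^ p) ^ k = ((- 1) ^ k :: complex)" using p2 by simp
  also have "(- 1) ^ k * poly f 0 ^ p = ((- 1) * (- of_nat N)) ^ k" unfolding c1 power_mult_distrib ..
  finally have c'p: "c' ^ p = of_nat N ^ k" by simp
  have "coprime k p" using p k0 kp by (metis coprime_commute dvd_imp_le leD prime_imp_coprime)
  then obtain x y where xy: "k * x = p * y + 1" using bezout_nat[of k p] k0 by auto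
  \<comment> \<open>From \<open>c' ^ p = N ^ k\<close> and \<open>k * x = p * y + 1\<close> this is
    a p-th root of \<open>N\<close>.\<close>
  define \<beta> where "\<beta> = c' ^ x / of_nat (N ^ y)"
  have "\<beta> : EE" unfolding \<beta>_def EE_def
   using K.Lf_div_nat(1)[OF K.Lf_pow[of c' x], of "N ^ y"] c'E N prime_gt_0_nat by (simp add: EE_def)
  moreover have "\<beta> ^ p = of_nat N"
  proof -
   have "\<beta> ^ p = (c' ^ p) ^ x / (of_nat N ^ y) ^ p" by (simp add: \<beta>_def power_divide mult.commute flip: power_mult)
   also have "... = of_nat N ^ (k * x) / of_nat N ^ (p * y)" by (simp add: c'p power_mult mult.commute[of p y])
   also have "... = of_nat N" unfolding xy using N by (simp add: power_add)
   finally show ?thesis .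
  qed
  ultimately show False using EEnp by blast
 qed
qed (use N \<alpha> in auto)

end

section \<open>The index of an operator on a lattice\<close>


lemma power_bounded_imp_le_one:
 fixes x C :: real
 assumes "!!m. x ^ m <= C" shows "x <= 1"
proof (rule ccontr)
 assume "~ x <= 1"
 then obtain m where "C < x ^ m" using real_arch_pow[of x C] by auto
 thus False using assms[of m] by simp
qed

text \<open>\<open>\<Lambda>\<close> stands for the logarithms of relative units and
  \<open>D\<close> for 1 - \<sigma>. By \<open>I\<close> and \<open>fin\<close>,
  \<open>m * h\<close> coordinates control the lattice up to finitely many elements, so its rank is
  at most \<open>m * h\<close>; \<open>pD\<close> makes the m-th iterate of \<open>D\<close> divide
  multiplication by \<open>p\<close>. With m = p - 1 the model is a module of rank h over the
  integers of K, where the cokernel of 1 - \<zeta> has p^h elements.\<close>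

locale real_lattice =
 fixes \<Lambda> :: "('g => real) set" and D :: "('g => real) => ('g => real)" and I :: "'g set" and p m h :: nat
 assumes zero: "0 : \<Lambda>" and diff: "f : \<Lambda> ==> g : \<Lambda> ==> f - g : \<Lambda>"
  and D: "f : \<Lambda> ==> D f : \<Lambda>" and Ddiff: "f : \<Lambda> ==> g : \<Lambda> ==> D (f - g) = D f - D g"
  and Dinj: "f : \<Lambda> ==> D f = 0 ==> f = 0"
  and p1: "p > 1" and m: "m > 0"
  and pD: "f : \<Lambda> ==> EX e:\<Lambda>. (%g. real p * f g) = (D ^^ m) e"
  and I: "finite I" "card I = m * h"
  and fin: "finite {f : \<Lambda>. ALL i:I. \<bar>f i\<bar> <= 1}"
begin

lemma add: "f : \<Lambda> ==> g : \<Lambda> ==> f + g : \<Lambda>"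
 using diff[of f "0 - g"] diff[OF zero, of g] by simp

lemma sumL: "(!!i. i : A ==> f i : \<Lambda>) ==> sum f A : \<Lambda>"
 by (induction A rule: infinite_finite_induct) (auto simp: zero add)

lemma scale: "f : \<Lambda> ==> (%g. real k * f g) : \<Lambda>"
proof (induction k)
 case 0
 thus ?case using zero by (simp add: zero_fun_def)
next
 case (Suc k)
 have "(%g. real (Suc k) * f g) = (%g. real k * f g) + f" by (rule ext) (simp add: algebra_simps)
 thus ?case using Suc add by simp
qed

lemma D0: "D 0 = 0" using Ddiff[OF zero zero] by simp

lemma Dadd: "f : \<Lambda> ==> g : \<Lambda> ==> D (f + g) = D f + D g"
 using Ddiff[of f "0 - g"] Ddiff[OF zero, of g] diff[OF zero, of g] D0 by simp

lemma Dn: "f : \<Lambda> ==> (D ^^ n) f : \<Lambda>" by (induction n) (auto simp: D)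

lemma Dsum: "(!!i. i : A ==> f i : \<Lambda>) ==> D (sum f A) = (\<Sum>i\<in>A. D (f i))"
 by (induction A rule: infinite_finite_induct) (auto simp: D0 Dadd sumL)

text \<open>Rounding down the coordinates in \<open>I\<close> leaves at most
  \<open>(2 * r + 1) ^ (m * h)\<close> boxes. Two points of one box differ by one of the finitely
  many elements with bound 1.\<close>

lemma count:
 obtains K where "!!r::nat. finite {f : \<Lambda>. ALL i:I. \<bar>f i\<bar> <= real r} &
  card {f : \<Lambda>. ALL i:I. \<bar>f i\<bar> <= real r} <= K * (2 * r + 1) ^ (m * h)"
proof
 define U where "U = {f : \<Lambda>. ALL i:I. \<bar>f i\<bar> <= 1}"
 fix r :: nat
 define V where "V = {f : \<Lambda>. ALL i:I. \<bar>f i\<bar> <= real r}"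
 define F where "F = (%f. \<lambda>i\<in>I. \<lfloor>f i :: real\<rfloor>)"
 define B where "B = (\<Pi>\<^sub>E i\<in>I. {- int r..int r})"
 have finB: "finite B" unfolding B_def using I by (simp add: finite_PiE)
 have cardB: "card B = (2 * r + 1) ^ (m * h)"
 proof -
  have c: "card {- int r..int r} = 2 * r + 1" by simp
  show ?thesis unfolding B_def card_PiE[OF I(1)] c using I(2) by simp
 qed
 have FV: "F ` V <= B"
 proof
  fix y assume "y : F ` V"
  then obtain f where f: "f : V" "y = F f" by blast
  have "\<lfloor>f i\<rfloor> : {- int r..int r}" if "i : I" for i
  proof -
   have "- real r <= f i" "f i <= real r" using f that by (auto simp: V_def abs_le_iff)
   thus ?thesis by (auto simp: le_floor_iff floor_le_iff)
  qed
  thus "y : B" unfolding f(2) F_def B_def by auto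
 qed
 have fib: "finite {f : V. F f = y} & card {f : V. F f = y} <= card U" if yV: "y : F ` V" for y
 proof -
  obtain f0 where f0: "f0 : V" "F f0 = y" using yV by blast
  have inj: "inj_on (%f. f - f0) {f : V. F f = y}" by (rule inj_onI) simp
  have "(%f. f - f0) ` {f : V. F f = y} <= U"
  proof
   fix z assume "z : (%f. f - f0) ` {f : V. F f = y}"
   then obtain f where f: "f : V" "F f = y" "z = f - f0" by blast
   have "\<bar>f i - f0 i\<bar> <= 1" if "i : I" for i
   proof -
    have "F f i = F f0 i" by (simp only: f(2) f0(2))
    hence "\<lfloor>f i\<rfloor> = \<lfloor>f0 i\<rfloor>" using that by (simp add: F_def)
    thus ?thesis by linarith
   qed
   thus "z : U" using f f0 diff by (auto simp: U_def V_def)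
  qed
  thus ?thesis using inj fin inj_on_finite[OF inj] card_inj_on_le[OF inj] by (simp add: U_def)
 qed
 have finFV: "finite (F ` V)" using finite_subset[OF FV finB] .
 have Veq: "V = (\<Union>y\<in>F ` V. {f : V. F f = y})" by blast
 have finV: "finite V" by (subst Veq) (use finFV fib in blast)
 have "card V = (\<Sum>y\<in>F ` V. card {f : V. F f = y})"
  using sum.image_gen[OF finV, of "%_. 1::nat" F] by (simp only: card_eq_sum)
 also have "... <= (\<Sum>y\<in>F ` V. card U)" by (rule sum_mono) (use fib in blast)
 also have "... = card U * card (F ` V)" by simp
 also have "... <= card U * card B" by (intro mult_left_mono card_mono finB FV) simp
 finally show "finite {f : \<Lambda>. ALL i:I. \<bar>f i\<bar> <= real r} &
  card {f : \<Lambda>. ALL i:I. \<bar>f i\<bar> <= real r} <= card {f : \<Lambda>. ALL i:I. \<bar>f i\<bar> <= 1} * (2 * r + 1) ^ (m * h)"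
  using finV by (simp only: V_def U_def cardB)
qed

lemma digits_inj:
 assumes S: "S <= \<Lambda>" and dist: "!!s t e. s : S ==> t : S ==> e : \<Lambda> ==> s - t = (%g. real p * e g) ==> s = t"
  and s: "!!i. i < n ==> s i : S" and t: "!!i. i < n ==> t i : S"
  and eq: "(\<Sum>i<n. (%g. real (p ^ i) * s i g)) = (\<Sum>i<n. (%g. real (p ^ i) * t i g))"
 shows "ALL i<n. s i = t i"
 using s t eq
proof (induction n arbitrary: s t)
 case (Suc n)
 have sh: "(\<Sum>i<Suc n. (%g. real (p ^ i) * u i g)) = u 0 + (%g. real p * (\<Sum>i<n. (%g. real (p ^ i) * u (Suc i) g)) g)"
  for u :: "nat => 'g => real"
 proof (rule ext)
  fix g
  have ap: "(\<Sum>i<k. (%g. w i g)) g = (\<Sum>i<k. w i g)" for w :: "nat => 'g => real" and k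
   by (induction k) simp_all
  show "(\<Sum>i<Suc n. (%g. real (p ^ i) * u i g)) g = (u 0 + (%g. real p * (\<Sum>i<n. (%g. real (p ^ i) * u (Suc i) g)) g)) g"
   unfolding plus_fun_def ap sum.lessThan_Suc_shift by (simp add: sum_distrib_left mult.assoc)
 qed
 define x where "x = (\<Sum>i<n. (%g. real (p ^ i) * s (Suc i) g))"
 define y where "y = (\<Sum>i<n. (%g. real (p ^ i) * t (Suc i) g))"
 have x: "x : \<Lambda>" unfolding x_def by (intro sumL scale) (use Suc.prems(1) S in auto)
 have y: "y : \<Lambda>" unfolding y_def by (intro sumL scale) (use Suc.prems(2) S in auto)
 have eq: "s 0 + (%g. real p * x g) = t 0 + (%g. real p * y g)"
  using Suc.prems(3) unfolding sh x_def y_def .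
 have "s 0 - t 0 = (%g. real p * (y - x) g)"
 proof (rule ext)
  fix g
  have "s 0 g + real p * x g = t 0 g + real p * y g" using fun_cong[OF eq, of g] by simp
  thus "(s 0 - t 0) g = real p * (y - x) g" by (simp add: algebra_simps)
 qed
 hence st0: "s 0 = t 0" using dist[of "s 0" "t 0" "y - x"] Suc.prems diff[OF y x] by simp
 have "x = y"
 proof (rule ext)
  fix g
  have "s 0 g + real p * x g = t 0 g + real p * y g" using fun_cong[OF eq, of g] by simp
  thus "x g = y g" using st0 p1 by simp
 qed
 hence IHp: "(\<Sum>i<n. (%g. real (p ^ i) * s (Suc i) g)) = (\<Sum>i<n. (%g. real (p ^ i) * t (Suc i) g))" unfolding x_def y_def .
 have "ALL i<n. s (Suc i) = t (Suc i)"
 proof (rule Suc.IH[of "%i. s (Suc i)" "%i. t (Suc i)", OF _ _ IHp])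
  fix i assume "i < n"
  thus "s (Suc i) : S" "t (Suc i) : S" using Suc.prems(1,2)[of "Suc i"] by auto
 qed
 thus ?case using st0 by (auto simp: less_Suc_eq_0_disj)
qed simp

text \<open>Sums of n base-p digits from \<open>S\<close> are pairwise distinct and have coordinates
  bounded by a constant times \<open>p ^ n\<close>. By \<open>count\<close>, the n-th power of
  \<open>card S / p ^ (m * h)\<close> stays bounded for all n, so the ratio is at most 1.\<close>

lemma card_mod_p:
 assumes S: "finite S" "S <= \<Lambda>"
  and dist: "!!s t e. s : S ==> t : S ==> e : \<Lambda> ==> s - t = (%g. real p * e g) ==> s = t"
 shows "card S <= p ^ (m * h)"
proof -
 define R where "R = nat \<lceil>\<Sum>s\<in>S. \<Sum>i\<in>I. \<bar>s i\<bar>\<rceil>"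
 have R: "\<bar>s i\<bar> <= real R" if "s : S" "i : I" for s i
 proof -
  have "\<bar>s i\<bar> <= (\<Sum>i\<in>I. \<bar>s i\<bar>)" using that I by (intro member_le_sum) auto
  also have "... <= (\<Sum>s\<in>S. \<Sum>i\<in>I. \<bar>s i\<bar>)"
   using that S by (intro member_le_sum[of s S "%s. \<Sum>i\<in>I. \<bar>s i\<bar>"]) (auto simp: sum_nonneg)
  also have "... <= real R" by (simp add: R_def real_nat_ceiling_ge)
  finally show ?thesis .
 qed
 obtain K where K: "!!r::nat. finite {f : \<Lambda>. ALL i:I. \<bar>f i\<bar> <= real r} &
  card {f : \<Lambda>. ALL i:I. \<bar>f i\<bar> <= real r} <= K * (2 * r + 1) ^ (m * h)"
  by (rule count) blast
 have bound: "card S ^ n <= K * (2 * (R * p ^ n) + 1) ^ (m * h)" for n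
 proof -
  define F where "F = (%s. \<Sum>i<n. (%g. real (p ^ i) * s i g) :: 'g => real)"
  define W where "W = ({..<n} \<rightarrow>\<^sub>E S)"
  have inj: "inj_on F W"
  proof (rule inj_onI)
   fix s t assume st: "s : W" "t : W" "F s = F t"
   have "ALL i<n. s i = t i"
    by (rule digits_inj[OF S(2) dist]) (use st in \<open>auto simp: W_def F_def\<close>)
   thus "s = t" by (intro PiE_ext[OF st(1,2)[unfolded W_def]]) auto
  qed
  have "F ` W <= {f : \<Lambda>. ALL i:I. \<bar>f i\<bar> <= real (R * p ^ n)}"
  proof safe
   fix s assume s: "s : W"
   show "F s : \<Lambda>" unfolding F_def by (intro sumL scale) (use s S in \<open>auto simp: W_def\<close>)
   fix i assume i: "i : I"
   have Fs: "F s i = (\<Sum>j<n. real (p ^ j) * s j i)"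
   proof -
    have "(\<Sum>i<k. (%g. w i g)) g = (\<Sum>i<k. w i g)" for w :: "nat => 'g => real" and k g
     by (induction k) simp_all
    thus ?thesis by (simp add: F_def)
   qed
   have "\<bar>F s i\<bar> <= (\<Sum>j<n. \<bar>real (p ^ j) * s j i\<bar>)" unfolding Fs by (rule sum_abs)
   also have "... <= (\<Sum>j<n. real (p ^ j) * real R)"
   proof (rule sum_mono)
    fix j assume "j : {..<n}"
    hence "\<bar>s j i\<bar> <= real R" using R i s by (auto simp: W_def)
    thus "\<bar>real (p ^ j) * s j i\<bar> <= real (p ^ j) * real R" by (simp add: abs_mult mult_left_mono)
   qed
   also have "... = real (R * (\<Sum>j<n. p ^ j))" by (simp add: sum_distrib_left mult.commute)
   also have "... <= real (R * p ^ n)"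
   proof -
    have "(\<Sum>j<n. p ^ j) <= p ^ n"
    proof (induction n)
     case (Suc n)
     have "(\<Sum>j<Suc n. p ^ j) <= p ^ n + p ^ n" using Suc by simp
     also have "... <= p ^ Suc n" using p1 by (simp add: mult_2[symmetric])
     finally show ?case .
    qed simp
    thus ?thesis by (simp del: of_nat_mult of_nat_power of_nat_sum)
   qed
   finally show "\<bar>F s i\<bar> <= real (R * p ^ n)" .
  qed
  hence "card (F ` W) <= card {f : \<Lambda>. ALL i:I. \<bar>f i\<bar> <= real (R * p ^ n)}"
   using K by (intro card_mono) blast+
  also have "... <= K * (2 * (R * p ^ n) + 1) ^ (m * h)" using K by blast
  finally show ?thesis using card_image[OF inj] by (simp add: W_def card_PiE)
 qed
 define x where "x = real (card S) / real (p ^ (m * h))"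
 have "x ^ n <= real K * real (2 * R + 1) ^ (m * h)" for n
 proof -
  have "K * (2 * (R * p ^ n) + 1) ^ (m * h) <= K * ((2 * R + 1) * p ^ n) ^ (m * h)"
   using p1 by (intro mult_left_mono power_mono) (auto simp: algebra_simps)
  also have "... = K * (2 * R + 1) ^ (m * h) * (p ^ (m * h)) ^ n"
   by (simp only: power_mult_distrib mult.assoc power_mult[symmetric] mult.commute[of n])
  finally have "card S ^ n <= K * (2 * R + 1) ^ (m * h) * (p ^ (m * h)) ^ n" by (rule order_trans[OF bound[of n]])
  hence "real (card S ^ n) <= real (K * (2 * R + 1) ^ (m * h) * (p ^ (m * h)) ^ n)" by (simp only: of_nat_le_iff)
  hence "real (card S) ^ n <= real K * real (2 * R + 1) ^ (m * h) * real (p ^ (m * h)) ^ n"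
   by (simp only: of_nat_mult of_nat_power)
  moreover have "real (p ^ (m * h)) ^ n > 0" using p1 by simp
  ultimately show ?thesis unfolding x_def power_divide by (simp add: pos_divide_le_eq del: of_nat_power)
 qed
 hence "x <= 1" by (rule power_bounded_imp_le_one)
 hence "real (card S) <= real (p ^ (m * h))" using p1 unfolding x_def by (simp add: divide_le_eq split: if_splits)
 thus ?thesis by (simp only: of_nat_le_iff)
qed

lemma D_digits_inj:
 assumes S: "S <= \<Lambda>" and dist: "!!s t e. s : S ==> t : S ==> e : \<Lambda> ==> s - t = D e ==> s = t"
  and s: "!!i. i < n ==> s i : S" and t: "!!i. i < n ==> t i : S"
  and e: "e : \<Lambda>" and eq: "(\<Sum>i<n. (D ^^ i) (s i)) - (\<Sum>i<n. (D ^^ i) (t i)) = (D ^^ n) e"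
 shows "ALL i<n. s i = t i"
 using s t eq
proof (induction n arbitrary: s t)
 case (Suc n)
 define x where "x = (\<Sum>i<n. (D ^^ i) (s (Suc i)))"
 define y where "y = (\<Sum>i<n. (D ^^ i) (t (Suc i)))"
 have x: "x : \<Lambda>" unfolding x_def by (intro sumL Dn) (use Suc.prems(1) S in auto)
 have y: "y : \<Lambda>" unfolding y_def by (intro sumL Dn) (use Suc.prems(2) S in auto)
 have sx: "(\<Sum>i<Suc n. (D ^^ i) (s i)) = s 0 + D x"
  unfolding sum.lessThan_Suc_shift x_def using Suc.prems(1) S by (subst Dsum) (auto intro!: Dn)
 have ty: "(\<Sum>i<Suc n. (D ^^ i) (t i)) = t 0 + D y"
  unfolding sum.lessThan_Suc_shift y_def using Suc.prems(2) S by (subst Dsum) (auto intro!: Dn)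
 have eq: "s 0 + D x - (t 0 + D y) = D ((D ^^ n) e)" using Suc.prems(3) unfolding sx ty by (simp only: funpow.simps comp_apply)
 have en: "(D ^^ n) e : \<Lambda>" by (rule Dn[OF e])
 have "s 0 - t 0 = D ((D ^^ n) e - (x - y))"
  unfolding Ddiff[OF en diff[OF x y]] Ddiff[OF x y] eq[symmetric] by (simp add: algebra_simps)
 hence st0: "s 0 = t 0" using dist[of "s 0" "t 0"] Suc.prems diff[OF en diff[OF x y]] by simp
 have "D (x - y - (D ^^ n) e) = 0"
  unfolding Ddiff[OF diff[OF x y] en] Ddiff[OF x y] eq[symmetric] using st0 by simp
 hence "x - y - (D ^^ n) e = 0" by (rule Dinj[OF diff[OF diff[OF x y] en]])
 hence "x - y = (D ^^ n) e" by simp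
 hence IHp: "(\<Sum>i<n. (D ^^ i) (s (Suc i))) - (\<Sum>i<n. (D ^^ i) (t (Suc i))) = (D ^^ n) e" unfolding x_def y_def .
 have "ALL i<n. s (Suc i) = t (Suc i)"
 proof (rule Suc.IH[of "%i. s (Suc i)" "%i. t (Suc i)", OF _ _ IHp])
  fix i assume "i < n"
  thus "s (Suc i) : S" "t (Suc i) : S" using Suc.prems(1,2)[of "Suc i"] by auto
 qed
 thus ?case using st0 by (auto simp: less_Suc_eq_0_disj)
qed simp

text \<open>The \<open>card S ^ m\<close> sums of m digits in base \<open>D\<close> are distinct
  modulo the m-th iterate of \<open>D\<close>, hence modulo \<open>p\<close> by \<open>pD\<close>.
  Then \<open>card_mod_p\<close> bounds \<open>card S ^ m\<close>, and an m-th root is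
  taken.\<close>

theorem card_mod_D:
 assumes S: "finite S" "S <= \<Lambda>"
  and dist: "!!s t e. s : S ==> t : S ==> e : \<Lambda> ==> s - t = D e ==> s = t"
 shows "card S <= p ^ h"
proof -
 define F where "F = (%s. \<Sum>i<m. (D ^^ i) (s i))"
 define W where "W = ({..<m} \<rightarrow>\<^sub>E S)"
 have FL: "F s : \<Lambda>" if "s : W" for s
  unfolding F_def by (intro sumL Dn) (use that S in \<open>auto simp: W_def\<close>)
 have st: "s = t" if st: "s : W" "t : W" and e: "e : \<Lambda>" "F s - F t = (D ^^ m) e" for s t e
 proof -
  have "ALL i<m. s i = t i"
   by (rule D_digits_inj[OF S(2) dist _ _ e(1)]) (use st e(2) in \<open>auto simp: W_def F_def\<close>)
  thus "s = t" by (intro PiE_ext[OF st(1,2)[unfolded W_def]]) auto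
 qed
 have zD: "(D ^^ m) 0 = 0" by (induction m) (simp_all only: funpow.simps comp_apply id_apply D0)
 have inj: "inj_on F W" by (rule inj_onI) (rule st[OF _ _ zero], auto simp: zD)
 have "card (F ` W) <= p ^ (m * h)"
 proof (rule card_mod_p)
  show "finite (F ` W)" using S by (simp add: W_def finite_PiE)
  show "F ` W <= \<Lambda>" using FL by blast
  fix u v e assume uv: "u : F ` W" "v : F ` W" and e: "e : \<Lambda>" "u - v = (%g. real p * e g)"
  obtain s t where s: "s : W" "u = F s" and t: "t : W" "v = F t" using uv by blast
  obtain e' where e': "e' : \<Lambda>" "(%g. real p * e g) = (D ^^ m) e'" using pD[OF e(1)] by blast
  have "F s - F t = (D ^^ m) e'" using e(2) e'(2) s t by simp
  hence "s = t" by (rule st[OF s(1) t(1) e'(1)])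
  thus "u = v" using s t by simp
 qed
 hence "card S ^ m <= (p ^ h) ^ m" using card_image[OF inj] by (simp add: W_def card_PiE mult.commute flip: power_mult)
 thus ?thesis using m by (simp add: power_mono_iff)
qed

end

section \<open>Relative units\<close>


text \<open>Bounded conjugates bound the integers \<open>Tr (dua k * x)\<close>, and these determine
  \<open>x\<close>.\<close>

lemma (in numfield) finite_bounded_conjugates:
 fixes C :: real
 shows "finite {x : Oi. ALL g:G. norm (g x) <= C}"
proof -
 define S where "S = {x : Oi. ALL g:G. norm (g x) <= C}"
 define K where "K = \<lceil>\<Sum>k\<in>B. \<Sum>g\<in>G. norm (g (dua k)) * \<bar>C\<bar>\<rceil>"
 define F where "F = (%x. \<lambda>k\<in>B. \<lfloor>Re (Tr (dua k * x))\<rfloor>)"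
 have t: "of_int \<lfloor>Re (Tr (dua k * x))\<rfloor> = Tr (dua k * x)" if "x : Oi" "k : B" for x k
  using Tr_Ints[of "dua k * x"] that Oi_mult Oi_bas by (auto elim!: Ints_cases)
 have b: "\<bar>\<lfloor>Re (Tr (dua k * x))\<rfloor>\<bar> <= K" if x: "x : S" and k: "k : B" for x k
 proof -
  have xO: "x : Oi" using x by (simp add: S_def)
  have "norm (Tr (dua k * x)) <= (\<Sum>g\<in>G. norm (g (dua k * x)))" unfolding Tr_def by (rule norm_sum)
  also have "... <= (\<Sum>g\<in>G. norm (g (dua k)) * \<bar>C\<bar>)"
  proof (rule sum_mono)
   fix g assume g: "g : G"
   have "norm (g x) <= \<bar>C\<bar>" using x g by (auto simp: S_def)
   thus "norm (g (dua k * x)) <= norm (g (dua k)) * \<bar>C\<bar>"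
    unfolding Gmult[OF g dua(1)[OF k] Oi_L[OF xO]] norm_mult by (rule mult_left_mono) simp
  qed
  also have "... <= (\<Sum>k\<in>B. \<Sum>g\<in>G. norm (g (dua k)) * \<bar>C\<bar>)"
   using k Bfin by (intro member_le_sum[of k B "%k. \<Sum>g\<in>G. norm (g (dua k)) * \<bar>C\<bar>"]) (auto simp: sum_nonneg)
  also have "... <= of_int K" by (simp add: K_def)
  finally have "norm (Tr (dua k * x)) <= of_int K" .
  hence "norm (of_int \<lfloor>Re (Tr (dua k * x))\<rfloor> :: complex) <= of_int K" by (simp only: t[OF xO k])
  thus ?thesis by (simp add: norm_of_int)
 qed
 have "F ` S <= (\<Pi>\<^sub>E k\<in>B. {-K..K})"
 proof
  fix y assume "y : F ` S"
  then obtain x where x: "x : S" "y = F x" by blast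
  have "\<lfloor>Re (Tr (dua k * x))\<rfloor> : {-K..K}" if "k : B" for k using b[OF x(1) that] by (auto simp: abs_le_iff)
  thus "y : (\<Pi>\<^sub>E k\<in>B. {-K..K})" unfolding x(2) F_def by auto
 qed
 hence "finite (F ` S)" by (rule finite_subset) (rule finite_PiE[OF Bfin finite_atLeastAtMost_int])
 moreover have "inj_on F S"
 proof (rule inj_onI)
  fix x y assume xy: "x : S" "y : S" "F x = F y"
  have xO: "x : Oi" "y : Oi" using xy by (auto simp: S_def)
  have "Tr (dua k * x) = Tr (dua k * y)" if k: "k : B" for k
  proof -
   have "F x k = F y k" by (simp only: xy(3))
   hence e: "\<lfloor>Re (Tr (dua k * x))\<rfloor> = \<lfloor>Re (Tr (dua k * y))\<rfloor>" using k by (simp add: F_def)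
   have "Tr (dua k * x) = of_int \<lfloor>Re (Tr (dua k * x))\<rfloor>" by (rule t[OF xO(1) k, symmetric])
   also have "... = Tr (dua k * y)" unfolding e by (rule t[OF xO(2) k])
   finally show ?thesis .
  qed
  hence "of_nat D * x = of_nat D * y"
   unfolding dual[OF Oi_L[OF xO(1)], folded Tr_def] dual[OF Oi_L[OF xO(2)], folded Tr_def] by simp
  thus "x = y" using Dpos by simp
 qed
 ultimately show ?thesis unfolding S_def[symmetric] by (rule finite_imageD)
qed

locale kumL = kum +
 assumes n1: "n = 1" and dp: "d = p" and p2: "odd p"
begin

lemma qp: "q = p" using n1 by (simp add: q_def)
lemma r1: "r = 1" using n1 by (simp add: r_pow)
lemma \<zeta>eta: "\<zeta> = eta"
proof -
 have "eta ^ r = eta" by (simp add: r1)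
 thus ?thesis unfolding \<zeta>_def .
qed
lemma ltq: "a < q \<longleftrightarrow> a < p" and modq: "a mod q = a mod p" by (simp_all add: qp)
lemma ltd: "a < d \<longleftrightarrow> a < p" and modd: "a mod d = a mod p" and lessd: "{..<d} = {..<p}" by (simp_all add: dp)
lemma A_eq: "A = {1..<p}"
proof (rule Set.set_eqI)
 fix a
 have "a : A \<longleftrightarrow> a < p & ~ p dvd a" unfolding A_def by (simp add: ltq)
 also have "... \<longleftrightarrow> a : {1..<p}" by (cases "a = 0") (auto dest: dvd_imp_le)
 finally show "a : A \<longleftrightarrow> a : {1..<p}" .
qed
lemma A_lt: "a : A ==> a < p" by (simp add: A_eq)
lemma Gk_iff: "g : Gk \<longleftrightarrow> (EX a:A. EX b<p. g = au a b)" unfolding Gk_def lessd by auto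

definition sg :: "complex => complex" where "sg = au 1 1"
definition NK :: "complex => complex" where "NK x = (\<Prod>b<p. au 1 b x)"
text \<open>The norm may be any p-th root of unity: \<open>torsion_count\<close> produces units
  whose norm is such a root and reads an exponent off it. The logarithms of the conjugates over K
  still sum to zero.\<close>

definition U :: "complex set"
 where "U = {u : nf.Oi. u ~= 0 & inverse u : nf.Oi & (EX k. NK u = eta ^ k)}"

lemma au_G: "a : A ==> b < p ==> au a b : Gk" by (auto simp: Gk_iff)
lemma sg_G: "sg : Gk" unfolding sg_def by (rule au_G[OF one_A p_gt])

lemma au_au:
 assumes "a : A" "b < p" "a' : A" "b' < p"
 shows "au a b (au a' b' x) = au (a * a' mod p) ((b + a * b') mod p) x"
 using fun_cong[OF au_comp[of a b a' b'], of x] assms by (simp only: ltd modd modq)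

lemma au_sg: "a : A ==> b < p ==> au a b (sg x) = au a ((b + a) mod p) x"
 unfolding sg_def using au_au[of a b 1 1 x] p_gt one_A A_lt[of a] by simp

lemma bij_shift: assumes a: "~ p dvd a" shows "bij_betw (%j. (b + j * a) mod p) {..<p} {..<p}"
proof -
 have "inj_on (%j. (b + j * a) mod p) {..<p}"
 proof (rule inj_onI)
  have *: "i = j" if "i <= j" "j < p" "(b + i * a) mod p = (b + j * a) mod p" for i j
  proof -
   have "p dvd (b + j * a) - (b + i * a)" 
    using that(3) mod_eq_dvd_iff_nat[of "b + i * a" "b + j * a" p] that(1) by simp
   hence "p dvd (j - i) * a" by (simp add: diff_mult_distrib)
   hence "p dvd j - i" using p a by (simp add: prime_dvd_mult_iff)
   hence "j - i = 0" using that(2) dvd_imp_le[of p "j - i"] by (cases "j - i = 0") auto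
   thus ?thesis using that(1) by simp
  qed
  fix i j assume "i : {..<p}" "j : {..<p}" "(b + i * a) mod p = (b + j * a) mod p"
  thus "i = j" using *[of i j] *[of j i] by (cases "i <= j") auto
 qed
 moreover have "(%j. (b + j * a) mod p) ` {..<p} <= {..<p}" using p_gt by auto
 ultimately show ?thesis unfolding bij_betw_def by (simp add: endo_inj_surj)
qed

lemma A_dvd: "a : A ==> ~ p dvd a" by (simp add: A_def)

lemma au_NK:
 assumes a: "a : A" and x: "x : Lf"
 shows "au a 0 (NK x) = (\<Prod>b<p. au a b x)"
proof -
 have "au a 0 (NK x) = (\<Prod>b<p. au a 0 (au 1 b x))"
  unfolding NK_def by (rule nf.Gprod[OF au_G[OF a]]) (use p_gt nf.GL[OF au_G[OF one_A] x] in auto)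
 also have "... = (\<Prod>b<p. au a ((0 + b * a) mod p) x)"
  using au_au[OF a _ one_A] A_lt[OF a] p_gt by (intro prod.cong refl) (simp add: mult.commute)
 also have "... = (\<Prod>b<p. au a b x)"
  by (rule prod.reindex_bij_betw[OF bij_shift[OF A_dvd[OF a]]])
 finally show ?thesis .
qed

lemma NK_mult: "x : Lf ==> y : Lf ==> NK (x * y) = NK x * NK y"
 unfolding NK_def prod.distrib[symmetric] using Lf_add(4) one_A by (intro prod.cong refl) (simp add: ltd)


lemma NK_inverse: "x : Lf ==> NK (inverse x) = inverse (NK x)"
 unfolding NK_def prod_inversef[symmetric] by (intro prod.cong refl) (use nf.Ginv[OF au_G[OF one_A]] in auto)

lemma NK_sg: "NK (sg x) = NK x"
proof -
 have "NK (sg x) = (\<Prod>b<p. au 1 ((b + 1) mod p) x)"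
  unfolding NK_def by (intro prod.cong refl) (use au_sg[OF one_A] in simp)
 also have "... = (\<Prod>b<p. au 1 b x)"
  using prod.reindex_bij_betw[OF bij_shift[of 1 1], of "%b. au 1 b x"] p_gt by (simp add: add.commute)
 finally show ?thesis by (simp add: NK_def)
qed

lemma U_Lf: "u : U ==> u : Lf" "u : U ==> u : nf.Oi" "u : U ==> u ~= 0"
 by (auto simp: U_def nf.Oi_L)

lemma eta_inv_pow: "inverse (eta ^ k) = eta ^ (k * (p - 1))"
proof -
 have "eta ^ k * eta ^ (k * (p - 1)) = (eta ^ p) ^ k"
  using p_gt by (simp flip: power_add power_mult add: algebra_simps)
 hence "eta ^ k * eta ^ (k * (p - 1)) = 1" using etaq by (simp add: qp)
 thus ?thesis by (rule inverse_unique)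
qed

lemma U_1: "1 : U"
 using nf.Oi_1 nf.G1[OF au_G[OF one_A]] by (auto simp: U_def NK_def intro!: exI[of _ 0])

lemma U_mult: assumes "u : U" "w : U" shows "u * w : U"
proof -
 obtain k l where "NK u = eta ^ k" "NK w = eta ^ l" using assms by (auto simp: U_def)
 hence "NK (u * w) = eta ^ (k + l)" using NK_mult U_Lf assms by (simp add: power_add)
 thus ?thesis using assms nf.Oi_mult by (auto simp: U_def)
qed

lemma U_inverse: assumes "u : U" shows "inverse u : U"
proof -
 obtain k where "NK u = eta ^ k" using assms by (auto simp: U_def)
 hence "NK (inverse u) = eta ^ (k * (p - 1))" using NK_inverse U_Lf assms eta_inv_pow by simp
 thus ?thesis using assms by (auto simp: U_def)
qed

lemma U_div: "u : U ==> w : U ==> u / w : U"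
 using U_mult U_inverse by (simp add: divide_inverse)

lemma U_sg: assumes "u : U" shows "sg u : U"
proof -
 have "sg u ~= 0" by (rule nf.Gne[OF sg_G U_Lf(1)[OF assms] U_Lf(3)[OF assms]])
 moreover have "inverse (sg u) = sg (inverse u)" by (rule nf.Ginv[OF sg_G U_Lf(1)[OF assms], symmetric])
 ultimately show ?thesis using assms nf.Oi_G[OF sg_G] NK_sg by (auto simp: U_def)
qed

definition lg :: "complex => (complex => complex) => real"
 where "lg u = (%g. if g : Gk then ln (norm (g u)) else 0)"
definition Dg :: "((complex => complex) => real) => (complex => complex) => real"
 where "Dg f = (%g. if g : Gk then f g - f (%x. g (sg x)) else 0)"
definition Ig where "Ig = (%(a,b). au a b) ` ({1..(p - 1) div 2} \<times> {..<p - 1})"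

lemma lg_div: assumes "u : U" "w : U" shows "lg (u / w) = lg u - lg w"
proof (rule ext)
 fix g show "lg (u / w) g = (lg u - lg w) g"
 proof (cases "g : Gk")
  case True
  have "g u ~= 0" "g w ~= 0" using nf.Gne[OF True] U_Lf assms by auto
  thus ?thesis using True nf.Gdiv[OF True] U_Lf assms by (simp add: lg_def norm_divide ln_div)
 qed (simp add: lg_def)
qed

lemma Dg_lg: assumes "u : U" shows "Dg (lg u) = lg (u / sg u)"
proof (rule ext)
 fix g show "Dg (lg u) g = lg (u / sg u) g"
 proof (cases "g : Gk")
  case True
  have "lg (u / sg u) g = lg u g - lg (sg u) g" using lg_div[OF assms U_sg[OF assms]] by simp
  thus ?thesis using True nf.Gcomp[OF True sg_G] by (simp add: Dg_def lg_def)
 qed (simp add: Dg_def lg_def)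
qed

lemma lg_row_sum: assumes u: "u : U" and a: "a : A" shows "(\<Sum>b<p. lg u (au a b)) = 0"
proof -
 obtain k where k: "NK u = eta ^ k" using u by (auto simp: U_def)
 have nz: "au a b u ~= 0" if "b < p" for b using nf.Gne[OF au_G[OF a that]] U_Lf u by auto
 have "(\<Prod>b<p. au a b u) = au a 0 (eta ^ k)" using au_NK[OF a U_Lf(1)[OF u]] k by simp
 also have "... = (eta ^ a) ^ k" using au_pow[OF Lf_eta(1) a d_pos] Lf_eta(2)[OF a d_pos] by simp
 finally have "norm (\<Prod>b<p. au a b u) = 1" by (simp add: norm_power norm_eta)
 hence "ln (\<Prod>b<p. norm (au a b u)) = 0" by (simp add: prod_norm)
 moreover have "ln (\<Prod>b<p. norm (au a b u)) = (\<Sum>b<p. ln (norm (au a b u)))"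
  by (rule ln_prod) (use nz in auto)
 ultimately show ?thesis using au_G[OF a] by (simp add: lg_def)
qed

lemma lg_eq_0_iff: assumes u: "u : U" shows "lg u = 0 \<longleftrightarrow> (ALL g:Gk. norm (g u) = 1)"
proof -
 have "ln (norm (g u)) = 0 \<longleftrightarrow> norm (g u) = 1" if "g : Gk" for g
  using nf.Gne[OF that U_Lf(1)[OF u] U_Lf(3)[OF u]] by (simp add: ln_eq_zero_iff)
 thus ?thesis unfolding lg_def fun_eq_iff by auto
qed

lemma GkE: assumes "g : Gk" obtains a b where "a : A" "b < p" "g = au a b"
 using assms Gk_iff by blast

text \<open>A vector fixed by \<sigma> is constant along each row, since repeated addition of
  \<open>a\<close> reaches every residue modulo \<open>p\<close>; its row sums vanish.\<close>

lemma Dg_inj: assumes u: "u : U" and z: "Dg (lg u) = 0" shows "lg u = 0"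
proof (rule ext)
 fix g show "lg u g = 0 g"
 proof (cases "g : Gk")
  case True
  obtain a b where ab: "a : A" "b < p" "g = au a b" using GkE[OF True] .
  have st: "lg u (au a b) = lg u (au a ((b + a) mod p))" if b: "b < p" for b
  proof -
   have "Dg (lg u) (au a b) = 0" using z by simp
   moreover have "(%x. au a b (sg x)) = au a ((b + a) mod p)" by (rule ext) (rule au_sg[OF ab(1) b])
   ultimately show ?thesis using au_G[OF ab(1) b] by (simp add: Dg_def)
  qed
  have stj: "lg u (au a ((b + j * a) mod p)) = lg u (au a b)" for j
  proof (induction j)
   case 0 thus ?case using ab by simp
  next
   case (Suc j)
   have "((b + j * a) mod p + a) mod p = (b + Suc j * a) mod p" unfolding mod_add_left_eq by (simp add: algebra_simps)
   thus ?case using st[of "(b + j * a) mod p"] Suc p_gt by simp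
  qed
  have "(\<Sum>j<p. lg u (au a ((b + j * a) mod p))) = (\<Sum>b<p. lg u (au a b))"
   by (rule sum.reindex_bij_betw[OF bij_shift[OF A_dvd[OF ab(1)]]])
  hence "real p * lg u (au a b) = 0" unfolding stj lg_row_sum[OF u ab(1)] by simp
  thus ?thesis using p_gt ab(3) by simp
 qed (simp add: lg_def)
qed

end


context kum begin

lemma Lf_decomp:
 assumes x: "x : Lf"
 shows "EX c m. m > 0 & x = (\<Sum>j<d. I.ev eta (c j) * \<alpha> ^ j) / of_nat m &
  (ALL a:A. ALL b<d. au a b x = (\<Sum>j<d. I.ev (eta ^ a) (c j) * (\<zeta> ^ b * \<alpha>) ^ j) / of_nat m)"
proof -
 obtain f m where f: "m > 0" "x = Z eta \<alpha> f / of_nat m" using LfE[OF x] .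
 obtain c where c: "ALL x y. y ^ d = of_nat N --> Z x y f = (\<Sum>j<d. I.ev x (c j) * y ^ j)" using Z_reduce ..
 show ?thesis
 proof (intro exI conjI ballI allI impI)
  show "m > 0" by fact
  show "x = (\<Sum>j<d. I.ev eta (c j) * \<alpha> ^ j) / of_nat m" using f(2) c \<alpha>d by simp
  fix a b assume ab: "a : A" "b < d"
  have "(\<zeta> ^ b * \<alpha>) ^ d = of_nat N" using \<zeta>d[OF ab(2)] \<alpha>d by (simp add: power_mult_distrib)
  thus "au a b x = (\<Sum>j<d. I.ev (eta ^ a) (c j) * (\<zeta> ^ b * \<alpha>) ^ j) / of_nat m"
   unfolding f(2) au_eq[OF ab f(1)] using c by simp
 qed
qed

text \<open>\<sigma> multiplies the coefficient of \<open>\<alpha> ^ j\<close> by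
  \<open>\<zeta> ^ j\<close>, so by independence only the term with j = 0 of a fixed element
  survives.\<close>

lemma \<alpha>_free_if_fixed:
 assumes x: "x : Lf" and fx: "d = p ==> au 1 1 x = x"
 obtains f m where "m > 0" "x = I.ev eta f / of_nat m"
proof -
 obtain c m where c: "m > 0" "x = (\<Sum>j<d. I.ev eta (c j) * \<alpha> ^ j) / of_nat m"
  and ac: "ALL a:A. ALL b<d. au a b x = (\<Sum>j<d. I.ev (eta ^ a) (c j) * (\<zeta> ^ b * \<alpha>) ^ j) / of_nat m"
  using Lf_decomp[OF x] by (elim exE conjE)
 have z: "I.ev eta (c j) = 0" if j: "0 < j" "j < d" for j
 proof -
  have dp: "d = p" using d j by auto
  have "au 1 1 x = (\<Sum>j<d. I.ev (eta ^ 1) (c j) * (\<zeta> ^ 1 * \<alpha>) ^ j) / of_nat m"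
   by (rule ac[rule_format, OF one_A]) (use dp p_gt in simp)
  hence "(\<Sum>j<d. I.ev eta (c j) * (\<zeta> * \<alpha>) ^ j) = (\<Sum>j<d. I.ev eta (c j) * \<alpha> ^ j)"
   using fx[OF dp] c by simp
  hence "(\<Sum>j<d. I.ev eta (c j) * (\<zeta> * \<alpha>) ^ j - I.ev eta (c j) * \<alpha> ^ j) = 0"
   by (simp only: sum_subtractf diff_self)
  moreover have K: "I.ev eta (c j * (Polynomial.monom 1 (r * j) - 1)) = I.ev eta (c j) * (\<zeta> ^ j - 1)" for j
  proof -
   have "I.ev eta (Polynomial.monom 1 (r * j) - 1) + I.ev eta 1 = \<zeta> ^ j"
    unfolding I.ev_add[symmetric] by (simp add: I.ev_monom \<zeta>_def power_mult)
   hence "I.ev eta (Polynomial.monom 1 (r * j) - 1) = \<zeta> ^ j - 1" unfolding I.ev_1 by (simp only: eq_diff_eq)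
   thus ?thesis unfolding I.ev_mult by simp
  qed
  ultimately have "(\<Sum>j<d. I.ev eta (c j * (Polynomial.monom 1 (r * j) - 1)) * \<alpha> ^ j) = 0"
   unfolding K by (simp add: algebra_simps power_mult_distrib)
  hence "I.ev eta (c j * (Polynomial.monom 1 (r * j) - 1)) = 0" by (rule indep) (rule j(2))
  moreover have "\<zeta> ^ j ~= 1" using \<zeta>_pow_1_iff j dp by (auto dest: dvd_imp_le)
  ultimately show ?thesis
   using K[of j] by simp
 qed
 have "{..<d} = insert 0 {0<..<d}" using d_pos by auto
 hence "(\<Sum>j<d. I.ev eta (c j) * \<alpha> ^ j) = I.ev eta (c 0) + (\<Sum>j\<in>{0<..<d}. I.ev eta (c j) * \<alpha> ^ j)" by simp
 also have "(\<Sum>j\<in>{0<..<d}. I.ev eta (c j) * \<alpha> ^ j) = 0" by (rule sum.neutral) (use z in auto)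
 finally show ?thesis using that[of m "c 0"] c by simp
qed

end

lemma (in cyc) root_unity_pow:
 assumes "w ^ q = 1" shows "EX k<q. w = eta ^ k"
proof -
 have "(%k. eta ^ k) ` {..<q} <= {z. z ^ q = 1}"
 proof safe
  fix k have "(eta ^ k) ^ q = (eta ^ q) ^ k" by (simp add: mult.commute flip: power_mult)
  thus "(eta ^ k) ^ q = 1" by (simp add: etaq)
 qed
 moreover have "finite {z::complex. z ^ q = 1}" using q_pos by (intro finite_roots_unity) simp
 moreover have "card {z::complex. z ^ q = 1} = card ((%k. eta ^ k) ` {..<q})"
  using card_roots_unity_eq[of q] q_pos card_image[OF eta_inj] by simp
 ultimately have "(%k. eta ^ k) ` {..<q} = {z. z ^ q = 1}" using card_subset_eq by metis
 thus ?thesis using assms by auto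
qed

context kumL begin

text \<open>Complex conjugation sends \<open>eta ^ a\<close> to \<open>eta ^ (p - a)\<close> and the
  chosen p-th root of \<open>N\<close> to another one, so it permutes the embeddings
  \<open>au a b\<close>. The root \<alpha> is not assumed to be real, which is why \<open>b'\<close>
  is only shown to exist.\<close>

lemma norm_conj:
 assumes a: "a : A" and b: "b < p"
 obtains b' where "b' < p" "!!x. x : Lf ==> norm (au a b x) = norm (au (p - a) b' x)"
proof -
 have a': "p - a : A" and ap: "a < p" using a by (auto simp: A_eq)
 have ce: "cnj (eta ^ a) = eta ^ (p - a)"
 proof -
  have "eta ^ a * eta ^ (p - a) = eta ^ p" using ap by (simp flip: power_add)
  also have "... = 1" using etaq unfolding qp .
  finally have "eta ^ (p - a) = inverse (eta ^ a)" by (rule inverse_unique[symmetric])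
  moreover have "eta ^ a * cnj (eta ^ a) = of_real ((cmod (eta ^ a))\<^sup>2)" by (simp only: complex_norm_square)
  hence "eta ^ a * cnj (eta ^ a) = 1" by (simp only: norm_power norm_eta power_one of_real_1)
  hence "cnj (eta ^ a) = inverse (eta ^ a)" by (rule inverse_unique[symmetric])
  ultimately show ?thesis by simp
 qed
 have "(cnj (\<zeta> ^ b * \<alpha>) / \<alpha>) ^ q = 1"
 proof -
  have z1: "\<zeta> ^ p = 1" by (rule \<zeta>p)
  have "(\<zeta> ^ b * \<alpha>) ^ p = (\<zeta> ^ p) ^ b * \<alpha> ^ p"
   by (simp add: power_mult_distrib mult.commute flip: power_mult)
  also have "... = of_nat N" unfolding z1 using \<alpha>d unfolding dp by simp
  finally have "(cnj (\<zeta> ^ b * \<alpha>)) ^ p = of_nat N"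
   using complex_cnj_power[of "\<zeta> ^ b * \<alpha>" p] by simp
  moreover have "\<alpha> ^ p = of_nat N" using \<alpha>d unfolding dp .
  ultimately show ?thesis unfolding qp power_divide using Nprime by (auto simp: prime_gt_0_nat)
 qed
 then obtain c where c: "c < q" "cnj (\<zeta> ^ b * \<alpha>) / \<alpha> = eta ^ c" using root_unity_pow by blast
 have cp: "c < p" using c(1) unfolding qp .
 have cc: "cnj (\<zeta> ^ b * \<alpha>) = \<zeta> ^ c * \<alpha>" using c(2) \<alpha>_ne0 unfolding \<zeta>eta by (simp add: field_simps)
 have ci: "cnj (I.ev x f) = I.ev (cnj x) f" for x f
  by (induction f) (auto simp: I.ev_0 I.ev_pCons)
 have cZ: "cnj (Z x y f) = Z (cnj x) (cnj y) f" for x y f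
  by (induction f) (auto simp: E.ev_0 E.ev_pCons ci)
 show ?thesis
 proof
  show "c < p" by fact
  fix x assume "x : Lf"
  then obtain f m where f: "m > 0" "x = Z eta \<alpha> f / of_nat m" using LfE by blast
  have bd: "b < d" "c < d" using b cp unfolding dp by auto
  have "au (p - a) c x = cnj (au a b x)"
   unfolding f(2) au_eq[OF a bd(1) f(1)] au_eq[OF a' bd(2) f(1)] complex_cnj_divide cZ ce cc by simp
  thus "norm (au a b x) = norm (au (p - a) c x)" by simp
 qed
qed

lemma lg_conj: assumes a: "a : A" and b: "b < p"
 obtains b' where "b' < p" "!!u. u : U ==> lg u (au a b) = lg u (au (p - a) b')"
proof -
 obtain b' where b': "b' < p" "!!x. x : Lf ==> norm (au a b x) = norm (au (p - a) b' x)"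
  using norm_conj[OF a b] by blast
 have a': "p - a : A" using a by (auto simp: A_eq)
 show ?thesis
  by (rule that[OF b'(1)]) (simp add: lg_def au_G[OF a b] au_G[OF a' b'(1)] b'(2) U_Lf(1))
qed

lemma card_Ig: "card Ig = (p - 1) * ((p - 1) div 2)" and finite_Ig: "finite Ig"
proof -
 have "{1..(p - 1) div 2} \<times> {..<p - 1} <= A \<times> {..<d}" unfolding dp A_eq by auto
 hence "inj_on (%(a,b). au a b) ({1..(p - 1) div 2} \<times> {..<p - 1})" by (rule inj_on_subset[OF au_inj])
 thus "card Ig = (p - 1) * ((p - 1) div 2)" unfolding Ig_def by (simp add: card_image)
 show "finite Ig" unfolding Ig_def by simp
qed

text \<open>The dropped coordinate of a row is minus the sum of the other p - 1, and the rows beyond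
  the middle are reached by complex conjugation.\<close>

lemma lg_bound:
 assumes u: "u : U" and b: "ALL i:Ig. \<bar>lg u i\<bar> <= 1" and g: "g : Gk"
 shows "lg u g <= real p"
proof -
 have small: "\<bar>lg u (au a b)\<bar> <= real p" if a: "1 <= a" "a <= (p - 1) div 2" and bp: "b < p" for a b
 proof -
  have ab: "\<bar>lg u (au a j)\<bar> <= 1" if "j < p - 1" for j
   using b a that by (auto simp: Ig_def)
  have aA: "a : A" using a p_gt by (auto simp: A_eq)
  show ?thesis
  proof (cases "b < p - 1")
   case True thus ?thesis using ab[of b] p_gt by simp
  next
   case False
   hence bb: "b = p - 1" using bp by simp
   have "{..<p} = insert (p - 1) {..<p - 1}" using p_gt by auto
   hence "lg u (au a b) = - (\<Sum>j<p - 1. lg u (au a j))"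
    using lg_row_sum[OF u aA] bb by simp
   hence "\<bar>lg u (au a b)\<bar> <= (\<Sum>j<p - 1. \<bar>lg u (au a j)\<bar>)" using sum_abs[of "%j. lg u (au a j)" "{..<p - 1}"] by simp
   also have "... <= (\<Sum>j<p - 1. 1)" by (rule sum_mono) (use ab in auto)
   also have "... <= real p" by simp
   finally show ?thesis .
  qed
 qed
 obtain a b where ab: "a : A" "b < p" "g = au a b" using GkE[OF g] .
 show ?thesis
 proof (cases "a <= (p - 1) div 2")
  case True thus ?thesis using small[of a b] ab by (auto simp: A_eq)
 next
  case False
  obtain b' where "b' < p" "lg u (au a b) = lg u (au (p - a) b')" using lg_conj[OF ab(1,2)] u by blast
  moreover have "p - a <= (p - 1) div 2" using False p2 by presburger
  moreover have "1 <= p - a" using ab(1) by (auto simp: A_eq)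
  ultimately show ?thesis using small[of "p - a" b'] ab(3) by simp
 qed
qed

lemma finite_lg: "finite {f : lg ` U. ALL i:Ig. \<bar>f i\<bar> <= 1}"
proof (rule finite_subset)
 show "{f : lg ` U. ALL i:Ig. \<bar>f i\<bar> <= 1} <= lg ` {x : nf.Oi. ALL g:Gk. norm (g x) <= exp (real p)}"
 proof safe
  fix u assume u: "u : U" and b: "ALL i:Ig. \<bar>lg u i\<bar> <= 1"
  have "norm (g u) <= exp (real p)" if g: "g : Gk" for g
  proof -
   have "ln (norm (g u)) <= real p" using lg_bound[OF u b g] g by (simp add: lg_def)
   moreover have "norm (g u) > 0" using nf.Gne[OF g U_Lf(1)[OF u] U_Lf(3)[OF u]] by simp
   ultimately show ?thesis using ln_le_cancel_iff[of "norm (g u)" "exp (real p)"] by simp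
  qed
  thus "lg u : lg ` {x : nf.Oi. ALL g:Gk. norm (g x) <= exp (real p)}" using U_Lf(2)[OF u] by blast
 qed
 show "finite (lg ` {x : nf.Oi. ALL g:Gk. norm (g x) <= exp (real p)})"
  by (intro finite_imageI nf.finite_bounded_conjugates)
qed

section \<open>Integer polynomials in \<sigma> acting on logarithms\<close>

definition Sh :: "((complex => complex) => real) => (complex => complex) => real"
 where "Sh f = (%g. if g : Gk then f (%x. g (sg x)) else 0)"
text \<open>The variable acts as the shift by \<sigma>. By \<open>act_\<Phi>\<close> the logarithms
  become a module over the integer polynomials modulo \<open>\<Phi>\<close>, that is, over the ring
  of integers of K.\<close>

definition act :: "int poly => ((complex => complex) => real) => (complex => complex) => real"
 where "act h f = fold_coeffs (%a F g. of_int a * f g + Sh F g) h (%g. 0)"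

lemma act_0: "act 0 f = (%g. 0)" by (simp add: act_def)
lemma act_pCons: "act (pCons a h) f = (%g. of_int a * f g + Sh (act h f) g)"
 by (cases "a = 0 & h = 0") (auto simp: act_def Sh_def fun_eq_iff)
lemma Sh_add: "Sh (%g. f g + f' g) = (%g. Sh f g + Sh f' g)" by (auto simp: Sh_def)
lemma Sh_scale: "Sh (%g. c * f g) = (%g. c * Sh f g)" by (auto simp: Sh_def)
lemma Sh_0: "Sh (%g. 0) = (%g. 0)" by (auto simp: Sh_def)

lemma act_add: "act (h + k) f = (%g. act h f g + act k f g)"
 by (induction h k rule: poly_induct2) (auto simp: act_0 act_pCons Sh_add algebra_simps)

lemma act_smult: "act (Polynomial.smult a h) f = (%g. of_int a * act h f g)"
 by (induction h) (auto simp: act_0 act_pCons Sh_scale algebra_simps)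

lemma act_mult: "act (h * k) f = act h (act k f)"
proof (induction h)
 case 0 thus ?case by (simp add: act_0)
next
 case (pCons a h)
 have "act (pCons a h * k) f = (%g. of_int a * act k f g + Sh (act (h * k) f) g)"
  by (simp add: mult_pCons_left act_add act_smult act_pCons)
 thus ?case by (simp add: act_pCons pCons)
qed

lemma act_zero: "act h (%g. 0) = (%g. 0)" by (induction h) (auto simp: act_0 act_pCons Sh_0)

lemma act_monom: "act (Polynomial.monom 1 k) f = (Sh ^^ k) f"
 by (induction k) (auto simp: monom_Suc act_pCons monom_0 act_0 Sh_0)

lemma act_sum: "act (sum F S) f = (%g. \<Sum>i\<in>S. act (F i) f g)"
 by (induction S rule: infinite_finite_induct) (auto simp: act_0 act_add)

lemma Sh_lg: assumes "u : U" shows "Sh (lg u) = lg (sg u)"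
 using nf.Gcomp[OF _ sg_G] by (auto simp: Sh_def lg_def)

lemma lg_1: "lg 1 = (%g. 0)" by (auto simp: lg_def fun_eq_iff nf.G1)

lemma lg_mult: assumes "u : U" "w : U" shows "lg (u * w) = (%g. lg u g + lg w g)"
proof -
 have "u * w = u / inverse w" by (simp add: divide_inverse)
 moreover have "lg (inverse w) = lg 1 - lg w" using lg_div[OF U_1 assms(2)] by (simp add: inverse_eq_divide)
 ultimately show ?thesis using lg_div[OF assms(1) U_inverse[OF assms(2)]] by (auto simp: lg_1)
qed

lemma act_scale_lg: assumes u: "u : U" shows "EX w:U. (%g. of_int a * lg u g) = lg w"
proof -
 have n: "EX w:U. (%g. of_nat k * lg v g) = lg w" if v: "v : U" for v k
 proof (induction k)
  case 0 show ?case by (rule bexI[of _ 1]) (auto simp: lg_1 U_1)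
 next
  case (Suc k)
  then obtain w where w: "w : U" "(%g. of_nat k * lg v g) = lg w" by blast
  have "lg (v * w) = (%g. of_nat (Suc k) * lg v g)" unfolding lg_mult[OF v w(1)] w(2)[symmetric] by (auto simp: algebra_simps)
  thus ?case using U_mult[OF v w(1)] by (metis (no_types))
 qed
 have i: "lg (inverse u) = (%g. - lg u g)" using lg_div[OF U_1 u] by (auto simp: inverse_eq_divide lg_1)
 show ?thesis
 proof (cases "a >= 0")
  case True thus ?thesis using n[OF u, of "nat a"] by simp
 next
  case False thus ?thesis using n[OF U_inverse[OF u], of "nat (- a)"] unfolding i by simp
 qed
qed

lemma act_lg: assumes u: "u : U" shows "EX w:U. act h (lg u) = lg w"
proof (induction h)
 case 0 show ?case by (rule bexI[of _ 1]) (auto simp: lg_1 U_1 act_0)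
next
 case (pCons a h)
 then obtain w where w: "w : U" "act h (lg u) = lg w" by blast
 obtain v where v: "v : U" "(%g. of_int a * lg u g) = lg v" using act_scale_lg[OF u] by blast
 have "act (pCons a h) (lg u) = (%g. lg v g + lg (sg w) g)"
  unfolding act_pCons w(2) Sh_lg[OF w(1)] v(2)[symmetric] ..
 also have "... = lg (v * sg w)" by (rule lg_mult[OF v(1) U_sg[OF w(1)], symmetric])
 finally show ?case using U_mult[OF v(1) U_sg[OF w(1)]] by blast
qed

lemma act_D: assumes u: "u : U" shows "act ([:1, -1:] ^ k) (lg u) = (Dg ^^ k) (lg u)"
 using u
proof (induction k)
 case 0
 show ?case unfolding power_0 one_pCons act_pCons by (auto simp: act_0 Sh_0)
next
 case (Suc k)
 obtain w where w: "w : U" "act ([:1,-1:] ^ k) (lg u) = lg w" using act_lg[OF u] by blast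
 have "act [:1,-1:] (lg w) = Dg (lg w)"
 proof (rule ext)
  fix g show "act [:1,-1:] (lg w) g = Dg (lg w) g"
   by (cases "g : Gk") (auto simp: act_pCons act_0 Sh_0 Dg_def, auto simp: Sh_def lg_def)
 qed
 thus ?case unfolding power_Suc act_mult w(2) using Suc.IH[OF u] w(2) by simp
qed

lemma act_\<Phi>: assumes u: "u : U" shows "act \<Phi> (lg u) = (%g. 0)"
proof (rule ext)
 fix g
 have pw: "EX w:U. (Sh ^^ k) (lg u) = lg w" for k
  using act_lg[OF u, of "Polynomial.monom 1 k"] unfolding act_monom .
 have e: "act \<Phi> (lg u) g = (\<Sum>k<p. (Sh ^^ k) (lg u) g)"
 proof -
  have rk: "r * k = k" for k by (simp only: r1 mult_1)
  show ?thesis unfolding \<Phi>_def act_sum rk act_monom ..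
 qed
 show "act \<Phi> (lg u) g = 0"
 proof (cases "g : Gk")
  case True
  then obtain a b where ab: "a : A" "b < p" "g = au a b" using GkE by blast
  have sh: "(Sh ^^ k) F (au a b) = F (au a ((b + k * a) mod p))" if "b < p" for k F b
   using that
  proof (induction k arbitrary: b)
   case 0 thus ?case by simp
  next
   case (Suc k)
   have "(%x. au a b (sg x)) = au a ((b + a) mod p)" by (rule ext) (rule au_sg[OF ab(1) Suc.prems])
   moreover have "((b + a) mod p + k * a) mod p = (b + Suc k * a) mod p" unfolding mod_add_left_eq by (simp add: algebra_simps)
   ultimately show ?case using Suc.IH[of "(b + a) mod p"] Suc.prems au_G[OF ab(1) Suc.prems] p_gt by (simp add: Sh_def)
  qed
  have "(\<Sum>k<p. lg u (au a ((b + k * a) mod p))) = (\<Sum>b<p. lg u (au a b))"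
   by (rule sum.reindex_bij_betw[OF bij_shift[OF A_dvd[OF ab(1)]]])
  moreover have "act \<Phi> (lg u) g = (\<Sum>k<p. lg u (au a ((b + k * a) mod p)))"
   using e unfolding ab(3) sh[OF ab(2)] .
  ultimately show ?thesis using lg_row_sum[OF u ab(1)] by simp
 next
  case False
  have "(Sh ^^ k) (lg u) g = 0" for k using pw[of k] False by (auto simp: lg_def)
  thus ?thesis unfolding e by simp
 qed
qed

text \<open>At \<open>eta\<close> this is the factorisation of \<open>p\<close> as the product of
  all \<open>1 - eta ^ a\<close>, each of which is a multiple of \<open>1 - eta\<close>; the
  difference of the two sides as polynomials is then a multiple of \<open>\<Phi>\<close>.\<close>

lemma p_eq_power_D: "EX V u. [:int p:] = [:1,-1:] ^ (p - 1) * V + u * \<Phi>"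
proof -
 define V :: "int poly" where "V = (\<Prod>a\<in>A. \<Sum>k<a. Polynomial.monom 1 k)"
 have evp: "I.ev eta (prod F S) = (\<Prod>i\<in>S. I.ev eta (F i))" for F :: "nat => int poly" and S
  by (induction S rule: infinite_finite_induct) (auto simp: I.ev_1 I.ev_mult)
 have evk: "I.ev eta (F ^ k) = I.ev eta F ^ k" for F k by (induction k) (auto simp: I.ev_1 I.ev_mult)
 have cA: "card A = p - 1" by (simp add: A_eq)
 have "I.ev eta ([:1,-1:] ^ (p - 1) * V) = lm ^ card A * (\<Prod>a\<in>A. \<Sum>k<a. eta ^ k)"
  unfolding V_def I.ev_mult evp evk cA
  by (simp add: I.ev_sum I.ev_monom lm_def I.ev_pCons I.ev_0)
 also have "... = of_nat p" unfolding prod_p[symmetric] by (simp add: one_minus_dvd prod.distrib)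
 finally have e: "I.ev eta ([:1,-1:] ^ (p - 1) * V) = of_nat p" .
 have "I.ev eta ([:int p:] - [:1,-1:] ^ (p - 1) * V) + I.ev eta ([:1,-1:] ^ (p - 1) * V) = of_nat p"
  unfolding I.ev_add[symmetric] by (simp add: I.ev_pCons I.ev_0)
 hence "I.ev eta ([:int p:] - [:1,-1:] ^ (p - 1) * V) = 0" unfolding e by simp
 then obtain u where "[:int p:] - [:1,-1:] ^ (p - 1) * V = \<Phi> * u" by (rule ev_zero_dvd)
 hence "[:int p:] = [:1,-1:] ^ (p - 1) * V + u * \<Phi>" by (simp add: algebra_simps)
 thus ?thesis by blast
qed

lemma p_lg: assumes u: "u : U" shows "EX e:U. (%g. real p * lg u g) = (Dg ^^ (p - 1)) (lg e)"
proof -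
 obtain V w where Vw: "[:int p:] = [:1,-1:] ^ (p - 1) * V + w * \<Phi>" using p_eq_power_D by blast
 obtain e where e: "e : U" "act V (lg u) = lg e" using act_lg[OF u] by blast
 have "(%g. real p * lg u g) = act [:int p:] (lg u)" by (auto simp: act_pCons act_0 Sh_0)
 also have "... = (Dg ^^ (p - 1)) (lg e)"
  unfolding Vw act_add act_mult act_\<Phi>[OF u] act_zero e(2) act_D[OF e(1)] by simp
 finally show ?thesis using e(1) by blast
qed

lemma lattice: "real_lattice (lg ` U) Dg Ig p (p - 1) ((p - 1) div 2)"
proof
 show "0 : lg ` U" by (rule image_eqI[of _ _ 1]) (auto simp: lg_1 U_1)
 show "f - g : lg ` U" if "f : lg ` U" "g : lg ` U" for f g
  using that lg_div[symmetric] U_div by auto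
 show "Dg f : lg ` U" if "f : lg ` U" for f
  using that Dg_lg U_div U_sg by auto
 show "Dg (f - g) = Dg f - Dg g" for f g by (auto simp: Dg_def)
 show "f = 0" if "f : lg ` U" "Dg f = 0" for f using that Dg_inj by auto
 show "EX e:lg ` U. (%g. real p * f g) = (Dg ^^ (p - 1)) e" if "f : lg ` U" for f
  using that p_lg by auto
qed (use p_gt card_Ig finite_Ig finite_lg in auto)

end


section \<open>Torsion units and the index of the units u / \<sigma> u\<close>

context cyc begin

lemma I_ev_power: "I.ev x (f ^ k) = I.ev x f ^ k"
 by (induction k) (auto simp: I.ev_1 I.ev_mult)

text \<open>Otherwise a power \<open>y\<close> of the given root satisfies
  \<open>y ^ p = eta\<close>, so it is a primitive root of unity of order p^2 in K. Then an integer
  multiple of \<open>y\<close> is a polynomial in \<open>y ^ p\<close>, a relation of degree below p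
  * (p - 1), which must be trivial. But the right side has no linear term, as its derivative at 0
  shows.\<close>

lemma p_power_root_free:
 assumes n1: "n = 1" and m: "m > (0::nat)" and x: "(I.ev eta f / of_nat m) ^ p = eta ^ k"
 shows "p dvd k"
proof (rule ccontr)
 assume k: "~ p dvd k"
 have qp: "q = p" using n1 by (simp add: q_def)
 have r1: "r = 1" using n1 by (simp add: r_pow)
 have "coprime k p" using prime_imp_coprime[OF p k] by (simp add: coprime_commute)
 then obtain j where j: "[k * j = 1] (mod p)" by (metis cong_solve_coprime_nat One_nat_def)
 have etam: "eta ^ i = eta ^ (i mod p)" for i
 proof -
  have "eta ^ i = eta ^ (p * (i div p) + i mod p)" by simp
  thus ?thesis using etaq unfolding qp by (simp only: power_add power_mult power_one mult_1)
 qed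
 define y where "y = (I.ev eta f / of_nat m) ^ j"
 have "y ^ p = eta ^ (k * j)" unfolding y_def by (simp add: x power_mult[symmetric] mult.commute[of j]) (simp add: x power_mult)
 also have "... = eta ^ 1" unfolding etam[of "k * j"] etam[of 1] using j by (simp add: cong_def)
 finally have yp: "y ^ p = eta" by simp
 interpret C: cyc p 2 "p ^ 2" p y
 proof
  show "y ^ p\<^sup>2 = 1" using yp etaq unfolding qp by (simp add: power2_eq_square power_mult)
  have "eta ^ r ~= 1" by (rule etar)
  thus "y ^ p ~= 1" unfolding yp r1 by simp
 qed (use p in auto)
 have y2: "of_nat (m ^ j) * y = I.ev eta (f ^ j)" unfolding y_def I_ev_power power_divide using m by simp
 have cA: "card A = p - 1" using card_A r1 by simp
 obtain u s where us: "f ^ j = \<Phi> * u + s" "pdeg s < pdeg \<Phi>"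
  using monic_division[OF lead_\<Phi>, of "f ^ j"] \<Phi>_degree card_A_pos by auto
 have "1 : A" using q_pos p_gt by (simp add: A_def)
 hence "I.ev eta \<Phi> = 0" using \<Phi>_root[of 1] by simp
 hence ys: "of_nat (m ^ j) * y = I.ev eta s" using y2 us(1) by (simp add: I.ev_add I.ev_mult)
 define G where "G = [:0, int (m ^ j):] - pcompose s (Polynomial.monom 1 p)"
 have "I.ev y G + I.ev y (pcompose s (Polynomial.monom 1 p)) = of_nat (m ^ j) * y"
  unfolding I.ev_add[symmetric] G_def by (simp add: I.ev_pCons I.ev_0 mult.commute)
 hence "I.ev y G = 0" unfolding ev_pcompose I.ev_monom using ys yp by simp
 moreover have "pdeg G < card C.A"
 proof -
  have CA: "card C.A = p * (p - 1)" by (rule C.card_A)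
  have p2: "p >= 3 \<or> p = 2" using p_gt by linarith
  have ds: "pdeg s <= p - 2" using us(2) by (simp add: \<Phi>_degree cA)
  have "pdeg (pcompose s (Polynomial.monom 1 p)) = pdeg s * p"
   by (simp add: degree_pcompose degree_monom_eq)
  also have "... <= (p - 2) * p" using ds by simp
  also have "... < p * (p - 1)" using p_gt by (simp add: mult.commute)
  finally have a: "pdeg (pcompose s (Polynomial.monom 1 p)) < p * (p - 1)" .
  have b: "pdeg [:0, int (m ^ j):] < p * (p - 1)"
  proof -
   have "1 * 1 < p * (p - 1)" using p_gt p2 by (intro mult_less_le_imp_less) auto
   thus ?thesis by (rule le_less_trans[rotated]) simp
  qed
  show ?thesis unfolding CA G_def using degree_diff_le_max[of "[:0, int (m ^ j):]" "pcompose s (Polynomial.monom 1 p)"] a b by linarith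
 qed
 ultimately have "G = 0" by (intro C.ev_small_zero)
 hence "[:0, int (m ^ j):] = pcompose s (Polynomial.monom 1 p)" by (simp add: G_def)
 hence "pderiv [:0, int (m ^ j):] = pderiv (pcompose s (Polynomial.monom 1 p))" by simp
 hence "poly.coeff (pderiv [:0, int (m ^ j):]) 0 = 0"
  using p_gt by (simp add: pderiv_pcompose pderiv_monom coeff_mult_0)
 thus False using m by (simp add: pderiv_pCons)
qed

end

context kumL begin

lemma eta_p: "eta ^ p = 1" using etaq unfolding qp .

lemma eta_pow_eq_1_iff: "eta ^ k = 1 \<longleftrightarrow> p dvd k" using eta_pow_1_iff[of k] unfolding qp .

lemma root_unity: "w ^ p = 1 ==> EX k<p. w = eta ^ k" using root_unity_pow[of w] unfolding qp .

lemma fixed_all: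
 assumes x: "x : Lf" and fx: "sg x = x" and b: "b < p"
 shows "au 1 b x = x"
 using b
proof (induction b)
 case 0 show ?case by (rule au_id[OF x])
next
 case (Suc b)
 have "au 1 b (sg x) = au 1 ((b + 1) mod p) x" using Suc.prems by (intro au_sg[OF one_A]) simp
 thus ?case using Suc fx by simp
qed

lemma NK_fixed: assumes "x : Lf" "sg x = x" shows "NK x = x ^ p"
 unfolding NK_def using fixed_all[OF assms] by simp

lemma fixed_K: assumes "x : Lf" "sg x = x" obtains f m where "m > 0" "x = I.ev eta f / of_nat m"
 by (rule \<alpha>_free_if_fixed[OF assms(1)]) (use assms(2) in \<open>auto simp: sg_def\<close>)

text \<open>A fixed unit lies in K and its norm is its p-th power. By
  \<open>p_power_root_free\<close> the only root of unity of order dividing \<open>p\<close> that is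
  a p-th power in K is 1.\<close>

lemma U_fixed: assumes u: "u : U" and fx: "sg u = u" and t: "lg u = 0" shows "EX k<p. u = eta ^ k"
proof -
 obtain k where k: "NK u = eta ^ k" using u by (auto simp: U_def)
 obtain f m where f: "m > 0" "u = I.ev eta f / of_nat m" using fixed_K[OF U_Lf(1)[OF u] fx] .
 have up: "u ^ p = eta ^ k" using NK_fixed[OF U_Lf(1)[OF u] fx] k by simp
 have "p dvd k" by (rule p_power_root_free[OF n1 f(1)]) (use up f(2) in simp)
 hence "u ^ p = 1" using up eta_pow_eq_1_iff by simp
 thus ?thesis by (rule root_unity)
qed

definition Tor where "Tor = {u : U. lg u = 0}"
definition dD where "dD u = u / sg u"

lemma dD_U: "u : U ==> dD u : U" unfolding dD_def using U_div U_sg by blast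
lemma dD_div: "u : U ==> w : U ==> dD (u / w) = dD u / dD w"
 unfolding dD_def using nf.Gdiv[OF sg_G] U_Lf(1) by (simp add: field_simps)

lemma finite_Tor: "finite Tor"
proof (rule finite_subset)
 show "Tor <= {x : nf.Oi. ALL g:Gk. norm (g x) <= 1}"
  using lg_eq_0_iff U_Lf by (auto simp: Tor_def)
qed (rule nf.finite_bounded_conjugates)

lemma Tor_div: "u : Tor ==> w : Tor ==> u / w : Tor"
 using U_div lg_div by (auto simp: Tor_def)

text \<open>Two torsion units with the same value of \<open>dD\<close> differ by a fixed one, and by
  \<open>U_fixed\<close> there are at most \<open>p\<close> of those.\<close>

lemma card_Tor: "card Tor <= p * card (dD ` Tor)"
proof -
 have "card Tor = (\<Sum>y\<in>dD ` Tor. card {u : Tor. dD u = y})"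
  using sum.image_gen[OF finite_Tor, of "%_. 1::nat" dD] by simp
 also have "... <= (\<Sum>y\<in>dD ` Tor. p)"
 proof (rule sum_mono)
  fix y assume "y : dD ` Tor"
  then obtain t where t: "t : Tor" "y = dD t" by blast
  have tU: "t : U" using t by (simp add: Tor_def)
  have "{u : Tor. dD u = y} <= (%k. t * eta ^ k) ` {..<p}"
  proof safe
   fix u assume u: "u : Tor" "y = dD u"
   have uU: "u : U" using u by (simp add: Tor_def)
   have z: "t ~= 0" "u ~= 0" "sg u ~= 0" "sg t ~= 0" using U_Lf(3) tU uU U_sg by auto
   have "sg (u / t) = sg u / sg t" using nf.Gdiv[OF sg_G] U_Lf tU uU by simp
   also have "... = u / t" using t(2) u(2) z unfolding dD_def by (simp add: field_simps)
   finally have "EX k<p. u / t = eta ^ k"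
    using U_fixed[OF U_div[OF uU tU]] Tor_div[OF u(1) t(1)] by (simp add: Tor_def)
   thus "u : (%k. t * eta ^ k) ` {..<p}" using z by (auto simp: field_simps)
  qed
  hence "card {u : Tor. dD u = y} <= card ((%k. t * eta ^ k) ` {..<p})" by (intro card_mono) auto
  also have "... <= p" using card_image_le[of "{..<p}" "%k. t * eta ^ k"] by simp
  finally show "card {u : Tor. dD u = y} <= p" .
 qed
 finally show ?thesis by (simp add: mult.commute)
qed

lemma card_Tor_mod:
 assumes S: "finite S" "S <= Tor"
  and dist: "!!s t e. s : S ==> t : S ==> e : U ==> s / t = dD e ==> s = t"
 shows "card S <= p"
proof -
 have fin: "finite (dD ` Tor)" using finite_Tor by simp
 have sub: "(%(s,t). s * t) ` (S \<times> dD ` Tor) <= Tor"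
 proof safe
  fix s t assume st: "s : S" "t : Tor"
  have tU: "t : U" "lg t = 0" using st by (auto simp: Tor_def)
  have "lg (dD t) = Dg (lg t)" using Dg_lg[OF tU(1)] by (simp add: dD_def)
  also have "... = 0" using tU(2) by (auto simp: Dg_def)
  finally have d: "dD t : Tor" using dD_U[OF tU(1)] by (simp add: Tor_def)
  have "1 : Tor" using U_1 lg_1 by (auto simp: Tor_def)
  from Tor_div[OF this d] have "inverse (dD t) : Tor" by (simp add: inverse_eq_divide)
  from Tor_div[OF _ this, of s] st S have "s / inverse (dD t) : Tor" by auto
  thus "s * dD t : Tor" by (simp add: divide_inverse)
 qed
 have inj: "inj_on (%(s,t). s * t) (S \<times> dD ` Tor)"
 proof (rule inj_onI, clarify)
  fix s t s' t' assume h: "s : S" "t : Tor" "s' : S" "t' : Tor" "s * dD t = s' * dD t'"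
  have U: "t : U" "t' : U" "s : U" "s' : U" using h S by (auto simp: Tor_def)
  have nz: "s ~= 0" "s' ~= 0" "dD t ~= 0" "dD t' ~= 0" using U_Lf(3) U dD_U by auto
  have "s / s' = dD (t' / t)" using h(5) nz unfolding dD_div[OF U(2) U(1)] by (simp add: field_simps)
  hence "s = s'" by (rule dist[OF h(1) h(3) U_div[OF U(2) U(1)]])
  thus "s = s' & dD t = dD t'" using h(5) nz by simp
 qed
 have "card S * card (dD ` Tor) = card ((%(s,t). s * t) ` (S \<times> dD ` Tor))"
  by (simp add: card_image[OF inj] card_cartesian_product)
 also have "... <= card Tor" by (rule card_mono[OF finite_Tor sub])
 also have "... <= p * card (dD ` Tor)" by (rule card_Tor)
 finally have "card S * card (dD ` Tor) <= p * card (dD ` Tor)" .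
 moreover have "card (dD ` Tor) > 0" using fin U_1 lg_1 by (auto simp: card_gt_0_iff Tor_def zero_fun_def)
 ultimately show ?thesis by simp
qed

text \<open>Two counts are multiplied. By \<open>real_lattice.card_mod_D\<close> the logarithms of
  \<open>S\<close> meet at most \<open>p ^ ((p - 1) div 2)\<close> classes modulo 1 - \<sigma>.
  Within a class, division by a reference element and by a suitable \<open>dD e\<close> turns the
  elements into torsion units that stay distinct modulo \<open>dD\<close>, so by
  \<open>card_Tor_mod\<close> there are at most \<open>p\<close> of them.\<close>

theorem card_units_mod:
 assumes S: "finite S" "S <= U"
  and dist: "!!s t e. s : S ==> t : S ==> e : U ==> s / t = dD e ==> s = t"
 shows "card S <= p ^ ((p - 1) div 2 + 1)"
proof -
 define R where "R = (%s t. EX e:U. lg s - lg t = Dg (lg e))"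
 have Dg0: "Dg (lg 1) = 0" by (auto simp: lg_1 Dg_def)
 have Rrefl: "R s s" for s unfolding R_def using U_1 Dg0 by (intro bexI[of _ 1]) auto
 have Dsub: "Dg (f - g) = Dg f - Dg g" for f g by (auto simp: Dg_def)
 have Rst: "R s' t'" if R: "R s t'" "R s s'" for s s' t'
 proof -
  obtain e e' where e: "e : U" "lg s - lg t' = Dg (lg e)" "e' : U" "lg s - lg s' = Dg (lg e')"
   using R unfolding R_def by blast
  have "lg s' - lg t' = (lg s - lg t') - (lg s - lg s')" by simp
  also have "... = Dg (lg (e / e'))" unfolding e(2,4) lg_div[OF e(1,3)] Dsub ..
  finally show ?thesis unfolding R_def using U_div[OF e(1,3)] by blast
 qed
 define cl where "cl = (%s. {t : S. R s t})"
 have cleq: "cl s = cl s'" if "R s s'" for s s'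
 proof -
  have "R s' s" by (rule Rst[OF Rrefl that])
  thus ?thesis unfolding cl_def using Rst that by blast
 qed
 define rep where "rep = (%c. SOME s. s : S & cl s = c)"
 have rep: "rep c : S & cl (rep c) = c" if "c : cl ` S" for c
  unfolding rep_def by (rule someI_ex) (use that in blast)
 have clcard: "card (cl ` S) <= p ^ ((p - 1) div 2)"
 proof -
  have injr: "inj_on (%c. lg (rep c)) (cl ` S)"
  proof (rule inj_onI)
   fix c c' assume h: "c : cl ` S" "c' : cl ` S" "lg (rep c) = lg (rep c')"
   have "R (rep c) (rep c')" unfolding R_def using U_1 Dg0 h(3) by (intro bexI[of _ 1]) auto
   from cleq[OF this] show "c = c'" using rep[OF h(1)] rep[OF h(2)] by simp
  qed
  have "card ((%c. lg (rep c)) ` (cl ` S)) <= p ^ ((p - 1) div 2)"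
  proof (rule real_lattice.card_mod_D[OF lattice])
   show "finite ((%c. lg (rep c)) ` cl ` S)" using S by simp
   show "(%c. lg (rep c)) ` cl ` S <= lg ` U" using rep S by blast
   fix s t e assume h: "s : (%c. lg (rep c)) ` cl ` S" "t : (%c. lg (rep c)) ` cl ` S" "e : lg ` U" "s - t = Dg e"
   then obtain c c' w where c: "c : cl ` S" "s = lg (rep c)" "c' : cl ` S" "t = lg (rep c')" "w : U" "e = lg w" by blast
   have "R (rep c) (rep c')" unfolding R_def using h(4) c by blast
   from cleq[OF this] show "s = t" using rep[OF c(1)] rep[OF c(3)] c by simp
  qed
  thus ?thesis by (simp add: card_image[OF injr])
 qed
 have each: "card {s : S. cl s = c} <= p" if c: "c : cl ` S" for c
 proof -
  define s0 where "s0 = rep c"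
  have s0: "s0 : S" "cl s0 = c" using rep[OF c] by (auto simp: s0_def)
  have s0U: "s0 : U" using s0 S by blast
  define C where "C = {s : S. cl s = c}"
  have ex: "ALL s:C. EX e. e : U & lg s - lg s0 = Dg (lg e)"
  proof
   fix s assume "s : C"
   hence "s0 : cl s" using s0 Rrefl by (auto simp: C_def cl_def)
   thus "EX e. e : U & lg s - lg s0 = Dg (lg e)" unfolding cl_def R_def by blast
  qed
  obtain e where e: "ALL s:C. e s : U & lg s - lg s0 = Dg (lg (e s))" using bchoice[OF ex] ..
  define \<tau> where "\<tau> = (%s. s / s0 / dD (e s))"
  have CU: "s : U" if "s : C" for s using that S by (auto simp: C_def)
  have \<tau>T: "\<tau> s : Tor" if s: "s : C" for s
  proof -
   have eU: "e s : U" "lg s - lg s0 = Dg (lg (e s))" using e s by auto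
   have "lg (\<tau> s) = (lg s - lg s0) - lg (dD (e s))"
    unfolding \<tau>_def lg_div[OF U_div[OF CU[OF s] s0U] dD_U[OF eU(1)]] lg_div[OF CU[OF s] s0U] ..
   also have "lg (dD (e s)) = Dg (lg (e s))" unfolding dD_def by (rule Dg_lg[OF eU(1), symmetric])
   finally have "lg (\<tau> s) = 0" by (simp only: eU(2) diff_self)
   moreover have "\<tau> s : U" unfolding \<tau>_def by (rule U_div[OF U_div[OF CU[OF s] s0U] dD_U[OF eU(1)]])
   ultimately show ?thesis by (simp add: Tor_def)
  qed
  have key: "s = s'" if h: "s : C" "s' : C" "w : U" "\<tau> s / \<tau> s' = dD w" for s s' w
  proof -
   have eU: "e s : U" "e s' : U" using e h by auto
   have nz: "s ~= 0" "s' ~= 0" "s0 ~= 0" "dD (e s) ~= 0" "dD (e s') ~= 0"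
    using U_Lf(3) CU h s0U dD_U eU by auto
   have eq: "e s / e s' * w = (e s / e s') / inverse w" by (simp add: divide_inverse)
   have iw: "dD (inverse w) = inverse (dD w)" using dD_div[OF U_1 h(3)] nf.G1[OF sg_G] by (simp add: inverse_eq_divide dD_def)
   have "dD (e s / e s' * w) = dD (e s) / dD (e s') * dD w"
    unfolding eq dD_div[OF U_div[OF eU] U_inverse[OF h(3)]] dD_div[OF eU] iw by (simp add: divide_inverse)
   also have "... = s / s'" unfolding h(4)[symmetric] \<tau>_def using nz by (simp add: field_simps)
   finally have "s / s' = dD (e s / e s' * w)" ..
   thus ?thesis
    by (rule dist[rotated 3]) (use h eU U_div U_mult in \<open>auto simp: C_def\<close>)
  qed
  have inj: "inj_on \<tau> C"
  proof (rule inj_onI)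
   fix s s' assume h: "s : C" "s' : C" "\<tau> s = \<tau> s'"
   have "\<tau> s' ~= 0" using \<tau>T[OF h(2)] U_Lf(3) by (auto simp: Tor_def)
   hence "\<tau> s / \<tau> s' = dD 1" using h(3) nf.G1[OF sg_G] by (simp add: dD_def)
   thus "s = s'" by (rule key[OF h(1,2) U_1])
  qed
  have "card (\<tau> ` C) <= p"
  proof (rule card_Tor_mod)
   show "finite (\<tau> ` C)" using S by (simp add: C_def)
   show "\<tau> ` C <= Tor" using \<tau>T by blast
   fix s t w assume h: "s : \<tau> ` C" "t : \<tau> ` C" "w : U" "s / t = dD w"
   then obtain a b where "a : C" "s = \<tau> a" "b : C" "t = \<tau> b" by blast
   thus "s = t" using key[of a b w] h by simp
  qed
  thus ?thesis using card_image[OF inj] by (simp add: C_def)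
 qed
 have "card S = (\<Sum>c\<in>cl ` S. card {s : S. cl s = c})"
  using sum.image_gen[OF S(1), of "%_. 1::nat" cl] by simp
 also have "... <= (\<Sum>c\<in>cl ` S. p)" by (rule sum_mono) (rule each)
 also have "... <= p ^ ((p - 1) div 2) * p" using clcard by simp
 finally show ?thesis by (simp add: mult.commute)
qed

end

section \<open>Totally ramified primes\<close>


context kumL begin

definition Kf :: "complex set" where "Kf = {x : Lf. sg x = x}"

lemma Kf_Lf: "x : Kf ==> x : Lf" by (simp add: Kf_def)
lemma Kf_add: "x : Kf ==> y : Kf ==> x + y : Kf"
 unfolding Kf_def using nf.Gadd[OF sg_G] nf.Ladd by simp
lemma Kf_mult: "x : Kf ==> y : Kf ==> x * y : Kf"
 unfolding Kf_def using nf.Gmult[OF sg_G] nf.Lmult by simp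
lemma Kf_of_int: "of_int c : Kf" unfolding Kf_def using nf.Gof_int[OF sg_G] nf.Lof_int by simp
lemma Kf_0: "0 : Kf" using Kf_of_int[of 0] by simp
lemma Kf_divide: "x : Kf ==> y : Kf ==> x / y : Kf"
 unfolding Kf_def using nf.Gdiv[OF sg_G] nf.Ldiv by simp
lemma sg_eta: "sg eta = eta" unfolding sg_def using Lf_eta(2)[OF one_A, of 1] d_pos dp p_gt by simp
lemma Kf_ev: "I.ev eta f : Kf"
proof -
 have "1 < d" using dp p_gt by simp
 hence "sg (I.ev eta f) = I.ev (sg eta) f" unfolding sg_def by (rule au_ev[OF Lf_eta(1) one_A])
 thus ?thesis unfolding Kf_def sg_eta using Lf_ev[OF Lf_eta(1)] by simp
qed

lemma KfE: assumes "x : Kf" obtains f m where "m > 0" "x = I.ev eta f / of_nat m"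
proof -
 have h: "x : Lf" "sg x = x" using assms by (auto simp: Kf_def)
 show ?thesis by (rule fixed_K[OF h]) (rule that)
qed

lemma Lf_poly:
 assumes x: "x : Lf"
 shows "EX F. (ALL i. poly.coeff F i : Kf) & pdeg F < p & poly F \<alpha> = x & poly F (eta * \<alpha>) = sg x"
proof -
 obtain c m where c: "m > 0" "x = (\<Sum>j<d. I.ev eta (c j) * \<alpha> ^ j) / of_nat m"
  and ac: "ALL a:A. ALL b<d. au a b x = (\<Sum>j<d. I.ev (eta ^ a) (c j) * (\<zeta> ^ b * \<alpha>) ^ j) / of_nat m"
  using Lf_decomp[OF x] by (elim exE conjE)
 have "1 < d" using dp p_gt by simp
 from ac[rule_format, OF one_A this]
 have sx: "sg x = (\<Sum>j<d. I.ev eta (c j) * (eta * \<alpha>) ^ j) / of_nat m" unfolding sg_def by (simp add: \<zeta>eta)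
 define F where "F = (\<Sum>j<d. Polynomial.monom (I.ev eta (c j) / of_nat m) j)"
 have cF: "poly.coeff F i = (if i < d then I.ev eta (c i) / of_nat m else 0)" for i
  by (simp add: F_def coeff_sum coeff_monom)
 have pF: "poly F y = (\<Sum>j<d. I.ev eta (c j) * y ^ j) / of_nat m" for y
  by (simp add: F_def poly_sum poly_monom sum_divide_distrib)
 show ?thesis
 proof (intro exI conjI allI)
  have "of_nat m : Kf" using Kf_of_int[of "int m"] by simp
  thus "poly.coeff F i : Kf" for i unfolding cF using Kf_divide[OF Kf_ev] Kf_0 by simp
  show "pdeg F < p" by (rule degree_lessI) (use p_gt cF dp in auto)
 qed (use c sx pF in auto)
qed

definition vv :: "complex set => complex => int" where "vv P = numfield_prime.v Lf P"
text \<open>Total ramification over K, phrased through the valuation alone so that the prime of K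
  below \<open>P\<close> never has to be named.\<close>

definition ram :: "complex set => bool"
 where "ram P \<longleftrightarrow> nf.prm P & (ALL x:Lf. x ~= 0 --> vv P (sg x) = vv P x) & (ALL k:Kf. k ~= 0 --> int p dvd vv P k)"

end

locale kumLP = kumL + fixes P :: "complex set" assumes prmP: "nf.prm P"
begin

sublocale V: numfield_prime Lf Gk Bk bask duak Dk P
 by unfold_locales (rule prmP)

lemma vv_eq: "vv P = V.v" by (simp add: vv_def)

lemma v_ge0: "x : nf.Oi ==> x ~= 0 ==> V.v x >= 0" using V.v_Oi by simp

lemma v_pos_iff: "x : nf.Oi ==> x ~= 0 ==> V.v x > 0 \<longleftrightarrow> x : P"
 using V.v_Oi[of x] V.we_pos_iff[of x] by auto

lemma eta_Oi: "eta ^ k : nf.Oi" unfolding nf.Oi_def using Lf_pow[OF Lf_eta(1)] algebraic_int_power_complex[OF eta_alg] by simp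
lemma \<alpha>_Oi: "\<alpha> : nf.Oi" unfolding nf.Oi_def using Lf_\<alpha>(1) \<alpha>_alg by simp

lemma v_eta: "V.v (eta ^ k) = 0"
proof -
 have L: "eta ^ k : Lf" "eta ^ k ~= 0" using Lf_pow[OF Lf_eta(1)] eta_ne0 by auto
 have "int p * V.v (eta ^ k) = V.v ((eta ^ k) ^ p)" by (rule V.v_power[OF L, symmetric])
 also have "(eta ^ k) ^ p = (eta ^ p) ^ k" by (simp add: mult.commute flip: power_mult)
 finally show ?thesis using V.v_1 p_gt by (simp add: eta_p)
qed

text \<open>Expand \<open>x\<close> in powers of \<open>\<alpha> - of_int s\<close> with
  coefficients in K. The terms have distinct valuations because \<open>M\<close> does not divide
  \<open>j * t\<close> for 0 < j < p, so \<open>x\<close> and its image under \<sigma> both have the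
  least of them as valuation. It is applied with s = 0 to primes over \<open>N\<close> and with s =
  1 to primes over \<open>p\<close>.\<close>

lemma ramI:
 assumes M: "M > 0" "!!k. k : Kf ==> k ~= 0 ==> M dvd V.v k"
  and nz: "\<alpha> - of_int s ~= 0" "eta * \<alpha> - of_int s ~= 0"
  and t: "V.v (\<alpha> - of_int s) = t" "V.v (eta * \<alpha> - of_int s) = t"
  and Mt: "!!j. 0 < j ==> j < p ==> ~ M dvd int j * t" "M dvd int p * t"
 shows "ram P"
proof -
 have main: "V.v (sg x) = V.v x & M dvd int p * V.v x" if x: "x : Lf" "x ~= 0" for x
 proof -
  obtain F where F: "ALL i. poly.coeff F i : Kf" "pdeg F < p" "poly F \<alpha> = x" "poly F (eta * \<alpha>) = sg x"
   using Lf_poly[OF x(1)] by blast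
  define G where "G = pcompose F [:of_int s, 1:]"
  have cG: "poly.coeff G i : Kf" for i
  proof -
   have "ALL i. poly.coeff (pcompose F [:of_int s, 1:]) i : Kf"
    using F(1)
   proof (induction F)
    case 0 thus ?case using Kf_0 by simp
   next
    case (pCons a F)
    have a: "a : Kf" using pCons.prems[rule_format, of 0] by simp
    have "ALL i. poly.coeff F i : Kf" using pCons.prems by (metis coeff_pCons_Suc)
    hence IH: "ALL i. poly.coeff (pcompose F [:of_int s, 1:]) i : Kf" by (rule pCons.IH)
    define H where "H = pcompose F [:of_int s, 1:]"
    have "poly.coeff (pcompose (pCons a F) [:of_int s, 1:]) i
      = (if i = 0 then a else poly.coeff H (i - 1)) + of_int s * poly.coeff H i" for i
     unfolding pcompose_pCons H_def[symmetric] by (cases i) (simp_all add: coeff_pCons)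
    thus ?case
     using a IH[folded H_def] Kf_add Kf_mult[OF Kf_of_int[of s]] by simp
   qed
   thus ?thesis by (simp add: G_def)
  qed
  have dG: "pdeg G < p" unfolding G_def using F(2) by (simp add: degree_pcompose)
  define S where "S = {j. j < p & poly.coeff G j ~= 0}"
  have finS: "finite S" by (simp add: S_def)
  have sum: "poly G z = (\<Sum>j\<in>S. poly.coeff G j * z ^ j)" for z
  proof -
   have "poly G z = (\<Sum>j\<le>pdeg G. poly.coeff G j * z ^ j)" by (rule poly_altdef)
   also have "... = (\<Sum>j\<in>S. poly.coeff G j * z ^ j)"
    by (rule sum.mono_neutral_right) (use dG in \<open>auto simp: S_def coeff_eq_0 intro: le_degree\<close>)
   finally show ?thesis .
  qed
  have xs: "x = (\<Sum>j\<in>S. poly.coeff G j * (\<alpha> - of_int s) ^ j)"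
  proof -
   have "poly G (\<alpha> - of_int s) = x" unfolding G_def poly_pcompose using F(3) by simp
   thus ?thesis using sum by simp
  qed
  have ss: "sg x = (\<Sum>j\<in>S. poly.coeff G j * (eta * \<alpha> - of_int s) ^ j)"
  proof -
   have "poly G (eta * \<alpha> - of_int s) = sg x" unfolding G_def poly_pcompose using F(4) by simp
   thus ?thesis using sum by simp
  qed
  have Sne: "S ~= {}" using xs x(2) by auto
  define val where "val = (%j. V.v (poly.coeff G j) + int j * t)"
  have injval: "inj_on val S"
  proof (rule inj_onI)
   have *: False if "i : S" "j : S" "val i = val j" "i < j" for i j
   proof -
    have "M dvd V.v (poly.coeff G i)" "M dvd V.v (poly.coeff G j)" using M(2) cG that by (auto simp: S_def)
    hence "M dvd V.v (poly.coeff G i) - V.v (poly.coeff G j)" by simp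
    also have "... = int (j - i) * t" using that(3,4) by (simp add: val_def of_nat_diff algebra_simps)
    finally have "M dvd int (j - i) * t" .
    moreover have "0 < j - i" "j - i < p" using that by (auto simp: S_def)
    ultimately show False using Mt(1) by blast
   qed
   fix i j assume "i : S" "j : S" "val i = val j"
   thus "i = j" using *[of i j] *[of j i] by (metis nat_neq_iff)
  qed
  have gen: "V.v (\<Sum>j\<in>S. poly.coeff G j * z ^ j) = Min (val ` S)"
   if z: "z : Lf" "z ~= 0" "V.v z = t" for z
  proof -
   have v: "poly.coeff G j * z ^ j : Lf & poly.coeff G j * z ^ j ~= 0" "V.v (poly.coeff G j * z ^ j) = val j" if "j : S" for j
    using that z cG[of j] V.v_mult[of "poly.coeff G j" "z ^ j"] V.v_power[of z j]
    by (auto simp: S_def val_def Kf_Lf nf.Lmult nf.Lpow)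
   have inj: "inj_on (%j. V.v (poly.coeff G j * z ^ j)) S"
    using injval v(2) by (auto simp: inj_on_def)
   have im: "(%j. V.v (poly.coeff G j * z ^ j)) ` S = val ` S" by (rule image_cong[OF refl]) (rule v(2))
   show ?thesis
    using V.v_sum_distinct[OF finS Sne v(1) inj] unfolding im by simp
  qed
  have La: "\<alpha> - of_int s : Lf" using nf.Ldiff[OF Lf_\<alpha>(1) nf.Lof_int] .
  have Lb: "eta * \<alpha> - of_int s : Lf" using nf.Ldiff[OF nf.Lmult[OF Lf_eta(1) Lf_\<alpha>(1)] nf.Lof_int] .
  have v1: "V.v x = Min (val ` S)" unfolding xs by (rule gen[OF La nz(1) t(1)])
  have v2: "V.v (sg x) = Min (val ` S)" unfolding ss by (rule gen[OF Lb nz(2) t(2)])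
  have "Min (val ` S) : val ` S" using finS Sne by (intro Min_in) auto
  then obtain j where j: "j : S" "V.v x = val j" using v1 by auto
  have "M dvd V.v (poly.coeff G j)" using M(2) cG j by (auto simp: S_def)
  hence "M dvd int p * V.v (poly.coeff G j) + int j * (int p * t)" using Mt(2) by simp
  hence "M dvd int p * V.v x" unfolding j(2) val_def by (simp add: algebra_simps)
  thus ?thesis using v1 v2 by simp
 qed
 \<comment> \<open>\<open>M\<close> divides p times every valuation, so an element of valuation 1
   makes it a divisor of p; the value 1 is excluded by the hypothesis at j = 1.\<close>
 have "M = int p"
 proof -
  obtain x where x: "x : P" "x ~= 0" "V.we x = V.w P" using V.w_attained[OF V.fidP V.P_Oi] .
  have xO: "x : nf.Oi" using x V.P_Oi by blast
  have "V.v x = 1" using V.v_Oi[OF xO x(2)] x(3) V.w_self by simp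
  hence Mp: "M dvd int p" using main[OF nf.Oi_L[OF xO] x(2)] by simp
  have "M ~= 1" using Mt(1)[of 1] p_gt by auto
  moreover have "nat M dvd p" using Mp M(1) by (simp add: nat_dvd_iff)
  hence "nat M = 1 \<or> nat M = p" using p by (simp add: prime_nat_iff)
  ultimately show ?thesis using M(1) by auto
 qed
 thus ?thesis unfolding ram_def vv_eq using prmP main M(2) by auto
qed

end


section \<open>Ramification of the primes over N and over p\<close>

lemma (in cyc) poly_root_split: "EX h. I.ev y f = (y - of_int c) * I.ev y h + of_int (poly f c)"
proof -
 have "poly (f - [:poly f c:]) c = 0" by simp
 hence "[:-c, 1:] dvd f - [:poly f c:]" by (simp only: poly_eq_0_iff_dvd)
 then obtain h where h: "f - [:poly f c:] = [:-c, 1:] * h" by (elim dvdE)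
 hence "f = [:-c, 1:] * h + [:poly f c:]" by (simp add: algebra_simps)
 hence "I.ev y f = I.ev y ([:-c, 1:] * h + [:poly f c:])" by simp
 also have "... = (y - of_int c) * I.ev y h + of_int (poly f c)"
  unfolding I.ev_add I.ev_mult by (simp add: I.ev_pCons I.ev_0)
 finally show ?thesis by blast
qed

context kumLP begin

lemma A_p1: "card A = p - 1" by (simp add: A_eq)

lemma one_minus_eta_Oi: "1 - eta ^ k : nf.Oi" using nf.Oi_diff[OF nf.Oi_1 eta_Oi] .

lemma ev_Oi: "I.ev eta f : nf.Oi"
 using ev_alg[OF eta_alg] Lf_ev[OF Lf_eta(1)] by (simp add: nf.Oi_def)

lemma one_minus_eta_ne: "a : A ==> 1 - eta ^ a ~= 0" using eta_pow_eq_1_iff A_dvd by simp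

lemma p_in_P: assumes a: "a : A" and h: "1 - eta ^ a : P" shows "of_nat p : P"
proof -
 have "of_nat p = (\<Prod>b\<in>A - {a}. 1 - eta ^ b) * (1 - eta ^ a)"
  unfolding prod_p[symmetric] using a A_fin by (simp add: prod.remove mult.commute)
 thus ?thesis using nf.fidD(4)[OF V.fidP nf.Oi_prod[OF one_minus_eta_Oi] h] by simp
qed

lemma N_not_p: "N ~= p"
proof
 assume "N = p"
 hence "[p = 1] (mod p)" using N1 unfolding qp by simp
 thus False using p_gt by (simp add: cong_def)
qed

lemma not_both: assumes "of_nat N : P" "of_nat p : P" shows False
proof -
 have "int N ~= 0" using Nprime by (auto simp: prime_gt_0_nat)
 moreover have "~ int p dvd int N" using primes_dvd_imp_eq[OF p Nprime] N_not_p by auto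
 ultimately have "(of_int (int N) :: complex) ~: P" by (intro V.v_int(3)[OF p assms(2)])
 thus False using assms(1) by simp
qed

lemma eta_diff_notin: assumes N: "of_nat N : P" and ab: "a < p" "b < p" "a < b" shows "eta ^ a - eta ^ b ~: P"
proof
 assume h: "eta ^ a - eta ^ b : P"
 have "eta ^ (p - a) * (eta ^ a - eta ^ b) = eta ^ p - eta ^ (p + (b - a))"
  using ab by (simp add: algebra_simps flip: power_add)
 also have "... = 1 - eta ^ (b - a)" by (simp add: power_add eta_p)
 finally have "1 - eta ^ (b - a) : P" using nf.fidD(4)[OF V.fidP eta_Oi h, of "p - a"] by simp
 hence "of_nat p : P" by (rule p_in_P[rotated]) (use ab in \<open>auto simp: A_eq\<close>)
 thus False using not_both[OF N] by simp
qed

text \<open>The factors \<open>of_nat c - eta ^ a\<close> have product \<open>\<Phi>\<close>(c). Two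
  of them in \<open>P\<close> would put a difference of powers of \<open>eta\<close>, hence
  \<open>p\<close>, into \<open>P\<close>; so a single factor carries the whole valuation.\<close>

lemma eta_residue:
 assumes NP: "of_nat N : P" and c: "int N ^ e dvd poly \<Phi> (int c)" "~ [c = 1] (mod N)" "e > 0"
 obtains a where "a : A" "of_nat c - eta ^ a ~= 0" "V.v (of_nat c - eta ^ a) >= int e * V.v (of_nat N)"
  "of_nat c - eta ^ a : P"
proof -
 have ne: "of_nat c - eta ^ a ~= 0" for a
 proof
  assume "of_nat c - eta ^ a = 0"
  hence "norm (of_nat c :: complex) = norm (eta ^ a)" by simp
  hence "c = 1" by (simp add: norm_power norm_eta)
  thus False using c(2) by simp
 qed
 have O: "of_nat c - eta ^ a : nf.Oi" for a using nf.Oi_diff[OF nf.Oi_of_nat eta_Oi] .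
 have evc: "of_int (poly \<Phi> (int c)) = (\<Prod>a\<in>A. of_nat c - eta ^ a)"
 proof -
  have "I.ev (of_int (int c)) f = of_int (poly f (int c))" for f
   by (induction f) (auto simp: I.ev_0 I.ev_pCons)
  thus ?thesis using \<Phi>_prod[of "of_nat c"] by (metis of_int_of_nat_eq)
 qed
 have "(of_int (poly \<Phi> (int c)) :: complex) ~= 0" unfolding evc using ne A_fin by simp
 hence s0: "poly \<Phi> (int c) ~= 0" by auto
 note vi = V.v_int[OF Nprime NP s0]
 have "e <= multiplicity (int N) (poly \<Phi> (int c))"
  using c(1) s0 Nprime by (intro multiplicity_geI) (auto simp: prime_nat_iff)
 hence "int e * V.v (of_nat N) <= V.v (of_int (poly \<Phi> (int c)))"
  unfolding vi(1) using vi(2) by (intro mult_right_mono) auto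
 also have "... = (\<Sum>a\<in>A. V.v (of_nat c - eta ^ a))"
  unfolding evc by (rule V.v_prod[OF A_fin]) (use ne O nf.Oi_L in auto)
 finally have ge: "int e * V.v (of_nat N) <= (\<Sum>a\<in>A. V.v (of_nat c - eta ^ a))" .
 have ge0: "V.v (of_nat c - eta ^ a) >= 0" for a by (rule v_ge0[OF O ne])
 have "EX a:A. of_nat c - eta ^ a : P"
 proof (rule ccontr)
  assume "~ ?thesis"
  hence "V.v (of_nat c - eta ^ a) = 0" if "a : A" for a
   using that v_pos_iff[OF O ne, of a] ge0[of a] by auto
  hence "int e * V.v (of_nat N) <= 0" using ge by simp
  thus False using vi(2) c(3) by (simp add: mult_le_0_iff)
 qed
 then obtain a where a: "a : A" "of_nat c - eta ^ a : P" by blast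
 have "V.v (of_nat c - eta ^ b) = 0" if b: "b : A - {a}" for b
 proof (rule ccontr)
  assume "V.v (of_nat c - eta ^ b) ~= 0"
  hence bP: "of_nat c - eta ^ b : P" using v_pos_iff[OF O ne, of b] ge0[of b] by linarith
  have "eta ^ b - eta ^ a : P" "eta ^ a - eta ^ b : P"
   using nf.fid_diff[OF V.fidP a(2) bP] nf.fid_diff[OF V.fidP bP a(2)] by simp_all
  moreover have "a < p" "b < p" "a ~= b" using a(1) b by (auto simp: A_eq)
  ultimately show False using eta_diff_notin[OF NP, of a b] eta_diff_notin[OF NP, of b a] by (metis nat_neq_iff)
 qed
 hence "(\<Sum>a\<in>A. V.v (of_nat c - eta ^ a)) = V.v (of_nat c - eta ^ a)"
  using a(1) A_fin by (simp add: sum.remove)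
 thus ?thesis using that[OF a(1) ne _ a(2)] ge by simp
qed

text \<open>\<open>N\<close> is unramified in K. By \<open>eta_residue\<close> some conjugate of
  \<open>eta\<close> agrees with an integer up to high precision, so an element of K that is a
  polynomial in \<open>eta\<close> agrees with an integer and shares its valuation, a multiple of
  that of \<open>N\<close>.\<close>

lemma v_K_N:
 assumes NP: "of_nat N : P" and k: "k : Kf" "k ~= 0"
 shows "V.v (of_nat N) dvd V.v k"
proof -
 have ints: "V.v (of_nat N) dvd V.v (of_int s)" if "s ~= 0" for s using V.v_int(1)[OF Nprime NP that] by simp
 have ev: "V.v (of_nat N) dvd V.v (I.ev eta f)" if nz: "I.ev eta f ~= 0" for f
 proof -
  define x where "x = I.ev eta f"
  have x: "x : nf.Oi" "x ~= 0" using ev_Oi nz by (auto simp: x_def)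
  \<comment> \<open>The precision exceeds the valuation of \<open>x\<close>, so the error term
    cannot affect it.\<close>
  define e where "e = nat (V.v x) + 1"
  have ve: "V.v x < int e" using v_ge0[OF x] by (simp add: e_def)
  have vN: "V.v (of_nat N) > 0" using V.v_int(2)[OF Nprime NP, of 1] by simp
  obtain c where c: "int N ^ e dvd poly \<Phi> (int c)" "~ [c ^ r = 1] (mod N)" "[c ^ q = 1] (mod N)"
   using cyclotomic_root_mod[OF Nprime N1 p2, of e] by (auto simp: e_def)
  have "c ^ r = c" by (simp only: r1 power_one_right)
  hence c2: "~ [c = 1] (mod N)" using c(2) by simp
  obtain a where a: "a : A" "of_nat c - eta ^ a ~= 0" "V.v (of_nat c - eta ^ a) >= int e * V.v (of_nat N)"
   using eta_residue[OF NP c(1) c2] by (auto simp: e_def)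
  \<comment> \<open>\<open>b\<close> inverts \<open>a\<close> modulo \<open>q\<close>; thus
    \<open>x\<close> becomes a polynomial in \<open>eta ^ a\<close>, the conjugate that is close to
    the integer \<open>c\<close>.\<close>
  obtain b where b: "b : A" "a * b mod q = 1" using A_inverse[OF a(1)] .
  have "(eta ^ a) ^ b = eta" using eta_mod[of "a * b"] b(2) by (simp add: power_mult)
  hence xf: "x = I.ev (eta ^ a) (pcompose f (Polynomial.monom 1 b))"
   unfolding ev_pcompose I.ev_monom x_def by simp
  obtain h where h: "x = (eta ^ a - of_int (int c)) * I.ev (eta ^ a) h + of_int (poly (pcompose f (Polynomial.monom 1 b)) (int c))"
   using poly_root_split[of "eta ^ a" "pcompose f (Polynomial.monom 1 b)" "int c"] unfolding xf[symmetric] by blast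
  define s where "s = poly (pcompose f (Polynomial.monom 1 b)) (int c)"
  define H where "H = I.ev (eta ^ a) h"
  have HO: "H : nf.Oi"
  proof -
   have "H = I.ev eta (pcompose h (Polynomial.monom 1 a))" unfolding H_def ev_pcompose I.ev_monom by simp
   thus ?thesis using ev_Oi by simp
  qed
  define y where "y = (eta ^ a - of_nat c) * H"
  have xe: "x = y + of_int s" unfolding h y_def H_def s_def by simp
  have cO: "of_nat c - eta ^ a : nf.Oi" using nf.Oi_diff[OF nf.Oi_of_nat eta_Oi] .
  have ya: "y = - ((of_nat c - eta ^ a) * H)" by (simp add: y_def algebra_simps)
  have vy: "V.v y >= int e & y : nf.Oi" if "y ~= 0"
  proof -
   have H0: "H ~= 0" using that by (auto simp: y_def)
   have "V.v y = V.v (of_nat c - eta ^ a) + V.v H" unfolding ya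
    using V.v_minus[OF nf.Oi_L[OF nf.Oi_mult[OF cO HO]]] V.v_mult[OF nf.Oi_L[OF cO] a(2) nf.Oi_L[OF HO] H0] a(2) H0 by simp
   moreover have "V.v H >= 0" by (rule v_ge0[OF HO H0])
   moreover have "int e * 1 <= int e * V.v (of_nat N)" using vN by (intro mult_left_mono) auto
   ultimately show ?thesis using a(3) nf.Oi_minus[OF nf.Oi_mult[OF cO HO]] ya by simp
  qed
  show ?thesis
  proof (cases "y = 0")
   case True
   thus ?thesis using xe x(2) ints[of s] by (auto simp: x_def)
  next
   case False
   have "V.v (x + (- y)) = V.v x"
    using V.v_add_less(2)[OF nf.Oi_L[OF x(1)] x(2), of "- y"] V.v_minus[of y] vy[OF False] ve False nf.Oi_L nf.Oi_minus by simp
   moreover have "x + (- y) ~= 0"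
    using V.v_add_less(1)[OF nf.Oi_L[OF x(1)] x(2), of "- y"] V.v_minus[of y] vy[OF False] ve False nf.Oi_L nf.Oi_minus by simp
   ultimately show ?thesis using xe ints[of s] by (auto simp: x_def)
  qed
 qed
 obtain f m where f: "m > 0" "k = I.ev eta f / of_nat m" using KfE[OF k(1)] .
 have nz: "I.ev eta f ~= 0" using f k(2) by auto
 have "V.v k = V.v (I.ev eta f) - V.v (of_int (int m))"
  unfolding f(2) using V.v_divide[OF nf.Oi_L[OF ev_Oi] nz, of "of_nat m"] f(1) nf.Lof_nat by simp
 thus ?thesis using ev[OF nz] ints[of "int m"] f(1) by (simp only: dvd_diff)
qed

lemma ram_N: assumes NP: "of_nat N : P" shows "ram P"
proof -
 have ap: "\<alpha> ^ p = of_nat N" using \<alpha>d unfolding dp .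
 have pe: "int p * V.v \<alpha> = V.v (of_nat N)" using V.v_power[OF Lf_\<alpha>(1) \<alpha>_ne0, of p] ap by simp
 have vN: "V.v (of_nat N) > 0" using V.v_int(2)[OF Nprime NP, of 1] by simp
 hence e: "V.v \<alpha> > 0" unfolding pe[symmetric] using p_gt by (simp add: zero_less_mult_iff)
 show ?thesis
 proof (rule ramI[of "V.v (of_nat N)" 0 "V.v \<alpha>"])
  show "V.v (eta * \<alpha> - of_int 0) = V.v \<alpha>"
   using V.v_mult[OF Lf_eta(1) eta_ne0 Lf_\<alpha>(1) \<alpha>_ne0] v_eta[of 1] by simp
  fix j assume j: "0 < j" "j < p"
  show "~ V.v (of_nat N) dvd int j * V.v \<alpha>"
  proof
   assume "V.v (of_nat N) dvd int j * V.v \<alpha>"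
   hence "int p dvd int j" unfolding pe[symmetric] using e by simp
   thus False using j by (auto dest: dvd_imp_le)
  qed
 qed (use vN v_K_N[OF NP] \<alpha>_ne0 eta_ne0 pe in auto)
qed

lemma v_lm_conj: assumes a: "a : A" shows "V.v (1 - eta ^ a) = V.v lm"
proof -
 obtain u where u: "algebraic_int u" "lm = (1 - eta ^ a) * u" using lm_dvd_conj[OF a] .
 have L: "1 - eta ^ a : Lf" "lm : Lf" using nf.Oi_L[OF one_minus_eta_Oi, of a] nf.Oi_L[OF one_minus_eta_Oi, of 1] by (auto simp: lm_def)
 have "u = lm / (1 - eta ^ a)" using u(2) one_minus_eta_ne[OF a] by simp
 hence uO: "u : nf.Oi" using u(1) nf.Ldiv[OF L(2,1)] by (simp add: nf.Oi_def)
 have u0: "u ~= 0" using u(2) lm_ne0 by auto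
 have "(\<Sum>k<a. eta ^ k) : nf.Oi" by (rule nf.Oi_sum[OF eta_Oi])
 moreover have "(\<Sum>k<a. eta ^ k) ~= 0" using one_minus_dvd[of a] one_minus_eta_ne[OF a] by auto
 ultimately have "V.v (1 - eta ^ a) >= V.v lm"
  unfolding one_minus_dvd using V.v_mult[OF L(2) lm_ne0] nf.Oi_L v_ge0 by simp
 moreover have "V.v lm = V.v (1 - eta ^ a) + V.v u" by (subst u(2)) (rule V.v_mult[OF L(1) one_minus_eta_ne[OF a] nf.Oi_L[OF uO] u0])
 ultimately show ?thesis using v_ge0[OF uO u0] by simp
qed

lemma v_p: "V.v (of_nat p) = (int p - 1) * V.v lm"
proof -
 have "V.v (of_nat p) = (\<Sum>a\<in>A. V.v (1 - eta ^ a))"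
  unfolding prod_p[symmetric] by (rule V.v_prod[OF A_fin]) (use one_minus_eta_ne one_minus_eta_Oi nf.Oi_L in auto)
 also have "... = (\<Sum>a\<in>A. V.v lm)" by (rule sum.cong[OF refl v_lm_conj])
 also have "... = (int p - 1) * V.v lm" using p_gt by (simp add: A_p1 of_nat_diff)
 finally show ?thesis .
qed

text \<open>In units of the valuation of \<open>lm\<close>, an integer has valuation a multiple of p
  - 1 by \<open>v_p\<close>. So in an expansion in powers \<open>lm ^ i\<close> with i < p - 1 the
  valuations of the terms lie in different classes modulo p - 1.\<close>

lemma v_K_lm:
 assumes pP: "of_nat p : P" and k: "k : Kf" "k ~= 0"
 shows "V.v lm dvd V.v k"
proof -
 have lmL: "lm : Lf" using nf.Oi_L[OF one_minus_eta_Oi, of 1] by (simp add: lm_def)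
 have vp: "V.v (of_nat p) > 0" using V.v_int(2)[OF p pP, of 1] by simp
 hence vl: "V.v lm > 0" unfolding v_p using p_gt by (simp add: zero_less_mult_iff)
 have ints: "EX j. V.v (of_int s) = int j * (int p - 1) * V.v lm" if "s ~= 0" for s
  using V.v_int(1)[OF p pP that] unfolding v_p by (intro exI[of _ "multiplicity (int p) s"]) simp
 have intd: "V.v lm dvd V.v (of_int s)" if s: "s ~= 0" for s
  using ints[OF s] by auto
 have ev: "V.v lm dvd V.v (I.ev eta f)" if nz: "I.ev eta f ~= 0" for f
 proof -
  obtain u F where us: "f = \<Phi> * u + F" "pdeg F < pdeg \<Phi>"
   using monic_division[OF lead_\<Phi>, of f] \<Phi>_degree card_A_pos by auto
  have "I.ev eta \<Phi> = 0" using \<Phi>_root[OF one_A] by simp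
  hence fF: "I.ev eta f = I.ev eta F" using us(1) by (simp add: I.ev_add I.ev_mult)
  define G where "G = pcompose F [:1,-1:]"
  have dG: "pdeg G < p - 1" unfolding G_def using us(2) by (simp add: degree_pcompose \<Phi>_degree A_p1)
  have "I.ev lm G = I.ev eta F" unfolding G_def ev_pcompose by (simp add: I.ev_pCons I.ev_0 lm_def)
  moreover have "I.ev lm G = (\<Sum>i\<in>{i. i < p - 1 & poly.coeff G i ~= 0}. of_int (poly.coeff G i) * lm ^ i)"
   unfolding I.ev_altdef by (rule sum.mono_neutral_right) (use dG in \<open>auto simp: coeff_eq_0 intro: le_degree\<close>)
  ultimately have xs: "I.ev eta f = (\<Sum>i\<in>{i. i < p - 1 & poly.coeff G i ~= 0}. of_int (poly.coeff G i) * lm ^ i)" using fF by simp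
  define S where "S = {i. i < p - 1 & poly.coeff G i ~= 0}"
  have finS: "finite S" by (simp add: S_def)
  have Sne: "S ~= {}"
  proof
   assume "S = {}"
   hence "I.ev eta f = 0" unfolding xs S_def[symmetric] by simp
   thus False using nz by simp
  qed
  have lt: "int i < int p - 1" if "i : S" for i using that by (simp add: S_def) linarith
  have v: "of_int (poly.coeff G i) * lm ^ i : Lf & of_int (poly.coeff G i) * lm ^ i ~= 0"
   "EX j. V.v (of_int (poly.coeff G i) * lm ^ i) = (int j * (int p - 1) + int i) * V.v lm" if i: "i : S" for i
  proof -
   have c: "poly.coeff G i ~= 0" using i by (simp add: S_def)
   show "of_int (poly.coeff G i) * lm ^ i : Lf & of_int (poly.coeff G i) * lm ^ i ~= 0"
    using c lm_ne0 lmL nf.Lmult nf.Lpow nf.Lof_int by simp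
   obtain j where j: "V.v (of_int (poly.coeff G i)) = int j * (int p - 1) * V.v lm" using ints[OF c] ..
   have "V.v (of_int (poly.coeff G i) * lm ^ i) = V.v (of_int (poly.coeff G i)) + int i * V.v lm"
    using V.v_mult[OF nf.Lof_int, of "poly.coeff G i" "lm ^ i"] V.v_power[OF lmL lm_ne0] c lm_ne0 nf.Lpow[OF lmL] by simp
   also have "... = (int j * (int p - 1) + int i) * V.v lm" unfolding j by (simp add: algebra_simps)
   finally show "EX j. V.v (of_int (poly.coeff G i) * lm ^ i) = (int j * (int p - 1) + int i) * V.v lm" ..
  qed
  have inj: "inj_on (%i. V.v (of_int (poly.coeff G i) * lm ^ i)) S"
  proof (rule inj_onI)
   fix i k assume h: "i : S" "k : S" "V.v (of_int (poly.coeff G i) * lm ^ i) = V.v (of_int (poly.coeff G k) * lm ^ k)"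
   obtain j where j: "V.v (of_int (poly.coeff G i) * lm ^ i) = (int j * (int p - 1) + int i) * V.v lm" using v(2)[OF h(1)] ..
   obtain l where l: "V.v (of_int (poly.coeff G k) * lm ^ k) = (int l * (int p - 1) + int k) * V.v lm" using v(2)[OF h(2)] ..
   have eq: "int j * (int p - 1) + int i = int l * (int p - 1) + int k" using h(3) vl unfolding j l by simp
   have "int i = (int j * (int p - 1) + int i) mod (int p - 1)" using lt[OF h(1)] by simp
   also have "... = int k" unfolding eq using lt[OF h(2)] by simp
   finally show "i = k" by simp
  qed
  have "V.v (I.ev eta f) = Min ((%i. V.v (of_int (poly.coeff G i) * lm ^ i)) ` S)"
   unfolding xs S_def[symmetric] using V.v_sum_distinct[OF finS Sne v(1) inj] by simp
  also have "... : (%i. V.v (of_int (poly.coeff G i) * lm ^ i)) ` S" using finS Sne by (intro Min_in) auto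
  finally obtain i where "i : S" "V.v (I.ev eta f) = V.v (of_int (poly.coeff G i) * lm ^ i)" by auto
  thus ?thesis using v(2)[of i] by auto
 qed
 obtain f m where f: "m > 0" "k = I.ev eta f / of_nat m" using KfE[OF k(1)] .
 have nz: "I.ev eta f ~= 0" using f k(2) by auto
 have "V.v k = V.v (I.ev eta f) - V.v (of_int (int m))"
  unfolding f(2) using V.v_divide[OF nf.Oi_L[OF ev_Oi] nz, of "of_nat m"] f(1) nf.Lof_nat by simp
 thus ?thesis using ev[OF nz] intd[of "int m"] f(1) by (simp only: dvd_diff)
qed

text \<open>\<open>N - 1\<close> is the product of all \<open>\<alpha> - eta ^ k\<close>. As p^2
  does not divide it, its valuation is that of \<open>p\<close>, namely p - 1 times that of
  \<open>lm\<close>. If \<open>\<alpha> - 1\<close> had at least the valuation of \<open>lm\<close>,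
  so would all p factors, which is too much. Hence the valuation of \<open>\<alpha> - 1\<close> is
  smaller, all factors share it, and p times it is p - 1 times the valuation of
  \<open>lm\<close>.\<close>

lemma ram_p: assumes pP: "of_nat p : P" and N2: "~ [N = 1] (mod p ^ 2)" shows "ram P"
proof -
 have vp: "V.v (of_nat p) > 0" using V.v_int(2)[OF p pP, of 1] by simp
 hence vl: "V.v lm > 0" unfolding v_p using p_gt by (simp add: zero_less_mult_iff)
 have ap: "\<alpha> ^ p = of_nat N" using \<alpha>d unfolding dp .
 have N2': "N > 1" using Nprime prime_gt_1_nat by blast
 have ne: "\<alpha> - eta ^ k ~= 0" for k
 proof
  assume "\<alpha> - eta ^ k = 0"
  hence "\<alpha> ^ p = (eta ^ p) ^ k" by (simp add: mult.commute flip: power_mult)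
  thus False using N2' by (simp add: ap eta_p)
 qed
 have O: "\<alpha> - eta ^ k : nf.Oi" for k by (rule nf.Oi_diff[OF \<alpha>_Oi eta_Oi])
 have prod: "of_nat N - 1 = (\<Prod>k<p. \<alpha> - eta ^ k)"
 proof -
  have i: "{..<p} = insert 0 A" using p_gt by (auto simp: A_eq)
  have "(\<Prod>k<p. \<alpha> - eta ^ k) = (\<alpha> - 1) * I.ev \<alpha> \<Phi>" unfolding i \<Phi>_prod using A_fin by (simp add: A_eq)
  also have "I.ev \<alpha> \<Phi> = (\<Sum>k<p. \<alpha> ^ k)"
  proof -
   have rk: "r * k = k" for k by (simp only: r1 mult_1)
   show ?thesis unfolding \<Phi>_def rk by (simp add: I.ev_sum I.ev_monom)
  qed
  also have "(\<alpha> - 1) * (\<Sum>k<p. \<alpha> ^ k) = \<alpha> ^ p - 1" by (rule power_diff_1_eq[symmetric])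
  finally show ?thesis by (simp add: ap)
 qed
 have sumv: "(\<Sum>k<p. V.v (\<alpha> - eta ^ k)) = (int p - 1) * V.v lm"
 proof -
  have "int p dvd int N - 1"
   using N1 unfolding qp cong_iff_dvd_diff[symmetric] by (metis cong_int_iff of_nat_1)
  then obtain c where c: "int N - 1 = int p * c" by (elim dvdE)
  have "~ int p dvd c"
  proof
   assume "int p dvd c"
   hence "int (p ^ 2) dvd int N - 1" unfolding c by (simp add: power2_eq_square)
   hence "[int N = int 1] (mod int (p ^ 2))" by (simp add: cong_iff_dvd_diff)
   thus False using N2 by (simp only: cong_int_iff)
  qed
  hence m: "multiplicity (int p) c = 0" by (rule not_dvd_imp_multiplicity_0)
  have c0: "c ~= 0" using c N2' by auto
  have "(\<Sum>k<p. V.v (\<alpha> - eta ^ k)) = V.v (of_nat N - 1)"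
   unfolding prod by (rule V.v_prod[symmetric]) (use ne O nf.Oi_L in auto)
  also have "(of_nat N - 1 :: complex) = of_nat p * of_int c"
   using c by (metis of_int_1 of_int_diff of_int_mult of_int_of_nat_eq)
  also have "V.v (of_nat p * of_int c) = V.v (of_nat p) + V.v (of_int c)"
   by (rule V.v_mult) (use c0 p_gt nf.Lof_nat nf.Lof_int in auto)
  also have "V.v (of_int c) = 0" using V.v_int(1)[OF p pP c0] m by simp
  finally show ?thesis by (simp add: v_p)
 qed
 have AO: "{..<p} = insert 0 A" using p_gt by (auto simp: A_eq)
 have dec: "\<alpha> - eta ^ k = (\<alpha> - 1) + (1 - eta ^ k)" for k by simp
 have L1: "\<alpha> - 1 : Lf" "\<alpha> - 1 ~= 0" using O[of 0] ne[of 0] nf.Oi_L by auto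
 have L2: "1 - eta ^ k : Lf" for k by (rule nf.Oi_L[OF one_minus_eta_Oi])
 have lt: "V.v (\<alpha> - 1) < V.v lm"
 proof (rule ccontr)
  assume n: "~ V.v (\<alpha> - 1) < V.v lm"
  have "V.v lm <= V.v (\<alpha> - eta ^ k)" if "k < p" for k
  proof (cases "k = 0")
   case True thus ?thesis using n by simp
  next
   case False
   hence kA: "k : A" using that by (simp add: A_eq)
   have "min (V.v (\<alpha> - 1)) (V.v (1 - eta ^ k)) <= V.v ((\<alpha> - 1) + (1 - eta ^ k))"
    by (rule V.v_add[OF L1 L2 one_minus_eta_ne[OF kA]]) (use dec ne[of k] in simp)
   thus ?thesis unfolding dec[symmetric] using n v_lm_conj[OF kA] by simp
  qed
  hence "(\<Sum>k<p. V.v lm) <= (\<Sum>k<p. V.v (\<alpha> - eta ^ k))" by (intro sum_mono) auto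
  thus False unfolding sumv using vl by (simp add: algebra_simps)
 qed
 have all: "V.v (\<alpha> - eta ^ k) = V.v (\<alpha> - 1)" if "k < p" for k
 proof (cases "k = 0")
  case False
  hence kA: "k : A" using that by (simp add: A_eq)
  show ?thesis unfolding dec[of k]
   by (rule V.v_add_less(2)[OF L1 L2 one_minus_eta_ne[OF kA]]) (use v_lm_conj[OF kA] lt in simp)
 qed simp
 define t where "t = V.v (\<alpha> - 1)"
 have pt: "int p * t = (int p - 1) * V.v lm" using sumv all by (simp add: t_def)
 have eta1: "eta * \<alpha> - 1 = eta * (\<alpha> - eta ^ (p - 1))"
 proof -
  have "eta * eta ^ (p - 1) = eta ^ p" using p_gt by (simp flip: power_Suc)
  thus ?thesis by (simp add: eta_p algebra_simps)
 qed
 have vt2: "V.v (eta * \<alpha> - 1) = t"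
  unfolding eta1 using V.v_mult[OF Lf_eta(1) eta_ne0 nf.Oi_L[OF O] ne] v_eta[of 1] all[of "p - 1"] p_gt by (simp add: t_def)
 show ?thesis
 proof (rule ramI[of "V.v lm" 1 t])
  show "eta * \<alpha> - of_int 1 ~= 0" using eta1 eta_ne0 ne[of "p - 1"] by simp
  fix j assume j: "0 < j" "j < p"
  show "~ V.v lm dvd int j * t"
  proof
   assume "V.v lm dvd int j * t"
   then obtain l where l: "int j * t = V.v lm * l" by (elim dvdE)
   have "int j * (int p - 1) * V.v lm = int j * (int p * t)" unfolding pt by simp
   also have "... = (int p * l) * V.v lm" using l by (simp add: algebra_simps)
   finally have "int j * (int p - 1) = int p * l" using vl by simp
   hence "int j = int p * (int j - l)" by (simp add: algebra_simps)
   hence "int p dvd int j" by (metis dvd_triv_left)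
   thus False using j by (auto dest: dvd_imp_le)
  qed
 qed (use vl v_K_lm[OF pP] L1 vt2 pt in \<open>auto simp: t_def\<close>)
qed

end


section \<open>Galois action on ideals\<close>

context numfield begin

lemma fid_G_image:
 assumes g: "g : G" and J: "fid J" shows "fid (g ` J)"
proof -
 note D = fidD[OF J]
 have "g ` J <= L" using D(1) GL[OF g] by blast
 moreover have "0 : g ` J" using D(2) G0[OF g] by (metis imageI)
 moreover have "x + y : g ` J" if "x : g ` J" "y : g ` J" for x y
 proof -
  obtain x' y' where "x' : J" "y' : J" "x = g x'" "y = g y'" using \<open>x : g ` J\<close> \<open>y : g ` J\<close> by blast
  hence "x + y = g (x' + y')" "x' + y' : J" using Gadd[OF g] D(1,3) by auto
  thus ?thesis by blast
 qed
 moreover have "a * x : g ` J" if "a : Oi" "x : g ` J" for a x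
 proof -
  have "a : g ` Oi" using \<open>a : Oi\<close> Oi_G_image[OF g] by simp
  then obtain a' where a': "a' : Oi" "a = g a'" by blast
  obtain x' where x': "x' : J" "x = g x'" using \<open>x : g ` J\<close> by blast
  have "a * x = g (a' * x')" using Gmult[OF g] D(1)[OF x'(1)] Oi_L[OF a'(1)] a' x' by simp
  thus ?thesis using D(4)[OF a'(1) x'(1)] by blast
 qed
 moreover have "EX x:g ` J. x ~= 0" using D(5) Gne[OF g] D(1) by blast
 moreover have "EX d:Oi. d ~= 0 & (ALL x:g ` J. d * x : Oi)"
 proof -
  obtain d where d: "d : Oi" "d ~= 0" "ALL x:J. d * x : Oi" using D(6) by blast
  have "g d * g x : Oi" if "x : J" for x
   using Oi_G[OF g, of "d * x"] d(3) that Gmult[OF g Oi_L[OF d(1)] D(1)[OF that]] by simp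
  thus ?thesis using Oi_G[OF g d(1)] Gne[OF g Oi_L[OF d(1)] d(2)] by blast
 qed
 ultimately show ?thesis unfolding fid_def by blast
qed

lemma G_image_Oi: "g : G ==> J <= Oi ==> g ` J <= Oi" using Oi_G by blast

lemma smul_G_image:
 assumes g: "g : G" and J: "fid J" and x: "x : L" shows "g ` smul x J = smul (g x) (g ` J)"
 unfolding smul_def image_image by (rule image_cong[OF refl]) (use Gmult[OF g x] fidD(1)[OF J] in blast)

lemma iprod_G_image:
 assumes g: "g : G" and I: "fid I" and J: "fid J" shows "g ` (I \<star> J) = (g ` I) \<star> (g ` J)"
proof
 have "I \<star> J <= {x : L. g x : (g ` I) \<star> (g ` J)}"
 proof (rule iprod_least)
  fix x y assume "x : I" "y : J"
  thus "x * y : {x : L. g x : (g ` I) \<star> (g ` J)}"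
   using fidD(1)[OF I] fidD(1)[OF J] Lmult Gmult[OF g] iprod_prod[of "g x" "g ` I" "g y" "g ` J"] by simp
 next
  fix x y assume "x : {x : L. g x : (g ` I) \<star> (g ` J)}" "y : {x : L. g x : (g ` I) \<star> (g ` J)}"
  thus "x + y : {x : L. g x : (g ` I) \<star> (g ` J)}" using Ladd Gadd[OF g] iprod_add by simp
 qed
 thus "g ` (I \<star> J) <= (g ` I) \<star> (g ` J)" by blast
 show "(g ` I) \<star> (g ` J) <= g ` (I \<star> J)"
 proof (rule iprod_least)
  fix x y assume "x : g ` I" "y : g ` J"
  then obtain x' y' where h: "x' : I" "y' : J" "x = g x'" "y = g y'" by blast
  hence "x * y = g (x' * y')" using Gmult[OF g] fidD(1)[OF I] fidD(1)[OF J] by simp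
  thus "x * y : g ` (I \<star> J)" using iprod_prod[OF h(1,2)] by blast
 next
  fix x y assume "x : g ` (I \<star> J)" "y : g ` (I \<star> J)"
  then obtain x' y' where h: "x' : I \<star> J" "y' : I \<star> J" "x = g x'" "y = g y'" by blast
  hence "x + y = g (x' + y')" using Gadd[OF g] fidD(1)[OF fid_iprod[OF I J]] by simp
  thus "x + y : g ` (I \<star> J)" using iprod_add[OF h(1,2)] by blast
 qed
qed

text \<open>Both quotients stabilise \<open>M\<close>, so \<open>stable_imp_integral\<close> applies
  to each. This is how an equality of ideals produces a unit.\<close>

lemma smul_inject_unit:
 assumes M: "fid M" and x: "x : L" "x ~= 0" and y: "y : L" "y ~= 0" and e: "smul x M = smul y M"
 shows "x / y : Oi" "y / x : Oi"
proof -
 have *: "x / y : Oi" if x: "x : L" "x ~= 0" and y: "y : L" "y ~= 0" and e: "smul x M = smul y M" for x y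
 proof (rule stable_imp_integral[OF M Ldiv[OF x(1) y(1)]])
  fix m assume "m : M"
  hence "x * m : smul y M" using smul_mem[of m M x] e by simp
  thus "x / y * m : M" using smul_iff[OF y(2)] by simp
 qed
 show "x / y : Oi" by (rule *[OF x y e])
 show "y / x : Oi" by (rule *[OF y x e[symmetric]])
qed

lemma smul_iprod_smul: assumes "fid I" "fid J"
 shows "smul x I \<star> smul y J = smul (x * y) (I \<star> J)"
proof -
 have "smul x I \<star> smul y J = smul x (I \<star> smul y J)" by (rule smul_iprod[symmetric])
 also have "I \<star> smul y J = smul y (J \<star> I)" using smul_iprod[of y J I] iprod_comm[of I "smul y J"] by simp
 finally show ?thesis using iprod_comm[of I J] by (simp add: smul_smul)
qed

lemma ipow_eigen:
 assumes g: "g : G" and J: "fid J" and e: "g ` J = smul h J"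
 shows "g ` ipow J n = smul (h ^ n) (ipow J n)"
proof (induction n)
 case 0 show ?case using Oi_G_image[OF g] by simp
next
 case (Suc n)
 show ?case using iprod_G_image[OF g J fid_ipow[OF J]] smul_iprod_smul[OF J fid_ipow[OF J]] by (simp add: e Suc)
qed

lemma iprods_eigen:
 assumes g: "g : G" and Q: "!!i. i < r ==> fid (Q i)" and e: "!!i. i < r ==> g ` Q i = smul (h i) (Q i)"
 shows "g ` iprods r Q a = smul (\<Prod>i<r. h i ^ a i) (iprods r Q a)"
 using Q e
proof (induction r)
 case 0 show ?case using Oi_G_image[OF g] by simp
next
 case (Suc r)
 have f: "fid (ipow (Q r) (a r))" "fid (iprods r Q a)" using Suc.prems by (auto intro: fid_ipow fid_iprods)
 have "g ` iprods r Q a = smul (\<Prod>i<r. h i ^ a i) (iprods r Q a)" by (rule Suc.IH) (use Suc.prems in auto)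
 moreover have "g ` ipow (Q r) (a r) = smul (h r ^ a r) (ipow (Q r) (a r))"
  by (rule ipow_eigen[OF g]) (use Suc.prems in auto)
 ultimately show ?case
  using iprod_G_image[OF g f] smul_iprod_smul[OF f] by (simp add: mult.commute)
qed

lemma prm_G_image:
 assumes g: "g : G" and P: "prm P" shows "prm (g ` P)"
proof -
 have P': "fid P" "P <= Oi" "1 ~: P" "ALL a:Oi. ALL b:Oi. a * b : P --> a : P \<or> b : P"
  using P unfolding prm_def by auto
 have mem: "g x : g ` P \<longleftrightarrow> x : P" if "x : L" for x
  using inj_onD[OF Ginj[OF g], of x] that fidD(1)[OF P'(1)] by (auto simp: image_iff)
 have "a : g ` P \<or> b : g ` P" if ab: "a : Oi" "b : Oi" "a * b : g ` P" for a b
 proof -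
  have "a : g ` Oi" "b : g ` Oi" using ab Oi_G_image[OF g] by auto
  then obtain a' b' where h: "a' : Oi" "a = g a'" "b' : Oi" "b = g b'" by blast
  have "a * b = g (a' * b')" using h Gmult[OF g] Oi_L by simp
  hence "a' * b' : P" using ab(3) mem[OF Oi_L[OF Oi_mult[OF h(1,3)]]] by simp
  thus ?thesis using P'(4) h by blast
 qed
 moreover have "1 ~: g ` P" using mem[OF L1] G1[OF g] P'(3) by simp
 ultimately show ?thesis unfolding prm_def using fid_G_image[OF g P'(1)] G_image_Oi[OF g P'(2)] by blast
qed

lemma ex_prime_over:
 assumes l: "Factorial_Ring.prime (l::nat)"
 obtains P where "prm P" "of_nat l : P"
proof -
 have l0: "l > 0" "l ~= 1" using l prime_gt_0_nat[OF l] by auto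
 define I where "I = smul (of_nat l) Oi"
 have I: "idl I"
  unfolding I_def using l0 Oi_mult[OF Oi_of_nat] by (intro fid_idl fid_smul[OF fid_Oi]) (auto simp: Lof_nat smul_def)
 have "of_nat l : I" using smul_mem[OF Oi_1, of "of_nat l"] by (simp add: I_def)
 moreover have "1 ~: I"
 proof
  assume "1 : I"
  hence "1 / of_nat l : Oi" unfolding I_def using smul_iff[of "of_nat l" 1 Oi] l0 by simp
  moreover have "(1 / of_nat l :: complex) : \<rat>" by simp
  ultimately have "(1 / of_nat l :: complex) : \<int>" by (rule Oi_Rats)
  then obtain z where "(1 / of_nat l :: complex) = of_int z" by (auto elim: Ints_cases)
  hence "(of_int (int l * z) :: complex) = of_int 1" using l0 by (simp add: field_simps)
  hence "int l * z = 1" by (simp only: of_int_eq_iff)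
  hence "int l dvd 1" by (metis dvd_triv_left)
  thus False using l0 by simp
 qed
 ultimately show ?thesis using ex_prime_ideal[OF I l0(1)] that by blast
qed

end

context numfield_prime begin

lemma w_eq_0: assumes "fid I" "I <= Oi" "~ I <= P" shows "w I = 0"
proof -
 have PO: "P \<star> Oi = P" using iprod_Oi[OF fidP] iprod_comm[of P Oi] by simp
 have "~ I <= ipow P (Suc 0)" using assms(3) by (simp add: PO)
 thus ?thesis using w_ge_iff[OF assms(1,2), of "Suc 0"] by simp
qed

lemma v_unit: assumes "u : Oi" "u ~= 0" "inverse u : Oi" shows "v u = 0"
proof -
 have "v u >= 0" "v (inverse u) >= 0" using v_Oi assms by auto
 thus ?thesis using v_inverse[OF Oi_L[OF assms(1)] assms(2)] by simp
qed

lemma w_G_image: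
 assumes I: "fid I" "I <= Oi" and g: "g : G" and vg: "!!x. x : L ==> x ~= 0 ==> v (g x) = v x"
 shows "w (g ` I) = w I"
proof (rule antisym)
 have weg: "we (g x) = we x" "g x ~= 0" if "x : I" "x ~= 0" for x
 proof -
  have xO: "x : Oi" using that I by blast
  show "g x ~= 0" by (rule Gne[OF g Oi_L[OF xO] that(2)])
  thus "we (g x) = we x" using vg[OF Oi_L[OF xO] that(2)] v_Oi[OF xO that(2)] v_Oi[OF Oi_G[OF g xO]] by simp
 qed
 have gI: "fid (g ` I)" "g ` I <= Oi" using fid_G_image[OF g I(1)] G_image_Oi[OF g I(2)] by auto
 obtain x where x: "x : I" "x ~= 0" "we x = w I" using w_attained[OF I] .
 show "w (g ` I) <= w I" using w_le_we[OF gI, of "g x"] weg[OF x(1,2)] x by simp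
 obtain y where y: "y : g ` I" "y ~= 0" "we y = w (g ` I)" using w_attained[OF gI] .
 then obtain x where "x : I" "y = g x" by blast
 thus "w I <= w (g ` I)" using y w_le_we[OF I, of x] weg[of x] G0[OF g] by (cases "x = 0") auto
qed

end

context kumL begin

lemma ram_image: assumes "ram P" shows "sg ` P = P"
proof -
 have prm: "nf.prm P" and vs: "ALL x:Lf. x ~= 0 --> vv P (sg x) = vv P x" using assms unfolding ram_def by auto
 interpret R: kumLP p n q r eta d N \<alpha> P by unfold_locales (rule prm)
 have mem: "sg x : P \<longleftrightarrow> x : P" if x: "x : nf.Oi" for x
 proof (cases "x = 0")
  case True thus ?thesis using nf.G0[OF sg_G] by simp
 next
  case False
  have "R.V.v (sg x) = R.V.v x" using vs nf.Oi_L[OF x] False unfolding R.vv_eq by blast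
  thus ?thesis
   using R.v_pos_iff[OF x False] R.v_pos_iff[OF nf.Oi_G[OF sg_G x] nf.Gne[OF sg_G nf.Oi_L[OF x] False]] by simp
 qed
 show ?thesis
 proof
  show "sg ` P <= P" using mem R.V.P_Oi by blast
  show "P <= sg ` P"
  proof
   fix x assume x: "x : P"
   hence "x : sg ` nf.Oi" using R.V.P_Oi nf.Oi_G_image[OF sg_G] by blast
   then obtain z where "z : nf.Oi" "x = sg z" by blast
   thus "x : sg ` P" using mem x by blast
  qed
 qed
qed

text \<open>All are conjugates of one prime over \<open>N\<close>. If that prime contains
  \<open>of_nat c - eta ^ a0\<close>, the conjugate by \<open>au a 0\<close> contains
  \<open>of_nat c - eta ^ (a * a0 mod p)\<close>, and no prime over \<open>N\<close> contains two
  such elements.\<close>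

lemma primes_over_N:
 obtains Q where "!!a. a : A ==> nf.prm (Q a) & of_nat N : Q a" "!!a b. a : A ==> b : A ==> a ~= b ==> ~ Q a <= Q b"
proof -
 obtain P where P: "nf.prm P" "of_nat N : P" using nf.ex_prime_over[OF Nprime] .
 interpret R: kumLP p n q r eta d N \<alpha> P by unfold_locales (rule P)
 obtain c where c: "int N ^ 1 dvd poly \<Phi> (int c)" "~ [c ^ r = 1] (mod N)" "[c ^ q = 1] (mod N)"
  using cyclotomic_root_mod[OF Nprime N1 p2, of 1] by auto
 have "c ^ r = c" by (simp only: r1 power_one_right)
 hence c2: "~ [c = 1] (mod N)" using c(2) by simp
 obtain a0 where a0: "a0 : A" "of_nat c - eta ^ a0 : P" using R.eta_residue[OF P(2) c(1) c2] by auto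
 define Q where "Q = (%a. au a 0 ` P)"
 have p0: "0 < p" using p_gt by simp
 have prm: "nf.prm (Q a) & of_nat N : Q a" if a: "a : A" for a
 proof
  show "nf.prm (Q a)" unfolding Q_def by (rule nf.prm_G_image[OF au_G[OF a p0] P(1)])
  show "of_nat N : Q a" unfolding Q_def using nf.Gof_nat[OF au_G[OF a p0], of N] P(2) by (metis imageI)
 qed
 have cQ: "of_nat c - eta ^ (a * a0 mod p) : Q a" if a: "a : A" for a
 proof -
  have "au a 0 (of_nat c - eta ^ a0) = of_nat c - (eta ^ a) ^ a0"
   using nf.Gdiff[OF au_G[OF a p0] nf.Lof_nat Lf_pow[OF Lf_eta(1)]] nf.Gof_nat[OF au_G[OF a p0]] au_pow[OF Lf_eta(1) a d_pos] Lf_eta(2)[OF a d_pos] by simp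
  also have "(eta ^ a) ^ a0 = eta ^ (a * a0 mod p)" using eta_mod[of "a * a0"] unfolding modq by (simp add: power_mult)
  finally show ?thesis using a0(2) unfolding Q_def by (metis imageI)
 qed
 have "~ Q a <= Q b" if ab: "a : A" "b : A" "a ~= b" for a b
 proof
  assume "Q a <= Q b"
  interpret S: kumLP p n q r eta d N \<alpha> "Q b" by unfold_locales (use prm[OF ab(2)] in blast)
  have m: "of_nat c - eta ^ (a * a0 mod p) : Q b" "of_nat c - eta ^ (b * a0 mod p) : Q b"
   using cQ[OF ab(1)] cQ[OF ab(2)] \<open>Q a <= Q b\<close> by auto
  have d: "eta ^ (a * a0 mod p) - eta ^ (b * a0 mod p) : Q b" "eta ^ (b * a0 mod p) - eta ^ (a * a0 mod p) : Q b"
   using nf.fid_diff[OF S.V.fidP m(2) m(1)] nf.fid_diff[OF S.V.fidP m(1) m(2)] by simp_all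
  have ne: "a * a0 mod p ~= b * a0 mod p"
  proof
   assume "a * a0 mod p = b * a0 mod p"
   hence eq: "(0 + a * a0) mod p = (0 + b * a0) mod p" by simp
   have inj: "inj_on (%j. (0 + j * a0) mod p) {..<p}" using bij_shift[OF A_dvd[OF a0(1)], of 0] unfolding bij_betw_def by blast
   have "a = b" by (rule inj_onD[OF inj eq]) (use ab A_lt in auto)
   thus False using ab by simp
  qed
  have NQ: "of_nat N : Q b" using prm[OF ab(2)] by blast
  show False using S.eta_diff_notin[OF NQ, of "a * a0 mod p" "b * a0 mod p"] S.eta_diff_notin[OF NQ, of "b * a0 mod p" "a * a0 mod p"] d ne p_gt
   by (metis nat_neq_iff mod_less_divisor p0)
 qed
 thus ?thesis using that[of Q] prm by blast
qed

end

section \<open>Counting torsion classes\<close>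


context kumL begin

lemma vv_props:
 assumes "ram Q"
 shows "numfield_prime Lf Gk Bk bask duak Dk Q" "nf.fid Q" "Q <= nf.Oi"
proof -
 have prm: "nf.prm Q" using assms unfolding ram_def by auto
 interpret R: kumLP p n q r eta d N \<alpha> Q by unfold_locales (rule prm)
 show "numfield_prime Lf Gk Bk bask duak Dk Q" by (rule R.V.numfield_prime_axioms)
 show "nf.fid Q" "Q <= nf.Oi" by (rule R.V.fidP, rule R.V.P_Oi)
qed

lemma NK_nonzero: "x : Lf ==> x ~= 0 ==> NK x ~= 0"
 unfolding NK_def using nf.Gne[OF au_G[OF one_A]] by simp

lemma au_Suc: "b < p ==> sg (au 1 b x) = au 1 (Suc b mod p) x"
 unfolding sg_def using au_au[OF one_A p_gt one_A, of b x] p_gt by simp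

text \<open>An explicit solution of \<open>\<sigma> g / g = y\<^sup>p / N y\<close>, the quotient having norm one.\<close>

lemma power_norm_quotient:
 assumes y: "y : Lf" "y ~= 0"
 obtains g where "g : Lf" "g ~= 0" "sg g * NK y = g * y ^ p"
  "!!Q. ram Q ==> vv Q y = 0 ==> vv Q g = 0"
proof -
 define Y where "Y = (%k. \<Prod>i<k. au 1 i y)"
 have aL: "au 1 i y : Lf" "au 1 i y ~= 0" if "i < p" for i
  using nf.GL[OF au_G[OF one_A that] y(1)] nf.Gne[OF au_G[OF one_A that] y] by auto
 have YL: "Y k : Lf" "Y k ~= 0" if "k <= p" for k
  using that aL unfolding Y_def by (auto intro!: nf.Lprod)
 have Y0: "Y 0 = 1" by (simp add: Y_def)
 have Yp: "Y p = NK y" by (simp add: Y_def NK_def)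
 have sY: "sg (Y k) * y = Y (Suc k)" if k: "k < p" for k
 proof -
  have "sg (Y k) = (\<Prod>i<k. sg (au 1 i y))" unfolding Y_def by (rule nf.Gprod[OF sg_G]) (use aL k in auto)
  also have "... = (\<Prod>i<k. au 1 (Suc i) y)" by (rule prod.cong[OF refl]) (use au_Suc k in auto)
  finally show ?thesis unfolding Y_def prod.lessThan_Suc_shift[of _ k] using au_id[OF y(1)] by (simp add: mult.commute)
 qed
 \<comment> \<open>Each partial product satisfies \<open>sg (Y k) * y = Y (Suc k)\<close>, so the
   product of all \<open>Y k\<close> changes under \<sigma> by a telescoping quotient: the factor
   \<open>y ^ p\<close> against the end term \<open>Y p\<close>, which is the norm.\<close>
 define g where "g = inverse (\<Prod>k<p. Y k)"
 have PL: "(\<Prod>k<p. Y k) : Lf" "(\<Prod>k<p. Y k) ~= 0" using YL by (auto intro!: nf.Lprod)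
 have "sg (\<Prod>k<p. Y k) = (\<Prod>k<p. sg (Y k))" by (rule nf.Gprod[OF sg_G]) (use YL in auto)
 hence "sg (\<Prod>k<p. Y k) * y ^ p = (\<Prod>k<p. sg (Y k) * y)" by (simp add: prod.distrib)
 also have "... = (\<Prod>k<p. Y (Suc k))" by (rule prod.cong[OF refl]) (use sY in simp)
 also have "... = (\<Prod>k<p. Y k) * NK y"
  using prod.lessThan_Suc[of Y p] prod.lessThan_Suc_shift[of Y p] Y0 Yp by simp
 finally have e: "sg (\<Prod>k<p. Y k) * y ^ p = (\<Prod>k<p. Y k) * NK y" .
 have sP: "sg (\<Prod>k<p. Y k) ~= 0" by (rule nf.Gne[OF sg_G PL])
 show ?thesis
 proof
  show "g : Lf" "g ~= 0" using PL nf.Linv by (auto simp: g_def)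
  have "sg g = inverse (sg (\<Prod>k<p. Y k))" unfolding g_def by (rule nf.Ginv[OF sg_G PL(1)])
  moreover have "inverse s * n' = inverse P * Y" if "s * Y = P * n'" "s ~= 0" "P ~= 0" for s n' P Y :: complex
   using that by (simp add: field_simps)
  from this[OF e sP PL(2)] have "inverse (sg (\<Prod>k<p. Y k)) * NK y = g * y ^ p" by (simp only: g_def)
  ultimately show "sg g * NK y = g * y ^ p" by (simp only:)
  fix Q assume Q: "ram Q" and vy: "vv Q y = 0"
  interpret R: numfield_prime Lf Gk Bk bask duak Dk Q by (rule vv_props(1)[OF Q])
  have vs: "R.v (sg x) = R.v x" if "x : Lf" "x ~= 0" for x using Q that unfolding ram_def vv_def by blast
  have va: "R.v (au 1 i y) = 0" if "i < p" for i
   using that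
  proof (induction i)
   case 0 show ?case using au_id[OF y(1)] vy by (simp add: vv_def)
  next
   case (Suc i)
   hence "au 1 (Suc i) y = sg (au 1 i y)" using au_Suc[of i y] by simp
   thus ?case using Suc vs[OF aL[of i]] by simp
  qed
  have "R.v (Y k) = 0" if "k <= p" for k
   unfolding Y_def using R.v_prod[of "{..<k}" "%i. au 1 i y"] aL va that by simp
  hence "R.v (\<Prod>k<p. Y k) = 0" using R.v_prod[of "{..<p}" Y] YL by simp
  thus "vv Q g = 0" using R.v_inverse[OF PL] by (simp add: g_def vv_def)
 qed
qed

lemma NK_divide: "x : Lf ==> x' : Lf ==> NK (x / x') = NK x / NK x'"
 unfolding divide_inverse using NK_mult[OF _ nf.Linv] NK_inverse by simp

lemma NK_pow: "y : Lf ==> NK (y ^ k) = NK y ^ k"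
proof (induction k)
 case 0 show ?case using nf.G1[OF au_G[OF one_A]] by (simp add: NK_def)
next
 case (Suc k) thus ?case using NK_mult[OF Suc.prems nf.Lpow[OF Suc.prems]] by simp
qed

lemma eta_pow_eq: "eta ^ i = eta ^ j ==> i mod p = j mod p"
proof -
 assume "eta ^ i = eta ^ j"
 hence "eta ^ (i mod q) = eta ^ (j mod q)" using eta_mod[of i] eta_mod[of j] by simp
 hence "i mod q = j mod q" by (rule inj_onD[OF eta_inj]) (use q_pos in auto)
 thus ?thesis unfolding modq .
qed

lemma unit_algebra:
 fixes s g m y z ya y0 :: complex
 assumes "g ~= 0" "m ~= 0" "y ~= 0" "z ~= 0" "ya ~= 0" "y0 ~= 0"
 shows "s / (g * y ^ p / m) ^ b / (z / g ^ b) * (ya / y0)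
  = s * ((inverse y ^ b) ^ p * inverse y0) / (inverse ya * z) * m ^ b"
proof -
 have "(inverse y ^ b) ^ p = inverse ((y ^ p) ^ b)" by (simp add: power_inverse mult.commute flip: power_mult)
 moreover have "(g * y ^ p / m) ^ b = g ^ b * (y ^ p) ^ b / m ^ b" by (simp add: power_mult_distrib power_divide)
 moreover define G E M where "G = g ^ b" and "E = (y ^ p) ^ b" and "M = m ^ b"
 moreover have "G ~= 0" "E ~= 0" "M ~= 0" using assms by (auto simp: G_def E_def M_def)
 ultimately show ?thesis using assms by (simp add: divide_inverse mult_ac)
qed

text \<open>The last index \<open>p - 1\<close> belongs to \<open>J\<close>. The hypothesis
  \<open>cs\<close> lists the two ways to detect the exponent of \<open>J\<close> modulo p: through
  the norm of the unit if \<open>p\<close> does not divide \<open>c0\<close>, or through the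
  valuation at \<open>J\<close> if \<open>J\<close> is itself totally ramified and y = 1.\<close>

theorem torsion_count:
 assumes Q: "!!i. i < p - 1 ==> ram (Q i)" "!!i j. i < p - 1 ==> j < p - 1 ==> i ~= j ==> ~ Q i <= Q j"
  and J: "nf.fid J" "J <= nf.Oi" and y: "y : Lf" "y ~= 0" and yJ: "J = nf.smul y (sg ` J)"
  and Ny: "NK y = eta ^ c0"
  and cs: "~ p dvd c0 \<or> (y = 1 & ram J & (ALL i<p - 1. ~ Q i <= J))"
 shows "p ^ ((p - 1) div 2) <= card {x : carrier (class_group Lf). x [^]\<^bsub>class_group Lf\<^esub> p = \<one>\<^bsub>class_group Lf\<^esub>}"
proof -
 interpret C: comm_group "class_group Lf" by (rule nf.comm_group_class_group)
 define I where "I = (%i. if i < p - 1 then Q i else J)"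
 define h where "h = (%i. if i < p - 1 then 1 else inverse y)"
 have Ifid: "nf.fid (I i)" "I i <= nf.Oi" for i using vv_props[OF Q(1)] J by (auto simp: I_def)
 have Ih: "sg ` I i = nf.smul (h i) (I i)" for i
 proof (cases "i < p - 1")
  case True thus ?thesis using ram_image[OF Q(1)] by (simp add: I_def h_def)
 next
  case False
  have "nf.smul (inverse y) J = sg ` J"
   by (subst yJ) (use y(2) in \<open>simp add: nf.smul_smul\<close>)
  thus ?thesis using False by (simp add: I_def h_def)
 qed
 define W where "W = (%a. nf.iprods p I a)"
 have Wfid: "nf.fid (W a)" for a unfolding W_def by (rule nf.fid_iprods) (rule Ifid)
 have pS: "{..<p} = insert (p - 1) {..<p - 1}" using p_gt by auto
 have Wsg: "sg ` W a = nf.smul (inverse y ^ a (p - 1)) (W a)" for a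
 proof -
  have "(\<Prod>i<p. h i ^ a i) = inverse y ^ a (p - 1)" unfolding pS by (simp add: h_def)
  thus ?thesis unfolding W_def using nf.iprods_eigen[where Q = I and h = h and r = p and a = a, OF sg_G Ifid(1) Ih] by simp
 qed
 have clW: "cl = gprod (class_group Lf) p (%i. nf.cls (I i)) a" if "cl = nf.cls (W a)" for cl a
  using that nf.cls_iprods[where Q = I and r = p and c = a, OF Ifid(1)] by (simp add: W_def)
 obtain g where g: "g : Lf" "g ~= 0" "sg g * NK y = g * y ^ p"
  "!!Q. ram Q ==> vv Q y = 0 ==> vv Q g = 0" using power_norm_quotient[OF y] by blast
 have sg0: "sg x : Lf" "x ~= 0 ==> sg x ~= 0" if "x : Lf" for x using nf.GL[OF sg_G that] nf.Gne[OF sg_G that] by auto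
 have NKy: "NK y ~= 0" by (rule NK_nonzero[OF y])
 have vy: "vv R y = 0" if R: "ram R" for R
 proof -
  interpret R: numfield_prime Lf Gk Bk bask duak Dk R by (rule vv_props(1)[OF R])
  have "R.w (sg ` J) = R.w J" using R unfolding ram_def vv_def by (intro R.w_G_image[OF J sg_G]) auto
  moreover have "int (R.w (nf.smul y (sg ` J))) = R.v y + int (R.w (sg ` J))"
   by (rule R.w_smul[OF nf.fid_G_image[OF sg_G J(1)] nf.G_image_Oi[OF sg_G J(2)] y]) (use yJ J(2) in simp)
  ultimately show ?thesis using yJ by (simp add: vv_def)
 qed
 \<comment> \<open>Every vector \<open>a\<close> in the fibre of \<open>a0\<close> yields an element
   \<open>z a\<close> and from it a unit \<open>u a\<close>. By \<open>sep\<close>, distinct vectors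
   give units that are distinct modulo all \<open>dD e\<close>, so \<open>card_units_mod\<close>
   bounds the fibre.\<close>
 have fibre: "card {a : {..<p} \<rightarrow>\<^sub>E {0..<p}. EX c. gprod (class_group Lf) p (%i. nf.cls (I i)) a
   = gprod (class_group Lf) p (%i. nf.cls (I i)) c [^]\<^bsub>class_group Lf\<^esub> p \<otimes>\<^bsub>class_group Lf\<^esub>
    gprod (class_group Lf) p (%i. nf.cls (I i)) a0} <= p ^ ((p - 1) div 2 + 1)" for a0
 proof -
  define F where "F = {a : {..<p} \<rightarrow>\<^sub>E {0..<p}. EX c. gprod (class_group Lf) p (%i. nf.cls (I i)) a
   = gprod (class_group Lf) p (%i. nf.cls (I i)) c [^]\<^bsub>class_group Lf\<^esub> p \<otimes>\<^bsub>class_group Lf\<^esub>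
    gprod (class_group Lf) p (%i. nf.cls (I i)) a0}"
  have finF: "finite F" unfolding F_def by (rule finite_subset[OF _ finite_PiE[of "{..<p}" "%_. {0..<p}"]]) auto
  define rel where "rel = (%a z c. z : Lf & z ~= 0 & W a = nf.smul z (nf.ipow (W c) p \<star> W a0))"
  have ex: "ALL a:F. EX zc. rel a (fst zc) (snd zc)"
  proof
   fix a assume "a : F"
   then obtain c where c: "gprod (class_group Lf) p (%i. nf.cls (I i)) a
    = gprod (class_group Lf) p (%i. nf.cls (I i)) c [^]\<^bsub>class_group Lf\<^esub> p \<otimes>\<^bsub>class_group Lf\<^esub>
     gprod (class_group Lf) p (%i. nf.cls (I i)) a0" by (auto simp: F_def)
   have "nf.cls (W a) = nf.cls (nf.ipow (W c) p \<star> W a0)"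
    unfolding nf.cls_mult[OF nf.fid_ipow[OF Wfid] Wfid] nf.cls_pow[OF Wfid, symmetric]
    using c clW[OF refl, of a] clW[OF refl, of c] clW[OF refl, of a0] by simp
   then obtain z where "z : Lf" "z ~= 0" "W a = nf.smul z (nf.ipow (W c) p \<star> W a0)"
    using nf.cls_eq_iff[OF Wfid nf.fid_iprod[OF nf.fid_ipow[OF Wfid] Wfid]] by blast
   thus "EX zc. rel a (fst zc) (snd zc)" unfolding rel_def by (intro exI[of _ "(z, c)"]) simp
  qed
  obtain zc where zc: "ALL a:F. rel a (fst (zc a)) (snd (zc a))" using bchoice[OF ex] ..
  define z where "z = (%a. fst (zc a))"
  define c where "c = (%a. snd (zc a))"
  have zL: "z a : Lf" "z a ~= 0" and zW: "W a = nf.smul (z a) (nf.ipow (W (c a)) p \<star> W a0)" if "a : F" for a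
   using zc that unfolding rel_def z_def c_def by auto
  \<comment> \<open>\<sigma> puts a power of \<open>y ^ p\<close> on the p-th power of
    \<open>W (c a)\<close>. Dividing by the same power of \<open>g\<close> trades
    \<open>y ^ p\<close> for the norm of \<open>y\<close>, a root of unity.\<close>
  define zs where "zs = (%a. z a / g ^ (c a (p - 1)))"
  have zsL: "zs a : Lf" "zs a ~= 0" if "a : F" for a
   using zL[OF that] g nf.Ldiv nf.Lpow by (auto simp: zs_def)
  \<comment> \<open>The powers of \<open>y\<close> undo what \<sigma> does to \<open>W a\<close> and
    \<open>W a0\<close>. Without them the quotient would be a unit only up to such powers.\<close>
  define u where "u = (%a. sg (zs a) / zs a * (y ^ a (p - 1) / y ^ a0 (p - 1)))"
  have uL: "u a : Lf" "u a ~= 0" if "a : F" for a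
   using zsL[OF that] sg0[OF zsL(1)[OF that]] y by (auto simp: u_def intro!: nf.Lmult nf.Ldiv nf.Lpow)
  have NKu: "NK (u a) = eta ^ (c0 * a (p - 1)) / eta ^ (c0 * a0 (p - 1))" if a: "a : F" for a
  proof -
   have z: "zs a : Lf" "sg (zs a) : Lf" using zsL[OF a] sg0 by auto
   have "NK (u a) = NK (sg (zs a)) / NK (zs a) * (NK (y ^ a (p - 1)) / NK (y ^ a0 (p - 1)))"
    unfolding u_def NK_mult[OF nf.Ldiv[OF z(2,1)] nf.Ldiv[OF nf.Lpow[OF y(1)] nf.Lpow[OF y(1)]]]
     NK_divide[OF z(2,1)] NK_divide[OF nf.Lpow[OF y(1)] nf.Lpow[OF y(1)]] ..
   also have "... = eta ^ (c0 * a (p - 1)) / eta ^ (c0 * a0 (p - 1))"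
    unfolding NK_sg NK_pow[OF y(1)] Ny power_mult using NK_nonzero[OF zsL[OF a]] by simp
   finally show ?thesis .
  qed
  have uU: "u a : U" if a: "a : F" for a
  proof -
   define M where "M = nf.ipow (W (c a)) p \<star> W a0"
   have fM: "nf.fid M" unfolding M_def by (intro nf.fid_iprod nf.fid_ipow Wfid)
   define b where "b = c a (p - 1)"
   have sM: "sg ` M = nf.smul ((inverse y ^ b) ^ p * inverse y ^ a0 (p - 1)) M"
    unfolding M_def nf.iprod_G_image[OF sg_G nf.fid_ipow[OF Wfid] Wfid] nf.ipow_eigen[OF sg_G Wfid Wsg] Wsg
     nf.smul_iprod_smul[OF nf.fid_ipow[OF Wfid] Wfid] b_def ..
   have "sg ` W a = nf.smul (sg (z a)) (sg ` M)"
    unfolding zW[OF a] M_def[symmetric] by (rule nf.smul_G_image[OF sg_G fM zL(1)[OF a]])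
   hence e1: "nf.smul (inverse y ^ a (p - 1)) (W a) = nf.smul (sg (z a) * ((inverse y ^ b) ^ p * inverse y ^ a0 (p - 1))) M"
    unfolding sM nf.smul_smul Wsg .
   have "nf.smul (inverse y ^ a (p - 1) * z a) M = nf.smul (inverse y ^ a (p - 1)) (W a)"
    unfolding zW[OF a] M_def nf.smul_smul ..
   also note e1
   finally have XX0: "nf.smul (inverse y ^ a (p - 1) * z a) M = nf.smul (sg (z a) * ((inverse y ^ b) ^ p * inverse y ^ a0 (p - 1))) M" .
   define xx where "xx = inverse y ^ a (p - 1) * z a"
   define xx' where "xx' = sg (z a) * ((inverse y ^ b) ^ p * inverse y ^ a0 (p - 1))"
   have XX: "nf.smul xx' M = nf.smul xx M" unfolding xx_def xx'_def XX0 ..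
   have xx: "xx : Lf" "xx ~= 0" "xx' : Lf" "xx' ~= 0"
    using zL[OF a] sg0[OF zL(1)[OF a]] y unfolding xx_def xx'_def by (auto intro!: nf.Lmult nf.Lpow nf.Linv)
   have OX: "xx' / xx : nf.Oi" "xx / xx' : nf.Oi" using nf.smul_inject_unit[OF fM xx(3,4,1,2) XX] by auto
   have sgz: "sg (zs a) = sg (z a) / sg g ^ b"
    unfolding zs_def b_def using nf.Gdiv[OF sg_G zL(1)[OF a] nf.Lpow[OF g(1)]] nf.Gpow[OF sg_G g(1)] by simp
   have sgg: "sg g = g * y ^ p / NK y" using g(3) NKy by (simp add: field_simps)
   have uX: "u a = xx' / xx * NK y ^ b"
   proof -
    have "u a = sg (z a) / (g * y ^ p / NK y) ^ b / (z a / g ^ b) * (y ^ a (p - 1) / y ^ a0 (p - 1))"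
     unfolding u_def sgz sgg by (simp add: zs_def b_def)
    also have "... = xx' / xx * NK y ^ b"
     unfolding xx_def xx'_def power_inverse[of y "a (p - 1)"] power_inverse[of y "a0 (p - 1)"]
     by (rule unit_algebra) (use g(2) NKy y(2) zL[OF a] in auto)
    finally show ?thesis .
   qed
   have NO: "NK y ^ b : nf.Oi" "inverse (NK y ^ b) : nf.Oi"
    unfolding Ny eta_inv_pow power_mult[symmetric] nf.Oi_def
    using Lf_pow[OF Lf_eta(1)] algebraic_int_power_complex[OF eta_alg] by auto
   have "u a : nf.Oi" unfolding uX by (rule nf.Oi_mult[OF OX(1) NO(1)])
   moreover have "inverse (u a) = xx / xx' * inverse (NK y ^ b)" unfolding uX by (simp add: field_simps)
   hence "inverse (u a) : nf.Oi" using nf.Oi_mult[OF OX(2) NO(2)] by simp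
   moreover have "EX k. NK (u a) = eta ^ k"
   proof -
    have "NK (u a) = eta ^ (c0 * a (p - 1)) / eta ^ (c0 * a0 (p - 1))" by (rule NKu[OF a])
    also have "... = eta ^ (c0 * a (p - 1)) * inverse (eta ^ (c0 * a0 (p - 1)))"
     by (simp only: divide_inverse)
    also have "... = eta ^ (c0 * a (p - 1) + c0 * a0 (p - 1) * (p - 1))" unfolding eta_inv_pow power_add ..
    finally show ?thesis ..
   qed
   ultimately show ?thesis using uL(2)[OF a] by (simp add: U_def)
  qed
  have sep: "a = a'" if a: "a : F" and a': "a' : F" and e: "e : U" and ue: "u a / u a' = dD e" for a a' e
  proof -
   have aP: "a : {..<p} \<rightarrow>\<^sub>E {0..<p}" "a' : {..<p} \<rightarrow>\<^sub>E {0..<p}" using a a' by (auto simp: F_def)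
   have alt: "a i < p" "a' i < p" if "i < p" for i using PiE_mem[OF aP(1), of i] PiE_mem[OF aP(2), of i] that by auto
   have eL: "e : Lf" "e ~= 0" "sg e : Lf" "sg e ~= 0" using U_Lf(1,3)[OF e] U_Lf(1,3)[OF U_sg[OF e]] by auto
   \<comment> \<open>Units \<open>dD e\<close> have norm 1, whereas the norm of \<open>u a\<close>
     is \<open>eta\<close> to the power \<open>c0\<close> times the change of the last exponent; so
     if \<open>p\<close> does not divide \<open>c0\<close> the last exponents agree.\<close>
   have "NK (u a / u a') = 1"
    unfolding ue dD_def NK_divide[OF eL(1,3)] NK_sg using NK_nonzero[OF eL(1,2)] by simp
   hence "eta ^ (c0 * a (p - 1)) = eta ^ (c0 * a' (p - 1))"
    unfolding NK_divide[OF uL(1)[OF a] uL(1)[OF a']] NKu[OF a] NKu[OF a'] using eta_ne0 by simp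
   hence c0b: "[c0 * a (p - 1) = c0 * a' (p - 1)] (mod p)" unfolding cong_def by (rule eta_pow_eq)
   have beq: "a (p - 1) = a' (p - 1)" if "~ p dvd c0"
   proof -
    have "coprime c0 p" using prime_imp_coprime[OF p that] by (simp add: coprime_commute)
    hence "[a (p - 1) = a' (p - 1)] (mod p)" using c0b by (simp add: cong_mult_lcancel_nat)
    thus ?thesis using alt[of "p - 1"] p_gt by (simp add: cong_def)
   qed
   have yy: "y ^ a (p - 1) / y ^ a' (p - 1) = 1" using cs beq y(2) by auto
   have zz: "zs a ~= 0" "zs a' ~= 0" "sg (zs a) ~= 0" "sg (zs a') ~= 0"
    using zsL[OF a] zsL[OF a'] sg0 by auto
   have "u a / u a' = (sg (zs a) / zs a) / (sg (zs a') / zs a') * (y ^ a (p - 1) / y ^ a' (p - 1))"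
    unfolding u_def using zz y(2) by (simp add: divide_simps)
   hence eq: "(sg (zs a) / zs a) / (sg (zs a') / zs a') = e / sg e" unfolding yy ue dD_def by simp
   \<comment> \<open>Once the powers of \<open>y\<close> cancel, this element is fixed by \<sigma>
     and lies in K. Its valuation at a totally ramified prime is divisible by p, and up to multiples
     of p it is the difference of the valuations of \<open>W a\<close> and \<open>W a'\<close>, from
     which the exponents are read off.\<close>
   define k where "k = e * (zs a / zs a')"
   have kL: "k : Lf" "k ~= 0" unfolding k_def using eL zsL[OF a] zsL[OF a'] by (auto intro!: nf.Lmult nf.Ldiv)
   have "sg k = sg e * (sg (zs a) / sg (zs a'))"
    unfolding k_def nf.Gmult[OF sg_G eL(1) nf.Ldiv[OF zsL(1)[OF a] zsL(1)[OF a']]] nf.Gdiv[OF sg_G zsL(1)[OF a] zsL(1)[OF a']] ..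
   also have "... = k" unfolding k_def using eq eL zz by (simp add: field_simps)
   finally have kK: "k : Kf" using kL by (simp add: Kf_def)
   have dvd: "int p dvd int (\<Sum>i<p. a i * numfield_prime.w Lf R (I i)) - int (\<Sum>i<p. a' i * numfield_prime.w Lf R (I i))"
    if R: "ram R" for R
   proof -
    interpret R: numfield_prime Lf Gk Bk bask duak Dk R by (rule vv_props(1)[OF R])
    have wW: "R.w (W a) = (\<Sum>i<p. a i * R.w (I i))" "W a <= nf.Oi" for a
     unfolding W_def using R.w_iprods[of p I a] Ifid by auto
    have vg: "R.v g = 0" using g(4)[OF R vy[OF R]] by (simp add: vv_def)
    have wz: "EX t. int (R.w (W a)) = R.v (zs a) + int (p * t) + int (R.w (W a0))" if a: "a : F" for a
    proof -
     have f: "nf.fid (nf.ipow (W (c a)) p)" "nf.ipow (W (c a)) p <= nf.Oi" "R.w (nf.ipow (W (c a)) p) = p * R.w (W (c a))"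
      using nf.fid_ipow[OF Wfid] R.w_ipow[OF Wfid wW(2)] by auto
     have fO: "nf.ipow (W (c a)) p \<star> W a0 <= nf.Oi"
      using nf.fid_subset_iprod[OF f(1) wW(2)] f(2) by blast
     have "int (R.w (W a)) = R.v (z a) + int (R.w (nf.ipow (W (c a)) p \<star> W a0))"
      by (subst zW[OF a], rule R.w_smul[OF nf.fid_iprod[OF f(1) Wfid] fO zL[OF a]])
       (use zW[OF a] wW(2)[of a] in simp)
     moreover have "R.v (zs a) = R.v (z a)"
      unfolding zs_def using R.v_divide[OF zL[OF a] nf.Lpow[OF g(1)]] R.v_power[OF g(1,2)] g(2) vg by simp
     ultimately show ?thesis using R.w_mult[OF f(1,2) Wfid wW(2)] f(3) by auto
    qed
    obtain t where t: "int (R.w (W a)) = R.v (zs a) + int (p * t) + int (R.w (W a0))" using wz[OF a] ..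
    obtain t' where t': "int (R.w (W a')) = R.v (zs a') + int (p * t') + int (R.w (W a0))" using wz[OF a'] ..
    have "R.v e = 0" by (rule R.v_unit) (use e in \<open>auto simp: U_def\<close>)
    hence "R.v k = R.v (zs a) - R.v (zs a')"
     unfolding k_def using R.v_mult[OF eL(1,2) nf.Ldiv[OF zsL(1)[OF a] zsL(1)[OF a']]] zz
      R.v_divide[OF zsL[OF a] zsL[OF a']] by simp
    hence "int (R.w (W a)) - int (R.w (W a')) = R.v k + int p * (int t - int t')"
     using t t' by (simp add: algebra_simps)
    moreover have "int p dvd R.v k" using R kK kL(2) unfolding ram_def vv_def by blast
    ultimately show ?thesis unfolding wW(1)[symmetric] by simp
   qed
   have small: "x = x'" if "int p dvd int x - int x'" "x < p" "x' < p" for x x'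
   proof -
    have "[int x = int x'] (mod int p)" using that(1) by (simp add: cong_iff_dvd_diff)
    hence "[x = x'] (mod p)" by (simp only: cong_int_iff)
    thus ?thesis using that(2,3) by (simp add: cong_def)
   qed
   have beq': "a (p - 1) = a' (p - 1)"
   proof (cases "p dvd c0")
    case False thus ?thesis by (rule beq)
   next
    case True
    hence J': "ram J" "ALL i<p - 1. ~ Q i <= J" using cs by auto
    interpret R: numfield_prime Lf Gk Bk bask duak Dk J by (rule vv_props(1)[OF J'(1)])
    have "R.w (I i) = 0" if "i < p - 1" for i
     using R.w_eq_0[OF Ifid, of i] J'(2) that by (simp add: I_def)
    hence "(\<Sum>i<p. x i * R.w (I i)) = x (p - 1)" for x :: "nat => nat"
     unfolding pS using R.w_self by (simp add: I_def)
    hence "int p dvd int (a (p - 1)) - int (a' (p - 1))" using dvd[OF J'(1)] by simp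
    thus ?thesis by (rule small) (use alt p_gt in auto)
   qed
   show "a = a'"
   proof (rule PiE_ext[OF aP])
    fix j assume "j : {..<p}"
    hence jp: "j < p" by simp
    show "a j = a' j"
    proof (cases "j = p - 1")
     case True thus ?thesis using beq' by simp
    next
     case False
     hence j: "j < p - 1" using jp by simp
     interpret R: numfield_prime Lf Gk Bk bask duak Dk "Q j" by (rule vv_props(1)[OF Q(1)[OF j]])
     have w0: "R.w (I i) = (if i = j then 1 else 0)" if "i < p - 1" for i
      using R.w_eq_0[OF Ifid, of i] R.w_self Q(2)[OF that j] that by (simp add: I_def)
     have "(\<Sum>i<p. x i * R.w (I i)) = x (p - 1) * R.w (I (p - 1)) + x j" for x :: "nat => nat"
     proof -
      have "(\<Sum>i<p - 1. x i * R.w (I i)) = (\<Sum>i<p - 1. if i = j then x i else 0)"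
       by (rule sum.cong[OF refl]) (use w0 in auto)
      thus ?thesis unfolding pS using j by simp
     qed
     hence "int p dvd int (a j) - int (a' j)" using dvd[OF Q(1)[OF j]] beq' by simp
     thus ?thesis by (rule small) (use alt jp in auto)
    qed
   qed
  qed
  have inj: "inj_on u F"
  proof (rule inj_onI)
   fix a a' assume h: "a : F" "a' : F" "u a = u a'"
   have "u a / u a' = dD 1" using h uL(2)[OF h(2)] nf.G1[OF sg_G] by (simp add: dD_def)
   thus "a = a'" by (rule sep[OF h(1,2) U_1])
  qed
  have "card (u ` F) <= p ^ ((p - 1) div 2 + 1)"
  proof (rule card_units_mod)
   show "finite (u ` F)" using finF by simp
   show "u ` F <= U" using uU by blast
   fix s t e assume st: "s : u ` F" "t : u ` F" "e : U" "s / t = dD e"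
   then obtain a a' where "a : F" "s = u a" "a' : F" "t = u a'" by blast
   thus "s = t" using sep[of a a' e] st by simp
  qed
  thus ?thesis unfolding F_def[symmetric] by (simp add: card_image[OF inj])
 qed
 have "p ^ p <= p ^ ((p - 1) div 2 + 1) * card {x : carrier (class_group Lf). x [^]\<^bsub>class_group Lf\<^esub> p = \<one>\<^bsub>class_group Lf\<^esub>}"
  by (rule C.card_torsion_ge[OF nf.finite_class_group _ _ _ fibre]) (use p_gt nf.cls_carrier[OF Ifid(1)] in auto)
 moreover have "p = ((p - 1) div 2 + 1) + (p - 1) div 2" using p2 by (auto elim!: oddE)
 hence "p ^ p = p ^ ((p - 1) div 2 + 1) * p ^ ((p - 1) div 2)" by (metis power_add)
 ultimately show ?thesis using p_gt by simp
qed

end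

section \<open>Norms from the cyclotomic field of conductor p squared\<close>


text \<open>Iterates of a point that is not fixed form an orbit of exactly \<open>p\<close>
  elements, and these orbits partition the set of points that are not fixed.\<close>

lemma card_fixpoints_mod:
 assumes fin: "finite V" and f: "!!v. v : V ==> f v : V" and per: "!!v. v : V ==> (f ^^ p) v = v"
  and p: "Factorial_Ring.prime (p::nat)"
 shows "[card V = card {v : V. f v = v}] (mod p)"
proof -
 define R where "R = (%v. range (%i. (f ^^ i) v))"
 have p0: "p > 0" using prime_gt_0_nat[OF p] .
 have fV: "(f ^^ i) v : V" if "v : V" for i v using that by (induction i) (auto simp: f)
 have perk: "(f ^^ (p * k)) v = v" if v: "v : V" for k v
  by (induction k) (auto simp: funpow_add per[OF v] v)
 have md: "(f ^^ i) v = (f ^^ (i mod p)) v" if v: "v : V" for i v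
 proof -
  have "(f ^^ i) v = (f ^^ (i mod p + p * (i div p))) v" by simp
  thus ?thesis unfolding funpow_add by (simp add: perk[OF v])
 qed
 have Rp: "R v = (%i. (f ^^ i) v) ` {..<p}" if v: "v : V" for v
 proof
  show "R v <= (%i. (f ^^ i) v) ` {..<p}" unfolding R_def
  proof
   fix x assume "x : range (%i. (f ^^ i) v)"
   then obtain i where "x = (f ^^ i) v" by blast
   hence "x = (f ^^ (i mod p)) v" using md[OF v] by simp
   thus "x : (%i. (f ^^ i) v) ` {..<p}" using p0 by simp
  qed
 qed (auto simp: R_def)
 have bck: "v = (f ^^ (p * i - i)) ((f ^^ i) v)" if v: "v : V" for i v
 proof -
  have "(f ^^ (p * i - i)) ((f ^^ i) v) = (f ^^ (p * i - i + i)) v" by (simp add: funpow_add)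
  also have "p * i - i + i = p * i" using p0 by simp
  finally show ?thesis using perk[OF v] by simp
 qed
 have Req: "R u = R v" if v: "v : V" and u: "u : R v" for u v
 proof -
  have sub: "R ((f ^^ i) v) <= R v" for i v unfolding R_def by (auto simp flip: funpow_add[THEN fun_cong, simplified o_def])
  obtain i where i: "u = (f ^^ i) v" using u by (auto simp: R_def)
  have "R v <= R u" using sub[of "p * i - i" u] bck[OF v, of i] i by simp
  thus ?thesis using sub[of i v] i by auto
 qed
 define W where "W = {v : V. f v ~= v}"
 have RW: "R v <= W" if v: "v : W" for v
 proof
  fix u assume u: "u : R v"
  have vV: "v : V" using v by (simp add: W_def)
  obtain i where i: "u = (f ^^ i) v" using u by (auto simp: R_def)
  have "f u ~= u"
  proof
   assume fu: "f u = u"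
   have "(f ^^ j) u = u" for j by (induction j) (auto simp: fu)
   hence "v = u" using bck[OF vV, of i] i by simp
   thus False using fu v by (simp add: W_def)
  qed
  thus "u : W" using fV[OF vV] i by (simp add: W_def)
 qed
 have cardR: "card (R v) = p" if v: "v : W" for v
 proof -
  have vV: "v : V" and nf: "f v ~= v" using v by (auto simp: W_def)
  have "inj_on (%i. (f ^^ i) v) {..<p}"
  proof (rule inj_onI)
   have *: False if "i < j" "j < p" "(f ^^ i) v = (f ^^ j) v" for i j
   proof -
    define k where "k = j - i"
    have "(f ^^ (p * i - i)) ((f ^^ j) v) = v" using bck[OF vV, of i] that(3) by simp
    moreover have "(f ^^ (p * i - i)) ((f ^^ j) v) = (f ^^ (p * i + k)) v"
    proof -
     have "i <= p * i" using p0 by simp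
     hence "p * i - i + j = p * i + k" using that(1) by (simp add: k_def)
     thus ?thesis by (metis funpow_add comp_apply)
    qed
    moreover have "(f ^^ (p * i + k)) v = (f ^^ k) v"
     using md[OF vV, of "p * i + k"] md[OF vV, of k] by simp
    ultimately have kv: "(f ^^ k) v = v" by simp
    have "~ p dvd k" using that by (auto simp: k_def dest: dvd_imp_le)
    hence "coprime k p" using prime_imp_coprime[OF p, of k] by (simp add: coprime_commute)
    then obtain t where "[k * t = 1] (mod p)" by (metis cong_solve_coprime_nat One_nat_def)
    hence "(k * t) mod p = 1 mod p" by (simp add: cong_def)
    moreover have "(f ^^ (k * t)) v = v" by (induction t) (auto simp: funpow_add kv)
    ultimately have "(f ^^ 1) v = v" using md[OF vV, of "k * t"] md[OF vV, of 1] by simp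
    thus False using nf by simp
   qed
   fix i j assume "i : {..<p}" "j : {..<p}" "(f ^^ i) v = (f ^^ j) v"
   thus "i = j" using *[of i j] *[of j i] by (metis lessThan_iff nat_neq_iff)
  qed
  thus ?thesis unfolding Rp[OF vV] by (simp add: card_image)
 qed
 have vR: "v : R v" for v unfolding R_def by (rule range_eqI[of _ _ 0]) simp
 have UW: "\<Union> (R ` W) = W" using RW vR by blast
 have finW: "finite W" using fin by (simp add: W_def)
 have "p * card (R ` W) = card (\<Union> (R ` W))"
 proof (rule card_partition)
  show "finite (R ` W)" "finite (\<Union> (R ` W))" using finW UW by auto
  show "card c = p" if "c : R ` W" for c using that cardR by auto
  fix c1 c2 assume c: "c1 : R ` W" "c2 : R ` W" "c1 ~= c2"
  show "c1 \<inter> c2 = {}"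
  proof (rule ccontr)
   assume "c1 \<inter> c2 ~= {}"
   then obtain u where u: "u : c1" "u : c2" by blast
   obtain v1 v2 where vs: "v1 : V" "c1 = R v1" "v2 : V" "c2 = R v2" using c(1,2) unfolding W_def by blast
   have "R u = c1" "R u = c2" using Req[OF vs(1), of u] Req[OF vs(3), of u] u vs by simp_all
   thus False using c(3) by simp
  qed
 qed
 hence cW: "card W = p * card (R ` W)" unfolding UW by simp
 have "V = W \<union> {v : V. f v = v}" "W \<inter> {v : V. f v = v} = {}" by (auto simp: W_def)
 hence "card V = card W + card {v : V. f v = v}" using fin finW card_Un_disjoint[of W "{v : V. f v = v}"] by simp
 thus ?thesis unfolding cW by (simp add: cong_def)
qed

context numfield begin

text \<open>The Galois action on classes, computed on an arbitrary representative;
  \<open>cact_cls\<close> shows that the choice is immaterial.\<close>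

definition cact :: "(complex => complex) => complex set set => complex set set"
 where "cact g c = cls (g ` (SOME I. fid I & c = cls I))"

lemma cact_cls: assumes g: "g : G" and I: "fid I" shows "cact g (cls I) = cls (g ` I)"
proof -
 define J where "J = (SOME J. fid J & cls I = cls J)"
 have J: "fid J & cls I = cls J" unfolding J_def by (rule someI[of _ I]) (simp add: I)
 then obtain x where x: "x : L" "x ~= 0" "I = smul x J" using cls_eq_iff[OF I] by blast
 have "g ` I = smul (g x) (g ` J)" unfolding x(3) using smul_G_image[OF g] J x by blast
 hence "cls (g ` I) = cls (g ` J)"
  using cls_eq_iff[OF fid_G_image[OF g I] fid_G_image[OF g]] J GL[OF g x(1)] Gne[OF g x(1,2)] by blast
 thus ?thesis unfolding cact_def J_def[symmetric] by simp
qed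

lemma cls_principal_iff: assumes "fid I" shows "cls I = \<one>\<^bsub>class_group L\<^esub> \<longleftrightarrow> (EX x:L. x ~= 0 & I = smul x Oi)"
 using cls_eq_iff[OF assms fid_Oi] by (simp add: cls_one)

end

context kum begin

lemma au_pow_A: "a : A ==> a ^ j mod q : A"
proof (induction j)
 case 0 show ?case using one_A q_pos by simp
next
 case (Suc j)
 have "a * (a ^ j mod q) mod q : A" by (rule A_mult[OF Suc.prems Suc.IH[OF Suc.prems]])
 thus ?case by (simp add: mod_mult_right_eq)
qed

lemma au_Gk: "a : A ==> b < d ==> au a b : Gk" unfolding Gk_def by auto

lemma au_step: assumes a: "a : A" shows "au a 0 (au (a ^ j mod q) 0 x) = au (a ^ Suc j mod q) 0 x"
 using fun_cong[OF au_comp[OF a d_pos au_pow_A[OF a] d_pos, of j], of x] d_pos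
 by (simp add: mod_mult_right_eq)

lemma au_one_pow: assumes "x : Lf" shows "au (a ^ 0 mod q) 0 x = x"
 using au_id[OF assms] q_pos by simp

text \<open>Hilbert 90 for the cyclic group generated by \<open>au a 0\<close>, of order
  \<open>M\<close>: the resolvent, the sum of \<open>c j * g j \<phi>\<close>, solves the equation
  for every \<phi>. It is nonzero for some \<phi> in the dual frame, by the orthogonality
  \<open>dual_sum\<close>.\<close>

lemma hilbert90:
 assumes a: "a : A" and M: "M > 0" "a ^ M mod q = 1" "!!j. 0 < j ==> j < M ==> a ^ j mod q ~= 1"
  and k: "k : Lf" and Nk: "(\<Prod>j<M. au (a ^ j mod q) 0 k) = 1"
 obtains z where "z : Lf" "z ~= 0" "z = k * au a 0 z"
proof -
 define g where "g = (%j. au (a ^ j mod q) 0)"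
 have gG: "g j : Gk" for j unfolding g_def by (rule au_Gk[OF au_pow_A[OF a] d_pos])
 have aG: "au a 0 : Gk" by (rule au_Gk[OF a d_pos])
 have gS: "au a 0 (g j x) = g (Suc j) x" for j x unfolding g_def by (rule au_step[OF a])
 have g0: "g 0 x = x" if "x : Lf" for x unfolding g_def by (rule au_one_pow[OF that])
 have gM: "g M x = x" if "x : Lf" for x unfolding g_def M(2) by (rule au_id[OF that])
 define c where "c = (%j. \<Prod>i<j. g i k)"
 have gkL: "g i k : Lf" for i by (rule nf.GL[OF gG k])
 have cL: "c j : Lf" for j unfolding c_def by (rule nf.Lprod[OF gkL])
 have c0: "c 0 = 1" by (simp add: c_def)
 have cM: "c M = 1" using Nk by (simp add: c_def g_def)
 have cS: "k * au a 0 (c j) = c (Suc j)" for j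
 proof -
  have "au a 0 (c j) = (\<Prod>i<j. g (Suc i) k)"
   unfolding c_def gS[symmetric] by (rule nf.Gprod[OF aG gkL])
  thus ?thesis unfolding c_def prod.lessThan_Suc_shift[of _ j] g0[OF k] by simp
 qed
 define z where "z = (%\<phi>. \<Sum>j<M. c j * g j \<phi>)"
 have zL: "z \<phi> : Lf" if "\<phi> : Lf" for \<phi> unfolding z_def by (intro nf.Lsum nf.Lmult cL nf.GL[OF gG that])
 have zz: "z \<phi> = k * au a 0 (z \<phi>)" if \<phi>: "\<phi> : Lf" for \<phi>
 proof -
  have "au a 0 (z \<phi>) = (\<Sum>j<M. au a 0 (c j * g j \<phi>))"
   unfolding z_def by (rule nf.Gsum[OF aG]) (intro nf.Lmult cL nf.GL[OF gG \<phi>])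
  also have "... = (\<Sum>j<M. au a 0 (c j) * g (Suc j) \<phi>)"
   by (rule sum.cong[OF refl]) (simp add: nf.Gmult[OF aG cL nf.GL[OF gG \<phi>]] gS)
  finally have "k * au a 0 (z \<phi>) = (\<Sum>j<M. c (Suc j) * g (Suc j) \<phi>)"
   by (simp add: sum_distrib_left cS mult.assoc[symmetric])
  also have "... = (\<Sum>j<M. c j * g j \<phi>)"
   using sum.lessThan_Suc[of "%j. c j * g j \<phi>" M] sum.lessThan_Suc_shift[of "%j. c j * g j \<phi>" M]
    c0 cM g0[OF \<phi>] gM[OF \<phi>] by simp
  finally show ?thesis by (simp add: z_def)
 qed
 have "EX i j. z (duak (i,j)) ~= 0"
 proof (rule ccontr)
  assume "~ ?thesis"
  hence 0: "z (duak (i,j)) = 0" for i j by blast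
  have gd: "g l (duak (i,j)) = (eta ^ (a ^ l mod q)) ^ (q - i) * (\<zeta> ^ 0 * \<alpha>) ^ (d - j)" for l i j
  proof -
   have aA: "a ^ l mod q : A" by (rule au_pow_A[OF a])
   show ?thesis unfolding g_def duak_def using Lf_add(4)[OF Lf_pow[OF Lf_eta(1)] Lf_pow[OF Lf_\<alpha>(1)] aA d_pos]
    au_pow[OF Lf_eta(1) aA d_pos] au_pow[OF Lf_\<alpha>(1) aA d_pos] Lf_eta(2)[OF aA d_pos] Lf_\<alpha>(2)[OF aA d_pos] by simp
  qed
  \<comment> \<open>If all resolvents vanished, pairing them with the frame would isolate the
    coefficient of the identity, \<open>c 0 = 1\<close>, and give \<open>Dk = 0\<close>.\<close>
  have "0 = (\<Sum>i<q. \<Sum>j<d. z (duak (i,j)) * (eta ^ i * \<alpha> ^ j))" by (simp add: 0)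
  also have "... = (\<Sum>i<q. \<Sum>j<d. \<Sum>l<M. c l * ((eta ^ (a ^ l mod q)) ^ (q - i) * (\<zeta> ^ 0 * \<alpha>) ^ (d - j) * (eta ^ i * \<alpha> ^ j)))"
   unfolding z_def sum_distrib_right gd by (simp only: mult.assoc)
  also have "... = (\<Sum>i<q. \<Sum>l<M. \<Sum>j<d. c l * ((eta ^ (a ^ l mod q)) ^ (q - i) * (\<zeta> ^ 0 * \<alpha>) ^ (d - j) * (eta ^ i * \<alpha> ^ j)))"
   by (rule sum.cong[OF refl]) (rule sum.swap)
  also have "... = (\<Sum>l<M. \<Sum>i<q. \<Sum>j<d. c l * ((eta ^ (a ^ l mod q)) ^ (q - i) * (\<zeta> ^ 0 * \<alpha>) ^ (d - j) * (eta ^ i * \<alpha> ^ j)))"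
   by (rule sum.swap)
  also have "... = (\<Sum>l<M. c l * (if a ^ l mod q = 1 & (0::nat) = 0 then of_nat Dk else 0))"
   by (rule sum.cong[OF refl], unfold sum_distrib_left[symmetric], subst dual_sum[OF au_pow_A[OF a] d_pos]) simp
  also have "... = (\<Sum>l<M. if l = 0 then of_nat Dk else 0)"
  proof (rule sum.cong[OF refl])
   fix l assume l: "l : {..<M}"
   show "c l * (if a ^ l mod q = 1 & (0::nat) = 0 then of_nat Dk else 0) = (if l = 0 then of_nat Dk else 0)"
    using M(3)[of l] l c0 q_pos by (cases "l = 0") auto
  qed
  also have "... = of_nat Dk" using M(1) by simp
  finally show False using nf.Dpos by simp
 qed
 then obtain i j where ij: "z (duak (i,j)) ~= 0" by blast
 show ?thesis by (rule that[OF zL[OF Lf_duak] ij zz[OF Lf_duak]])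
qed

end


text \<open>The field of p^2-th roots of unity; with \<open>d = 1\<close> the element \<alpha> is
  \<open>N\<close> itself and the Galois group is the group of residues prime to p^2.\<close>

locale kumE = kum +
 assumes n2: "n = 2" and d1: "d = 1" and p2: "odd p"
begin

lemma q2: "q = p ^ 2" using n2 by (simp add: q_def)


lemma eta_O: "eta ^ k : nf.Oi"
 unfolding nf.Oi_def using Lf_pow[OF Lf_eta(1)] algebraic_int_power_complex[OF eta_alg] by simp
lemma lm_O: "lm : nf.Oi" unfolding lm_def using nf.Oi_diff[OF nf.Oi_1 eta_O[of 1]] by simp

lemma trace_formula:
 assumes x: "x : Lf"
 shows "of_nat q * x = (\<Sum>i<q. (\<Sum>g\<in>Gk. g (eta ^ (q - i) * x)) * eta ^ i)"
proof -
 have N0: "(of_nat N :: complex) ~= 0" using Nprime by (auto simp: prime_gt_0_nat)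
 have ld: "{..<d} = {0}" by (simp add: d1 lessThan_Suc)
 have DkE: "(of_nat Dk :: complex) = of_nat N * of_nat q" unfolding Dk_def by (simp add: d1)
 have "of_nat Dk * x = (\<Sum>k\<in>Bk. (\<Sum>g\<in>Gk. g (duak k * x)) * bask k)" by (rule dual_k[OF x])
 also have "... = (\<Sum>i<q. (\<Sum>g\<in>Gk. g (duak (i,0) * x)) * bask (i,0))"
 proof -
  have "Bk = (%i. (i,0)) ` {..<q}" unfolding Bk_def ld by auto
  thus ?thesis by (simp add: sum.reindex inj_on_def)
 qed
 also have "... = (\<Sum>i<q. of_nat N * ((\<Sum>g\<in>Gk. g (eta ^ (q - i) * x)) * eta ^ i))"
 proof (rule sum.cong[OF refl])
  fix i
  have "g (duak (i,0) * x) = of_nat N * g (eta ^ (q - i) * x)" if g: "g : Gk" for g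
  proof -
   have "duak (i,0) * x = of_nat N * (eta ^ (q - i) * x)"
    unfolding duak_def by (simp add: \<alpha>d mult_ac)
   hence "g (duak (i,0) * x) = g (of_nat N * (eta ^ (q - i) * x))" by (simp only:)
   also have "... = of_nat N * g (eta ^ (q - i) * x)"
    unfolding nf.Gmult[OF g nf.Lof_nat nf.Lmult[OF Lf_pow[OF Lf_eta(1)] x]] nf.Gof_nat[OF g] ..
   finally show ?thesis .
  qed
  hence "(\<Sum>g\<in>Gk. g (duak (i,0) * x)) = of_nat N * (\<Sum>g\<in>Gk. g (eta ^ (q - i) * x))"
   by (simp add: sum_distrib_left)
  thus "(\<Sum>g\<in>Gk. g (duak (i,0) * x)) * bask (i,0) = of_nat N * ((\<Sum>g\<in>Gk. g (eta ^ (q - i) * x)) * eta ^ i)"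
   by (simp add: bask_def)
 qed
 also have "... = of_nat N * (\<Sum>i<q. (\<Sum>g\<in>Gk. g (eta ^ (q - i) * x)) * eta ^ i)" by (simp add: sum_distrib_left)
 finally have "of_nat N * (of_nat q * x) = of_nat N * (\<Sum>i<q. (\<Sum>g\<in>Gk. g (eta ^ (q - i) * x)) * eta ^ i)"
  unfolding DkE by (simp only: mult.assoc)
 thus ?thesis using N0 by simp
qed

text \<open>By \<open>trace_formula\<close> the multiple \<open>of_nat q * x\<close>, with q = p^2,
  is an integral combination of powers of \<open>eta\<close>, hence of \<open>lm\<close>. Then
  \<open>lm_sum_dvd\<close> allows the coefficients to be divided by \<open>p\<close> twice.\<close>

lemma integral_basis:
 assumes x: "x : nf.Oi"
 shows "EX s. x = (\<Sum>i<card A. of_int (s i) * lm ^ i)"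
proof -
 have red: "EX s. x = (\<Sum>i<card A. of_int (s i) * lm ^ i)"
  if "algebraic_int x" "of_nat (p ^ k) * x = (\<Sum>i<card A. of_int (s i) * lm ^ i)" for k x s
  using that
 proof (induction k arbitrary: s)
  case 0 thus ?case by auto
 next
  case (Suc k)
  have e: "of_nat p * (of_nat (p ^ k) * x) = of_nat (p ^ Suc k) * x" by simp
  have "(\<Sum>i<card A. of_int (s i) * lm ^ i) = of_nat p * (of_nat (p ^ k) * x)" by (simp only: e Suc.prems(2))
  moreover have "algebraic_int (of_nat (p ^ k) * x)"
   by (rule algebraic_int_mult_complex[OF nf.Oi_alg[OF nf.Oi_of_nat] Suc.prems(1)])
  ultimately have dv: "int p dvd s i" if "i < card A" for i using lm_sum_dvd that by blast
  define s' where "s' = (%i. s i div int p)"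
  have "of_nat p * (\<Sum>i<card A. of_int (s' i) * lm ^ i) = (\<Sum>i<card A. of_int (int p * s' i) * lm ^ i)"
   by (simp add: sum_distrib_left mult.assoc)
  also have "... = (\<Sum>i<card A. of_int (s i) * lm ^ i)"
   by (rule sum.cong[OF refl]) (use dv in \<open>simp add: s'_def\<close>)
  also have "... = of_nat p * (of_nat (p ^ k) * x)" by (simp only: e Suc.prems(2))
  finally have "of_nat (p ^ k) * x = (\<Sum>i<card A. of_int (s' i) * lm ^ i)" using p_gt by simp
  thus ?case by (rule Suc.IH[OF Suc.prems(1)])
 qed
 define c where "c = (%i. \<lfloor>Re (\<Sum>g\<in>Gk. g (eta ^ (q - i) * x))\<rfloor>)"
 have ci: "of_int (c i) = (\<Sum>g\<in>Gk. g (eta ^ (q - i) * x))" for i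
 proof -
  obtain z where z: "(\<Sum>g\<in>Gk. g (eta ^ (q - i) * x)) = of_int z"
   using nf.Tr_Ints[OF nf.Oi_mult[OF eta_O x, of "q - i"]] unfolding nf.Tr_def by (elim Ints_cases)
  show ?thesis unfolding c_def z by simp
 qed
 define f where "f = (\<Sum>i<q. Polynomial.monom (c i) i)"
 have "of_nat q * x = (\<Sum>i<q. of_int (c i) * eta ^ i)" unfolding trace_formula[OF nf.Oi_L[OF x]] ci ..
 also have "... = I.ev eta f" by (simp add: f_def I.ev_sum I.ev_monom)
 finally have qx: "of_nat q * x = I.ev eta f" .
 obtain u F where us: "f = \<Phi> * u + F" "pdeg F < pdeg \<Phi>"
  using monic_division[OF lead_\<Phi>, of f] \<Phi>_degree card_A_pos by auto
 have "I.ev eta \<Phi> = 0" using \<Phi>_root[OF one_A] by simp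
 hence fF: "I.ev eta f = I.ev eta F" using us(1) by (simp add: I.ev_add I.ev_mult)
 define H where "H = pcompose F [:1,-1:]"
 have dH: "pdeg H < card A" unfolding H_def using us(2) by (simp add: degree_pcompose \<Phi>_degree)
 have "I.ev lm H = I.ev eta F" unfolding H_def ev_pcompose by (simp add: I.ev_pCons I.ev_0 lm_def)
 moreover have "I.ev lm H = (\<Sum>i<card A. of_int (poly.coeff H i) * lm ^ i)"
  unfolding I.ev_altdef by (rule sum.mono_neutral_left) (use dH in \<open>auto simp: coeff_eq_0\<close>)
 ultimately have "of_nat (p ^ 2) * x = (\<Sum>i<card A. of_int (poly.coeff H i) * lm ^ i)"
  using qx fF unfolding q2 by simp
 thus ?thesis using red[of x 2] nf.Oi_alg[OF x] by blast
qed

lemma residue_int: assumes x: "x : nf.Oi" obtains a y where "y : nf.Oi" "x = of_int a + lm * y"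
proof -
 obtain s where s: "x = (\<Sum>i<card A. of_int (s i) * lm ^ i)" using integral_basis[OF x] by blast
 have "{..<card A} = insert 0 (Suc ` {..<card A - 1})"
 proof -
  obtain m where "card A = Suc m" using card_A_pos by (cases "card A") auto
  thus ?thesis using lessThan_Suc_eq_insert_0 by simp
 qed
 hence "x = of_int (s 0) + (\<Sum>i<card A - 1. of_int (s (Suc i)) * lm ^ Suc i)"
  unfolding s by (simp add: sum.reindex)
 also have "... = of_int (s 0) + lm * (\<Sum>i<card A - 1. of_int (s (Suc i)) * lm ^ i)"
  by (simp add: sum_distrib_left mult_ac)
 finally show ?thesis
  by (rule that[rotated]) (intro nf.Oi_sum nf.Oi_mult nf.Oi_of_int nf.Oi_pow lm_O)
qed

lemma p_eq_lm: obtains u where "u : nf.Oi" "of_nat p = lm ^ card A * u"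
proof -
 obtain u where u: "algebraic_int u" "of_nat p = lm ^ card A * u" using p_dvd_lm by blast
 have "u = of_nat p / lm ^ card A" using u(2) lm_ne0 by simp
 hence "u : Lf" using nf.Ldiv[OF nf.Lof_nat nf.Lpow[OF nf.Oi_L[OF lm_O]]] by simp
 thus ?thesis using that[of u] u by (simp add: nf.Oi_def)
qed

text \<open>Either the ideal lies inside the multiples of \<open>lm\<close>, and \<open>lm\<close>
  is divided out, or it has an element that is an integer prime to \<open>p\<close> modulo
  \<open>lm\<close>. Some multiple of that element is 1 plus a multiple of \<open>lm\<close>; a
  finite geometric series, together with the power of \<open>lm\<close> in the ideal, then produces
  1.\<close>

lemma lm_power_principal:
 "nf.fid M ==> M <= nf.Oi ==> lm ^ k : M ==> EX x:Lf. x ~= 0 & M = nf.smul x nf.Oi"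
proof (induction k arbitrary: M)
 case 0
 have "nf.idl M" using nf.fid_idl 0 by blast
 hence "M = nf.Oi" using nf.idl_one[of M] 0(3) by simp
 thus ?case using nf.L1 by (intro bexI[of _ 1]) auto
next
 case (Suc k)
 note D = nf.fidD[OF Suc.prems(1)]
 show ?case
 proof (cases "M <= nf.smul lm nf.Oi")
  case True
  have lL: "inverse lm : Lf" "inverse lm ~= 0" using nf.Linv[OF nf.Oi_L[OF lm_O]] lm_ne0 by auto
  define M' where "M' = nf.smul (inverse lm) M"
  have "nf.fid M'" unfolding M'_def by (rule nf.fid_smul[OF Suc.prems(1) lL])
  moreover have "M' <= nf.Oi"
  proof
   fix x assume "x : M'"
   then obtain m where m: "m : M" "x = inverse lm * m" by (auto simp: M'_def nf.smul_def)
   hence "m / lm : nf.Oi" using True nf.smul_iff[OF lm_ne0] by blast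
   thus "x : nf.Oi" using m by (simp add: divide_inverse mult.commute)
  qed
  moreover have "lm ^ k : M'"
  proof -
   have "inverse lm * lm ^ Suc k : M'" unfolding M'_def by (rule nf.smul_mem[OF Suc.prems(3)])
   moreover have "inverse lm * lm ^ Suc k = lm ^ k" using lm_ne0 by (simp add: mult.assoc[symmetric])
   ultimately show ?thesis by (simp only:)
  qed
  ultimately obtain x where x: "x : Lf" "x ~= 0" "M' = nf.smul x nf.Oi" using Suc.IH by blast
  have "M = nf.smul lm M'" unfolding M'_def nf.smul_smul using lm_ne0 by simp
  hence "M = nf.smul (lm * x) nf.Oi" by (simp add: x(3) nf.smul_smul)
  thus ?thesis using x lm_ne0 nf.Lmult[OF nf.Oi_L[OF lm_O] x(1)] by (intro bexI[of _ "lm * x"]) auto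
 next
  case False
  then obtain x where x: "x : M" "x ~: nf.smul lm nf.Oi" by blast
  obtain a y where ay: "y : nf.Oi" "x = of_int a + lm * y" using residue_int[of x] x(1) Suc.prems(2) by blast
  obtain u where u: "u : nf.Oi" "of_nat p = lm ^ card A * u" using p_eq_lm .
  have pl: "of_nat p = lm * (lm ^ (card A - 1) * u)"
   using u(2) card_A_pos by (metis mult.assoc power_eq_if less_numeral_extra(3))
  have lu: "lm ^ (card A - 1) * u : nf.Oi" by (intro nf.Oi_mult nf.Oi_pow lm_O u(1))
  have "~ int p dvd a"
  proof
   assume "int p dvd a"
   then obtain c where "a = int p * c" by (elim dvdE)
   hence "x = lm * ((lm ^ (card A - 1) * u) * of_int c + y)" unfolding ay(2) using pl by (simp add: algebra_simps)
   moreover have "(lm ^ (card A - 1) * u) * of_int c + y : nf.Oi" by (intro nf.Oi_add nf.Oi_mult[OF lu] nf.Oi_of_int ay(1))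
   ultimately show False using x(2) nf.smul_mem[of _ nf.Oi lm] by blast
  qed
  hence "coprime (int p) a" using p by (simp add: prime_imp_coprime)
  then obtain b c where bc: "b * int p + c * a = 1" using bezout_int[of "int p" a] by auto
  define y' where "y' = of_int c * y - (lm ^ (card A - 1) * u) * of_int b"
  have y'O: "y' : nf.Oi" unfolding y'_def by (intro nf.Oi_diff nf.Oi_mult[OF nf.Oi_of_int] ay(1) nf.Oi_mult[OF lu] nf.Oi_of_int)
  have one: "of_int b * of_nat p + of_int c * of_int a = (1::complex)"
   using arg_cong[OF bc, of "of_int :: int => complex"] by simp
  have cx: "of_int c * x = 1 + lm * y'" unfolding ay(2) y'_def using one unfolding pl by (simp add: algebra_simps)
  have cM: "of_int c * x : M" by (rule D(4)[OF nf.Oi_of_int x(1)])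
  define t where "t = - (lm * y')"
  have tO: "t : nf.Oi" unfolding t_def by (intro nf.Oi_minus nf.Oi_mult lm_O y'O)
  have "1 - t ^ Suc k = (1 - t) * (\<Sum>i<Suc k. t ^ i)" by (rule one_diff_power_eq)
  hence "1 = (\<Sum>i<Suc k. t ^ i) * (of_int c * x) + t ^ Suc k" unfolding cx t_def by (simp add: algebra_simps)
  moreover have "(\<Sum>i<Suc k. t ^ i) * (of_int c * x) : M" by (rule D(4)[OF nf.Oi_sum[OF nf.Oi_pow[OF tO]] cM])
  moreover have "t ^ Suc k = (- y') ^ Suc k * lm ^ Suc k" unfolding t_def by (simp add: power_mult_distrib[symmetric] mult.commute)
  hence "t ^ Suc k : M" using D(4)[OF nf.Oi_pow[OF nf.Oi_minus[OF y'O]] Suc.prems(3)] by (simp only:)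
  ultimately have "1 : M" using D(3) by metis
  hence "M = nf.Oi" using nf.idl_one[OF nf.fid_idl[OF Suc.prems(1,2)]] by blast
  thus ?thesis using nf.L1 by (intro bexI[of _ 1]) auto
 qed
qed

text \<open>Only \<open>p\<close> ramifies, so an invariant ideal is a rational number times a power
  of \<open>lm\<close>. To see this, let \<open>t\<close> be the least positive integer in an
  integral multiple \<open>J1\<close>. By invariance the traces of \<open>J1\<close> lie in it and
  are multiples of \<open>t\<close>, so \<open>trace_formula\<close> makes \<open>J1\<close> scaled
  by \<open>q / t\<close> integral; it contains \<open>q\<close>, hence a power of
  \<open>lm\<close>.\<close>

lemma invariant_principal:
 assumes J: "nf.fid J" and inv: "!!g. g : Gk ==> g ` J = J"
 shows "EX x:Lf. x ~= 0 & J = nf.smul x nf.Oi"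
proof -
 obtain d0 where d0: "d0 : nf.Oi" "d0 ~= 0" "ALL x:J. d0 * x : nf.Oi" using nf.fidD(6)[OF J] by blast
 obtain m where m: "m > 0" "of_nat m / d0 : nf.Oi" using nf.Nm_abs[OF d0(1,2)] by blast
 have mJ: "of_nat m * x : nf.Oi" if "x : J" for x
 proof -
  have "of_nat m * x = (of_nat m / d0) * (d0 * x)" using d0(2) by simp
  moreover have "(of_nat m / d0) * (d0 * x) : nf.Oi" using nf.Oi_mult[OF m(2), of "d0 * x"] d0(3) that by blast
  ultimately show ?thesis by (simp only:)
 qed
 define J1 where "J1 = nf.smul (of_nat m) J"
 have J1: "nf.fid J1" unfolding J1_def using nf.fid_smul[OF J nf.Lof_nat] m(1) by simp
 have J1O: "J1 <= nf.Oi" using mJ by (auto simp: J1_def nf.smul_def)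
 have inv1: "g ` J1 = J1" if g: "g : Gk" for g
  unfolding J1_def nf.smul_G_image[OF g J nf.Lof_nat] inv[OF g] nf.Gof_nat[OF g] ..
 note D = nf.fidD[OF J1]
 obtain x0 where x0: "x0 : J1" "x0 ~= 0" using D(5) by blast
 obtain m1 where m1: "m1 > 0" "of_nat m1 / x0 : nf.Oi" using nf.Nm_abs[of x0] x0 J1O by blast
 have m1J: "of_nat m1 : J1" using D(4)[OF m1(2) x0(1)] x0(2) by simp
 define t where "t = (LEAST t. t > 0 & of_nat t : J1)"
 have t: "t > 0" "of_nat t : J1" using LeastI[of "%t. t > 0 & of_nat t : J1" m1] m1(1) m1J by (auto simp: t_def)
 have dvt: "int t dvd s" if s: "of_int s : J1" for s
 proof (rule ccontr)
  assume nd: "~ int t dvd s"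
  define s' where "s' = nat (s mod int t)"
  have s': "0 < s'" "s' < t" "int s' = s mod int t" using nd t(1) by (auto simp: s'_def dvd_eq_mod_eq_0 nat_less_iff)
    (metis dvd_eq_mod_eq_0 nd of_nat_0_less_iff order_le_less pos_mod_sign)
  have "(of_nat s' :: complex) = of_int (int s')" by simp
  also have "... = of_int s - of_int (s div int t) * of_nat t"
   unfolding s'(3) by (simp add: minus_div_mult_eq_mod[symmetric])
  also have "... : J1" by (rule nf.fid_diff[OF J1 s D(4)[OF nf.Oi_of_int t(2)]])
  finally have "of_nat s' : J1" .
  hence "t <= s'" unfolding t_def using s'(1) by (intro Least_le) auto
  thus False using s'(2) by simp
 qed
 have qJ: "of_nat q * x / of_nat t : nf.Oi" if x: "x : J1" for x
 proof -
  have tr: "(\<Sum>g\<in>Gk. g (eta ^ (q - i) * x)) / of_nat t : nf.Oi" for i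
  proof -
   have y: "eta ^ (q - i) * x : J1" by (rule D(4)[OF eta_O x])
   have yO: "eta ^ (q - i) * x : nf.Oi" using y J1O by blast
   obtain s where s: "(\<Sum>g\<in>Gk. g (eta ^ (q - i) * x)) = of_int s"
    using nf.Tr_Ints[OF yO] unfolding nf.Tr_def by (auto elim: Ints_cases)
   have "(\<Sum>g\<in>Gk. g (eta ^ (q - i) * x)) : J1"
    by (rule nf.fid_sum[OF J1]) (use inv1 y in blast)
   hence "int t dvd s" using dvt s by simp
   then obtain c where "s = int t * c" by (elim dvdE)
   thus ?thesis unfolding s using t(1) nf.Oi_of_int by simp
  qed
  have "of_nat q * x / of_nat t = (\<Sum>i<q. (\<Sum>g\<in>Gk. g (eta ^ (q - i) * x)) * eta ^ i / of_nat t)"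
   unfolding trace_formula[OF D(1)[OF x]] by (rule sum_divide_distrib)
  also have "... = (\<Sum>i<q. (\<Sum>g\<in>Gk. g (eta ^ (q - i) * x)) / of_nat t * eta ^ i)"
   by (rule sum.cong[OF refl]) (simp only: times_divide_eq_left)
  also have "... : nf.Oi" by (intro nf.Oi_sum nf.Oi_mult tr eta_O)
  finally show ?thesis .
 qed
 define e where "e = (of_nat q / of_nat t :: complex)"
 have e: "e : Lf" "e ~= 0" unfolding e_def using t(1) q_pos nf.Ldiv[OF nf.Lof_nat nf.Lof_nat] by auto
 define M where "M = nf.smul e J1"
 have fM: "nf.fid M" unfolding M_def by (rule nf.fid_smul[OF J1 e])
 have MO: "M <= nf.Oi" using qJ by (auto simp: M_def nf.smul_def e_def)
 have "e * of_nat t : M" unfolding M_def by (rule nf.smul_mem[OF t(2)])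
 hence qM: "of_nat q : M" using t(1) by (simp add: e_def)
 obtain u where u: "algebraic_int u" "lm ^ card A = of_nat p * u" using lm_dvd_p by blast
 have uL: "u : nf.Oi"
 proof -
  have "u = lm ^ card A / of_nat p" using u(2) p_gt by simp
  thus ?thesis using u(1) nf.Ldiv[OF nf.Lpow[OF nf.Oi_L[OF lm_O]] nf.Lof_nat] by (simp add: nf.Oi_def)
 qed
 have qc: "(of_nat q :: complex) = of_nat p ^ 2" by (simp add: q2)
 have "lm ^ (card A * 2) = u ^ 2 * of_nat q" unfolding power_mult u(2) qc by (simp only: power_mult_distrib mult.commute)
 hence "lm ^ (card A * 2) : M" using nf.fidD(4)[OF fM nf.Oi_pow[OF uL] qM] by simp
 then obtain x where x: "x : Lf" "x ~= 0" "M = nf.smul x nf.Oi" using lm_power_principal[OF fM MO] by blast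
 have "J = nf.smul (inverse (e * of_nat m)) M"
 proof -
  have one: "inverse (e * of_nat m) * (e * of_nat m) = 1" by (rule left_inverse) (use e(2) m(1) in simp)
  show ?thesis unfolding M_def J1_def nf.smul_smul one nf.smul_1 ..
 qed
 hence "J = nf.smul (inverse (e * of_nat m) * x) nf.Oi" unfolding x(3) nf.smul_smul .
 moreover have "inverse (e * of_nat m) * x : Lf" by (intro nf.Lmult nf.Linv e x nf.Lof_nat)
 moreover have "inverse (e * of_nat m) * x ~= 0" using e(2) m(1) x(2) by simp
 ultimately show ?thesis by blast
qed

end


section \<open>Invariant classes of the field of p^2-th roots of unity\<close>

context numfield begin

text \<open>Used to see that a product over a closed orbit of ideals is unchanged when the orbit is
  moved by one step.\<close>

lemma iprods_shift:
 assumes "!!i. i <= r ==> fid (Q i)"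
 shows "iprods r (%i. Q (Suc i)) (%_. 1) \<star> Q 0 = iprods (Suc r) Q (%_. 1)"
 using assms
proof (induction r)
 case 0
 thus ?case using iprod_Oi[of "Q 0"] iprod_comm[of "Q 0" Oi] by simp
next
 case (Suc r)
 have "iprods (Suc r) (%i. Q (Suc i)) (%_. 1) \<star> Q 0
   = ipow (Q (Suc r)) 1 \<star> (iprods r (%i. Q (Suc i)) (%_. 1) \<star> Q 0)"
  by (simp only: iprods.simps iprod_assoc)
 also have "... = iprods (Suc (Suc r)) Q (%_. 1)" using Suc by simp
 finally show ?case .
qed

lemma iprods_image:
 assumes g: "g : G" and Q: "!!i. i < r ==> fid (Q i)"
 shows "g ` iprods r Q c = iprods r (%i. g ` Q i) c"
 using Q
proof (induction r)
 case 0 show ?case using Oi_G_image[OF g] by simp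
next
 case (Suc r)
 have ip: "g ` ipow I n = ipow (g ` I) n" if I: "fid I" for I n
  by (induction n) (use Oi_G_image[OF g] iprod_G_image[OF g I fid_ipow[OF I]] in auto)
 have f: "fid (ipow (Q r) (c r))" "fid (iprods r Q c)" using Suc.prems by (auto intro: fid_ipow fid_iprods)
 show ?case using iprod_G_image[OF g f] Suc ip[of "Q r"] by simp
qed

lemma ipow_mem: "x : I ==> x ^ n : ipow I n"
 by (induction n) (auto simp: Oi_1 iprod_prod)

lemma iprods_mem: "(!!i. i < r ==> x : Q i) ==> fid I ==> (!!i. i < r ==> fid (Q i)) ==> x ^ r : iprods r Q (%_. 1)"
proof (induction r)
 case (Suc r)
 have "x ^ 1 : ipow (Q r) 1" by (rule ipow_mem) (use Suc in auto)
 hence "x ^ 1 * x ^ r : ipow (Q r) 1 \<star> iprods r Q (%_. 1)" using Suc by (intro iprod_prod) auto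
 thus ?case by simp
qed (simp add: Oi_1)

lemma cact_mult:
 assumes g: "g : G" and c: "c : carrier (class_group L)" "c' : carrier (class_group L)"
 shows "cact g (c \<otimes>\<^bsub>class_group L\<^esub> c') = cact g c \<otimes>\<^bsub>class_group L\<^esub> cact g c'"
proof -
 obtain I I' where I: "fid I" "c = cls I" "fid I'" "c' = cls I'" using cls_surj c by metis
 have "c \<otimes>\<^bsub>class_group L\<^esub> c' = cls (I \<star> I')" using cls_mult I by simp
 hence "cact g (c \<otimes>\<^bsub>class_group L\<^esub> c') = cls (g ` (I \<star> I'))" using cact_cls[OF g fid_iprod] I by simp
 also have "... = cls (g ` I) \<otimes>\<^bsub>class_group L\<^esub> cls (g ` I')"
  unfolding iprod_G_image[OF g I(1,3)] by (rule cls_mult) (use fid_G_image[OF g] I in auto)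
 finally show ?thesis using cact_cls[OF g] I by simp
qed

lemma cact_closed: assumes g: "g : G" and c: "c : carrier (class_group L)" shows "cact g c : carrier (class_group L)"
proof -
 obtain I where "fid I" "c = cls I" using cls_surj c by metis
 thus ?thesis using cact_cls[OF g] cls_carrier fid_G_image[OF g] by simp
qed

lemma cact_one: assumes g: "g : G" shows "cact g \<one>\<^bsub>class_group L\<^esub> = \<one>\<^bsub>class_group L\<^esub>"
 using cact_cls[OF g fid_Oi] Oi_G_image[OF g] by (simp add: cls_one)

lemma cact_pow: assumes g: "g : G" and c: "c : carrier (class_group L)"
 shows "cact g (c [^]\<^bsub>class_group L\<^esub> (n::nat)) = cact g c [^]\<^bsub>class_group L\<^esub> n"
proof -
 interpret C: comm_group "class_group L" by (rule comm_group_class_group)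
 show ?thesis by (induction n) (auto simp: cact_one[OF g] cact_mult[OF g] c)
qed

end

context kumE begin

definition M where "M = p * (p - 1)"

lemma generator:
 obtains \<gamma> where "\<gamma> : A" "\<gamma> ^ M mod q = 1" "bij_betw (%j. \<gamma> ^ j mod q) {..<M} A" "M > 0"
  "!!j. 0 < j ==> j < M ==> \<gamma> ^ j mod q ~= 1"
proof -
 obtain g where "ALL k>0. residue_primroot (p ^ k) g" using residue_primroot_odd_prime_power_exists[OF p p2] .
 hence rp: "residue_primroot q g" unfolding q2 by simp
 have tot: "totient q = M" unfolding q2 M_def using totient_prime_power[OF p, of 2] by simp
 have A: "totatives q = A"
 proof (rule Set.set_eqI)
  fix a
  have "p dvd q" unfolding q2 by simp
  have *: "coprime a q \<longleftrightarrow> ~ p dvd a"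
  proof
   assume "coprime a q"
   show "~ p dvd a"
   proof
    assume "p dvd a"
    hence "p dvd 1" using \<open>coprime a q\<close> \<open>p dvd q\<close> using coprime_common_divisor[of a q p] \<open>p dvd a\<close> by blast
    thus False using p_gt by simp
   qed
  next
   assume "~ p dvd a"
   hence "coprime p a" using p by (simp add: prime_imp_coprime)
   thus "coprime a q" unfolding q2 by (simp add: coprime_commute)
  qed
  have "a : totatives q \<longleftrightarrow> 0 < a & a <= q & ~ p dvd a" unfolding totatives_def using * by auto
  also have "... \<longleftrightarrow> a < q & ~ p dvd a" using \<open>p dvd q\<close> by (cases "a = q"; cases "a = 0") auto
  finally show "a : totatives q \<longleftrightarrow> a : A" unfolding A_def by simp
 qed
 have q1: "q > 1" by (rule q_pos)
 have bij: "bij_betw (%i. g ^ i mod q) {..<M} A"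
  using residue_primroot_is_generator[OF q1 rp] unfolding tot A .
 define \<gamma> where "\<gamma> = g mod q"
 have pw: "\<gamma> ^ j mod q = g ^ j mod q" for j unfolding \<gamma>_def by (rule power_mod)
 have M0: "M > 1" unfolding M_def using p_gt p2 by (cases p; cases "p - 1") (auto simp: odd_pos)
 have "g ^ 1 mod q : A" by (rule bij_betwE[OF bij, rule_format]) (use M0 in simp)
 hence gA: "\<gamma> : A" by (simp add: \<gamma>_def)
 have ordM: "ord q g = M" using rp unfolding residue_primroot_def tot by simp
 show ?thesis
 proof
  show "\<gamma> : A" by fact
  show "bij_betw (%j. \<gamma> ^ j mod q) {..<M} A" using bij by (simp only: pw)
  show "\<gamma> ^ M mod q = 1" using ord_divides[of g M q] q1 unfolding pw ordM cong_def by simp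
  show "M > 0" using M0 by simp
  fix j assume j: "0 < j" "j < M"
  thus "\<gamma> ^ j mod q ~= 1" using ord_minimal[of j q g] q1 unfolding pw ordM cong_def by simp
 qed
qed

end

locale kumEg = kumE + fixes \<gamma> :: nat
 assumes \<gamma>A: "\<gamma> : A" and \<gamma>M: "\<gamma> ^ M mod q = 1" and \<gamma>bij: "bij_betw (%j. \<gamma> ^ j mod q) {..<M} A" and M0: "M > 0"
  and \<gamma>ne: "!!j. 0 < j ==> j < M ==> \<gamma> ^ j mod q ~= 1"
begin

definition gg :: "nat => complex => complex" where "gg j = au (\<gamma> ^ j mod q) 0"

lemma gg_G: "gg j : Gk" unfolding gg_def by (rule au_Gk[OF au_pow_A[OF \<gamma>A] d_pos])
lemma g1G: "au \<gamma> 0 : Gk" by (rule au_Gk[OF \<gamma>A d_pos])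
lemma gg_Suc: "au \<gamma> 0 (gg j x) = gg (Suc j) x" unfolding gg_def by (rule au_step[OF \<gamma>A])
lemma gg_0: "x : Lf ==> gg 0 x = x" unfolding gg_def by (rule au_one_pow)
lemma gg_M: "x : Lf ==> gg M x = x" unfolding gg_def \<gamma>M by (rule au_id)

lemma gg_add: assumes "x : Lf" shows "gg i (gg j x) = gg (i + j) x"
proof (induction i)
 case 0 show ?case using gg_0[OF nf.GL[OF gg_G assms]] by simp
next
 case (Suc i) show ?case unfolding gg_Suc[symmetric] Suc by (simp only: add_Suc gg_Suc)
qed

lemma Gk_gg: assumes "g : Gk" shows "EX j<M. g = gg j"
proof -
 obtain a b where ab: "a : A" "b < d" "g = au a b" using assms unfolding Gk_def by auto
 have "b = 0" using ab(2) d1 by simp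
 have "a : (%j. \<gamma> ^ j mod q) ` {..<M}" using bij_betw_imp_surj_on[OF \<gamma>bij] ab(1) by simp
 then obtain j where "a = \<gamma> ^ j mod q" "j : {..<M}" by (rule imageE)
 hence "j < M" "a = \<gamma> ^ j mod q" by simp_all
 thus ?thesis using ab(3) \<open>b = 0\<close> by (auto simp: gg_def)
qed

lemma Nm_gg: "nf.Nm x = (\<Prod>j<M. gg j x)"
proof -
 have ld: "{..<d} = {0}" by (simp add: d1 lessThan_Suc)
 have "nf.Nm x = (\<Prod>a\<in>A. au a 0 x)" unfolding nf.Nm_def prod_Gk ld by simp
 also have "... = (\<Prod>j<M. au (\<gamma> ^ j mod q) 0 x)" by (rule prod.reindex_bij_betw[OF \<gamma>bij, symmetric])
 finally show ?thesis by (simp add: gg_def)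
qed

lemma gg_image0: "nf.fid I ==> gg 0 ` I = I" "nf.fid I ==> gg M ` I = I"
 using gg_0 gg_M nf.fidD(1) by (force simp: image_iff)+

lemma cact_iter: assumes I: "nf.fid I" shows "(nf.cact (au \<gamma> 0) ^^ j) (nf.cls I) = nf.cls (gg j ` I)"
proof (induction j)
 case 0 show ?case using gg_image0(1)[OF I] by simp
next
 case (Suc j)
 have "au \<gamma> 0 ` gg j ` I = gg (Suc j) ` I" unfolding image_image gg_Suc ..
 thus ?case using Suc nf.cact_cls[OF g1G nf.fid_G_image[OF gg_G I]] by simp
qed

text \<open>The generator multiplies \<open>I\<close> by some \<open>k\<close> whose norm is a unit
  of the integers, 1 or -1. The square of \<open>k\<close> has norm 1, so by Hilbert 90 a multiple
  of \<open>I \<star> I\<close> is an invariant ideal, which is principal. The square is harmless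
  because p is odd.\<close>

lemma invariant_class:
 assumes I: "nf.fid I" and c: "nf.cls (au \<gamma> 0 ` I) = nf.cls I"
 shows "EX x:Lf. x ~= 0 & I \<star> I = nf.smul x nf.Oi"
proof -
 obtain k where k: "k : Lf" "k ~= 0" "au \<gamma> 0 ` I = nf.smul k I"
  using c nf.cls_eq_iff[OF nf.fid_G_image[OF g1G I] I] by blast
 define cc where "cc = (%j. \<Prod>i<j. gg i k)"
 have gkL: "gg i k : Lf" "gg i k ~= 0" for i using nf.GL[OF gg_G k(1)] nf.Gne[OF gg_G k(1,2)] by auto
 have cL: "cc j : Lf" "cc j ~= 0" for j unfolding cc_def using gkL by (auto intro: nf.Lprod)
 have cS: "au \<gamma> 0 (cc j) * k = cc (Suc j)" for j
 proof -
  have "au \<gamma> 0 (cc j) = (\<Prod>i<j. gg (Suc i) k)" unfolding cc_def gg_Suc[symmetric] by (rule nf.Gprod[OF g1G gkL(1)])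
  thus ?thesis unfolding cc_def prod.lessThan_Suc_shift[of _ j] gg_0[OF k(1)] by (simp add: mult.commute)
 qed
 have gI: "gg j ` I = nf.smul (cc j) I" for j
 proof (induction j)
  case 0 show ?case using gg_image0(1)[OF I] by (simp add: cc_def)
 next
  case (Suc j)
  have "gg (Suc j) ` I = au \<gamma> 0 ` gg j ` I" unfolding image_image gg_Suc ..
  also have "... = nf.smul (cc (Suc j)) I"
   unfolding Suc nf.smul_G_image[OF g1G I cL(1)] k(3) nf.smul_smul cS ..
  finally show ?case .
 qed
 have eM: "nf.smul (cc M) I = nf.smul 1 I" using gI[of M] gg_image0(2)[OF I] by simp
 have O: "cc M : nf.Oi" "1 / cc M : nf.Oi"
  using nf.smul_inject_unit[OF I cL nf.L1 one_neq_zero eM] by auto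
 have cN: "cc M = nf.Nm k" unfolding cc_def Nm_gg ..
 have R: "cc M : \<rat>" unfolding cN by (rule nf.Nm_Rats[OF k(1)])
 have Z: "cc M : \<int>" "1 / cc M : \<int>" using nf.Oi_Rats[OF O(1) R] nf.Oi_Rats[OF O(2)] R by auto
 obtain s where s: "cc M = of_int s" using Z(1) by (elim Ints_cases)
 obtain t where t: "1 / cc M = of_int t" using Z(2) by (elim Ints_cases)
 have "(of_int (s * t) :: complex) = 1" using s t cL(2)[of M] by (simp add: field_simps)
 hence "s * t = 1" using of_int_eq_1_iff by blast
 hence "s = 1 \<or> s = - 1" by (rule pos_zmult_eq_1_iff_lemma)
 hence sq: "cc M ^ 2 = 1" unfolding s by auto
 have N2: "(\<Prod>j<M. au (\<gamma> ^ j mod q) 0 (k ^ 2)) = 1"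
  using nf.Nm_pow[OF k(1), of 2] sq unfolding cN Nm_gg gg_def by simp
 obtain z where z: "z : Lf" "z ~= 0" "z = k ^ 2 * au \<gamma> 0 z"
  using hilbert90[OF \<gamma>A M0 \<gamma>M \<gamma>ne nf.Lpow[OF k(1)] N2] by blast
 define J where "J = nf.smul z (I \<star> I)"
 have II: "nf.fid (I \<star> I)" by (rule nf.fid_iprod[OF I I])
 have J: "nf.fid J" unfolding J_def by (rule nf.fid_smul[OF II z(1,2)])
 have g1J: "au \<gamma> 0 ` J = J"
 proof -
  have "au \<gamma> 0 ` J = nf.smul (au \<gamma> 0 z * k ^ 2) (I \<star> I)"
   unfolding J_def nf.smul_G_image[OF g1G II z(1)] nf.iprod_G_image[OF g1G I I] k(3) nf.smul_iprod_smul[OF I I] nf.smul_smul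
   by (simp add: power2_eq_square)
  also have "au \<gamma> 0 z * k ^ 2 = z" using z(3) by (simp add: mult.commute)
  finally show ?thesis by (simp add: J_def)
 qed
 have ggJ: "gg j ` J = J" for j
 proof (induction j)
  case 0 show ?case by (rule gg_image0(1)[OF J])
 next
  case (Suc j)
  have "gg (Suc j) ` J = au \<gamma> 0 ` gg j ` J" unfolding image_image gg_Suc ..
  thus ?case by (simp add: Suc g1J)
 qed
 have "g ` J = J" if "g : Gk" for g using Gk_gg[OF that] ggJ by auto
 then obtain x where x: "x : Lf" "x ~= 0" "J = nf.smul x nf.Oi" using invariant_principal[OF J] by blast
 have "I \<star> I = nf.smul (inverse z) J" unfolding J_def nf.smul_smul using z(2) by simp
 hence "I \<star> I = nf.smul (inverse z * x) nf.Oi" by (simp add: x(3) nf.smul_smul)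
 thus ?thesis using x z nf.Lmult[OF nf.Linv[OF z(1)] x(1)] by (intro bexI[of _ "inverse z * x"]) auto
qed

text \<open>\<open>gg p\<close> generates the subgroup of order p - 1, with a fixed field of degree
  p. If the class of \<open>B\<close> had order divisible by p, the set \<open>V\<close> of
  p-torsion classes fixed by \<open>gg p\<close> would have a nontrivial member \<open>y\<close>,
  and translation by it shows that p divides the size of \<open>V\<close>. The generator acts on
  \<open>V\<close> with period p, so some nontrivial class in \<open>V\<close> is fixed by the whole
  group; its square is trivial by \<open>invariant_class\<close>, a contradiction.\<close>

lemma class_order_coprime:
 assumes B: "nf.fid B" and Bp: "gg p ` B = B"
 shows "EX m w. m > 0 & ~ p dvd m & w : Lf & w ~= 0 & nf.ipow B m = nf.smul w nf.Oi"
proof -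
 interpret C: comm_group "class_group Lf" by (rule nf.comm_group_class_group)
 define f where "f = nf.cact (au \<gamma> 0)"
 have fin: "finite (carrier (class_group Lf))" by (rule nf.finite_class_group)
 define hh where "hh = Coset.order (class_group Lf)"
 have o0: "hh ~= 0" unfolding hh_def Coset.order_def using fin C.one_closed by (auto simp: card_eq_0_iff)
 have np: "~ is_unit p" using p_gt by simp
 \<comment> \<open>The part of the class number prime to \<open>p\<close>; it remains to show that
   the m-th power of the class of \<open>B\<close> is trivial.\<close>
 obtain m where m: "hh = p ^ multiplicity p hh * m" "~ p dvd m" using multiplicity_decompose'[OF o0 np] .
 define x where "x = nf.cls B [^]\<^bsub>class_group Lf\<^esub> m"
 have BC: "nf.cls B : carrier (class_group Lf)" by (rule nf.cls_carrier[OF B])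
 have xC: "x : carrier (class_group Lf)" unfolding x_def using BC by simp
 have xp: "x [^]\<^bsub>class_group Lf\<^esub> (p ^ multiplicity p hh) = \<one>\<^bsub>class_group Lf\<^esub>"
 proof -
  have "x [^]\<^bsub>class_group Lf\<^esub> (p ^ multiplicity p hh) = nf.cls B [^]\<^bsub>class_group Lf\<^esub> hh"
   unfolding x_def C.nat_pow_pow[OF BC] by (subst (2) m(1)) (simp add: mult.commute)
  also have "... = \<one>\<^bsub>class_group Lf\<^esub>" unfolding hh_def by (rule C.pow_order_eq_1[OF BC])
  finally show ?thesis .
 qed
 have "x = \<one>\<^bsub>class_group Lf\<^esub>"
 proof (rule ccontr)
  assume x1: "x ~= \<one>\<^bsub>class_group Lf\<^esub>"
  define i where "i = (LEAST i. x [^]\<^bsub>class_group Lf\<^esub> (p ^ i) = \<one>\<^bsub>class_group Lf\<^esub>)"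
  have i: "x [^]\<^bsub>class_group Lf\<^esub> (p ^ i) = \<one>\<^bsub>class_group Lf\<^esub>" unfolding i_def by (rule LeastI[of _ "multiplicity p hh"]) (rule xp)
  have i0: "i ~= 0" using i x1 xC by (intro notI) simp
  have il: "x [^]\<^bsub>class_group Lf\<^esub> (p ^ (i - 1)) ~= \<one>\<^bsub>class_group Lf\<^esub>"
   using not_less_Least[of "i - 1" "%i. x [^]\<^bsub>class_group Lf\<^esub> (p ^ i) = \<one>\<^bsub>class_group Lf\<^esub>"] i0 unfolding i_def[symmetric] by simp
  define y where "y = x [^]\<^bsub>class_group Lf\<^esub> (p ^ (i - 1))"
  have yC: "y : carrier (class_group Lf)" using xC by (simp add: y_def)
  have yp: "y [^]\<^bsub>class_group Lf\<^esub> p = \<one>\<^bsub>class_group Lf\<^esub>"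
   unfolding y_def C.nat_pow_pow[OF xC] using i i0 by (simp add: power_Suc2[symmetric])
  have y1: "y ~= \<one>\<^bsub>class_group Lf\<^esub>" using il by (simp add: y_def)
  have ycls: "y = nf.cls (nf.ipow B (m * p ^ (i - 1)))"
   unfolding y_def x_def C.nat_pow_pow[OF BC] by (rule nf.cls_pow[OF B])
  have yfix: "(f ^^ p) y = y"
  proof -
   have "gg p ` nf.ipow B (m * p ^ (i - 1)) = nf.smul (1 ^ (m * p ^ (i - 1))) (nf.ipow B (m * p ^ (i - 1)))"
    by (rule nf.ipow_eigen[OF gg_G B]) (simp add: Bp)
   thus ?thesis unfolding ycls f_def cact_iter[OF nf.fid_ipow[OF B]] by simp
  qed
  define V where "V = {c : carrier (class_group Lf). c [^]\<^bsub>class_group Lf\<^esub> p = \<one>\<^bsub>class_group Lf\<^esub> & (f ^^ p) c = c}"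
  have finV: "finite V" using fin by (simp add: V_def)
  have fC: "f c : carrier (class_group Lf)" if "c : carrier (class_group Lf)" for c
   unfolding f_def by (rule nf.cact_closed[OF g1G that])
  have fm: "(f ^^ j) (c \<otimes>\<^bsub>class_group Lf\<^esub> c') = (f ^^ j) c \<otimes>\<^bsub>class_group Lf\<^esub> (f ^^ j) c' & (f ^^ j) c : carrier (class_group Lf)"
   if "c : carrier (class_group Lf)" "c' : carrier (class_group Lf)" for j c c'
  proof -
   have cl: "(f ^^ j) c : carrier (class_group Lf)" if "c : carrier (class_group Lf)" for c j
    using that fC by (induction j) auto
   show ?thesis using that by (induction j) (auto simp: f_def nf.cact_mult[OF g1G] cl[unfolded f_def] nf.cact_closed[OF g1G])
  qed
  have yV: "y : V" using yC yp yfix by (simp add: V_def)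
  have card0: "[card V = 0] (mod p)"
  proof -
   have it: "((%v. y \<otimes>\<^bsub>class_group Lf\<^esub> v) ^^ j) v = y [^]\<^bsub>class_group Lf\<^esub> j \<otimes>\<^bsub>class_group Lf\<^esub> v" if "v : V" for j v
    using that yC by (induction j) (auto simp: V_def C.m_ac)
   have "[card V = card {v : V. y \<otimes>\<^bsub>class_group Lf\<^esub> v = v}] (mod p)"
   proof (rule card_fixpoints_mod[OF finV _ _ p])
    show "y \<otimes>\<^bsub>class_group Lf\<^esub> v : V" if "v : V" for v
     using that yV fm yC by (auto simp: V_def C.nat_pow_distrib)
    show "((%v. y \<otimes>\<^bsub>class_group Lf\<^esub> v) ^^ p) v = v" if "v : V" for v
     using it[OF that, of p] yp that by (simp add: V_def)
   qed
   moreover have "{v : V. y \<otimes>\<^bsub>class_group Lf\<^esub> v = v} = {}"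
    using y1 yC C.r_cancel_one' unfolding V_def by auto
   ultimately show ?thesis by simp
  qed
  have "[card V = card {v : V. f v = v}] (mod p)"
  proof (rule card_fixpoints_mod[OF finV _ _ p])
   show "f v : V" if "v : V" for v
    using that fC nf.cact_pow[OF g1G, of v p] nf.cact_one[OF g1G] funpow_swap1[of f p v]
    by (auto simp: V_def f_def)
   show "(f ^^ p) v = v" if "v : V" for v using that by (simp add: V_def)
  qed
  hence "p dvd card {v : V. f v = v}" using card0 by (simp add: cong_def dvd_eq_mod_eq_0)
  moreover have oneV: "\<one>\<^bsub>class_group Lf\<^esub> : {v : V. f v = v}"
  proof -
   have "(f ^^ j) \<one>\<^bsub>class_group Lf\<^esub> = \<one>\<^bsub>class_group Lf\<^esub>" for j
    by (induction j) (auto simp: f_def nf.cact_one[OF g1G])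
   from this[of p] this[of 1] show ?thesis by (simp add: V_def)
  qed
  moreover have finF: "finite {v : V. f v = v}" using finV by simp
  ultimately have "p <= card {v : V. f v = v}" by (intro dvd_imp_le) (auto simp: card_gt_0_iff)
  hence "~ {v : V. f v = v} <= {\<one>\<^bsub>class_group Lf\<^esub>}"
   using p_gt card_mono[of "{\<one>\<^bsub>class_group Lf\<^esub>}" "{v : V. f v = v}"] by auto
  then obtain v where v: "v : V" "f v = v" "v ~= \<one>\<^bsub>class_group Lf\<^esub>" by blast
  have vC: "v : carrier (class_group Lf)" and vp: "v [^]\<^bsub>class_group Lf\<^esub> p = \<one>\<^bsub>class_group Lf\<^esub>" using v(1) by (auto simp: V_def)
  obtain I where I: "nf.fid I" "v = nf.cls I" using nf.cls_surj[OF vC] by blast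
  have "nf.cls (au \<gamma> 0 ` I) = nf.cls I" using v(2) nf.cact_cls[OF g1G I(1)] I(2) by (simp add: f_def)
  then obtain x where "x : Lf" "x ~= 0" "I \<star> I = nf.smul x nf.Oi" using invariant_class[OF I(1)] by blast
  hence "nf.cls (I \<star> I) = \<one>\<^bsub>class_group Lf\<^esub>" using nf.cls_principal_iff[OF nf.fid_iprod[OF I(1) I(1)]] by blast
  hence v2: "v [^]\<^bsub>class_group Lf\<^esub> (2::nat) = \<one>\<^bsub>class_group Lf\<^esub>"
   using nf.cls_mult[OF I(1) I(1)] I(2) vC by (simp add: numeral_2_eq_2)
  obtain h where h: "p = 2 * h + 1" using p2 by (elim oddE)
  have "v [^]\<^bsub>class_group Lf\<^esub> p = (v [^]\<^bsub>class_group Lf\<^esub> (2::nat)) [^]\<^bsub>class_group Lf\<^esub> h \<otimes>\<^bsub>class_group Lf\<^esub> v"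
   unfolding C.nat_pow_pow[OF vC] h using vC by simp
  hence "v = \<one>\<^bsub>class_group Lf\<^esub>" using v2 vp vC by simp
  thus False using v(3) by simp
 qed
 hence "nf.cls (nf.ipow B m) = \<one>\<^bsub>class_group Lf\<^esub>" using nf.cls_pow[OF B, of m] by (simp add: x_def)
 moreover have "m > 0" using m(1) o0 by (intro Nat.gr0I) auto
 ultimately show ?thesis using nf.cls_principal_iff[OF nf.fid_ipow[OF B]] m(2) by blast
qed

end


section \<open>An element whose norm to K is a power of N\<close>

context numfield_prime begin

lemma prod_mem: "finite S ==> (!!i. i : S ==> f i : Oi) ==> prod f S : P ==> EX i:S. f i : P"
proof (induction S rule: finite_induct)
 case empty thus ?case using P1 by simp
next
 case (insert a S)
 hence "f a : P \<or> prod f S : P" using Pprime[of "f a" "prod f S"] Oi_prod[of S f] by simp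
 thus ?case using insert by auto
qed

end

context kumEg begin

text \<open>\<open>N\<close> splits completely. If a nontrivial automorphism preserved a prime
  \<open>R\<close> over \<open>N\<close>, then \<open>R\<close> would contain
  \<open>of_nat c - eta ^ b\<close> and its image, hence \<open>1 - x\<close> for a root of unity
  \<open>x\<close> other than 1, hence \<open>q\<close> as the sum of all \<open>1 - x ^ k\<close>.
  That forces N = p, against the congruence for \<open>N\<close>.\<close>

lemma prime_conj_not_sub:
 assumes R: "nf.prm R" "of_nat N : R" and a: "a : A" "a ~= 1"
 shows "~ au a 0 ` R <= R"
proof
 assume sub: "au a 0 ` R <= R"
 interpret R: numfield_prime Lf Gk Bk bask duak Dk R by unfold_locales (rule R(1))
 obtain c where c: "int N ^ 1 dvd poly \<Phi> (int c)" using cyclotomic_root_mod[OF Nprime N1 p2, of 1] by auto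
 then obtain t where t: "poly \<Phi> (int c) = int N * t" by (auto elim: dvdE)
 have O: "of_nat c - eta ^ b : nf.Oi" for b using nf.Oi_diff[OF nf.Oi_of_nat eta_O] .
 have "(\<Prod>b\<in>A. of_nat c - eta ^ b) = of_int (poly \<Phi> (int c))"
 proof -
  have "I.ev (of_int (int c)) f = of_int (poly f (int c))" for f
   by (induction f) (auto simp: I.ev_0 I.ev_pCons)
  thus ?thesis using \<Phi>_prod[of "of_nat c"] by (metis of_int_of_nat_eq)
 qed
 also have "... = of_int t * of_nat N" by (simp add: t)
 also have "... : R" by (rule nf.fidD(4)[OF R.fidP nf.Oi_of_int R(2)])
 finally obtain b where b: "b : A" "of_nat c - eta ^ b : R" using R.prod_mem[OF A_fin, of "%b. of_nat c - eta ^ b"] O by blast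
 have "au a 0 (of_nat c - eta ^ b) = of_nat c - (eta ^ a) ^ b"
  using nf.Gdiff[OF au_Gk[OF a(1) d_pos] nf.Lof_nat Lf_pow[OF Lf_eta(1)]] nf.Gof_nat[OF au_Gk[OF a(1) d_pos]]
   au_pow[OF Lf_eta(1) a(1) d_pos] Lf_eta(2)[OF a(1) d_pos] by simp
 hence "of_nat c - (eta ^ a) ^ b : R" using sub b(2) by (metis image_subset_iff)
 hence "(of_nat c - (eta ^ a) ^ b) - (of_nat c - eta ^ b) : R" using nf.fid_diff[OF R.fidP] b(2) by blast
 hence h: "eta ^ b - eta ^ (a * b) : R" by (simp add: power_mult)
 define x where "x = eta ^ (a * b + (q - b))"
 have bq: "b < q" using b(1) by (simp add: A_def)
 have "eta ^ b * eta ^ (q - b) = 1" using bq etaq by (simp flip: power_add)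
 hence "(eta ^ b - eta ^ (a * b)) * eta ^ (q - b) = 1 - x" by (simp add: x_def algebra_simps power_add)
 hence xR: "1 - x : R" using nf.fid_mult_right[OF R.fidP h eta_O, of "q - b"] by simp
 have xq: "x ^ q = 1"
 proof -
  have "x ^ q = (eta ^ q) ^ (a * b + (q - b))" by (simp add: x_def mult.commute flip: power_mult)
  thus ?thesis by (simp add: etaq)
 qed
 have x1: "x ~= 1"
 proof
  assume "x = 1"
  hence "x * eta ^ b = eta ^ b" by simp
  moreover have "x * eta ^ b = eta ^ (a * b)" using \<open>eta ^ b * eta ^ (q - b) = 1\<close> by (simp add: x_def power_add mult_ac)
  ultimately have "eta ^ (a * b) = eta ^ b" by metis
  hence "eta ^ (a * b mod q) = eta ^ (1 * b mod q)" unfolding eta_mod[of "a * b", symmetric] mult_1 eta_mod[of b, symmetric] .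
  hence "a * b mod q = 1 * b mod q" by (rule inj_onD[OF eta_inj]) (use q_pos in auto)
  hence "[a * b = 1 * b] (mod q)" by (simp add: cong_def)
  hence "[a = 1] (mod q)" using cong_mult_rcancel_nat[of b q a 1] coprime_A[OF b(1)] by simp
  thus False using a q_pos by (simp add: cong_def A_def)
 qed
 have "(\<Sum>k<q. x ^ k) = 0" using sum_unit_powers[OF xq] x1 by simp
 hence e: "of_nat q = (\<Sum>k<q. 1 - x ^ k)" by (simp add: sum_subtractf)
 have xO: "x ^ k : nf.Oi" for k unfolding x_def by (simp only: power_mult[symmetric] eta_O)
 have "1 - x ^ k : R" for k
  unfolding one_diff_power_eq by (rule nf.fid_mult_right[OF R.fidP xR nf.Oi_sum[OF xO]])
 hence "of_nat q : R" unfolding e by (intro nf.fid_sum[OF R.fidP])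
 hence qR: "of_int (int q) : R" by simp
 have "int N dvd int q" using R.v_int(3)[OF Nprime R(2), of "int q"] qR q_pos by fastforce
 hence "N dvd p ^ 2" unfolding q2 by presburger
 hence "N dvd p" using Nprime prime_dvd_power by blast
 hence "N = p" using primes_dvd_imp_eq[OF Nprime p] by simp
 hence "[p = 1] (mod p ^ 2)" using N1 unfolding q2 by simp
 hence "[p = 1] (mod p)" by (rule cong_dvd_modulus_nat) simp
 thus False using p_gt by (simp add: cong_def)
qed

lemma \<gamma>_pow_eq: assumes "\<gamma> ^ i mod q = \<gamma> ^ j mod q" shows "i mod M = j mod M"
proof -
 have md: "\<gamma> ^ i mod q = \<gamma> ^ (i mod M) mod q" for i
 proof -
  have "\<gamma> ^ i = (\<gamma> ^ M) ^ (i div M) * \<gamma> ^ (i mod M)" by (simp flip: power_add power_mult)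
  hence "\<gamma> ^ i mod q = ((\<gamma> ^ M mod q) ^ (i div M) mod q) * \<gamma> ^ (i mod M) mod q"
   by (simp add: power_mod mod_mult_left_eq)
  thus ?thesis unfolding \<gamma>M using q_pos by simp
 qed
 have "\<gamma> ^ (i mod M) mod q = \<gamma> ^ (j mod M) mod q" using assms md[of i] md[of j] by simp
 thus ?thesis using bij_betw_imp_inj_on[OF \<gamma>bij] M0 by (auto dest: inj_onD)
qed

text \<open>The Chinese remainder theorem for exponents modulo p * (p - 1): the part
  \<open>(p - 1) * i\<close> runs through the subgroup of order p, the Galois group over K, and
  \<open>p * j\<close> through the subgroup of order p - 1.\<close>

lemma double_index: "bij_betw (%(i,j). \<gamma> ^ ((p - 1) * i + p * j) mod q) ({..<p} \<times> {..<p - 1}) A"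
proof -
 have inj: "inj_on (%(i,j). \<gamma> ^ ((p - 1) * i + p * j) mod q) ({..<p} \<times> {..<p - 1})"
 proof (rule inj_onI, clarify)
  fix i j i' j' assume h: "i < p" "j < p - 1" "i' < p" "j' < p - 1"
   "\<gamma> ^ ((p - 1) * i + p * j) mod q = \<gamma> ^ ((p - 1) * i' + p * j') mod q"
  have c: "[(p - 1) * i + p * j = (p - 1) * i' + p * j'] (mod M)"
   unfolding cong_def by (rule \<gamma>_pow_eq[OF h(5)])
  have c1: "[(p - 1) * i + p * j = (p - 1) * i' + p * j'] (mod p)"
   by (rule cong_dvd_modulus_nat[OF c]) (simp add: M_def)
  hence "[(p - 1) * i = (p - 1) * i'] (mod p)" by (simp add: cong_def)
  moreover have "coprime (p - 1) p" using p_gt coprime_diff_one_left_nat[of p] by simp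
  ultimately have "[i = i'] (mod p)" by (simp add: cong_mult_lcancel_nat)
  hence ii: "i = i'" using h(1,3) by (simp add: cong_def)
  have c2: "[(p - 1) * i + p * j = (p - 1) * i' + p * j'] (mod (p - 1))"
   by (rule cong_dvd_modulus_nat[OF c]) (simp add: M_def)
  hence "[p * j = p * j'] (mod (p - 1))" by (simp add: cong_def)
  moreover have "coprime p (p - 1)" using p_gt coprime_diff_one_left_nat[of p] by (simp add: coprime_commute)
  ultimately have "[j = j'] (mod (p - 1))" by (simp add: cong_mult_lcancel_nat)
  hence "j = j'" using h(2,4) by (simp add: cong_def)
  thus "i = i' & j = j'" using ii by simp
 qed
 have "card ((%(i,j). \<gamma> ^ ((p - 1) * i + p * j) mod q) ` ({..<p} \<times> {..<p - 1})) = M"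
  unfolding card_image[OF inj] M_def by simp
 moreover have "card A = M" using bij_betw_same_card[OF \<gamma>bij] by simp
 moreover have "(%(i,j). \<gamma> ^ ((p - 1) * i + p * j) mod q) ` ({..<p} \<times> {..<p - 1}) <= A"
  using au_pow_A[OF \<gamma>A] by auto
 ultimately have "(%(i,j). \<gamma> ^ ((p - 1) * i + p * j) mod q) ` ({..<p} \<times> {..<p - 1}) = A"
  using card_subset_eq[OF A_fin] by metis
 thus ?thesis using inj unfolding bij_betw_def by simp
qed

text \<open>\<open>B\<close> is the product of the conjugates of a prime over \<open>N\<close> under
  the powers of \<open>gg p\<close>, so some power of it with exponent \<open>m\<close> prime to p
  is generated by an element \<open>w\<close>. The norm of \<open>w\<close> is, up to sign, a power
  of \<open>N\<close>, and its valuation \<open>m * (p - 1)\<close> shows that p does not divide the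
  exponent. \<open>W\<close> is the partial norm of \<open>w ^ 2\<close>; its norm to K is the full
  norm of \<open>w ^ 2\<close>, the square being there to remove the sign.\<close>

lemma norm_power_N:
 obtains W c where "W : Lf" "W ~= 0" "(\<Prod>i<p. gg ((p - 1) * i) W) = of_nat N ^ c" "~ p dvd c"
proof -
 obtain R where R: "nf.prm R" "of_nat N : R" using nf.ex_prime_over[OF Nprime] .
 interpret R: numfield_prime Lf Gk Bk bask duak Dk R by unfold_locales (rule R(1))
 define Q where "Q = (%j. gg (p * j) ` R)"
 have Qf: "nf.fid (Q j)" "Q j <= nf.Oi" for j
  unfolding Q_def using nf.fid_G_image[OF gg_G R.fidP] nf.G_image_Oi[OF gg_G R.P_Oi] by auto
 define B where "B = nf.iprods (p - 1) Q (%_. 1)"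
 have B: "nf.fid B" unfolding B_def by (rule nf.fid_iprods) (rule Qf)
 have BO: "B <= nf.Oi" unfolding B_def using R.w_iprods[of "p - 1" Q "%_. 1"] Qf by blast
 have gQ: "gg i ` Q j = gg (i + p * j) ` R" for i j
  unfolding Q_def image_image using gg_add nf.fidD(1)[OF R.fidP] by (intro image_cong[OF refl]) blast
 have "gg p ` B = B"
 proof -
  have "gg p ` B = nf.iprods (p - 1) (%i. gg p ` Q i) (%_. 1)" unfolding B_def by (rule nf.iprods_image[OF gg_G Qf(1)])
  also have "(%i. gg p ` Q i) = (%i. Q (Suc i))" by (rule ext, unfold gQ) (simp add: Q_def)
  finally have e1: "gg p ` B = nf.iprods (p - 1) (%i. Q (Suc i)) (%_. 1)" .
  have QM: "Q (p - 1) = Q 0"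
  proof -
   have "gg M ` R = gg 0 ` R" using gg_image0[OF R.fidP] by simp
   thus ?thesis by (simp add: Q_def M_def)
  qed
  have "nf.iprods (p - 1) (%i. Q (Suc i)) (%_. 1) \<star> Q 0 = nf.iprods (Suc (p - 1)) Q (%_. 1)"
   by (rule nf.iprods_shift[OF Qf(1)])
  also have "... = nf.ipow (Q 0) 1 \<star> B" unfolding nf.iprods.simps QM B_def ..
  also have "... = B \<star> Q 0"
   using nf.iprod_Oi[OF Qf(1), of 0] nf.iprod_comm[of "Q 0" nf.Oi] nf.iprod_comm[of "Q 0" B] by simp
  finally have "Q 0 \<star> nf.iprods (p - 1) (%i. Q (Suc i)) (%_. 1) = Q 0 \<star> B" using nf.iprod_comm by simp
  thus ?thesis unfolding e1
   by (intro nf.iprod_cancel[OF Qf(1) nf.fid_iprods B]) (rule Qf(1))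
 qed
 then obtain m w where mw: "m > 0" "~ p dvd m" "w : Lf" "w ~= 0" "nf.ipow B m = nf.smul w nf.Oi"
  using class_order_coprime[OF B] by blast
 have BmO: "nf.ipow B m <= nf.Oi" using R.w_ipow[OF B BO] by blast
 have wO: "w : nf.Oi" using BmO nf.smul_mem[OF nf.Oi_1, of w] unfolding mw(5) by auto
 obtain s where s: "nf.Nm w = of_int s" using nf.Nm_Ints[OF wO] by (elim Ints_cases)
 have s0: "s ~= 0" using s nf.Nm_nz[OF mw(3)] mw(4) by auto
 have wR: "R.w (g ` R) = (if g = au 1 0 then 1 else 0)" if g: "g : Gk" for g
 proof -
  obtain a b where ab: "a : A" "b < d" "g = au a b" using g unfolding Gk_def by auto
  have b0: "b = 0" using ab(2) d1 by simp
  show ?thesis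
  proof (cases "a = 1")
   case True
   have "au 1 0 ` R = R" using au_id nf.fidD(1)[OF R.fidP] by (force simp: image_iff)
   thus ?thesis using ab b0 True R.w_self by simp
  next
   case False
   have "au a 0 ~= au 1 0"
   proof
    assume "au a 0 = au 1 0"
    hence "(case (a,0) of (a,b) => au a b) = (case (1,0) of (a,b) => au a b)" by simp
    hence "(a, 0::nat) = (1, 0)" by (rule inj_onD[OF au_inj]) (use ab one_A d_pos in auto)
    thus False using False by simp
   qed
   thus ?thesis using R.w_eq_0[OF nf.fid_G_image[OF g R.fidP] nf.G_image_Oi[OF g R.P_Oi]]
     prime_conj_not_sub[OF R ab(1) False] ab b0 by simp
  qed
 qed
 have idG: "au 1 0 : Gk" by (rule au_Gk[OF one_A d_pos])
 have vN: "R.v (of_int s) = int m * (int p - 1)"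
 proof -
  have vg: "R.v (g w) = int (m * (\<Sum>j<p - 1. R.w (g ` Q j)))" if g: "g : Gk" for g
  proof -
   have gw: "g w : nf.Oi" "g w ~= 0" using nf.Oi_G[OF g wO] nf.Gne[OF g mw(3,4)] by auto
   have "nf.smul (g w) nf.Oi = g ` nf.ipow B m"
    unfolding mw(5) nf.smul_G_image[OF g nf.fid_Oi mw(3)] nf.Oi_G_image[OF g] ..
   also have "... = nf.ipow (g ` B) m"
    by (induction m) (use nf.Oi_G_image[OF g] nf.iprod_G_image[OF g B nf.fid_ipow[OF B]] in auto)
   finally have "R.we (g w) = R.w (nf.ipow (g ` B) m)" by (simp add: R.we_def)
   also have "... = m * R.w (g ` B)" using R.w_ipow[OF nf.fid_G_image[OF g B] nf.G_image_Oi[OF g BO]] by blast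
   also have "g ` B = nf.iprods (p - 1) (%j. g ` Q j) (%_. 1)" unfolding B_def by (rule nf.iprods_image[OF g Qf(1)])
   also have "R.w ... = (\<Sum>j<p - 1. R.w (g ` Q j))"
    using R.w_iprods[of "p - 1" "%j. g ` Q j" "%_. 1"] nf.fid_G_image[OF g Qf(1)] nf.G_image_Oi[OF g Qf(2)] by simp
   finally show ?thesis using R.v_Oi[OF gw] by simp
  qed
  have Lg: "g w : Lf & g w ~= 0" if "g : Gk" for g using nf.GL[OF that mw(3)] nf.Gne[OF that mw(3,4)] by simp
  have "R.v (of_int s) = (\<Sum>g\<in>Gk. R.v (g w))" unfolding s[symmetric] nf.Nm_def by (rule R.v_prod[OF nf.Gfin Lg])
  also have "... = (\<Sum>g\<in>Gk. int m * (\<Sum>j<p - 1. int (R.w (g ` Q j))))" by (rule sum.cong[OF refl]) (simp add: vg)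
  also have "... = int m * (\<Sum>j<p - 1. \<Sum>g\<in>Gk. int (R.w (g ` Q j)))"
   by (subst sum.swap) (simp only: sum_distrib_left)
  \<comment> \<open>Each \<open>Q j\<close> is a conjugate of \<open>R\<close>, and since
    \<open>N\<close> splits completely exactly one automorphism carries it back to
    \<open>R\<close>.\<close>
  also have "(\<Sum>j<p - 1. \<Sum>g\<in>Gk. int (R.w (g ` Q j))) = (\<Sum>j<p - 1. 1)"
  proof (rule sum.cong[OF refl])
   fix j
   have "(\<Sum>g\<in>Gk. int (R.w (g ` Q j))) = (\<Sum>g\<in>Gk. (%h. int (R.w (h ` R))) (%x. g (gg (p * j) x)))"
    by (simp add: Q_def image_image)
   also have "... = (\<Sum>h\<in>Gk. int (R.w (h ` R)))" proof -
    have "(%x. g (gg (p * j) x)) ` R = (%x. gg (p * j) (g x)) ` R" if g: "g : Gk" for g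
    proof -
     obtain i where i: "g = gg i" using Gk_gg[OF g] by blast
     show ?thesis unfolding i
      by (rule image_cong[OF refl]) (use gg_add nf.fidD(1)[OF R.fidP] in \<open>simp add: add.commute\<close>)
    qed
    thus ?thesis using nf.sum_G_comp[OF gg_G[of "p * j"], of "%h. int (R.w (h ` R))"] by simp
   qed
   also have "... = (\<Sum>h\<in>Gk. if h = au 1 0 then 1 else 0)" by (rule sum.cong[OF refl]) (simp add: wR)
   also have "... = 1" using idG nf.Gfin by simp
   finally show "(\<Sum>g\<in>Gk. int (R.w (g ` Q j))) = 1" .
  qed
  finally show ?thesis using p_gt by (simp add: of_nat_diff)
 qed
 define c where "c = multiplicity (int N) s"
 have pc: "~ p dvd c"
 proof
  assume "p dvd c"
  hence "int p dvd R.v (of_int s)" unfolding R.v_int(1)[OF Nprime R(2) s0] c_def[symmetric] by simp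
  hence "int p dvd int (m * (p - 1))" unfolding vN using p_gt by (simp add: of_nat_diff)
  hence "p dvd m * (p - 1)" by (simp only: int_dvd_int_iff)
  hence "p dvd m \<or> p dvd p - 1" using p prime_dvd_mult_iff by blast
  thus False using mw(2) p_gt by (auto dest: dvd_imp_le)
 qed
 have npN: "~ is_unit (int N)" using Nprime by (auto simp: prime_nat_iff)
 obtain y where y: "s = int N ^ c * y" "~ int N dvd y" unfolding c_def by (rule multiplicity_decompose'[OF s0 npN])
 \<comment> \<open>\<open>w\<close> divides a power of \<open>N\<close>, so its norm has no prime
   factor other than \<open>N\<close>.\<close>
 have y1: "y ^ 2 = 1"
 proof -
  have NQ: "of_nat N : Q j" for j unfolding Q_def using nf.Gof_nat[OF gg_G] R(2) by (metis imageI)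
  have "of_nat N ^ (p - 1) : B" unfolding B_def by (rule nf.iprods_mem[OF NQ R.fidP Qf(1)])
  hence "(of_nat N ^ (p - 1)) ^ m : nf.smul w nf.Oi" unfolding mw(5)[symmetric] by (rule nf.ipow_mem)
  hence h: "(of_nat N ^ (p - 1)) ^ m / w : nf.Oi" using nf.smul_iff[OF mw(4)] by blast
  obtain t where t: "nf.Nm ((of_nat N ^ (p - 1)) ^ m / w) = of_int t" using nf.Nm_Ints[OF h] by (elim Ints_cases)
  define K where "K = (p - 1) * m"
  have Ne: "((of_nat N ^ (p - 1)) ^ m :: complex) = of_int (int N ^ K)" by (simp add: K_def power_mult)
  have "nf.Nm (of_int (int N ^ K)) = nf.Nm ((of_nat N ^ (p - 1)) ^ m / w * w)" unfolding Ne using mw(4) by simp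
  also have "... = of_int t * of_int s" unfolding nf.Nm_mult[OF nf.Oi_L[OF h] mw(3)] t s ..
  finally have "(of_int (int N ^ K) ^ card Gk :: complex) = of_int t * of_int s" unfolding nf.Nm_of_int .
  hence "(of_int ((int N ^ K) ^ card Gk) :: complex) = of_int (t * s)" by simp
  hence "(int N ^ K) ^ card Gk = t * s" by (simp only: of_int_eq_iff)
  hence "y dvd int N ^ (K * card Gk)" unfolding y(1) power_mult by simp
  moreover have "coprime (int N) y" using prime_imp_coprime[of "int N" y] y(2) Nprime by simp
  hence "coprime y (int N ^ (K * card Gk))" by (simp add: coprime_commute)
  ultimately have "is_unit y" by (metis coprime_absorb_left)
  thus ?thesis by (auto simp: zdvd1_eq abs_if power2_eq_square split: if_splits)
 qed
 define W where "W = (\<Prod>j<p - 1. gg (p * j) (w ^ 2))"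
 have w2: "w ^ 2 : Lf" "w ^ 2 ~= 0" using nf.Lpow[OF mw(3)] mw(4) by auto
 have gL: "gg i (w ^ 2) : Lf" "gg i (w ^ 2) ~= 0" for i using nf.GL[OF gg_G w2(1)] nf.Gne[OF gg_G w2] by auto
 have "(\<Prod>i<p. gg ((p - 1) * i) W) = (\<Prod>i<p. \<Prod>j<p - 1. gg ((p - 1) * i + p * j) (w ^ 2))"
  unfolding W_def by (intro prod.cong refl) (simp add: nf.Gprod[OF gg_G gL(1)] gg_add[OF w2(1)])
 also have "... = (\<Prod>ij\<in>{..<p} \<times> {..<p - 1}. au (case ij of (i,j) => \<gamma> ^ ((p - 1) * i + p * j) mod q) 0 (w ^ 2))"
  by (simp add: prod.cartesian_product gg_def case_prod_unfold)
 also have "... = (\<Prod>a\<in>A. au a 0 (w ^ 2))" using prod.reindex_bij_betw[OF double_index, of "%a. au a 0 (w ^ 2)"] by simp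
 also have "... = nf.Nm (w ^ 2)"
 proof -
  have ld: "{..<d} = {0}" by (simp add: d1 lessThan_Suc)
  show ?thesis unfolding nf.Nm_def prod_Gk ld by simp
 qed
 also have "... = of_int (s ^ 2)" using nf.Nm_pow[OF mw(3), of 2] s by simp
 also have "s ^ 2 = int N ^ (c * 2)" unfolding y(1) power_mult_distrib y1 by (simp add: power_mult)
 finally have fin: "(\<Prod>i<p. gg ((p - 1) * i) W) = of_nat N ^ (c * 2)" by simp
 have "~ p dvd c * 2"
 proof
  assume "p dvd c * 2"
  hence "p dvd 2" using pc p prime_dvd_mult_iff by blast
  hence "p = 2" using primes_dvd_imp_eq[OF p two_is_prime_nat] by simp
  thus False using p2 by simp
 qed
 thus ?thesis using that[of W "c * 2"] fin gL unfolding W_def by (simp add: nf.Lprod)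
qed

end

section \<open>Conclusion\<close>


context kum begin

lemma Lf_ev_div: assumes "m > 0" shows "I.ev eta f / of_nat m : Lf"
 "a : A ==> b < d ==> au a b (I.ev eta f / of_nat m) = I.ev (eta ^ a) f / of_nat m"
 using Lf_div_nat[OF Lf_ev[OF Lf_eta(1)] assms] au_ev[OF Lf_eta(1)] Lf_eta(2) by auto

end

context kumEg begin

text \<open>A generator of the residues that are 1 modulo p, the Galois group of the field of p^2-th
  roots of unity over K.\<close>

definition bb where "bb = \<gamma> ^ (p - 1) mod q"

lemma bb_pow: "bb ^ i mod q = \<gamma> ^ ((p - 1) * i) mod q"
 unfolding bb_def power_mod power_mult ..

lemma bb_A: "bb : A" unfolding bb_def by (rule au_pow_A[OF \<gamma>A])

lemma bb_mod_p: "bb mod p = 1"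
proof -
 have "~ p dvd \<gamma>" using \<gamma>A by (simp add: A_def)
 hence "[\<gamma> ^ (p - 1) = 1] (mod p)" by (rule fermat_theorem[OF p])
 moreover have "p dvd q" unfolding q2 by simp
 ultimately show ?thesis using p_gt unfolding bb_def cong_def by (simp add: mod_mod_cancel)
qed

lemma bb_p: "bb ^ p mod q = 1" unfolding bb_pow using \<gamma>M by (simp add: M_def mult.commute)

lemma bb_ne: assumes "0 < i" "i < p" shows "bb ^ i mod q ~= 1"
proof -
 have "0 < (p - 1) * i" "(p - 1) * i < M" using assms p_gt unfolding M_def by (auto simp: mult.commute)
 thus ?thesis unfolding bb_pow by (rule \<gamma>ne)
qed

lemma bb_norm:
 obtains f m c where "m > 0" "I.ev eta f ~= 0" "(\<Prod>i<p. I.ev (eta ^ (bb ^ i mod q)) f / of_nat m) = of_nat N ^ c" "~ p dvd c"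
proof -
 obtain W c where W: "W : Lf" "W ~= 0" "(\<Prod>i<p. gg ((p - 1) * i) W) = of_nat N ^ c" "~ p dvd c"
  using norm_power_N .
 have "d ~= p" using d1 p_gt by simp
 then obtain f m where f: "m > 0" "W = I.ev eta f / of_nat m" using \<alpha>_free_if_fixed[OF W(1)] by blast
 have "gg ((p - 1) * i) W = I.ev (eta ^ (bb ^ i mod q)) f / of_nat m" for i
  unfolding gg_def f(2) bb_pow by (rule Lf_ev_div(2)[OF f(1) au_pow_A[OF \<gamma>A] d_pos])
 thus ?thesis using that[of m f c] W f by auto
qed

end

context kum begin

lemma bij_powers_one_mod:
 assumes n2: "n = 2" and b: "b : A" "b mod p = 1" "b ^ p mod q = 1" "!!i. 0 < i ==> i < p ==> b ^ i mod q ~= 1"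
 shows "bij_betw (%i. b ^ i mod q) {..<p} ((%k. 1 + p * k) ` {..<p})"
proof -
 have q2: "q = p * p" using n2 by (simp add: q_def power2_eq_square)
 have pq: "p dvd q" unfolding q2 by simp
 have cop: "coprime b q" by (rule coprime_A[OF b(1)])
 have inj: "inj_on (%i. b ^ i mod q) {..<p}"
 proof (rule inj_onI)
  have *: False if "i < j" "j < p" "b ^ i mod q = b ^ j mod q" for i j
  proof -
   have "[b ^ i * 1 = b ^ i * b ^ (j - i)] (mod q)" using that by (simp add: cong_def flip: power_add)
   hence "[1 = b ^ (j - i)] (mod q)" using cong_mult_lcancel_nat[of "b ^ i" q 1 "b ^ (j - i)"] cop by simp
   hence "b ^ (j - i) mod q = 1" using q_pos by (simp add: cong_def)
   moreover have "0 < j - i" "j - i < p" using that by auto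
   ultimately show False using b(4) by blast
  qed
  fix i j assume "i : {..<p}" "j : {..<p}" "b ^ i mod q = b ^ j mod q"
  thus "i = j" using *[of i j] *[of j i] by (metis lessThan_iff nat_neq_iff)
 qed
 have sub: "(%i. b ^ i mod q) ` {..<p} <= (%k. 1 + p * k) ` {..<p}"
 proof
  fix x assume "x : (%i. b ^ i mod q) ` {..<p}"
  then obtain i where i: "x = b ^ i mod q" by blast
  have "x mod p = (b mod p) ^ i mod p" unfolding i using pq by (simp add: mod_mod_cancel power_mod)
  hence xp: "x mod p = 1" using b(2) p_gt by simp
  have "x < q" unfolding i using q_pos by simp
  hence "x div p < p" unfolding q2 using p_gt by (simp add: less_mult_imp_div_less)
  moreover have "x = 1 + p * (x div p)" using xp mult_div_mod_eq[of p x] by simp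
  ultimately show "x : (%k. 1 + p * k) ` {..<p}" by blast
 qed
 have "card ((%k. 1 + p * k) ` {..<p}) = p" using p_gt by (simp add: card_image inj_on_def)
 hence "(%i. b ^ i mod q) ` {..<p} = (%k. 1 + p * k) ` {..<p}"
  by (intro card_subset_eq sub) (auto simp: card_image[OF inj])
 thus ?thesis using inj by (simp add: bij_betw_def)
qed

text \<open>Summation over the residues 1 + p * k kills the powers of \<open>eta\<close> whose
  exponent is not divisible by p. Applied to an element fixed by that group, it rewrites the element
  with coefficients in K.\<close>

lemma trace_to_subfield:
 assumes n2: "n = 2"
 shows "EX f'. (\<Sum>k<p. I.ev (eta ^ (1 + p * k)) f) = of_nat p * I.ev (eta ^ p) f'"
proof -
 have rp: "r = p" using n2 by (simp add: r_pow)
 have z: "\<zeta> = eta ^ p" unfolding \<zeta>_def using rp by (simp only: )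
 define f' where "f' = (\<Sum>l\<le>pdeg f. if p dvd l then Polynomial.monom (poly.coeff f l) (l div p) else 0)"
 have t: "(\<Sum>k<p. (eta ^ (1 + p * k)) ^ l) = of_nat p * (if p dvd l then (eta ^ p) ^ (l div p) else 0)" for l
 proof -
  have "(eta ^ (1 + p * k)) ^ l = eta ^ l * (\<zeta> ^ l) ^ k" for k
  proof -
   have "(1 + p * k) * l = l + p * l * k" by (simp add: algebra_simps)
   thus ?thesis unfolding z power_mult[symmetric] power_add[symmetric] by (simp only: mult.assoc)
  qed
  hence e: "(\<Sum>k<p. (eta ^ (1 + p * k)) ^ l) = eta ^ l * (\<Sum>k<p. (\<zeta> ^ l) ^ k)" by (simp add: sum_distrib_left)
  have "(\<zeta> ^ l) ^ p = (\<zeta> ^ p) ^ l" by (simp add: mult.commute flip: power_mult)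
  hence zl: "(\<zeta> ^ l) ^ p = 1" by (simp add: \<zeta>p)
  show ?thesis unfolding e sum_unit_powers[OF zl] \<zeta>_pow_1_iff by (auto simp flip: power_mult)
 qed
 have "(\<Sum>k<p. I.ev (eta ^ (1 + p * k)) f) = (\<Sum>l\<le>pdeg f. of_int (poly.coeff f l) * (\<Sum>k<p. (eta ^ (1 + p * k)) ^ l))"
  unfolding I.ev_altdef sum_distrib_left by (rule sum.swap)
 also have "... = (\<Sum>l\<le>pdeg f. of_nat p * I.ev (eta ^ p) (if p dvd l then Polynomial.monom (poly.coeff f l) (l div p) else 0))"
  unfolding t by (rule sum.cong[OF refl]) (auto simp: I.ev_monom I.ev_0)
 also have "... = of_nat p * I.ev (eta ^ p) f'" unfolding f'_def I.ev_sum sum_distrib_left ..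
 finally show ?thesis by blast
qed

end

context kumL begin

text \<open>In the compositum, \<sigma> moves the root \<alpha> of \<open>N\<close> and \<tau> moves
  a p-th root \<theta> of \<open>eta\<close>. Over \<tau> both \<open>W\<close> and
  \<open>\<alpha> ^ c\<close> have norm \<open>N ^ c\<close>, so \<open>x = W / \<alpha> ^ c\<close>
  is \<open>z\<close> divided by \<tau> z, by Hilbert 90. As \<sigma> x = x /
  \<open>eta ^ c\<close>, the quotient of \<sigma> z by \<open>z\<close> is multiplied by
  \<open>eta ^ c\<close> under \<tau>, and so is \<open>\<theta> ^ e\<close> for a suitable e. Their
  quotient \<open>y\<close> is fixed by \<tau>, hence lies in L, and its norm over \<sigma> is the
  inverse of \<open>\<theta> ^ (p * e)\<close>, that is, of \<open>eta ^ e\<close>.\<close>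

lemma ex_norm_root_of_unity:
 assumes N2: "[N = 1] (mod p ^ 2)"
 obtains y c where "y : Lf" "y ~= 0" "NK y = eta ^ c" "~ p dvd c"
proof -
 obtain \<theta> where \<theta>: "eta = \<theta> ^ p"
 proof -
  have "~ constant (poly (Polynomial.monom 1 p - [:eta:]))"
   using p_gt by (simp add: constant_degree degree_add_eq_left degree_monom_eq diff_conv_add_uminus del: add_uminus_conv_diff)
  then obtain z where "poly (Polynomial.monom 1 p - [:eta:]) z = 0" using fundamental_theorem_of_algebra by blast
  thus ?thesis using that[of z] by (simp add: poly_monom)
 qed
 have eta1: "eta ~= 1" using eta_pow_eq_1_iff[of 1] p_gt by simp
 interpret C2: cyc p 2 "p ^ 2" p \<theta>
 proof
  show "\<theta> ^ p\<^sup>2 = 1" using \<theta> eta_p by (simp add: power2_eq_square power_mult)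
  show "\<theta> ^ p ~= 1" using eta1 \<theta> by simp
 qed (use p in auto)
 interpret E1: kum p 2 "p ^ 2" p \<theta> 1 N "of_nat N" by (rule C2.kum_one[OF Nprime N2])
 interpret E1: kumE p 2 "p ^ 2" p \<theta> 1 N "of_nat N" by unfold_locales (use p2 in auto)
 obtain \<gamma> where \<gamma>: "\<gamma> : C2.A" "\<gamma> ^ E1.M mod p\<^sup>2 = 1" "bij_betw (%j. \<gamma> ^ j mod p\<^sup>2) {..<E1.M} C2.A" "E1.M > 0"
  "!!j. 0 < j ==> j < E1.M ==> \<gamma> ^ j mod p\<^sup>2 ~= 1" using E1.generator by blast
 interpret G: kumEg p 2 "p ^ 2" p \<theta> 1 N "of_nat N" \<gamma> by unfold_locales (use \<gamma> in auto)
 obtain f m c where f: "m > 0" "I.ev \<theta> f ~= 0" "(\<Prod>i<p. I.ev (\<theta> ^ (G.bb ^ i mod p\<^sup>2)) f / of_nat m) = of_nat N ^ c" "~ p dvd c"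
  using G.bb_norm by blast
 define b where "b = G.bb"
 have b: "b : C2.A" "b mod p = 1" "b ^ p mod p\<^sup>2 = 1" "!!i. 0 < i ==> i < p ==> b ^ i mod p\<^sup>2 ~= 1"
  unfolding b_def using G.bb_A G.bb_mod_p G.bb_p G.bb_ne by auto
 have ap: "\<alpha> ^ p = of_nat N" using \<alpha>d unfolding dp .
 interpret K2: kum p 2 "p ^ 2" p \<theta> p N \<alpha> by (rule C2.kum_p[OF Nprime N2 p2 ap])
 have \<zeta>2: "C2.\<zeta> = eta" unfolding C2.\<zeta>_def \<theta> ..
 have p0: "0 < p" "1 < p" using p_gt by auto
 define W where "W = I.ev \<theta> f / of_nat m"
 have WL: "W : K2.Lf" "W ~= 0" unfolding W_def using K2.Lf_ev_div(1)[OF f(1)] f by auto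
 have auW: "K2.au a i W = I.ev (\<theta> ^ a) f / of_nat m" if "a : C2.A" "i < p" for a i
  unfolding W_def by (rule K2.Lf_ev_div(2)[OF f(1) that])
 define x where "x = W / \<alpha> ^ c"
 have ac: "\<alpha> ^ c : K2.Lf" "\<alpha> ^ c ~= 0" using K2.Lf_pow[OF K2.Lf_\<alpha>(1)] \<alpha>_ne0 by auto
 have xL: "x : K2.Lf" "x ~= 0" unfolding x_def using K2.nf.Ldiv[OF WL(1) ac(1)] WL ac by auto
 have aux: "K2.au a i x = K2.au a i W / (eta ^ i * \<alpha>) ^ c" if "a : C2.A" "i < p" for a i
 proof -
  have "K2.au a i (\<alpha> ^ c) = (eta ^ i * \<alpha>) ^ c"
   unfolding K2.au_pow[OF K2.Lf_\<alpha>(1) that] K2.Lf_\<alpha>(2)[OF that] \<zeta>2 ..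
  thus ?thesis unfolding x_def using K2.nf.Gdiv[OF K2.au_Gk[OF that] WL(1) ac(1)] by simp
 qed
 have bA: "b ^ i mod p\<^sup>2 : C2.A" for i by (rule K2.au_pow_A[OF b(1)])
 have Nx: "(\<Prod>i<p. K2.au (b ^ i mod p\<^sup>2) 0 x) = 1"
 proof -
  have "(\<Prod>i<p. K2.au (b ^ i mod p\<^sup>2) 0 x) = (\<Prod>i<p. (I.ev (\<theta> ^ (b ^ i mod p\<^sup>2)) f / of_nat m) / \<alpha> ^ c)"
   by (rule prod.cong[OF refl]) (simp add: aux[OF bA p0(1)] auW[OF bA p0(1)])
  also have "... = (\<Prod>i<p. I.ev (\<theta> ^ (b ^ i mod p\<^sup>2)) f / of_nat m) / (\<Prod>i<p. \<alpha> ^ c)" by (rule prod_dividef)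
  also have "... = of_nat N ^ c / (\<alpha> ^ c) ^ p" unfolding b_def f(3) prod_constant card_lessThan ..
  also have "(\<alpha> ^ c) ^ p = (\<alpha> ^ p) ^ c" by (simp add: mult.commute flip: power_mult)
  finally show ?thesis using Nprime by (auto simp: ap prime_gt_0_nat)
 qed
 obtain z where z: "z : K2.Lf" "z ~= 0" "z = x * K2.au b 0 z"
  using K2.hilbert90[OF b(1) p0(1) b(3) b(4) xL(1) Nx] by blast
 define \<sigma> where "\<sigma> = K2.au 1 1"
 define \<tau> where "\<tau> = K2.au b 0"
 have G: "\<sigma> : K2.Gk" "\<tau> : K2.Gk" unfolding \<sigma>_def \<tau>_def using K2.au_Gk[OF K2.one_A p0(2)] K2.au_Gk[OF b(1) p0(1)] by auto
 have comm: "\<sigma> (\<tau> v) = \<tau> (\<sigma> v)" for v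
 proof -
  have "(%v. \<sigma> (\<tau> v)) = K2.au (1 * b mod p\<^sup>2) ((1 + 1 * 0) mod p)" unfolding \<sigma>_def \<tau>_def by (rule K2.au_comp[OF K2.one_A p0(2) b(1) p0(1)])
  moreover have "(%v. \<tau> (\<sigma> v)) = K2.au (b * 1 mod p\<^sup>2) ((0 + b * 1) mod p)" unfolding \<sigma>_def \<tau>_def by (rule K2.au_comp[OF b(1) p0(1) K2.one_A p0(2)])
  ultimately have "(%v. \<sigma> (\<tau> v)) = (%v. \<tau> (\<sigma> v))" using b(2) p0 by simp
  thus ?thesis by (rule fun_cong)
 qed
 have szL: "\<sigma> z : K2.Lf" "\<sigma> z ~= 0" "\<tau> z : K2.Lf" "\<tau> z ~= 0"
  using K2.nf.GL[OF _ z(1)] K2.nf.Gne[OF _ z(1,2)] G by auto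
 have tz: "\<tau> z = z / x" using z(3) xL(2) unfolding \<tau>_def by (simp add: field_simps)
 have sx: "\<sigma> x = x / eta ^ c"
 proof -
  have "\<sigma> x = W / (eta ^ 1 * \<alpha>) ^ c" unfolding \<sigma>_def aux[OF K2.one_A p0(2)] auW[OF K2.one_A p0(2)] by (simp add: W_def)
  thus ?thesis unfolding x_def by (simp add: power_mult_distrib)
 qed
 have eta0: "eta ^ k ~= 0" for k using eta_ne0 by simp
 have ts: "\<tau> (\<sigma> z / z) = (\<sigma> z / z) * eta ^ c"
 proof -
  have "\<tau> (\<sigma> z / z) = \<sigma> (\<tau> z) / \<tau> z" unfolding K2.nf.Gdiv[OF G(2) szL(1) z(1)] comm ..
  also have "\<sigma> (\<tau> z) = \<sigma> z / \<sigma> x" unfolding tz by (rule K2.nf.Gdiv[OF G(1) z(1) xL(1)])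
  finally show ?thesis unfolding tz sx using xL(2) z(2) szL eta0 by (simp add: field_simps)
 qed
 \<comment> \<open>Since \<open>b\<close> is 1 modulo p, \<tau> multiplies \<theta> by
   \<open>eta ^ s\<close>. As \<open>b\<close> is not 1 modulo p^2, \<open>s\<close> is invertible
   modulo p, and e solves s * e = c modulo p.\<close>
 obtain s where s: "b = 1 + p * s" using b(2) mult_div_mod_eq[of p b] by (metis add.commute)
 have ps: "~ p dvd s"
 proof
  assume "p dvd s"
  then obtain k where "s = p * k" by (elim dvdE)
  hence "b = 1 + p\<^sup>2 * k" using s by (simp add: power2_eq_square)
  hence "b mod p\<^sup>2 = 1 mod p\<^sup>2" by (simp only: mod_mult_self2)
  hence "b mod p\<^sup>2 = 1" using C2.q_pos p0 by simp
  thus False using b(4)[of 1] p0 by simp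
 qed
 hence "coprime s p" using prime_imp_coprime[OF p ps] by (simp add: coprime_commute)
 then obtain s' where s': "[s * s' = 1] (mod p)" by (metis cong_solve_coprime_nat One_nat_def)
 define e where "e = s' * c"
 have se: "[s * e = c] (mod p)" using cong_scalar_right[OF s', of c] by (simp add: e_def mult.assoc)
 have pe: "~ p dvd e" 
 proof
  assume "p dvd e"
  hence "p dvd s * e" by simp
  thus False using se f(4) by (simp add: cong_dvd_iff)
 qed
 have te: "\<tau> (\<theta> ^ e) = \<theta> ^ e * eta ^ c"
 proof -
  have "\<tau> (\<theta> ^ e) = (\<theta> ^ b) ^ e" unfolding \<tau>_def K2.au_pow[OF K2.Lf_eta(1) b(1) p0(1)] K2.Lf_eta(2)[OF b(1) p0(1)] ..
  also have "... = \<theta> ^ e * (\<theta> ^ p) ^ (s * e)"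
  proof -
   have "b * e = e + p * (s * e)" unfolding s by (simp add: algebra_simps)
   thus ?thesis unfolding power_mult[symmetric] power_add[symmetric] by simp
  qed
  also have "(\<theta> ^ p) ^ (s * e) = eta ^ c"
  proof -
   have "eta ^ (s * e mod p) = eta ^ (c mod p)" using se by (simp add: cong_def)
   thus ?thesis unfolding \<theta>[symmetric] using eta_mod[of "s * e"] eta_mod[of c] unfolding modq by metis
  qed
  finally show ?thesis .
 qed
 define y where "y = \<sigma> z / z / \<theta> ^ e"
 have \<theta>e: "\<theta> ^ k : K2.Lf" "\<theta> ^ k ~= 0" for k using K2.Lf_pow[OF K2.Lf_eta(1)] C2.eta_ne0 by auto
 have yL: "y : K2.Lf" "y ~= 0" unfolding y_def using K2.nf.Ldiv[OF K2.nf.Ldiv[OF szL(1) z(1)] \<theta>e(1)] szL(2) z(2) \<theta>e(2) by auto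
 have ty: "\<tau> y = y"
  unfolding y_def K2.nf.Gdiv[OF G(2) K2.nf.Ldiv[OF szL(1) z(1)] \<theta>e(1)] ts te using eta_ne0 by simp
 have tiy: "K2.au (b ^ i mod p\<^sup>2) 0 y = y" for i
 proof (induction i)
  case 0 show ?case by (rule K2.au_one_pow[OF yL(1)])
 next
  case (Suc i) show ?case unfolding K2.au_step[OF b(1), symmetric] Suc using ty by (simp add: \<tau>_def)
 qed
 have Ny: "(\<Prod>i<p. K2.au 1 i y) = inverse (eta ^ e)"
 proof -
  have g: "K2.au 1 i : K2.Gk" if "i < p" for i by (rule K2.au_Gk[OF K2.one_A that])
  have "K2.au 1 i y = K2.au 1 ((i + 1) mod p) z / K2.au 1 i z / \<theta> ^ e" if i: "i < p" for i
  proof -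
   have "K2.au 1 i (\<sigma> z) = K2.au 1 ((i + 1) mod p) z"
    using fun_cong[OF K2.au_comp[OF K2.one_A i K2.one_A p0(2)], of z] C2.q_pos p0 by (simp add: \<sigma>_def)
   moreover have "K2.au 1 i (\<theta> ^ e) = \<theta> ^ e"
    unfolding K2.au_pow[OF K2.Lf_eta(1) K2.one_A i] K2.Lf_eta(2)[OF K2.one_A i] by simp
   ultimately show ?thesis
    unfolding y_def K2.nf.Gdiv[OF g[OF i] K2.nf.Ldiv[OF szL(1) z(1)] \<theta>e(1)] K2.nf.Gdiv[OF g[OF i] szL(1) z(1)] by simp
  qed
  hence "(\<Prod>i<p. K2.au 1 i y) = (\<Prod>i<p. K2.au 1 ((i + 1) mod p) z) / (\<Prod>i<p. K2.au 1 i z) / (\<theta> ^ e) ^ p"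
  proof -
   assume h: "!!i. i < p ==> K2.au 1 i y = K2.au 1 ((i + 1) mod p) z / K2.au 1 i z / \<theta> ^ e"
   have "(\<Prod>i<p. K2.au 1 i y) = (\<Prod>i<p. K2.au 1 ((i + 1) mod p) z / K2.au 1 i z / \<theta> ^ e)"
    by (rule prod.cong[OF refl]) (rule h, simp)
   thus ?thesis by (simp only: prod_dividef prod_constant card_lessThan)
  qed
  also have "(\<Prod>i<p. K2.au 1 ((i + 1) mod p) z) = (\<Prod>i<p. K2.au 1 i z)"
   using prod.reindex_bij_betw[OF bij_shift[of 1 1], of "%b. K2.au 1 b z"] p0 by (simp add: add.commute)
  also have "(\<theta> ^ e) ^ p = eta ^ e" unfolding \<theta> by (simp add: mult.commute flip: power_mult)
  finally show ?thesis using K2.nf.Gne[OF g z(1,2)] by (simp add: inverse_eq_divide)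
 qed
 obtain cc m' where cc: "m' > 0" "y = (\<Sum>j<p. I.ev \<theta> (cc j) * \<alpha> ^ j) / of_nat m'"
  and acc: "ALL a:C2.A. ALL b<p. K2.au a b y = (\<Sum>j<p. I.ev (\<theta> ^ a) (cc j) * (C2.\<zeta> ^ b * \<alpha>) ^ j) / of_nat m'"
  using K2.Lf_decomp[OF yL(1)] by (elim exE conjE)
 \<comment> \<open>\<open>y\<close> is fixed by \<tau>, so it equals its average over the powers of
   \<tau>; averaging turns the coefficients in \<theta> into polynomials in \<open>eta\<close>,
   which exhibits \<open>y\<close> as an element of L.\<close>
 have "ALL j. EX f'. (\<Sum>k<p. I.ev (\<theta> ^ (1 + p * k)) (cc j)) = of_nat p * I.ev (\<theta> ^ p) f'"
  using K2.trace_to_subfield by simp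
 then obtain F where F: "ALL j. (\<Sum>k<p. I.ev (\<theta> ^ (1 + p * k)) (cc j)) = of_nat p * I.ev (\<theta> ^ p) (F j)"
  unfolding choice_iff ..
 have ye: "y = (\<Sum>j<p. I.ev eta (F j) * \<alpha> ^ j) / of_nat m'"
 proof -
  have bij: "bij_betw (%i. b ^ i mod p\<^sup>2) {..<p} ((%k. 1 + p * k) ` {..<p})" by (rule K2.bij_powers_one_mod[OF refl b])
  have "of_nat p * y = (\<Sum>i<p. K2.au (b ^ i mod p\<^sup>2) 0 y)" unfolding tiy by simp
  also have "... = (\<Sum>i<p. (\<Sum>j<p. I.ev (\<theta> ^ (b ^ i mod p\<^sup>2)) (cc j) * \<alpha> ^ j) / of_nat m')"
   by (rule sum.cong[OF refl]) (simp add: acc[rule_format, OF bA p0(1)])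
  also have "... = (\<Sum>j<p. (\<Sum>i<p. I.ev (\<theta> ^ (b ^ i mod p\<^sup>2)) (cc j)) * \<alpha> ^ j) / of_nat m'"
   unfolding sum_divide_distrib[symmetric] sum_distrib_right by (subst sum.swap) simp
  also have "... = (\<Sum>j<p. (\<Sum>k<p. I.ev (\<theta> ^ (1 + p * k)) (cc j)) * \<alpha> ^ j) / of_nat m'"
  proof -
   have "(\<Sum>i<p. I.ev (\<theta> ^ (b ^ i mod p\<^sup>2)) (cc j)) = (\<Sum>k<p. I.ev (\<theta> ^ (1 + p * k)) (cc j))" for j
    using sum.reindex_bij_betw[OF bij, of "%a. I.ev (\<theta> ^ a) (cc j)"] p0(1)
    by (simp add: sum.reindex inj_on_def)
   thus ?thesis by simp
  qed
  also have "... = of_nat p * ((\<Sum>j<p. I.ev eta (F j) * \<alpha> ^ j) / of_nat m')"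
   using F by (simp add: \<theta> sum_distrib_left mult.assoc)
  finally have e: "of_nat p * y = of_nat p * ((\<Sum>j<p. I.ev eta (F j) * \<alpha> ^ j) / of_nat m')" .
  have "(of_nat p :: complex) ~= 0" using p0 by simp
  thus ?thesis using e by (rule mult_left_cancel[THEN iffD1])
 qed
 have yLf: "y : Lf" unfolding ye
  by (intro nf.Ldiv nf.Lsum nf.Lmult nf.Lof_nat Lf_ev[OF Lf_eta(1)] Lf_pow[OF Lf_\<alpha>(1)])
 \<comment> \<open>The automorphisms of L and of the compositum are different total functions; they
   agree on expressions in \<open>eta\<close> and \<alpha>, which is what the norm of
   \<open>y\<close> requires.\<close>
 have auy: "au 1 i y = K2.au 1 i y" if i: "i < p" for i
 proof -
  have id: "i < d" using i unfolding dp .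
  define S where "S = (\<Sum>j<p. I.ev eta (F j) * \<alpha> ^ j)"
  have gG: "au 1 i : Gk" by (rule au_G[OF one_A i])
  have kG: "K2.au 1 i : K2.Gk" by (rule K2.au_Gk[OF K2.one_A i])
  have sL: "S : Lf" "I.ev eta (F j) * \<alpha> ^ j : Lf" "\<alpha> ^ j : Lf" for j
   unfolding S_def by (intro nf.Lsum nf.Lmult Lf_ev[OF Lf_eta(1)] Lf_pow[OF Lf_\<alpha>(1)])+
  have etaK: "eta : K2.Lf" unfolding \<theta> by (rule K2.Lf_pow[OF K2.Lf_eta(1)])
  have sK: "S : K2.Lf" "I.ev eta (F j) * \<alpha> ^ j : K2.Lf" "\<alpha> ^ j : K2.Lf" "I.ev eta (F j) : K2.Lf" for j
   unfolding S_def by (intro K2.nf.Lsum K2.nf.Lmult K2.Lf_ev[OF etaK] K2.Lf_pow[OF K2.Lf_\<alpha>(1)])+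
  have "au 1 i (I.ev eta (F j) * \<alpha> ^ j) = I.ev eta (F j) * (eta ^ i * \<alpha>) ^ j" for j
   unfolding nf.Gmult[OF gG Lf_ev[OF Lf_eta(1)] sL(3)] au_ev[OF Lf_eta(1) one_A id] Lf_eta(2)[OF one_A id]
    au_pow[OF Lf_\<alpha>(1) one_A id] Lf_\<alpha>(2)[OF one_A id] \<zeta>eta by simp
  moreover have "K2.au 1 i eta = eta"
   unfolding \<theta> K2.au_pow[OF K2.Lf_eta(1) K2.one_A i] K2.Lf_eta(2)[OF K2.one_A i] by simp
  hence "K2.au 1 i (I.ev eta (F j) * \<alpha> ^ j) = I.ev eta (F j) * (eta ^ i * \<alpha>) ^ j" for j
   unfolding K2.nf.Gmult[OF kG sK(4,3)] K2.au_ev[OF etaK K2.one_A i]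
    K2.au_pow[OF K2.Lf_\<alpha>(1) K2.one_A i] K2.Lf_\<alpha>(2)[OF K2.one_A i] \<zeta>2 by simp
  ultimately have "au 1 i S = K2.au 1 i S"
   unfolding S_def nf.Gsum[OF gG sL(2)] K2.nf.Gsum[OF kG sK(2)] by simp
  thus ?thesis unfolding ye S_def[symmetric]
   nf.Gdiv[OF gG sL(1) nf.Lof_nat] K2.nf.Gdiv[OF kG sK(1) K2.nf.Lof_nat] nf.Gof_nat[OF gG] K2.nf.Gof_nat[OF kG] by simp
 qed
 have "NK y = eta ^ (e * (p - 1))"
  unfolding NK_def eta_inv_pow[symmetric] Ny[symmetric] by (rule prod.cong[OF refl]) (simp only: lessThan_iff auy)
 moreover have "~ p dvd e * (p - 1)"
  using pe p p_gt by (auto simp: prime_dvd_mult_iff dest: dvd_imp_le)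
 ultimately show ?thesis using that[OF yLf yL(2)] by blast
qed

text \<open>\<open>J\<close> is the intersection of the multiples of the partial norms
  \<open>Y k\<close>, k < p. Applying \<sigma> and multiplying by \<open>y\<close> carries the
  multiples of \<open>Y k\<close> to those of \<open>Y (Suc k)\<close>, and \<open>Y p\<close> is
  the norm of \<open>y\<close>, a unit; so the ideals are permuted cyclically.\<close>

lemma norm_unit_ideal:
 assumes y: "y : Lf" "y ~= 0" and Ny: "NK y = eta ^ c"
 obtains J where "nf.fid J" "J <= nf.Oi" "J = nf.smul y (sg ` J)"
proof -
 define Y where "Y = (%k. \<Prod>i<k. au 1 i y)"
 have aL: "au 1 i y : Lf" "au 1 i y ~= 0" if "i < p" for i
  using nf.GL[OF au_G[OF one_A that] y(1)] nf.Gne[OF au_G[OF one_A that] y] by auto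
 have YL: "Y k : Lf" "Y k ~= 0" if "k <= p" for k
  using that aL unfolding Y_def by (auto intro!: nf.Lprod)
 have Y0: "Y 0 = 1" by (simp add: Y_def)
 have Yp: "Y p = eta ^ c" using Ny by (simp add: Y_def NK_def)
 have sY: "y * sg (Y k) = Y (Suc k)" if k: "k < p" for k
 proof -
  have "sg (Y k) = (\<Prod>i<k. sg (au 1 i y))" unfolding Y_def by (rule nf.Gprod[OF sg_G]) (use aL k in auto)
  also have "... = (\<Prod>i<k. au 1 (Suc i) y)" by (rule prod.cong[OF refl]) (use au_Suc k in auto)
  finally show ?thesis unfolding Y_def prod.lessThan_Suc_shift[of _ k] using au_id[OF y(1)] by simp
 qed
 define J where "J = {x : Lf. ALL k<p. x / Y k : nf.Oi}"
 have JO: "J <= nf.Oi" using p_gt Y0 by (force simp: J_def)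
 have "ALL k:{..<p}. EX m. m > (0::nat) & of_nat m * inverse (Y k) : nf.Oi"
 proof
  fix k assume "k : {..<p}"
  hence "inverse (Y k) : Lf" using nf.Linv[OF YL(1), of k] by simp
  thus "EX m. m > (0::nat) & of_nat m * inverse (Y k) : nf.Oi" using nf.L_denom by blast
 qed
 then obtain m where m: "ALL k:{..<p}. m k > (0::nat) & of_nat (m k) * inverse (Y k) : nf.Oi" using bchoice by metis
 define t where "t = (of_nat (\<Prod>k<p. m k) :: complex)"
 have tJ: "t : J" unfolding J_def
 proof safe
  show "t : Lf" unfolding t_def by (rule nf.Lof_nat)
  fix k assume k: "k < p"
  have "(\<Prod>k<p. m k) = (\<Prod>i\<in>{..<p} - {k}. m i) * m k" using k prod.remove[of "{..<p}" k m] by (simp add: mult.commute)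
  hence "t = of_nat (\<Prod>i\<in>{..<p} - {k}. m i) * of_nat (m k)" unfolding t_def by (simp only: of_nat_mult)
  hence "t / Y k = of_nat (\<Prod>i\<in>{..<p} - {k}. m i) * (of_nat (m k) * inverse (Y k))" by (simp only: divide_inverse mult.assoc)
  moreover have "of_nat (m k) * inverse (Y k) : nf.Oi" using m k by blast
  ultimately show "t / Y k : nf.Oi" using nf.Oi_mult[OF nf.Oi_of_nat] by (simp only:)
 qed
 have t0: "t ~= 0" unfolding t_def using m by simp
 have "nf.idl J"
  unfolding nf.idl_def using JO nf.Ladd nf.Oi_add nf.Oi_0 nf.L0 nf.Oi_mult nf.Lmult nf.Oi_L
  by (auto simp: J_def add_divide_distrib simp flip: times_divide_eq_right)
 hence J: "nf.fid J" by (rule nf.idl_fid[OF _ tJ t0])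
 have sO: "v : nf.Oi \<longleftrightarrow> sg v : nf.Oi" if v: "v : Lf" for v
 proof
  assume "sg v : nf.Oi"
  hence "sg v : sg ` nf.Oi" using nf.Oi_G_image[OF sg_G] by simp
  then obtain v' where "v' : nf.Oi" "sg v = sg v'" by blast
  thus "v : nf.Oi" using inj_onD[OF nf.Ginj[OF sg_G], of v v'] v nf.Oi_L by auto
 qed (rule nf.Oi_G[OF sg_G])
 have step: "sg (x / Y k) = y * sg x / Y (Suc k)" if "x : Lf" "k < p" for x k
  using nf.Gdiv[OF sg_G that(1) YL(1)[of k]] that(2) sY[OF that(2)] y(2) by (simp flip: sY[OF that(2)])
 have last: "x / Y p : nf.Oi \<longleftrightarrow> x / Y 0 : nf.Oi" for x
 proof -
  have e: "inverse (eta ^ c) : nf.Oi" "eta ^ c : nf.Oi"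
   unfolding eta_inv_pow nf.Oi_def using Lf_pow[OF Lf_eta(1)] algebraic_int_power_complex[OF eta_alg] by auto
  have "x / eta ^ c = inverse (eta ^ c) * x" "x = eta ^ c * (x / eta ^ c)" using eta_ne0 by (auto simp: divide_inverse)
  thus ?thesis unfolding Yp Y0 using nf.Oi_mult[OF e(1)] nf.Oi_mult[OF e(2)] by (metis div_by_1)
 qed
 have iff: "x : J \<longleftrightarrow> y * sg x : J" if x: "x : Lf" for x
 proof -
  have yx: "y * sg x : Lf" by (rule nf.Lmult[OF y(1) nf.GL[OF sg_G x]])
  have "x : J \<longleftrightarrow> (ALL k<p. y * sg x / Y (Suc k) : nf.Oi)"
   using x sO[OF nf.Ldiv[OF x YL(1)]] step[OF x] by (auto simp: J_def)
  also have "... \<longleftrightarrow> (ALL k<p. y * sg x / Y k : nf.Oi)"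
  proof safe
   fix k assume h: "ALL k<p. y * sg x / Y (Suc k) : nf.Oi" "k < p"
   show "y * sg x / Y k : nf.Oi"
   proof (cases k)
    case 0
    have "y * sg x / Y p : nf.Oi" using h(1)[rule_format, of "p - 1"] p_gt by simp
    thus ?thesis using last 0 by blast
   next
    case (Suc i) thus ?thesis using h by simp
   qed
  next
   fix k assume h: "ALL k<p. y * sg x / Y k : nf.Oi" "k < p"
   show "y * sg x / Y (Suc k) : nf.Oi"
   proof (cases "Suc k = p")
    case True
    have "y * sg x / Y 0 : nf.Oi" using h(1) p_gt by simp
    thus ?thesis using last True by metis
   next
    case False thus ?thesis using h by simp
   qed
  qed
  finally show ?thesis using yx by (simp add: J_def)
 qed
 have "J = nf.smul y (sg ` J)"
 proof
  show "nf.smul y (sg ` J) <= J" using iff by (auto simp: nf.smul_def J_def)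
  show "J <= nf.smul y (sg ` J)"
  proof
   fix x assume x: "x : J"
   have "x / y : Lf" using nf.Ldiv[OF nf.fidD(1)[OF J x] y(1)] .
   hence "x / y : sg ` Lf" using nf.Gbij_L[OF sg_G] by (simp add: bij_betw_def)
   then obtain x' where x': "x' : Lf" "x / y = sg x'" by blast
   have "x = y * sg x'" unfolding x'(2)[symmetric] using y(2) by simp
   thus "x : nf.smul y (sg ` J)" using iff[OF x'(1)] x by (auto simp: nf.smul_def)
  qed
 qed
 thus ?thesis using that J JO by blast
qed

theorem torsion_bound:
 "p ^ ((p - 1) div 2) <= card {x : carrier (class_group Lf). x [^]\<^bsub>class_group Lf\<^esub> p = \<one>\<^bsub>class_group Lf\<^esub>}"
proof (rule primes_over_N)
 fix Q assume Q: "!!a. a : A ==> nf.prm (Q a) & of_nat N : Q a" "!!a b. a : A ==> b : A ==> a ~= b ==> ~ Q a <= Q b"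
 define Q' where "Q' = (%i. Q (Suc i))"
 have SA: "Suc i : A" if "i < p - 1" for i using that by (auto simp: A_eq)
 have ramQ: "ram (Q' i)" if "i < p - 1" for i
 proof -
  interpret R: kumLP p n q r eta d N \<alpha> "Q' i" by unfold_locales (use Q(1)[OF SA[OF that]] in \<open>simp add: Q'_def\<close>)
  show ?thesis by (rule R.ram_N) (use Q(1)[OF SA[OF that]] in \<open>simp add: Q'_def\<close>)
 qed
 have sepQ: "~ Q' i <= Q' j" if "i < p - 1" "j < p - 1" "i ~= j" for i j
  using Q(2)[OF SA[OF that(1)] SA[OF that(2)]] that(3) by (simp add: Q'_def)
 show ?thesis
 proof (cases "[N = 1] (mod p ^ 2)")
  case True
  obtain y c where y: "y : Lf" "y ~= 0" "NK y = eta ^ c" "~ p dvd c" using ex_norm_root_of_unity[OF True] .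
  obtain J where J: "nf.fid J" "J <= nf.Oi" "J = nf.smul y (sg ` J)" using norm_unit_ideal[OF y(1-3)] .
  show ?thesis by (rule torsion_count[OF ramQ sepQ J(1,2) y(1,2) J(3) y(3)]) (use y(4) in auto)
 next
  case False
  obtain P where P: "nf.prm P" "of_nat p : P" using nf.ex_prime_over[OF p] .
  interpret R: kumLP p n q r eta d N \<alpha> P by unfold_locales (rule P(1))
  have rP: "ram P" by (rule R.ram_p[OF P(2) False])
  have nQ: "~ Q' i <= P" if "i < p - 1" for i
   using Q(1)[OF SA[OF that]] R.not_both[OF _ P(2)] by (auto simp: Q'_def)
  \<comment> \<open>Here y is 1 and its norm is \<open>eta ^ 0\<close>, so \<open>p\<close> divides
    \<open>c0\<close> and the second alternative of \<open>cs\<close> applies.\<close>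
  have N1': "NK 1 = eta ^ 0" using nf.G1[OF au_G[OF one_A]] by (simp add: NK_def)
  show ?thesis
   by (rule torsion_count[OF ramQ sepQ R.V.fidP R.V.P_Oi nf.L1 one_neq_zero _ N1']) (use rP nQ ram_image[OF rP] in auto)
 qed
qed

end


lemma (in kumL) rat_adjoin_eq: "rat_adjoin {eta, \<alpha>} = Lf"
proof
 interpret R: ring complex_ring by (rule ring_from_type_algebra)
 have inv: "\<ominus>\<^bsub>complex_ring\<^esub> x = - x" for x
  by (rule R.minus_equality) (simp_all add: ring_of_type_algebra_def)
 have minv: "inv\<^bsub>complex_ring\<^esub> x = inverse x" if "x ~= 0" for x
  by (rule R.inv_char) (use that in \<open>simp_all add: ring_of_type_algebra_def\<close>)
 have ops: "x \<otimes>\<^bsub>complex_ring\<^esub> y = x * y" "x \<oplus>\<^bsub>complex_ring\<^esub> y = x + y" "\<one>\<^bsub>complex_ring\<^esub> = 1" "\<zero>\<^bsub>complex_ring\<^esub> = 0" for x y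
  by (simp_all add: ring_of_type_algebra_def)
 define F where "F = rat_adjoin {eta, \<alpha>}"
 have one: "1 : F" using generate_field.one[of complex_ring "{eta, \<alpha>}"] by (simp add: F_def rat_adjoin_def ops)
 have gens: "eta : F" "\<alpha> : F" by (auto simp: F_def rat_adjoin_def intro: generate_field.incl)
 have add: "x + y : F" if "x : F" "y : F" for x y
  using generate_field.eng_add[of x complex_ring "{eta, \<alpha>}" y] that by (simp add: F_def rat_adjoin_def ops)
 have mult: "x * y : F" if "x : F" "y : F" for x y
  using generate_field.eng_mult[of x complex_ring "{eta, \<alpha>}" y] that by (simp add: F_def rat_adjoin_def ops)
 have neg: "- x : F" if "x : F" for x
  using generate_field.a_inv[of x complex_ring "{eta, \<alpha>}"] that by (simp add: F_def rat_adjoin_def inv)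
 have invF: "inverse x : F" if "x : F" "x ~= 0" for x
  using generate_field.m_inv[of x complex_ring "{eta, \<alpha>}"] that by (simp add: F_def rat_adjoin_def minv ops)
 show "rat_adjoin {eta, \<alpha>} <= Lf"
 proof
  fix x assume "x : rat_adjoin {eta, \<alpha>}"
  hence "x : generate_field complex_ring {eta, \<alpha>}" by (simp add: rat_adjoin_def)
  thus "x : Lf"
  proof induction
   case (m_inv h)
   hence "h ~= 0" by (simp add: ops)
   thus ?case using nf.Linv[OF m_inv.IH] by (simp add: minv)
  qed (auto simp: ops inv nf.L1 Lf_eta Lf_\<alpha> nf.Ladd nf.Lmult nf.Lminus)
 qed
 have zero: "0 : F" using add[OF one neg[OF one]] by simp
 have natF: "of_nat k : F" for k by (induction k) (auto simp: zero one add)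
 have intF: "of_int k : F" for k using natF neg by (cases k) (auto simp del: of_nat_Suc)
 have evF: "I.ev eta f : F" for f by (induction f) (auto simp: I.ev_0 I.ev_pCons zero intF gens add mult)
 have ZF: "Z eta \<alpha> f : F" for f by (induction f) (auto simp: E.ev_0 E.ev_pCons zero evF gens add mult)
 show "Lf <= rat_adjoin {eta, \<alpha>}"
 proof
  fix x assume "x : Lf"
  then obtain f m where f: "m > 0" "x = Z eta \<alpha> f / of_nat m" using LfE by blast
  have "Z eta \<alpha> f * inverse (of_nat m) : F" using f(1) by (intro mult[OF ZF] invF natF) simp
  thus "x : rat_adjoin {eta, \<alpha>}" using f(2) by (simp add: F_def divide_inverse)
 qed
qed

theorem theorem3p2:
  fixes p N :: nat and \<zeta> \<alpha> :: complex
  assumes "Factorial_Ring.prime p" and "odd p"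
    and "Factorial_Ring.prime N" and "[N = 1] (mod p)"
    and "\<zeta> ^ p = 1" and "\<forall>k. 0 < k \<and> k < p \<longrightarrow> \<zeta> ^ k \<noteq> 1"
    and "\<alpha> ^ p = of_nat N"
  shows "p_rank p (class_group (rat_adjoin {\<zeta>, \<alpha>})) \<ge> enat ((p - 1) div 2)"
proof -
 interpret C: cyc p 1 p 1 \<zeta>
  by unfold_locales (use assms(1,5,6) prime_gt_1_nat[OF assms(1)] in auto)
 interpret K: kum p 1 p 1 \<zeta> p N \<alpha> by (rule C.kum_p[OF assms(3,4,2,7)])
 interpret K: kumL p 1 p 1 \<zeta> p N \<alpha> by unfold_locales (use assms(2) in auto)
 show ?thesis unfolding K.rat_adjoin_eq
  by (rule p_rank_ge_torsion[OF K.nf.comm_group_class_group K.nf.finite_class_group assms(1) K.torsion_bound])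
qed

end
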